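(* Let $a\ge b>0$ and $\mu,\nu\ge 0$, let $\alpha$ be real, unrestricted if $a>b$ and with $\alpha>0$ if $a=b$, and put $\chi=b^2/a^2$. Suppose that $0<a+b\le 2\pi$ if $\alpha>0$, and that $0<a+b<2\pi$ if $\alpha\le 0$. With $s_m^{\pm}=\alpha-\nu\pm\mu-2m$ ($m=0,1,2,\ldots$), suppose that the poles at $s=1$ and $s=s_m^\pm$ are all simple, i.e. $\mu$ is not a non-negative integer and $s_m^{+}\neq 1$, $s_m^{-}\neq 1$ for all $m\ge 0$. Then the following expansion holds for $0<\chi<1$: $$\sum_{n=1}^\infty\frac{K_\mu(an)\,I_\nu(bn)}{n^\alpha}=F(1)+\frac{b^\nu}{2^{1+\nu}}\sum_{m=0}^\infty\frac{(-1)^m\,\Gamma(\mu-m)\,\zeta(s_m^+)}{m!\,\Gamma(1+\nu)}\,F_m(\mu,\chi)\left(\frac a2\right)^{2m-\mu}$$ $$\qquad+\frac{b^\nu}{2^{1+\nu}}\sum_{m=0}^\infty\frac{(-1)^m\,\Gamma(-\mu-m)\,\zeta(s_m^-)}{m!\,\Gamma(1+\nu)}\,F_m(-\mu,\chi)\left(\frac a2\right)^{2m+\mu},$$ where $$F(1)=\frac{b^\nu(\frac12 a)^\alpha}{2a^{1+\nu}}\,\frac{\Gamma(\frac12-\frac12\alpha+\frac12\nu-\frac12\mu)\,\Gamma(\frac12-\frac12\alpha+\frac12\nu+\frac12\mu)}{\Gamma(1+\nu)}\;{}_2F_1\left(\frac{1-\alpha+\nu-\mu}{2},\frac{1-\a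lpha+\nu+\mu}{2};1+\nu;\chi\right).$$
   Context: $I_\nu$ and $K_\mu$ are the modified Bessel functions of the first and second kind, $\zeta$ is the (analytically continued) Riemann zeta function, and ${}_2F_1(A,B;C;z)$ is the Gauss hypergeometric function. For $m=0,1,2,\ldots$, $$F_m(\pm\mu,z)={}_2F_1(-m,-m\mp\mu;1+\nu;z).$$ The "poles" are those of the integrand $\tilde F(s)\,\zeta(s)\,(\frac12 a)^{-s}$, where $\tilde F(s)=(\frac12 a)^sF(s)$ and $F(s)=\int_0^\infty t^{s-1}\,t^{-\alpha}K_\mu(at)I_\nu(bt)\,dt$ (analytically continued); they lie at $s=1$ and at $s=s_m^\pm$.
   Formalization: The printed F_m(±μ,z) = 2F1(−m, −m∓μ; 1+ν; z) makes the expansion false (sign misprint); it is proved with F_m(±μ,z) = 2F1(−m, −m±μ; 1+ν; z) instead. *)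

theory Defs
  imports "HOL-Analysis.Analysis" "HOL-Complex_Analysis.Complex_Analysis"
begin

definition bessel_I :: "real \<Rightarrow> real \<Rightarrow> real" where
  "bessel_I \<nu> x = (\<Sum>k. rGamma (\<nu> + real k + 1) / fact k * (x / 2) powr (\<nu> + 2 * real k))"

definition bessel_K :: "real \<Rightarrow> real \<Rightarrow> real" where
  "bessel_K \<mu> x =
     (let q = (\<lambda>\<kappa>. pi / 2 * ((bessel_I (- \<kappa>) x - bessel_I \<kappa> x) / sin (\<kappa> * pi)))
      in if \<mu> \<in> \<int> then Lim (at \<mu>) q else q \<mu>)"

definition hyp2F1 :: "real \<Rightarrow> real \<Rightarrow> real \<Rightarrow> real \<Rightarrow> real" where
  "hyp2F1 A B C z = eval_fps (fps_hypergeo [A, B] [C] 1) z"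

text \<open>The continuation is unique off \<open>1\<close> because the punctured plane is connected; the value
  of \<open>zeta 1\<close> is unspecified.\<close>

definition zeta :: "complex \<Rightarrow> complex" where
  "zeta = (SOME f. f holomorphic_on (- {1}) \<and>
     (\<forall>s. Re s > 1 \<longrightarrow> (\<lambda>n. 1 / of_nat (Suc n) powr s) sums f s))"

text \<open>The order \<open>\<mu>\<close> is signed in the next two definitions: \<open>s_pole \<alpha> \<nu> \<mu> m\<close> and
  \<open>s_pole \<alpha> \<nu> (- \<mu>) m\<close> are the points \<open>s\<^sub>m\<^sup>+\<close> and \<open>s\<^sub>m\<^sup>-\<close>, and likewise \<open>F_poly m \<nu> (- \<mu>) z\<close>
  is \<open>F\<^sub>m(-\<mu>, z)\<close>.  The second parameter of \<open>F_poly\<close> is \<open>-m + \<mu>\<close>, the value at \<open>s = s\<^sub>m\<^sup>+\<close> of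
  the parameter \<open>(s - \<alpha> + \<nu> + \<mu>) / 2\<close> of the hypergeometric function in the Mellin transform
  below; with \<open>-m - \<mu>\<close> instead, the coefficients of \<open>\<zeta>(s\<^sub>m\<^sup>+)\<close> and \<open>\<zeta>(s\<^sub>m\<^sup>-)\<close> would not be
  those of the small-argument expansion of \<open>K\<^sub>\<mu>(a t) I\<^sub>\<nu>(b t)\<close>.\<close>

definition s_pole :: "real \<Rightarrow> real \<Rightarrow> real \<Rightarrow> nat \<Rightarrow> real" where
  "s_pole \<alpha> \<nu> \<mu> m = \<alpha> - \<nu> + \<mu> - 2 * real m"

definition F_poly :: "nat \<Rightarrow> real \<Rightarrow> real \<Rightarrow> real \<Rightarrow> real" where
  "F_poly m \<nu> \<mu> z = hyp2F1 (- real m) (- real m + \<mu>) (1 + \<nu>) z"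

text \<open>For \<open>a > b > 0\<close> and \<open>\<mu>, \<nu> \<ge> 0\<close> the integral converges absolutely exactly when
  \<open>Re s > \<alpha> - \<nu> + \<mu>\<close>; its continuation is unique off the points \<open>s\<^sub>m\<^sup>\<plusminus>\<close>.  For \<open>a = b\<close> there would be the further
  restriction \<open>Re s < 1 + \<alpha>\<close>.\<close>

definition mellin_KI :: "real \<Rightarrow> real \<Rightarrow> real \<Rightarrow> real \<Rightarrow> real \<Rightarrow> complex \<Rightarrow> complex" where
  "mellin_KI \<alpha> \<mu> \<nu> a b = (SOME F.
     F holomorphic_on (- (\<Union>m. {of_real (s_pole \<alpha> \<nu> \<mu> m), of_real (s_pole \<alpha> \<nu> (- \<mu>) m)})) \<and>
     (\<forall>s. Re s > \<alpha> - \<nu> + \<mu> \<longrightarrow>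
       ((\<lambda>t. of_real t powr (s - 1) * of_real (t powr (- \<alpha>) * bessel_K \<mu> (a * t) * bessel_I \<nu> (b * t)))
          has_integral F s) {0<..}))"

end

theory Submission imports Defs "HOL-Real_Asymp.Real_Asymp" begin

text \<open>The coefficients of the power series of \<open>I\<^sub>\<nu>\<close> turn the series of products into a sum over \<open>j\<close> of
\<open>I_coeff b \<nu> j\<close> times \<open>\<Sum>n. n powr (p - 1) * K\<^sub>\<mu>(a n)\<close> with \<open>p = 1 - \<alpha> + \<nu> + 2 j\<close>.  Each of
these series has a residue expansion (\<open>schloemilch_complex\<close>): a term \<open>mellin_K a \<mu> p\<close>, which
belongs to the pole of the zeta function at \<open>1\<close>, and two series of zeta values whose coefficients
\<open>K_coeff a (\<plusminus> \<mu>) k\<close> are those of the two halves of \<open>K\<^sub>\<mu>(a t)\<close> as a series in powers of \<open>t\<close>.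
Summed over \<open>j\<close>, the first terms give \<open>F(1)\<close>, because the Mellin transform of the product is the
termwise Mellin transform (\<open>mellin_KI_eq\<close>).  The rest consists of two double series over \<open>j\<close> and \<open>k\<close>
in which the zeta value depends on \<open>j + k\<close> only.  Summed along the diagonals they are the two series
of the theorem, because the convolution of the coefficients of \<open>I\<^sub>\<nu>\<close> and \<open>K\<^sub>\<mu>\<close> is a
terminating hypergeometric sum (\<open>I_K_convolution\<close>).

The conditions on \<open>a + b\<close> and \<open>\<alpha>\<close> make this rearrangement legitimate.  The zeta value on the
\<open>m\<close>-th diagonal grows like \<open>(2 m)! / (2 \<pi>) ^ (2 m)\<close> up to powers of \<open>m\<close>; the factorial turns the
convolution into the even part of the binomial expansion of \<open>(a + b) ^ (2 m)\<close>, and all powers of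
\<open>m\<close> combine to \<open>m powr (- 1 - \<alpha>)\<close> (\<open>I_K_convolution_bound\<close>, \<open>summable_residue_diagonals\<close>).

The expansion of the series in \<open>K\<^sub>\<mu>\<close> uses Poisson summation in place of contour integration.
The function \<open>K\<^sub>\<mu>\<close> is a mixture of exponentials, so Poisson summation for
\<open>t powr (p - 1) * K\<^sub>\<mu>(a t)\<close> follows by integration from the case of one exponential
(\<open>poisson_mixture\<close>), which is Lipschitz's formula.  For the exponent \<open>2\<close> that formula is the
partial fraction expansion of \<open>1 / sin\<^sup>2\<close>; other exponents follow by differentiation, and by writing
\<open>t powr (p - 2) * exp (- y t)\<close> with \<open>1 < p < 2\<close> as a mixture of exponentials again.  The Fourier
coefficient of frequency \<open>l\<close> is a Laplace transform on the imaginary axis at height \<open>2 \<pi> l > a\<close>,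
where it is a series of powers of \<open>1 / l\<close> (\<open>cosine_transform_bessel_K\<close>).  Summed over \<open>l\<close>,
these powers give zeta values to the right of \<open>1\<close>, which the functional equation reflects to the
points of the theorem.  This settles large real \<open>p\<close>; both sides are holomorphic in \<open>p\<close> off a
countable set, whose complement is connected.

Since \<open>zeta\<close> and \<open>mellin_KI\<close> are chosen among the functions with their defining properties,
their continuations are constructed: that of zeta to \<open>Re s > -1\<close> from the trapezoidal rule, its
functional equation in the strip \<open>-1 < Re s < 0\<close> from Lipschitz's formula as \<open>y\<close> tends to \<open>0\<close>,
and the left half-plane from the functional equation.  The power series of \<open>K\<^sub>\<mu>\<close>, which is how
\<open>bessel_K\<close> is given, and its integral representation, which is what the mixture argument uses, agree
because their difference solves a Volterra system (\<open>bessel_kernel_eq_series\<close>).\<close>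

section \<open>Lebesgue measure on the positive half-line\<close>

text \<open>The half-line is encoded as a measure rather than a set, so that theorems on product measures and on
dominated convergence apply to integrals over it as they stand.\<close>

definition pos_lborel :: "real measure" where
  "pos_lborel = density lborel (indicator {0<..})"

lemma sets_pos_lborel [simp, measurable_cong]: "sets pos_lborel = sets borel"
  by (simp add: pos_lborel_def)

lemma space_pos_lborel [simp]: "space pos_lborel = UNIV"
  by (simp add: pos_lborel_def)

lemma AE_pos_lborel: "AE t in pos_lborel. t > 0"
  unfolding pos_lborel_def by (subst AE_density) (auto simp: indicator_def split: if_splits)

lemma AE_pos_lborelI: "(\<And>t. t > 0 \<Longrightarrow> P t) \<Longrightarrow> AE t in pos_lborel. P t"
  by (rule AE_mp[OF AE_pos_lborel]) auto

interpretation pos_lborel: sigma_finite_measure pos_lborel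
proof -
  have "sigma_finite_measure (density lborel (\<lambda>x::real. ennreal (indicator {0<..} x)))"
    by (subst sigma_finite_measure.sigma_finite_iff_density_finite[OF sigma_finite_lborel]) auto
  moreover have "(\<lambda>x::real. ennreal (indicator {0<..} x)) = indicator {0<..}"
    by (auto simp: indicator_def)
  ultimately show "sigma_finite_measure pos_lborel" by (simp add: pos_lborel_def)
qed

lemma nn_integral_pos_lborel:
  assumes "f \<in> borel_measurable borel"
  shows "nn_integral pos_lborel f = (\<integral>\<^sup>+t. indicator {0<..} t * f t \<partial>lborel)"
  unfolding pos_lborel_def using assms by (subst nn_integral_density) auto

lemma integrable_pos_lborel:
  fixes f :: "real \<Rightarrow> 'b::{banach, second_countable_topology}"
  assumes "f \<in> borel_measurable borel"
  shows "integrable pos_lborel f \<longleftrightarrow> set_integrable lborel {0<..} f"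
proof -
  have "(indicator {0<..} :: real \<Rightarrow> ennreal) = (\<lambda>x. ennreal (indicator {0<..} x))"
    by (auto simp: indicator_def)
  then show ?thesis
    using assms unfolding pos_lborel_def set_integrable_def
    by (simp add: integrable_density)
qed

lemma integral_pos_lborel:
  fixes f :: "real \<Rightarrow> 'b::{banach, second_countable_topology}"
  assumes "f \<in> borel_measurable borel"
  shows "integral\<^sup>L pos_lborel f = set_lebesgue_integral lborel {0<..} f"
proof -
  have "(indicator {0<..} :: real \<Rightarrow> ennreal) = (\<lambda>x. ennreal (indicator {0<..} x))"
    by (auto simp: indicator_def)
  then show ?thesis
    using assms unfolding pos_lborel_def set_lebesgue_integral_def
    by (simp add: integral_density)
qed

lemma nn_integral_pos_lborel_cong:
  assumes "\<And>t. t > 0 \<Longrightarrow> f t = g t"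
  shows "nn_integral pos_lborel f = nn_integral pos_lborel g"
  by (rule nn_integral_cong_AE, rule AE_mp[OF AE_pos_lborel]) (use assms in auto)

lemma integral_pos_lborel_cong:
  fixes f :: "real \<Rightarrow> 'b::{banach, second_countable_topology}"
  assumes "f \<in> borel_measurable borel" "g \<in> borel_measurable borel" "\<And>t. t > 0 \<Longrightarrow> f t = g t"
  shows "integral\<^sup>L pos_lborel f = integral\<^sup>L pos_lborel g"
  by (rule integral_cong_AE[OF _ _ AE_mp[OF AE_pos_lborel]]) (use assms in auto)

lemma nn_integral_pos_lborel_scale:
  assumes [measurable]: "f \<in> borel_measurable borel" and c: "c > 0"
  shows "nn_integral pos_lborel f = ennreal c * (\<integral>\<^sup>+t. f (c * t) \<partial>pos_lborel)"
proof -
  have "nn_integral pos_lborel f = (\<integral>\<^sup>+t. indicator {0<..} t * f t \<partial>lborel)"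
    by (simp add: nn_integral_pos_lborel)
  also have "\<dots> = ennreal c * (\<integral>\<^sup>+t. indicator {0<..} (c * t) * f (c * t) \<partial>lborel)"
    by (subst nn_integral_real_affine[where c = c and t = 0]) (use c in auto)
  also have "(\<integral>\<^sup>+t. indicator {0<..} (c * t) * f (c * t) \<partial>lborel) = (\<integral>\<^sup>+t. f (c * t) \<partial>pos_lborel)"
    by (subst nn_integral_pos_lborel) (use c in \<open>auto intro!: nn_integral_cong simp: indicator_def zero_less_mult_iff\<close>)
  finally show ?thesis .
qed

lemma integrable_pos_lborel_iff_absolutely_integrable:
  fixes f :: "real \<Rightarrow> 'b::euclidean_space"
  assumes [measurable]: "f \<in> borel_measurable borel"
  shows "integrable pos_lborel f \<longleftrightarrow> f absolutely_integrable_on {0<..}"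
  unfolding integrable_pos_lborel[OF assms] set_integrable_def
  by (rule integrable_completion[symmetric]) measurable

lemma integral_pos_lborel_eq_integral:
  fixes f :: "real \<Rightarrow> 'b::euclidean_space"
  assumes [measurable]: "f \<in> borel_measurable borel" and "integrable pos_lborel f"
  shows "integral\<^sup>L pos_lborel f = integral {0<..} f"
proof -
  have "f absolutely_integrable_on {0<..}" using assms integrable_pos_lborel_iff_absolutely_integrable by blast
  then have "integral {0<..} f = (LINT x:{0<..}|lebesgue. f x)" by (rule set_lebesgue_integral_eq_integral(2)[symmetric])
  also have "\<dots> = (LINT x:{0<..}|lborel. f x)"
    unfolding set_lebesgue_integral_def by (rule integral_completion) measurable
  finally show ?thesis using integral_pos_lborel[OF assms(1)] by simp
qed

text \<open>This serves the substitutions \<open>v = w / u\<close> and \<open>t = sqrt u\<close>, which map the half-line onto itself.\<close>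

lemma pos_lborel_change_of_variables:
  fixes f G g g' :: "real \<Rightarrow> real"
  assumes [measurable]: "f \<in> borel_measurable borel" "G \<in> borel_measurable borel"
    and der: "\<And>u. u > 0 \<Longrightarrow> (g has_real_derivative g' u) (at u)"
    and inj: "inj_on g {0<..}" and img: "g ` {0<..} = {0<..}"
    and eq: "\<And>u. u > 0 \<Longrightarrow> \<bar>g' u\<bar> * f (g u) = G u"
    and int: "integrable pos_lborel G"
  shows "integrable pos_lborel f" "integral\<^sup>L pos_lborel f = integral\<^sup>L pos_lborel G"
proof -
  have G: "G absolutely_integrable_on {0<..}" using int integrable_pos_lborel_iff_absolutely_integrable[of G] by simp
  have "(\<lambda>u. \<bar>g' u\<bar> * f (g u)) absolutely_integrable_on {0<..} \<and> integral {0<..} (\<lambda>u. \<bar>g' u\<bar> * f (g u)) = integral {0<..} G"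
  proof
    show "integral {0<..} (\<lambda>u. \<bar>g' u\<bar> * f (g u)) = integral {0<..} G" by (rule integral_cong) (simp add: eq)
    show "(\<lambda>u. \<bar>g' u\<bar> * f (g u)) absolutely_integrable_on {0<..}"
      using G by (subst set_integrable_cong[OF refl refl]) (auto simp: eq)
  qed
  then have "f absolutely_integrable_on (g ` {0<..}) \<and> integral (g ` {0<..}) f = integral {0<..} G"
    by (subst (asm) has_absolute_integral_change_of_variables_1'[where g = g])
      (use inj der in \<open>auto intro: has_field_derivative_at_within\<close>)
  then show f: "integrable pos_lborel f" and "integral\<^sup>L pos_lborel f = integral\<^sup>L pos_lborel G"
    using int integrable_pos_lborel_iff_absolutely_integrable[of f] integral_pos_lborel_eq_integral[of f] integral_pos_lborel_eq_integral[of G]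
    by (auto simp: img)
qed

section \<open>Exponential integrals\<close>

text \<open>Differentiation under the integral sign.  The difference quotients at \<open>z\<close> are dominated because
\<open>\<bar>l x\<bar> * exp (Re z * l x)\<close> is at most a constant times the sum of the exponentials with a slightly
larger and a slightly smaller exponent, and both of these exponents lie in the open set \<open>S\<close>.\<close>

lemma exp_integral_has_field_derivative:
  fixes l f :: "'a \<Rightarrow> real"
  assumes [measurable]: "l \<in> borel_measurable M" "f \<in> borel_measurable M"
    and S: "open S" and int: "\<And>\<sigma>. \<sigma> \<in> S \<Longrightarrow> integrable M (\<lambda>x. exp (\<sigma> * l x) * f x)"
    and z: "Re z \<in> S"
  shows "((\<lambda>z. \<integral>x. exp (z * of_real (l x)) * of_real (f x) \<partial>M) has_field_derivative
           (\<integral>x. of_real (l x) * exp (z * of_real (l x)) * of_real (f x) \<partial>M)) (at z)"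
proof -
  define E where "E = (\<lambda>z x. exp (z * complex_of_real (l x)) * complex_of_real (f x))"
  obtain d where d: "d > 0" "ball (Re z) d \<subseteq> S" using S z openE by blast
  define e where "e = d / 3"
  have e: "e > 0" using d by (simp add: e_def)
  have eS: "Re z + 2 * e \<in> S" "Re z - 2 * e \<in> S" "\<And>w. Re w \<in> ball (Re z) d \<Longrightarrow> Re w \<in> S"
    using d by (auto simp: e_def dist_real_def)
  have intE: "integrable M (E w)" if "Re w \<in> S" for w
  proof (rule Bochner_Integration.integrable_bound[OF int[OF that]])
    show "AE x in M. norm (E w x) \<le> norm (exp (Re w * l x) * f x)"
      by (auto simp: E_def norm_mult abs_mult)
  qed (auto simp: E_def)
  \<comment> \<open>One exponent \<open>e\<close> pays for the Taylor remainder, the other one for the factor \<open>\<bar>l x\<bar> \<le> exp (e * \<bar>l x\<bar>) / e\<close>.\<close>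
  define W where "W = (\<lambda>x. (exp ((Re z + 2*e) * l x) * \<bar>f x\<bar> + exp ((Re z - 2*e) * l x) * \<bar>f x\<bar>) / e)"
  have intW: "integrable M W"
    unfolding W_def
    using integrable_abs[OF int[OF eS(1)]] integrable_abs[OF int[OF eS(2)]]
    by (intro integrable_divide Bochner_Integration.integrable_add) (simp_all add: abs_mult)
  have quot: "norm ((E (z + h) x - E z x) / h) \<le> W x" if h: "h \<noteq> 0" "norm h < e" for h x
  proof -
    let ?l = "complex_of_real (l x)"
    have "E (z + h) x - E z x = E z x * (exp (h * ?l) - 1)"
      by (simp add: E_def exp_add ring_distribs)
    moreover have "norm (exp (h * ?l) - 1) \<le> exp \<bar>Re (h * ?l)\<bar> * norm (h * ?l)"
      using Taylor_exp[of "h * ?l" 0] by simp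
    moreover have "\<bar>Re (h * ?l)\<bar> \<le> e * \<bar>l x\<bar>"
      using abs_Re_le_cmod[of h] h by (simp add: abs_mult mult_right_mono)
    then have "norm (exp (h * ?l) - 1) \<le> exp (e * \<bar>l x\<bar>) * (norm h * \<bar>l x\<bar>)"
      using calculation(2) by (elim order_trans) (auto simp: norm_mult intro!: mult_right_mono)
    ultimately have "norm (E (z + h) x - E z x) \<le> norm (E z x) * (exp (e * \<bar>l x\<bar>) * (norm h * \<bar>l x\<bar>))"
      by (simp only: norm_mult) (intro mult_left_mono, auto)
    moreover have "\<bar>l x\<bar> \<le> exp (e * \<bar>l x\<bar>) / e"
      using exp_ge_add_one_self[of "e * \<bar>l x\<bar>"] e by (simp add: field_simps del: exp_ge_add_one_self)
    then have "norm (E z x) * (exp (e * \<bar>l x\<bar>) * (norm h * \<bar>l x\<bar>)) \<le>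
       norm (E z x) * (exp (e * \<bar>l x\<bar>) * (norm h * (exp (e * \<bar>l x\<bar>) / e)))"
      by (intro mult_left_mono) auto
    moreover have "exp (2 * e * \<bar>l x\<bar>) = exp (e * \<bar>l x\<bar>) * exp (e * \<bar>l x\<bar>)"
      by (simp add: mult_exp_exp)
    ultimately have "norm (E (z + h) x - E z x) \<le> norm h * (norm (E z x) * (exp (2 * e * \<bar>l x\<bar>)) / e)"
      by (simp add: mult_ac)
    then have "norm ((E (z + h) x - E z x) / h) \<le> norm (E z x) * exp (2 * e * \<bar>l x\<bar>) / e"
      using h by (simp add: norm_divide field_simps)
    also have "\<dots> = (exp (Re z * l x + 2 * e * \<bar>l x\<bar>) * \<bar>f x\<bar>) / e"
      by (simp add: E_def norm_mult exp_add mult_ac)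
    also have "\<dots> \<le> W x"
    proof -
      have "exp (Re z * l x + 2 * e * \<bar>l x\<bar>) \<le> exp ((Re z + 2*e) * l x) + exp ((Re z - 2*e) * l x)"
        by (cases "l x \<ge> 0") (auto simp: ring_distribs intro: add_increasing add_increasing2)
      then show ?thesis unfolding W_def distrib_right[symmetric] using e
        by (intro divide_right_mono mult_right_mono) auto
    qed
    finally show ?thesis .
  qed
  have "((\<lambda>h. (\<integral>x. (E (z + h) x - E z x) / h \<partial>M)) \<longlongrightarrow> (\<integral>x. of_real (l x) * E z x \<partial>M)) (at 0)"
    unfolding tendsto_at_iff_sequentially
  proof (intro allI impI)
    fix X :: "nat \<Rightarrow> complex" assume X: "\<forall>i. X i \<in> UNIV - {0}" "X \<longlonglongrightarrow> 0"
    have ev: "\<forall>\<^sub>F n in sequentially. norm (X n) < e"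
      using tendstoD[OF X(2) e] by simp
    then obtain N where N: "\<And>n. n \<ge> N \<Longrightarrow> norm (X n) < e" by (auto simp: eventually_sequentially)
    have "(\<lambda>n. \<integral>x. (E (z + X (n + N)) x - E z x) / X (n + N) \<partial>M) \<longlonglongrightarrow> (\<integral>x. of_real (l x) * E z x \<partial>M)"
    proof (rule integral_dominated_convergence[where w = W])
      show "AE x in M. (\<lambda>n. (E (z + X (n + N)) x - E z x) / X (n + N)) \<longlonglongrightarrow> of_real (l x) * E z x"
      proof (rule AE_I2)
        fix x
        have "((\<lambda>w. E w x) has_field_derivative of_real (l x) * E z x) (at z)"
          unfolding E_def by (auto intro!: derivative_eq_intros)
        then have "((\<lambda>h. (E (z + h) x - E z x) / h) \<longlongrightarrow> of_real (l x) * E z x) (at 0)"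
          by (simp add: DERIV_def)
        then have "(\<lambda>n. (E (z + X n) x - E z x) / X n) \<longlonglongrightarrow> of_real (l x) * E z x"
          using X unfolding tendsto_at_iff_sequentially by (auto simp: o_def)
        then show "(\<lambda>n. (E (z + X (n + N)) x - E z x) / X (n + N)) \<longlonglongrightarrow> of_real (l x) * E z x"
          by (rule LIMSEQ_ignore_initial_segment)
      qed
      show "AE x in M. norm ((E (z + X (n + N)) x - E z x) / X (n + N)) \<le> W x" for n
        using X(1) N[of "n + N"] by (intro AE_I2 quot) auto
    qed (auto simp: E_def intW)
    then show "((\<lambda>h. \<integral>x. (E (z + h) x - E z x) / h \<partial>M) \<circ> X) \<longlonglongrightarrow> (\<integral>x. of_real (l x) * E z x \<partial>M)"
      unfolding o_def by (rule LIMSEQ_offset)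
  qed
  moreover have "\<forall>\<^sub>F h in at 0. (\<integral>x. (E (z + h) x - E z x) / h \<partial>M) = ((\<integral>x. E (z + h) x \<partial>M) - (\<integral>x. E z x \<partial>M)) / h"
  proof -
    have "\<forall>\<^sub>F h in at (0::complex). norm h < d" using d(1)
      by (auto simp: eventually_at intro!: exI[of _ d])
    then show ?thesis
    proof eventually_elim
      case (elim h)
      have "dist (Re z) (Re (z + h)) < d"
        using abs_Re_le_cmod[of h] elim by (simp add: dist_real_def)
      then have "Re (z + h) \<in> S" using d by auto
      then show ?case using intE[of "z + h"] intE[of z] z
        by simp
    qed
  qed
  ultimately have "((\<lambda>h. ((\<integral>x. E (z + h) x \<partial>M) - (\<integral>x. E z x \<partial>M)) / h) \<longlongrightarrow> (\<integral>x. of_real (l x) * E z x \<partial>M)) (at 0)"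
    by (rule Lim_transform_eventually)
  then show ?thesis by (simp add: DERIV_def E_def mult.assoc)
qed

lemma exp_integral_holomorphic:
  fixes l f :: "'a \<Rightarrow> real"
  assumes "l \<in> borel_measurable M" "f \<in> borel_measurable M"
    and "open S" and "\<And>\<sigma>. \<sigma> \<in> S \<Longrightarrow> integrable M (\<lambda>x. exp (\<sigma> * l x) * f x)"
  shows "(\<lambda>z. \<integral>x. exp (z * of_real (l x)) * of_real (f x) \<partial>M) holomorphic_on {z. Re z \<in> S}"
proof -
  have op: "open {z. Re z \<in> S}" using open_vimage[OF assms(3), of Re] by (simp add: vimage_def continuous_on_Re continuous_on_id)
  then show ?thesis
    unfolding holomorphic_on_open[OF op]
    using exp_integral_has_field_derivative[OF assms] by blast
qed

text \<open>The points of a real interval accumulate at its midpoint, so the identity theorem applies.\<close>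

lemma holomorphic_eq_if_eq_on_reals:
  assumes f: "f holomorphic_on A" and g: "g holomorphic_on A" and A: "open A" "connected A"
    and uv: "u < v" and sub: "of_real ` {u<..<v} \<subseteq> A"
    and eq: "\<And>x. u < x \<Longrightarrow> x < v \<Longrightarrow> f (of_real x) = g (of_real x)" and z: "z \<in> A"
  shows "f z = g z"
proof -
  define m where "m = (u + v) / 2"
  have m: "u < m" "m < v" using uv by (auto simp: m_def)
  have "f z - g z = 0"
  proof (rule analytic_continuation[OF _ A sub, of "\<lambda>z. f z - g z" "of_real m"])
    show "complex_of_real m islimpt of_real ` {u<..<v}"
      unfolding islimpt_approachable
    proof (intro allI impI)
      fix e :: real assume e: "e > 0"
      define x where "x = m + min (e / 2) ((v - m) / 2)"
      have "m < x" "x < v" "x - m < e" using m e by (auto simp: x_def min_def field_simps)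
      then have "complex_of_real x \<in> of_real ` {u<..<v}" "complex_of_real x \<noteq> of_real m"
          "dist (complex_of_real x) (of_real m) < e"
        using m by (auto simp: dist_real_def)
      then show "\<exists>x'\<in>of_real ` {u<..<v}. x' \<noteq> complex_of_real m \<and> dist x' (complex_of_real m) < e"
        by blast
    qed
    show "complex_of_real m \<in> A" using sub m by auto
  qed (use f g z eq in \<open>auto intro!: holomorphic_intros\<close>)
  then show ?thesis by simp
qed

lemma Gamma_nn_integral_scaled:
  assumes p: "p > 0" and z: "z > (0::real)"
  shows "(\<integral>\<^sup>+t. ennreal (t powr (p - 1) * exp (- z * t)) \<partial>pos_lborel) = ennreal (Gamma p * z powr - p)"
proof -
  have "ennreal (Gamma p) = (\<integral>\<^sup>+t. ennreal (t powr (p - 1) * exp (- t)) \<partial>pos_lborel)"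
    unfolding Gamma_conv_nn_integral_real[OF p]
    by (subst nn_integral_pos_lborel)
       (auto intro!: nn_integral_cong simp: indicator_def exp_minus divide_inverse)
  also have "\<dots> = ennreal z * (\<integral>\<^sup>+t. ennreal ((z * t) powr (p - 1) * exp (- (z * t))) \<partial>pos_lborel)"
    using z by (subst nn_integral_pos_lborel_scale[where c = z]) auto
  also have "\<dots> = (\<integral>\<^sup>+t. ennreal z * ennreal ((z * t) powr (p - 1) * exp (- (z * t))) \<partial>pos_lborel)"
    by (subst nn_integral_cmult) auto
  also have "\<dots> = (\<integral>\<^sup>+t. ennreal (z powr p) * ennreal (t powr (p - 1) * exp (- z * t)) \<partial>pos_lborel)"
    using z by (intro nn_integral_pos_lborel_cong) (auto simp: powr_mult powr_diff ennreal_mult[symmetric] field_simps)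
  also have "\<dots> = ennreal (z powr p) * (\<integral>\<^sup>+t. ennreal (t powr (p - 1) * exp (- z * t)) \<partial>pos_lborel)"
    by (subst nn_integral_cmult) auto
  finally have "ennreal (z powr - p) * ennreal (Gamma p) = (ennreal (z powr - p) * ennreal (z powr p)) * (\<integral>\<^sup>+t. ennreal (t powr (p - 1) * exp (- z * t)) \<partial>pos_lborel)"
    by (simp add: mult.assoc)
  also have "ennreal (z powr - p) * ennreal (z powr p) = 1"
    using z by (simp add: ennreal_mult[symmetric] powr_minus)
  finally show ?thesis using p by (simp add: ennreal_mult[symmetric] mult.commute)
qed

lemma Gamma_integrable_scaled:
  assumes p: "p > 0" and z: "z > (0::real)"
  shows "integrable pos_lborel (\<lambda>t. t powr (p - 1) * exp (- z * t))"
    and "(\<integral>t. t powr (p - 1) * exp (- z * t) \<partial>pos_lborel) = Gamma p * z powr - p"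
proof -
  have *: "has_bochner_integral pos_lborel (\<lambda>t. t powr (p - 1) * exp (- z * t)) (Gamma p * z powr - p)"
    by (rule has_bochner_integral_nn_integral[OF _ _ _ Gamma_nn_integral_scaled]) (use p z in auto)
  show "integrable pos_lborel (\<lambda>t. t powr (p - 1) * exp (- z * t))"
    "(\<integral>t. t powr (p - 1) * exp (- z * t) \<partial>pos_lborel) = Gamma p * z powr - p"
    using * by (auto simp: has_bochner_integral_iff)
qed

text \<open>Both sides are holomorphic in the right half-plane and agree on the positive real axis.\<close>

lemma Gamma_integral_complex_scaled:
  assumes p: "p > (0::real)" and z: "Re z > 0"
  shows "(\<integral>t. exp (- z * of_real t) * of_real (t powr (p - 1)) \<partial>pos_lborel) = of_real (Gamma p) * z powr (- of_real p)"
proof -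
  define F where "F = (\<lambda>z::complex. \<integral>t. exp (z * of_real (- t)) * of_real (t powr (p - 1)) \<partial>pos_lborel)"
  have hol: "F holomorphic_on {z. Re z \<in> {0<..}}"
    unfolding F_def
    by (rule exp_integral_holomorphic) (use Gamma_integrable_scaled(1)[OF p] in \<open>auto simp: mult.commute\<close>)
  have "F z = of_real (Gamma p) * z powr (- of_real p)"
  proof (rule holomorphic_eq_if_eq_on_reals[where f = F and g = "\<lambda>z. of_real (Gamma p) * z powr (- of_real p)" and A = "{z. Re z > 0}" and u = 0 and v = 1])
    show "F holomorphic_on {z. Re z > 0}" using hol by simp
    show "(\<lambda>z. of_real (Gamma p) * z powr (- of_real p)) holomorphic_on {z. Re z > 0}"
      by (intro holomorphic_intros) (auto simp: complex_nonpos_Reals_iff)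
    show "open {z. Re z > 0}" by (rule open_halfspace_Re_gt)
    show "connected {z. Re z > 0}" by (intro convex_connected convex_halfspace_Re_gt)
    fix x :: real assume x: "0 < x" "x < 1"
    have "F (of_real x) = (\<integral>t. complex_of_real (t powr (p - 1) * exp (- x * t)) \<partial>pos_lborel)"
      by (simp add: F_def exp_of_real[symmetric] mult.commute)
    also have "\<dots> = of_real (Gamma p * x powr - p)"
      by (subst integral_complex_of_real) (simp only: Gamma_integrable_scaled[OF p x(1)])
    also have "\<dots> = of_real (Gamma p) * of_real x powr (- of_real p)"
      using x by (simp add: powr_of_real[symmetric])
    finally show "F (of_real x) = of_real (Gamma p) * of_real x powr (- of_real p)" .
  qed (use z in auto)
  then show ?thesis by (simp add: F_def)
qed

section \<open>The Lipschitz formula\<close>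

lemma norm_powr_of_real_exponent:
  assumes "w \<noteq> (0::complex)"
  shows "norm (w powr of_real a) = norm w powr a"
  using assms by (simp add: powr_def)

text \<open>The contribution of the two lattice points \<open>\<plusminus> (l + 1)\<close> to Lipschitz's formula; they are complex
conjugates of each other.\<close>

definition lipschitz_kernel :: "real \<Rightarrow> real \<Rightarrow> nat \<Rightarrow> real" where
  "lipschitz_kernel p y l = 2 * Re ((of_real y + 2 * of_real pi * \<i> * of_nat (Suc l)) powr (- of_real p))"

text \<open>Poisson summation for \<open>t powr (p - 1) * exp (- y t)\<close>: the right-hand side is \<open>\<Gamma>(p)\<close> times the sum
of \<open>(y + 2 \<pi> i k) powr (- p)\<close> over all integers \<open>k\<close>.\<close>

definition lipschitz_formula :: "real \<Rightarrow> bool" where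
  "lipschitz_formula p \<longleftrightarrow> (\<forall>y>0. (\<lambda>n. real (Suc n) powr (p - 1) * exp (- (real (Suc n) * y)))
     sums (Gamma p * (y powr - p + (\<Sum>l. lipschitz_kernel p y l))))"

lemma lipschitz_point:
  fixes y :: real and l :: nat
  assumes y: "y > 0"
  defines "w \<equiv> of_real y + 2 * of_real pi * \<i> * of_nat (Suc l)"
  shows "w \<noteq> 0" "Re w = y" "w \<notin> \<real>\<^sub>\<le>\<^sub>0" "norm w \<ge> y" "norm w \<ge> 2 * pi * real (Suc l)"
proof -
  show re: "Re w = y" by (simp add: w_def)
  then show "w \<noteq> 0" "w \<notin> \<real>\<^sub>\<le>\<^sub>0" using y by (auto simp: complex_nonpos_Reals_iff)
  show "norm w \<ge> y" using abs_Re_le_cmod[of w] re y by simp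
  have "Im w = 2 * pi * real (Suc l)" by (simp add: w_def)
  then show "norm w \<ge> 2 * pi * real (Suc l)" using abs_Im_le_cmod[of w] by simp
qed

text \<open>The exponent \<open>r\<close> divides the decay between \<open>l\<close> and \<open>y\<close>: the sum over \<open>l\<close> needs \<open>r > 1\<close>, and
the remaining factor \<open>y powr (r - p)\<close> makes mixtures converge whose weights extend to large \<open>y\<close>.\<close>

lemma lipschitz_kernel_bound:
  assumes y: "y > 0" and r: "0 \<le> r" "r \<le> p"
  shows "\<bar>lipschitz_kernel p y l\<bar> \<le> 2 * (2 * pi * real (Suc l)) powr - r * y powr (r - p)"
proof -
  define w where "w = complex_of_real y + 2 * of_real pi * \<i> * of_nat (Suc l)"
  note w = lipschitz_point[OF y, of l, folded w_def]
  have "\<bar>lipschitz_kernel p y l\<bar> \<le> 2 * norm (w powr of_real (- p))"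
    using abs_Re_le_cmod[of "w powr of_real (- p)"] by (simp add: lipschitz_kernel_def w_def abs_mult)
  also have "norm (w powr of_real (- p)) = norm w powr - r * norm w powr (r - p)"
    using w(1) by (subst norm_powr_of_real_exponent) (auto simp flip: powr_add)
  also have "\<dots> \<le> (2 * pi * real (Suc l)) powr - r * y powr (r - p)"
    using w y r by (intro mult_mono powr_mono2') auto
  finally show ?thesis by simp
qed

lemma summable_lipschitz_weights:
  assumes "r > 1"
  shows "summable (\<lambda>l. (2 * pi * real (Suc l)) powr - r)"
proof -
  have "summable (\<lambda>l. real (Suc l) powr - r)"
    using assms by (subst summable_Suc_iff) (simp add: summable_real_powr_iff)
  then have "summable (\<lambda>l. (2 * pi) powr - r * real (Suc l) powr - r)" by (rule summable_mult)
  then show ?thesis by (simp add: powr_mult)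
qed

lemma summable_lipschitz_kernel:
  assumes "y > 0" "p > 1"
  shows "summable (\<lambda>l. \<bar>lipschitz_kernel p y l\<bar>)"
proof (rule summable_comparison_test')
  show "summable (\<lambda>l. 2 * ((2 * pi * real (Suc l)) powr - p) * y powr (p - p))"
    by (intro summable_mult summable_mult2 summable_lipschitz_weights assms)
  show "norm \<bar>lipschitz_kernel p y l\<bar> \<le> 2 * ((2 * pi * real (Suc l)) powr - p) * y powr (p - p)" for l
    using lipschitz_kernel_bound[of y p p l] assms by simp
qed

lemma lipschitz_kernel_has_real_derivative:
  assumes y: "y > 0"
  shows "((\<lambda>y. lipschitz_kernel p y l) has_real_derivative - p * lipschitz_kernel (p + 1) y l) (at y)"
proof -
  define c where "c = 2 * complex_of_real pi * \<i> * of_nat (Suc l)"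
  note w = lipschitz_point[OF y, of l, folded c_def]
  have "((\<lambda>z. (z + c) powr (- of_real p)) has_field_derivative
      (- of_real p * (of_real y + c) powr (- of_real p - 1))) (at (of_real y))"
    using w by (auto intro!: derivative_eq_intros)
  then have "((\<lambda>y. Re ((of_real y + c) powr (- of_real p))) has_real_derivative
      Re (- of_real p * (of_real y + c) powr (- of_real p - 1))) (at y)"
    by (intro has_field_derivative_Re has_vector_derivative_real_field)
  from DERIV_cmult[OF this, of 2] show ?thesis
    by (simp add: lipschitz_kernel_def c_def minus_diff_commute algebra_simps)
qed

text \<open>The second logarithmic derivative of the reflection formula of the Gamma function.\<close>

lemma Polygamma_1_reflection:
  fixes z :: complex assumes z: "z \<notin> \<int>"
  shows "Polygamma 1 z + Polygamma 1 (1 - z) = (of_real pi / sin (of_real pi * z))\<^sup>2"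
proof -
  have op: "open (- \<int> :: complex set)" by (simp add: open_Compl closed_Ints)
  have nz: "sin (of_real pi * u) \<noteq> 0" if "u \<notin> \<int>" for u :: complex
    using that by (auto simp: sin_eq_0 mult.commute)
  have nonpos: "u \<notin> \<int>\<^sub>\<le>\<^sub>0" "1 - u \<notin> \<int>\<^sub>\<le>\<^sub>0" if "u \<notin> \<int>" for u :: complex
    using that by (auto elim!: nonpos_Ints_cases simp: algebra_simps) (metis Ints_diff Ints_1 Ints_of_int diff_diff_eq2 add_diff_cancel_left')
  have D: "Digamma u - Digamma (1 - u) = - of_real pi * cos (of_real pi * u) / sin (of_real pi * u)" if u: "u \<notin> \<int>" for u :: complex
  proof -
    have "((\<lambda>u. Gamma u * Gamma (1 - u)) has_field_derivative
        (Gamma u * Gamma (1 - u) * (Digamma u - Digamma (1 - u)))) (at u)"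
      using nonpos[OF u] by (auto intro!: derivative_eq_intros simp: algebra_simps)
    moreover have "((\<lambda>u. of_real pi / sin (of_real pi * u)) has_field_derivative
        (- (of_real pi)\<^sup>2 * cos (of_real pi * u) / (sin (of_real pi * u))\<^sup>2)) (at u)"
      using nz[OF u] by (auto intro!: derivative_eq_intros simp: power2_eq_square)
    ultimately have "Gamma u * Gamma (1 - u) * (Digamma u - Digamma (1 - u)) =
        - (of_real pi)\<^sup>2 * cos (of_real pi * u) / (sin (of_real pi * u))\<^sup>2"
      by (intro DERIV_unique[where f = "\<lambda>u. Gamma u * Gamma (1 - u)" and x = u]) (auto simp: Gamma_reflection_complex)
    then have "(of_real pi / sin (of_real pi * u)) * (Digamma u - Digamma (1 - u)) =
        (of_real pi / sin (of_real pi * u)) * (- of_real pi * cos (of_real pi * u) / sin (of_real pi * u))"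
      by (simp add: Gamma_reflection_complex power2_eq_square)
    then show ?thesis using nz[OF u] by (subst (asm) mult_left_cancel) auto
  qed
  have "((\<lambda>u. Digamma u - Digamma (1 - u)) has_field_derivative (Polygamma 1 z + Polygamma 1 (1 - z))) (at z)"
    using nonpos[OF z] by (auto intro!: derivative_eq_intros)
  moreover have "((\<lambda>u. - of_real pi * cos (of_real pi * u) / sin (of_real pi * u)) has_field_derivative
      (of_real pi / sin (of_real pi * z))\<^sup>2) (at z)"
  proof -
    have cs: "cos (z * of_real pi) * cos (z * of_real pi) + sin (z * of_real pi) * sin (z * of_real pi) = 1"
      using sin_cos_squared_add[of "z * of_real pi"] by (simp add: power2_eq_square algebra_simps)
    show ?thesis
      using nz[OF z] by (auto intro!: derivative_eq_intros simp: power2_eq_square divide_simps)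
        (simp add: cs mult_ac flip: distrib_left)
  qed
  then have "((\<lambda>u. Digamma u - Digamma (1 - u)) has_field_derivative (of_real pi / sin (of_real pi * z))\<^sup>2) (at z)"
    by (rule has_field_derivative_transform_within_open[OF _ op]) (use z D in auto)
  ultimately show ?thesis by (rule DERIV_unique)
qed

text \<open>At \<open>\<tau> = i y / (2 \<pi>)\<close>, the inverse squares of the lattice points are, up to a constant factor, the series of
\<open>Polygamma 1\<close> at \<open>\<tau>\<close> and at \<open>1 - \<tau>\<close>.  Their sum is \<open>\<pi>\<^sup>2 / sin\<^sup>2 (\<pi> \<tau>)\<close>, which in terms of
\<open>exp (- y)\<close> is the derivative of a geometric series.\<close>

lemma lipschitz_formula_2: "lipschitz_formula 2"
  unfolding lipschitz_formula_def
proof (intro allI impI)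
  fix y :: real assume y: "y > 0"
  \<comment> \<open>The points \<open>\<tau> + k + 1\<close> and \<open>1 - \<tau> + k\<close> are imaginary multiples of conjugate lattice points.\<close>
  define \<tau> where "\<tau> = \<i> * of_real y / (2 * of_real pi)"
  define W where "W = (\<lambda>l. of_real y + 2 * of_real pi * \<i> * of_nat (Suc l))"
  have W: "W l \<noteq> 0" "cnj (W l) \<noteq> 0" for l
  proof -
    show "W l \<noteq> 0" unfolding W_def by (rule lipschitz_point(1)[OF y])
    then show "cnj (W l) \<noteq> 0" by simp
  qed
  have "Im \<tau> \<noteq> 0" using y by (simp add: \<tau>_def)
  then have tau: "\<tau> \<notin> \<int>" by (metis Im_complex_of_real Ints_cases of_real_of_int_eq)
  have tau0: "\<tau> \<noteq> 0" "1 - \<tau> \<noteq> 0" using tau by (auto simp: algebra_simps) 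
  have s1: "(\<lambda>k. inverse ((z + of_nat k)\<^sup>2)) sums Polygamma 1 z" if "z \<noteq> 0" for z :: complex
    using Polygamma_LIMSEQ[of z 1] that by (simp add: numeral_2_eq_2)
  have e1: "inverse ((\<tau> + of_nat (Suc k))\<^sup>2) = - 4 * of_real pi ^ 2 * inverse (cnj (W k) ^ 2)" for k
  proof -
    have "\<tau> + of_nat (Suc k) = \<i> / (2 * of_real pi) * cnj (W k)"
      by (simp add: \<tau>_def W_def field_simps)
    then show ?thesis by (simp only:) (simp add: power_mult_distrib power_divide inverse_eq_divide)
  qed
  have e2: "inverse ((1 - \<tau> + of_nat k)\<^sup>2) = - 4 * of_real pi ^ 2 * inverse (W k ^ 2)" for k
  proof -
    have "1 - \<tau> + of_nat k = - \<i> / (2 * of_real pi) * W k"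
      by (simp add: \<tau>_def W_def field_simps)
    then show ?thesis by (simp only:) (simp add: power_mult_distrib power_divide inverse_eq_divide)
  qed
  have e0: "inverse (\<tau>\<^sup>2) = - 4 * of_real pi ^ 2 * inverse (of_real y ^ 2)"
    using y by (simp add: \<tau>_def power_divide power_mult_distrib field_simps)
  have "(\<lambda>k. inverse ((\<tau> + of_nat (Suc k))\<^sup>2)) sums (Polygamma 1 \<tau> - inverse (\<tau>\<^sup>2))"
    using s1[OF tau0(1)] by (subst sums_Suc_iff) simp
  from sums_add[OF this s1[OF tau0(2)]]
  have "(\<lambda>k. - 4 * of_real pi ^ 2 * (inverse (cnj (W k) ^ 2) + inverse (W k ^ 2))) sums
      ((of_real pi / sin (of_real pi * \<tau>))\<^sup>2 - inverse (\<tau>\<^sup>2))"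
    unfolding e1 e2 using Polygamma_1_reflection[OF tau] by (simp add: algebra_simps)
  note m = sums_mult[OF this, of "- inverse (4 * of_real pi ^ 2)"]
  have "(\<lambda>k. inverse (cnj (W k) ^ 2) + inverse (W k ^ 2)) sums
      (- inverse (4 * of_real pi ^ 2) * ((of_real pi / sin (of_real pi * \<tau>))\<^sup>2 - inverse (\<tau>\<^sup>2)))"
  proof -
    have c: "- inverse (4 * complex_of_real pi ^ 2) * (- 4 * complex_of_real pi ^ 2 * u) = u" for u
      by simp
    show ?thesis using m unfolding c .
  qed
  also have "- inverse (4 * of_real pi ^ 2) * ((of_real pi / sin (of_real pi * \<tau>))\<^sup>2 - inverse (\<tau>\<^sup>2))
      = - inverse (4 * of_real pi ^ 2) * (of_real pi / sin (of_real pi * \<tau>))\<^sup>2 - inverse (of_real y ^ 2)"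
  proof -
    have "- inverse (4 * c\<^sup>2) * (X - (- 4 * c\<^sup>2 * Z)) = - inverse (4 * c\<^sup>2) * X - Z" if "c \<noteq> 0" for c X Z :: complex
      using that by (simp add: field_simps)
    then show ?thesis unfolding e0 by simp
  qed
  finally have "(\<lambda>k. inverse (cnj (W k) ^ 2) + inverse (W k ^ 2)) sums
      (- inverse (4 * of_real pi ^ 2) * (of_real pi / sin (of_real pi * \<tau>))\<^sup>2 - inverse (of_real y ^ 2))" .
  moreover have "inverse (cnj (W k) ^ 2) + inverse (W k ^ 2) = of_real (lipschitz_kernel 2 y k)" for k
  proof -
    have "W k powr (- of_real 2) = inverse (W k ^ 2)"
      using W(1)[of k] by (simp add: powr_minus)
    moreover have "inverse (cnj (W k) ^ 2) + inverse (W k ^ 2) = of_real (2 * Re (inverse (W k ^ 2)))"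
      using complex_add_cnj[of "inverse (W k ^ 2)"] by (simp add: add.commute)
    ultimately show ?thesis by (simp add: lipschitz_kernel_def W_def)
  qed
  moreover have "- inverse (4 * of_real pi ^ 2) * (of_real pi / sin (of_real pi * \<tau>))\<^sup>2 - inverse (of_real y ^ 2)
     = complex_of_real (exp (- y) / (1 - exp (- y))\<^sup>2 - inverse (y ^ 2))"
  proof -
    have "of_real pi * \<tau> = \<i> * of_real (y / 2)" by (simp add: \<tau>_def)
    then have "sin (of_real pi * \<tau>) = (exp (of_real (- (y / 2))) - exp (of_real (y / 2))) / (2 * \<i>)"
    proof -
      have "\<i> * (of_real pi * \<tau>) = of_real (- (y / 2))"
        unfolding \<open>of_real pi * \<tau> = _\<close> by (simp add: algebra_simps flip: mult.assoc)
      then show ?thesis unfolding sin_exp_eq by simp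
    qed
    also have "\<dots> = of_real (exp (- (y / 2)) - exp (y / 2)) / (2 * \<i>)" by (simp only: exp_of_real of_real_diff)
    finally have "(sin (of_real pi * \<tau>))\<^sup>2 = - of_real ((exp (- (y / 2)) - exp (y / 2))\<^sup>2 / 4)"
      by (simp add: power_divide power_mult_distrib)
    also have "(exp (- (y / 2)) - exp (y / 2))\<^sup>2 = (1 - exp (- y))\<^sup>2 / exp (- y)"
    proof -
      have "(1 - exp (- y))\<^sup>2 = (exp (- (y/2)) * (exp (y / 2) - exp (- (y/2))))\<^sup>2"
        by (simp add: right_diff_distrib mult_exp_exp)
      also have "\<dots> = exp (- y) * (exp (- (y / 2)) - exp (y / 2))\<^sup>2"
        by (simp add: power_mult_distrib power2_commute flip: exp_double)
      finally show ?thesis by simp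
    qed
    finally have sq: "(sin (of_real pi * \<tau>))\<^sup>2 = - complex_of_real ((1 - exp (- y))\<^sup>2 / exp (- y) / 4)" .
    show ?thesis unfolding power_divide sq using y
      by (simp add: field_simps)
  qed
  ultimately have "(\<lambda>k. complex_of_real (lipschitz_kernel 2 y k)) sums complex_of_real (exp (- y) / (1 - exp (- y))\<^sup>2 - inverse (y ^ 2))"
    by simp
  then have ker: "(\<lambda>k. lipschitz_kernel 2 y k) sums (exp (- y) / (1 - exp (- y))\<^sup>2 - inverse (y ^ 2))"
    by (simp only: sums_of_real_iff)
  have "(\<lambda>n. of_nat (Suc n) * exp (- y) ^ n) sums (1 / (1 - exp (- y))\<^sup>2)"
    by (rule geometric_deriv_sums) (use y in simp)
  from sums_mult2[OF this, of "exp (- y)"]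
  have "(\<lambda>n. real (Suc n) powr (2 - 1) * exp (- (real (Suc n) * y))) sums (exp (- y) / (1 - exp (- y))\<^sup>2)"
    by (simp add: exp_of_nat_mult[symmetric] mult_exp_exp algebra_simps)
  then show "(\<lambda>n. real (Suc n) powr (2 - 1) * exp (- (real (Suc n) * y))) sums
      (Gamma 2 * (y powr - 2 + (\<Sum>l. lipschitz_kernel 2 y l)))"
    using y by (simp add: Gamma_numeral powr_minus sums_unique[OF ker, symmetric])
qed

lemma summable_powr_exp:
  assumes "y > (0::real)"
  shows "summable (\<lambda>n. real (Suc n) powr s * exp (- (real (Suc n) * y)))"
proof -
  have "(\<lambda>n. real (Suc n) powr s * exp (- (real (Suc n) * y))) \<in> O(\<lambda>n. inverse (real n ^ 2))"
    using assms by real_asymp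
  then show ?thesis
    by (rule summable_comparison_test_bigo[rotated]) (simp add: inverse_power_summable)
qed

text \<open>Termwise differentiation with respect to \<open>y\<close> raises the exponent by one on both sides.\<close>

lemma lipschitz_formula_Suc:
  assumes p: "p > 1" and L: "lipschitz_formula p"
  shows "lipschitz_formula (p + 1)"
  unfolding lipschitz_formula_def
proof (intro allI impI)
  fix y :: real assume y: "y > 0"
  define S where "S = {y / 2<..}"
  have S: "convex S" "open S" "y \<in> S" "interior S = S" "\<And>x. x \<in> S \<Longrightarrow> x > y / 2" "\<And>x. x \<in> S \<Longrightarrow> x > 0"
    using y by (auto simp: S_def interior_open)
  define A where "A = (\<lambda>n x. real (Suc n) powr (p - 1) * exp (- (real (Suc n) * x)))"
  define A' where "A' = (\<lambda>n x. - (real (Suc n) powr p * exp (- (real (Suc n) * x))))"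
  have dA: "((\<lambda>x. \<Sum>n. A n x) has_field_derivative (\<Sum>n. A' n y)) (at y)"
  proof (rule has_field_derivative_series'(2)[OF S(1)])
    show "(A n has_field_derivative A' n x) (at x within S)" for n x
      unfolding A_def A'_def
      by (auto intro!: derivative_eq_intros simp: powr_diff) (simp add: field_simps)
    show "uniformly_convergent_on S (\<lambda>n x. \<Sum>i<n. A' i x)"
    proof (rule Weierstrass_m_test')
      show "summable (\<lambda>n. real (Suc n) powr p * exp (- (real (Suc n) * (y / 2))))"
        using y by (intro summable_powr_exp) auto
      show "norm (A' n x) \<le> real (Suc n) powr p * exp (- (real (Suc n) * (y / 2)))" if "x \<in> S" for n x
        using S(5)[OF that] by (simp add: A'_def mult_left_mono)
    qed
    show "summable (\<lambda>n. A n y)" unfolding A_def by (rule summable_powr_exp[OF y])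
  qed (use S in auto)
  have dK: "((\<lambda>x. \<Sum>l. lipschitz_kernel p x l) has_field_derivative (\<Sum>l. - p * lipschitz_kernel (p + 1) y l)) (at y)"
  proof (rule has_field_derivative_series'(2)[OF S(1)])
    show "((\<lambda>x. lipschitz_kernel p x l) has_field_derivative - p * lipschitz_kernel (p + 1) x l) (at x within S)" if "x \<in> S" for l x
      by (rule has_field_derivative_at_within[OF lipschitz_kernel_has_real_derivative[OF S(6)[OF that]]])
    show "uniformly_convergent_on S (\<lambda>n x. \<Sum>i<n. - p * lipschitz_kernel (p + 1) x i)"
    proof (rule Weierstrass_m_test')
      show "summable (\<lambda>l. p * (2 * ((2 * pi * real (Suc l)) powr - p) * (y / 2) powr (- 1)))"
        by (intro summable_mult summable_mult2 summable_lipschitz_weights p)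
      show "norm (- p * lipschitz_kernel (p + 1) x l) \<le> p * (2 * ((2 * pi * real (Suc l)) powr - p) * (y / 2) powr (- 1))"
        if "x \<in> S" for l x
      proof -
        have kb: "\<bar>lipschitz_kernel (p + 1) x l\<bar> \<le> 2 * (2 * pi * real (Suc l)) powr - p * x powr (p - (p + 1))"
          using S(6)[OF that] p by (intro lipschitz_kernel_bound) auto
        have "x powr (p - (p + 1)) \<le> (y / 2) powr (- 1)"
          using S(5)[OF that] y S(6)[OF that] le_imp_inverse_le[of "y / 2" x] by (simp add: powr_minus)
        then have "2 * (2 * pi * real (Suc l)) powr - p * x powr (p - (p + 1)) \<le> 2 * (2 * pi * real (Suc l)) powr - p * (y / 2) powr (- 1)"
          by (rule mult_left_mono) simp
        with kb have "\<bar>lipschitz_kernel (p + 1) x l\<bar> \<le> 2 * (2 * pi * real (Suc l)) powr - p * (y / 2) powr (- 1)"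
          by (rule order_trans)
        then have "p * \<bar>lipschitz_kernel (p + 1) x l\<bar> \<le> p * (2 * (2 * pi * real (Suc l)) powr - p * (y / 2) powr (- 1))"
          by (rule mult_left_mono) (use p in linarith)
        moreover have "norm (- p * lipschitz_kernel (p + 1) x l) = p * \<bar>lipschitz_kernel (p + 1) x l\<bar>"
          using p unfolding real_norm_def abs_mult by simp
        ultimately show ?thesis by (simp only:)
      qed
    qed
    show "summable (\<lambda>l. lipschitz_kernel p y l)"
      using summable_lipschitz_kernel[OF y p] by (rule summable_rabs_cancel)
  qed (use S in auto)
  have "((\<lambda>x. Gamma p * (x powr - p + (\<Sum>l. lipschitz_kernel p x l))) has_field_derivative
      Gamma p * (- p * y powr (- p - 1) + (\<Sum>l. - p * lipschitz_kernel (p + 1) y l))) (at y)"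
    using y by (intro DERIV_cmult DERIV_add dK) (auto intro!: derivative_eq_intros)
  then have "((\<lambda>x. \<Sum>n. A n x) has_field_derivative
      Gamma p * (- p * y powr (- p - 1) + (\<Sum>l. - p * lipschitz_kernel (p + 1) y l))) (at y)"
  proof (rule has_field_derivative_transform_within_open[OF _ S(2,3)])
    fix x assume "x \<in> S"
    then have "(\<lambda>n. A n x) sums (Gamma p * (x powr - p + (\<Sum>l. lipschitz_kernel p x l)))"
      using L S(6)[of x] unfolding lipschitz_formula_def A_def by blast
    then show "Gamma p * (x powr - p + (\<Sum>l. lipschitz_kernel p x l)) = (\<Sum>n. A n x)"
      by (rule sums_unique)
  qed
  with dA have "(\<Sum>n. A' n y) = Gamma p * (- p * y powr (- p - 1) + (\<Sum>l. - p * lipschitz_kernel (p + 1) y l))"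
    by (rule DERIV_unique)
  also have "(\<Sum>l. - p * lipschitz_kernel (p + 1) y l) = - p * (\<Sum>l. lipschitz_kernel (p + 1) y l)"
  proof -
    have "summable (\<lambda>l. lipschitz_kernel (p + 1) y l)"
      by (rule summable_rabs_cancel[OF summable_lipschitz_kernel[OF y]]) (use p in simp)
    then show ?thesis by (rule suminf_mult)
  qed
  also have "(\<Sum>n. A' n y) = - (\<Sum>n. real (Suc n) powr (p + 1 - 1) * exp (- (real (Suc n) * y)))"
  proof -
    have "summable (\<lambda>n. real (Suc n) powr (p + 1 - 1) * exp (- (real (Suc n) * y)))"
      using summable_powr_exp[OF y, of p] by simp
    from suminf_minus[OF this] show ?thesis by (simp add: A'_def)
  qed
  finally have "(\<Sum>n. real (Suc n) powr (p + 1 - 1) * exp (- (real (Suc n) * y)))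
      = Gamma (p + 1) * (y powr - (p + 1) + (\<Sum>l. lipschitz_kernel (p + 1) y l))"
  proof -
    assume *: "- (\<Sum>n. real (Suc n) powr (p + 1 - 1) * exp (- (real (Suc n) * y))) =
      Gamma p * (- p * y powr (- p - 1) + - p * (\<Sum>l. lipschitz_kernel (p + 1) y l))"
    have "Gamma (p + 1) = p * Gamma p" using p by (intro Gamma_plus1) (auto elim!: nonpos_Ints_cases')
    moreover have "- (p + 1) = - p - 1" by simp
    ultimately show ?thesis using * by (simp only:) (simp add: ring_distribs mult_ac)
  qed
  then show "(\<lambda>n. real (Suc n) powr (p + 1 - 1) * exp (- (real (Suc n) * y))) sums
      (Gamma (p + 1) * (y powr - (p + 1) + (\<Sum>l. lipschitz_kernel (p + 1) y l)))"
    using summable_powr_exp[OF y, of p] by (simp add: sums_iff)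
qed

section \<open>Poisson summation for mixtures of exponentials\<close>

text \<open>In this section \<open>g(t)\<close> is a mixture of the exponentials \<open>exp (- t Y)\<close> with nonnegative weight
\<open>\<phi>\<close>.  A property of a single exponential passes to \<open>g\<close> by exchanging integrals; as the weight is
nonnegative, finiteness of moments of \<open>g\<close> is all the integrability that this takes.\<close>

lemma mixture_moment:
  fixes \<phi> Y :: "'a \<Rightarrow> real"
  assumes "sigma_finite_measure M" and [measurable]: "\<phi> \<in> borel_measurable M" "Y \<in> borel_measurable M"
    and [measurable]: "g \<in> borel_measurable borel"
    and \<phi>: "\<And>\<omega>. \<phi> \<omega> \<ge> 0" and Y: "AE \<omega> in M. Y \<omega> > 0"
    and g: "\<forall>t>0. (\<integral>\<^sup>+\<omega>. ennreal (\<phi> \<omega> * exp (- t * Y \<omega>)) \<partial>M) = ennreal (g t)"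
    and g0: "\<And>t. g t \<ge> 0"
    and s: "s > 0"
  shows "(\<integral>\<^sup>+t. ennreal (t powr (s - 1) * g t) \<partial>pos_lborel) = ennreal (Gamma s) * (\<integral>\<^sup>+\<omega>. ennreal (\<phi> \<omega> * Y \<omega> powr - s) \<partial>M)"
proof -
  interpret M: sigma_finite_measure M by fact
  interpret pair_sigma_finite M pos_lborel ..
  have "(\<integral>\<^sup>+t. ennreal (t powr (s - 1) * g t) \<partial>pos_lborel)
      = (\<integral>\<^sup>+t. (\<integral>\<^sup>+\<omega>. ennreal (t powr (s - 1) * (\<phi> \<omega> * exp (- t * Y \<omega>))) \<partial>M) \<partial>pos_lborel)"
  proof (rule nn_integral_pos_lborel_cong)
    fix t :: real assume t: "t > 0"
    show "ennreal (t powr (s - 1) * g t) = (\<integral>\<^sup>+\<omega>. ennreal (t powr (s - 1) * (\<phi> \<omega> * exp (- t * Y \<omega>))) \<partial>M)"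
      using g[rule_format, OF t] \<phi> g0 by (simp add: ennreal_mult nn_integral_cmult)
  qed
  also have "\<dots> = (\<integral>\<^sup>+\<omega>. (\<integral>\<^sup>+t. ennreal (t powr (s - 1) * (\<phi> \<omega> * exp (- t * Y \<omega>))) \<partial>pos_lborel) \<partial>M)"
    by (rule Fubini') measurable
  also have "\<dots> = (\<integral>\<^sup>+\<omega>. ennreal (Gamma s) * ennreal (\<phi> \<omega> * Y \<omega> powr - s) \<partial>M)"
  proof (rule nn_integral_cong_AE, rule AE_mp[OF Y], intro AE_I2 impI)
    fix \<omega> assume Yp: "Y \<omega> > 0"
    have "(\<integral>\<^sup>+t. ennreal (t powr (s - 1) * (\<phi> \<omega> * exp (- t * Y \<omega>))) \<partial>pos_lborel)
        = (\<integral>\<^sup>+t. ennreal (\<phi> \<omega>) * ennreal (t powr (s - 1) * exp (- Y \<omega> * t)) \<partial>pos_lborel)"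
      using \<phi> by (intro nn_integral_cong) (simp add: ennreal_mult[symmetric] mult_ac)
    also have "\<dots> = ennreal (\<phi> \<omega>) * (\<integral>\<^sup>+t. ennreal (t powr (s - 1) * exp (- Y \<omega> * t)) \<partial>pos_lborel)"
      by (rule nn_integral_cmult) measurable
    also have "\<dots> = ennreal (Gamma s) * ennreal (\<phi> \<omega> * Y \<omega> powr - s)"
      unfolding Gamma_nn_integral_scaled[OF s Yp]
      using \<phi>[of \<omega>] s by (simp add: ennreal_mult[symmetric] mult_ac)
    finally show "(\<integral>\<^sup>+t. ennreal (t powr (s - 1) * (\<phi> \<omega> * exp (- t * Y \<omega>))) \<partial>pos_lborel) = ennreal (Gamma s) * ennreal (\<phi> \<omega> * Y \<omega> powr - s)" .
  qed
  also have "\<dots> = ennreal (Gamma s) * (\<integral>\<^sup>+\<omega>. ennreal (\<phi> \<omega> * Y \<omega> powr - s) \<partial>M)"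
    by (rule nn_integral_cmult) measurable
  finally show ?thesis .
qed

lemma mixture_moment_integrable:
  fixes \<phi> Y :: "'a \<Rightarrow> real"
  assumes "sigma_finite_measure M" and [measurable]: "\<phi> \<in> borel_measurable M" "Y \<in> borel_measurable M"
    and [measurable]: "g \<in> borel_measurable borel"
    and \<phi>: "\<And>\<omega>. \<phi> \<omega> \<ge> 0" and Y: "AE \<omega> in M. Y \<omega> > 0"
    and g: "\<forall>t>0. (\<integral>\<^sup>+\<omega>. ennreal (\<phi> \<omega> * exp (- t * Y \<omega>)) \<partial>M) = ennreal (g t)"
    and g0: "\<And>t. g t \<ge> 0"
    and s: "s > 0" and int: "integrable pos_lborel (\<lambda>t. t powr (s - 1) * g t)"
  shows "integrable M (\<lambda>\<omega>. \<phi> \<omega> * Y \<omega> powr - s)"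
    and "Gamma s * (\<integral>\<omega>. \<phi> \<omega> * Y \<omega> powr - s \<partial>M) = (\<integral>t. t powr (s - 1) * g t \<partial>pos_lborel)"
proof -
  have 1: "(\<integral>\<^sup>+t. ennreal (t powr (s - 1) * g t) \<partial>pos_lborel) = ennreal (\<integral>t. t powr (s - 1) * g t \<partial>pos_lborel)"
    by (rule nn_integral_eq_integral[OF int]) (use g0 in auto)
  have 2: "ennreal (Gamma s) * (\<integral>\<^sup>+\<omega>. ennreal (\<phi> \<omega> * Y \<omega> powr - s) \<partial>M) = ennreal (\<integral>t. t powr (s - 1) * g t \<partial>pos_lborel)"
    using mixture_moment[OF assms(1-8) s] g0 1 by simp
  have G: "Gamma s > 0" using s by simp
  have "(\<integral>\<^sup>+\<omega>. ennreal (\<phi> \<omega> * Y \<omega> powr - s) \<partial>M) < \<infinity>"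
  proof -
    have "ennreal (Gamma s) * (\<integral>\<^sup>+\<omega>. ennreal (\<phi> \<omega> * Y \<omega> powr - s) \<partial>M) \<noteq> top"
      unfolding 2 by simp
    then show ?thesis using G by (auto simp: ennreal_mult_eq_top_iff top.not_eq_extremum)
  qed
  then show int: "integrable M (\<lambda>\<omega>. \<phi> \<omega> * Y \<omega> powr - s)"
    using \<phi> by (intro integrableI_nonneg) (auto simp: top.not_eq_extremum)
  have "(\<integral>\<^sup>+\<omega>. ennreal (\<phi> \<omega> * Y \<omega> powr - s) \<partial>M) = ennreal (\<integral>\<omega>. \<phi> \<omega> * Y \<omega> powr - s \<partial>M)"
    by (rule nn_integral_eq_integral[OF int]) (use \<phi> in auto)
  with 2 show "Gamma s * (\<integral>\<omega>. \<phi> \<omega> * Y \<omega> powr - s \<partial>M) = (\<integral>t. t powr (s - 1) * g t \<partial>pos_lborel)"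
    using G \<phi> g0 by (simp add: ennreal_mult[symmetric] integral_nonneg_AE)
qed

text \<open>The factor \<open>exp (- z t)\<close> has modulus at most one, so the moment of order \<open>s\<close> dominates.  The boundary
\<open>Re z = 0\<close> is included because it carries the Fourier coefficients.\<close>

lemma mixture_laplace_transform:
  fixes \<phi> Y :: "'a \<Rightarrow> real"
  assumes "sigma_finite_measure M" and [measurable]: "\<phi> \<in> borel_measurable M" "Y \<in> borel_measurable M"
    and [measurable]: "g \<in> borel_measurable borel"
    and \<phi>: "\<And>\<omega>. \<phi> \<omega> \<ge> 0" and Y: "AE \<omega> in M. Y \<omega> > 0"
    and g: "\<forall>t>0. (\<integral>\<^sup>+\<omega>. ennreal (\<phi> \<omega> * exp (- t * Y \<omega>)) \<partial>M) = ennreal (g t)"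
    and g0: "\<And>t. g t \<ge> 0"
    and s: "s > 0" and int: "integrable pos_lborel (\<lambda>t. t powr (s - 1) * g t)"
    and z: "Re z \<ge> 0"
  shows "integrable M (\<lambda>\<omega>. complex_of_real (\<phi> \<omega>) * (of_real (Y \<omega>) + z) powr (- of_real s))"
    and "of_real (Gamma s) * (\<integral>\<omega>. complex_of_real (\<phi> \<omega>) * (of_real (Y \<omega>) + z) powr (- of_real s) \<partial>M)
       = (\<integral>t. exp (- z * of_real t) * of_real (t powr (s - 1) * g t) \<partial>pos_lborel)"
proof -
  interpret M: sigma_finite_measure M by fact
  interpret pair_sigma_finite M pos_lborel ..
  note mom = mixture_moment_integrable[OF assms(1-8) s int]
  define F where "F = (\<lambda>\<omega> t. complex_of_real (\<phi> \<omega>) * (exp (- (of_real (Y \<omega>) + z) * of_real t) * of_real (t powr (s - 1))))"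
  have [measurable]: "case_prod F \<in> borel_measurable (M \<Otimes>\<^sub>M pos_lborel)"
    unfolding F_def by measurable
  have normF: "norm (F \<omega> t) \<le> \<phi> \<omega> * (t powr (s - 1) * exp (- Y \<omega> * t))" if "t > 0" for \<omega> t
    using \<phi>[of \<omega>] that z by (auto simp: F_def norm_mult ring_distribs intro!: mult_left_mono)
  have bound: "integrable pos_lborel (\<lambda>t. \<phi> \<omega> * (t powr (s - 1) * exp (- Y \<omega> * t)))"
    "(\<integral>t. \<phi> \<omega> * (t powr (s - 1) * exp (- Y \<omega> * t)) \<partial>pos_lborel) = Gamma s * (\<phi> \<omega> * Y \<omega> powr - s)"
    if "Y \<omega> > 0" for \<omega>
    using Gamma_integrable_scaled[OF s that] by simp_all
  have intF: "integrable pos_lborel (F \<omega>)" if "Y \<omega> > 0" for \<omega>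
  proof (rule Bochner_Integration.integrable_bound[OF bound(1)[OF that]])
    show "AE t in pos_lborel. norm (F \<omega> t) \<le> norm (\<phi> \<omega> * (t powr (s - 1) * exp (- Y \<omega> * t)))"
    proof (rule AE_pos_lborelI)
      fix t :: real assume t: "t > 0"
      show "norm (F \<omega> t) \<le> norm (\<phi> \<omega> * (t powr (s - 1) * exp (- Y \<omega> * t)))"
        using normF[OF t, of \<omega>] abs_ge_self order_trans unfolding real_norm_def by blast
    qed
  qed (simp add: F_def)
  have intFF: "integrable (M \<Otimes>\<^sub>M pos_lborel) (case_prod F)"
  proof (rule Fubini_integrable)
    show "AE \<omega> in M. integrable pos_lborel (\<lambda>t. case_prod F (\<omega>, t))"
      using Y intF by auto
    show "integrable M (\<lambda>\<omega>. \<integral>t. norm (case_prod F (\<omega>, t)) \<partial>pos_lborel)"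
    proof (rule Bochner_Integration.integrable_bound[OF integrable_mult_right[OF mom(1), of "Gamma s"]])
      show "AE \<omega> in M. norm (\<integral>t. norm (case_prod F (\<omega>, t)) \<partial>pos_lborel) \<le> norm (Gamma s * (\<phi> \<omega> * Y \<omega> powr - s))"
      proof (rule AE_mp[OF Y], intro AE_I2 impI)
        fix \<omega> assume Yp: "Y \<omega> > 0"
        have "(\<integral>t. norm (F \<omega> t) \<partial>pos_lborel) \<le> (\<integral>t. \<phi> \<omega> * (t powr (s - 1) * exp (- Y \<omega> * t)) \<partial>pos_lborel)"
          by (rule integral_mono_AE[OF integrable_norm[OF intF[OF Yp]] bound(1)[OF Yp]])
             (rule AE_pos_lborelI, rule normF)
        moreover have "(\<integral>t. norm (F \<omega> t) \<partial>pos_lborel) \<ge> 0" by simp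
        ultimately show "norm (\<integral>t. norm (case_prod F (\<omega>, t)) \<partial>pos_lborel) \<le> norm (Gamma s * (\<phi> \<omega> * Y \<omega> powr - s))"
          unfolding bound(2)[OF Yp] by simp
      qed
    qed measurable
  qed measurable
  have inner1: "(\<integral>t. F \<omega> t \<partial>pos_lborel) = of_real (Gamma s) * (complex_of_real (\<phi> \<omega>) * (of_real (Y \<omega>) + z) powr (- of_real s))" if "Y \<omega> > 0" for \<omega>
    using Gamma_integral_complex_scaled[OF s, of "of_real (Y \<omega>) + z"] that z by (simp add: F_def)
  have inner2: "(\<integral>\<omega>. F \<omega> t \<partial>M) = exp (- z * of_real t) * of_real (t powr (s - 1) * g t)" if t: "t > 0" for t
  proof -
    have "(\<integral>\<omega>. F \<omega> t \<partial>M) = (\<integral>\<omega>. (exp (- z * of_real t) * of_real (t powr (s - 1))) * complex_of_real (\<phi> \<omega> * exp (- t * Y \<omega>)) \<partial>M)"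
      by (intro Bochner_Integration.integral_cong refl)
         (simp add: F_def ring_distribs exp_add exp_diff exp_minus exp_of_real[symmetric] divide_inverse mult_ac)
    also have "\<dots> = (exp (- z * of_real t) * of_real (t powr (s - 1))) * complex_of_real (\<integral>\<omega>. \<phi> \<omega> * exp (- t * Y \<omega>) \<partial>M)"
      by (simp only: integral_mult_right_zero integral_complex_of_real)
    also have "(\<integral>\<omega>. \<phi> \<omega> * exp (- t * Y \<omega>) \<partial>M) = g t"
      using g[rule_format, OF t] g0 \<phi> by (subst integral_eq_nn_integral) auto
    finally show ?thesis by simp
  qed
  have i1: "integrable M (\<lambda>\<omega>. \<integral>t. F \<omega> t \<partial>pos_lborel)" using integrable_fst'[OF intFF] by simp
  have "integrable M (\<lambda>\<omega>. of_real (Gamma s) * (complex_of_real (\<phi> \<omega>) * (of_real (Y \<omega>) + z) powr (- of_real s)))"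
    by (rule integrable_cong_AE_imp[OF i1]) (use Y inner1 in auto)
  then show "integrable M (\<lambda>\<omega>. complex_of_real (\<phi> \<omega>) * (of_real (Y \<omega>) + z) powr (- of_real s))"
  proof -
    assume i: "integrable M (\<lambda>\<omega>. of_real (Gamma s) * (complex_of_real (\<phi> \<omega>) * (of_real (Y \<omega>) + z) powr (- of_real s)))"
    have "complex_of_real (Gamma s) \<noteq> 0" using Gamma_real_pos[OF s] by (simp add: less_le)
    then have "inverse (complex_of_real (Gamma s)) * (of_real (Gamma s) * u) = u" for u by (simp flip: mult.assoc)
    with integrable_mult_right[OF i, of "inverse (of_real (Gamma s))"] show ?thesis by (simp only:)
  qed
  have "of_real (Gamma s) * (\<integral>\<omega>. complex_of_real (\<phi> \<omega>) * (of_real (Y \<omega>) + z) powr (- of_real s) \<partial>M)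
      = (\<integral>\<omega>. of_real (Gamma s) * (complex_of_real (\<phi> \<omega>) * (of_real (Y \<omega>) + z) powr (- of_real s)) \<partial>M)"
    by simp
  also have "\<dots> = (\<integral>\<omega>. (\<integral>t. F \<omega> t \<partial>pos_lborel) \<partial>M)"
    by (rule integral_cong_AE) (use Y inner1 in auto)
  also have "\<dots> = (\<integral>t. (\<integral>\<omega>. F \<omega> t \<partial>M) \<partial>pos_lborel)"
    by (rule Fubini_integral[OF intFF, symmetric])
  also have "\<dots> = (\<integral>t. exp (- z * of_real t) * of_real (t powr (s - 1) * g t) \<partial>pos_lborel)"
  proof (rule integral_pos_lborel_cong)
    show "(\<lambda>t. \<integral>\<omega>. F \<omega> t \<partial>M) \<in> borel_measurable borel"
      using borel_measurable_integrable[OF integrable_snd[of F, OF intFF]] 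
      by simp
  qed (use inner2 in auto)
  finally show "of_real (Gamma s) * (\<integral>\<omega>. complex_of_real (\<phi> \<omega>) * (of_real (Y \<omega>) + z) powr (- of_real s) \<partial>M)
       = (\<integral>t. exp (- z * of_real t) * of_real (t powr (s - 1) * g t) \<partial>pos_lborel)" .
qed

text \<open>Lipschitz's formula at \<open>y = Y \<omega>\<close>, integrated over \<open>\<omega>\<close>.  The moment of order \<open>p - r\<close>
justifies exchanging the integral with the sum over the frequencies, by the bound for the kernel with
exponent \<open>r\<close>.\<close>

theorem poisson_mixture:
  fixes \<phi> Y :: "'a \<Rightarrow> real"
  assumes "sigma_finite_measure M" and [measurable]: "\<phi> \<in> borel_measurable M" "Y \<in> borel_measurable M"
    and [measurable]: "g \<in> borel_measurable borel"
    and \<phi>: "\<And>\<omega>. \<phi> \<omega> \<ge> 0" and Y: "AE \<omega> in M. Y \<omega> > 0"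
    and g: "\<forall>t>0. (\<integral>\<^sup>+\<omega>. ennreal (\<phi> \<omega> * exp (- t * Y \<omega>)) \<partial>M) = ennreal (g t)"
    and g0: "\<And>t. g t \<ge> 0"
    and L: "lipschitz_formula p" and r: "1 < r" "r < p"
    and int: "integrable pos_lborel (\<lambda>t. t powr (p - 1) * g t)"
    and int': "integrable pos_lborel (\<lambda>t. t powr (p - r - 1) * g t)"
  shows "summable (\<lambda>l. 2 * (\<integral>t. cos (2 * pi * real (Suc l) * t) * (t powr (p - 1) * g t) \<partial>pos_lborel))"
    and "(\<lambda>n. real (Suc n) powr (p - 1) * g (real (Suc n))) sums
      ((\<integral>t. t powr (p - 1) * g t \<partial>pos_lborel)
       + (\<Sum>l. 2 * (\<integral>t. cos (2 * pi * real (Suc l) * t) * (t powr (p - 1) * g t) \<partial>pos_lborel)))"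
proof -
  have p: "p > 0" "p > 1" "p - r > 0" using r by auto
  note mom = mixture_moment_integrable[OF assms(1-8) p(1) int]
  note mom' = mixture_moment_integrable[OF assms(1-8) p(3) int']
  have [measurable]: "(\<lambda>\<omega>. lipschitz_kernel p (Y \<omega>) l) \<in> borel_measurable M" for l
    unfolding lipschitz_kernel_def by measurable
  define B where "B = (\<lambda>l. 2 * (2 * pi * real (Suc l)) powr - r)"
  have sB: "summable B" unfolding B_def by (intro summable_mult summable_lipschitz_weights r)
  have kb: "\<bar>\<phi> \<omega> * lipschitz_kernel p (Y \<omega>) l\<bar> \<le> B l * (\<phi> \<omega> * Y \<omega> powr - (p - r))" if "Y \<omega> > 0" for \<omega> l
  proof -
    have "\<bar>\<phi> \<omega> * lipschitz_kernel p (Y \<omega>) l\<bar> = \<phi> \<omega> * \<bar>lipschitz_kernel p (Y \<omega>) l\<bar>" using \<phi> by (simp add: abs_mult)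
    also have "\<dots> \<le> \<phi> \<omega> * (2 * (2 * pi * real (Suc l)) powr - r * Y \<omega> powr (r - p))"
      using that r \<phi> by (intro mult_left_mono lipschitz_kernel_bound) auto
    finally show ?thesis by (simp add: B_def mult_ac)
  qed
  have intk: "integrable M (\<lambda>\<omega>. \<phi> \<omega> * lipschitz_kernel p (Y \<omega>) l)" for l
  proof (rule Bochner_Integration.integrable_bound[OF integrable_mult_right[OF mom'(1), of "B l"]])
    show "AE \<omega> in M. norm (\<phi> \<omega> * lipschitz_kernel p (Y \<omega>) l) \<le> norm (B l * (\<phi> \<omega> * Y \<omega> powr - (p - r)))"
      using Y by eventually_elim (use kb in \<open>force intro: order_trans[OF _ abs_ge_self]\<close>)
  qed measurable
  have kvalue: "Gamma p * (\<integral>\<omega>. \<phi> \<omega> * lipschitz_kernel p (Y \<omega>) l \<partial>M)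
      = 2 * (\<integral>t. cos (2 * pi * real (Suc l) * t) * (t powr (p - 1) * g t) \<partial>pos_lborel)" for l
  proof -
    define z where "z = 2 * of_real pi * \<i> * of_nat (Suc l)"
    have z: "Re z \<ge> 0" by (simp add: z_def)
    note T = mixture_laplace_transform[OF assms(1-8) p(1) int z]
    have iz: "integrable pos_lborel (\<lambda>t. exp (- z * of_real t) * of_real (t powr (p - 1) * g t))"
    proof (rule Bochner_Integration.integrable_bound[OF int])
      show "AE t in pos_lborel. norm (exp (- z * of_real t) * of_real (t powr (p - 1) * g t)) \<le> norm (t powr (p - 1) * g t)"
        by (auto simp: norm_mult z_def)
    qed measurable
    have "(\<integral>\<omega>. \<phi> \<omega> * lipschitz_kernel p (Y \<omega>) l \<partial>M) = (\<integral>\<omega>. 2 * Re (complex_of_real (\<phi> \<omega>) * (of_real (Y \<omega>) + z) powr (- of_real p)) \<partial>M)"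
      by (intro Bochner_Integration.integral_cong refl) (simp add: lipschitz_kernel_def z_def)
    also have "\<dots> = 2 * Re (\<integral>\<omega>. complex_of_real (\<phi> \<omega>) * (of_real (Y \<omega>) + z) powr (- of_real p) \<partial>M)"
      by (simp only: integral_mult_right_zero integral_Re[OF T(1)])
    also have "Gamma p * \<dots> = 2 * Re (of_real (Gamma p) * (\<integral>\<omega>. complex_of_real (\<phi> \<omega>) * (of_real (Y \<omega>) + z) powr (- of_real p) \<partial>M))"
      by simp
    also have "\<dots> = 2 * (\<integral>t. Re (exp (- z * of_real t) * of_real (t powr (p - 1) * g t)) \<partial>pos_lborel)"
      by (simp only: T(2) integral_Re[OF iz])
    also have "(\<lambda>t. Re (exp (- z * of_real t) * of_real (t powr (p - 1) * g t))) = (\<lambda>t. cos (2 * pi * real (Suc l) * t) * (t powr (p - 1) * g t))"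
      by (auto simp: z_def Re_exp)
    finally show ?thesis .
  qed
  have skb: "(\<integral>\<omega>. \<bar>\<phi> \<omega> * lipschitz_kernel p (Y \<omega>) l\<bar> \<partial>M) \<le> B l * (\<integral>\<omega>. \<phi> \<omega> * Y \<omega> powr - (p - r) \<partial>M)" for l
  proof -
    have "(\<integral>\<omega>. \<bar>\<phi> \<omega> * lipschitz_kernel p (Y \<omega>) l\<bar> \<partial>M) \<le> (\<integral>\<omega>. B l * (\<phi> \<omega> * Y \<omega> powr - (p - r)) \<partial>M)"
      by (rule integral_mono_AE[OF integrable_abs[OF intk] integrable_mult_right[OF mom'(1)]])
         (rule AE_mp[OF Y AE_I2], use kb in blast)
    then show ?thesis by simp
  qed
  have sn: "summable (\<lambda>l. \<integral>\<omega>. norm (\<phi> \<omega> * lipschitz_kernel p (Y \<omega>) l) \<partial>M)"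
    by (rule summable_comparison_test'[OF summable_mult2[OF sB]]) (use skb in simp)
  have skY: "summable (\<lambda>l. norm (\<phi> \<omega> * lipschitz_kernel p (Y \<omega>) l))" if "Y \<omega> > 0" for \<omega>
    using summable_mult[OF summable_lipschitz_kernel[OF that p(2)], of "\<phi> \<omega>"] \<phi> by (simp add: abs_mult)
  have AEs: "AE \<omega> in M. summable (\<lambda>l. norm (\<phi> \<omega> * lipschitz_kernel p (Y \<omega>) l))"
    using Y skY by auto
  note K1 = integrable_suminf[OF intk AEs sn] and K2 = integral_suminf[OF intk AEs sn]
  have sk: "summable (\<lambda>l. \<integral>\<omega>. \<phi> \<omega> * lipschitz_kernel p (Y \<omega>) l \<partial>M)"
    by (rule summable_comparison_test'[OF sn]) (rule integral_norm_bound)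
  show "summable (\<lambda>l. 2 * (\<integral>t. cos (2 * pi * real (Suc l) * t) * (t powr (p - 1) * g t) \<partial>pos_lborel))"
    using summable_mult[OF sk, of "Gamma p"] by (simp only: kvalue)
  define H where "H = (\<lambda>\<omega>. Gamma p * (\<phi> \<omega> * Y \<omega> powr - p + (\<Sum>l. \<phi> \<omega> * lipschitz_kernel p (Y \<omega>) l)))"
  have intH: "integrable M H" unfolding H_def
    by (intro integrable_mult_right Bochner_Integration.integrable_add mom(1) K1)
  have H_eq: "(\<integral>\<omega>. H \<omega> \<partial>M) = (\<integral>t. t powr (p - 1) * g t \<partial>pos_lborel)
       + (\<Sum>l. 2 * (\<integral>t. cos (2 * pi * real (Suc l) * t) * (t powr (p - 1) * g t) \<partial>pos_lborel))"
    unfolding H_def using mom K1 K2 sk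
    by (simp add: distrib_left suminf_mult[symmetric] kvalue)
  define A where "A = (\<lambda>n \<omega>. \<phi> \<omega> * (real (Suc n) powr (p - 1) * exp (- (real (Suc n) * Y \<omega>))))"
  have A0: "A n \<omega> \<ge> 0" for n \<omega> using \<phi> by (simp add: A_def)
  have As: "(\<lambda>n. A n \<omega>) sums H \<omega>" if "Y \<omega> > 0" for \<omega>
  proof -
    have "(\<Sum>l. \<phi> \<omega> * lipschitz_kernel p (Y \<omega>) l) = \<phi> \<omega> * (\<Sum>l. lipschitz_kernel p (Y \<omega>) l)"
      by (rule suminf_mult[OF summable_rabs_cancel[OF summable_lipschitz_kernel[OF that p(2)]]])
    then have "H \<omega> = \<phi> \<omega> * (Gamma p * (Y \<omega> powr - p + (\<Sum>l. lipschitz_kernel p (Y \<omega>) l)))"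
      by (simp add: H_def algebra_simps)
    then show ?thesis unfolding A_def using L that by (auto simp: lipschitz_formula_def intro!: sums_mult)
  qed
  \<comment> \<open>The terms \<open>A\<close> are nonnegative, so their partial sums are dominated by the other side of Lipschitz's formula.\<close>
  have intA: "integrable M (A n)" for n
  proof (rule Bochner_Integration.integrable_bound[OF intH])
    show "AE \<omega> in M. norm (A n \<omega>) \<le> norm (H \<omega>)"
      using Y
    proof eventually_elim
      case (elim \<omega>)
      have "(\<Sum>i\<in>{n}. A i \<omega>) \<le> H \<omega>"
        using As[OF elim] A0 sum_le_suminf[of "\<lambda>n. A n \<omega>" "{n}"] by (simp add: sums_iff)
      then show ?case using A0[of n \<omega>] by simp
    qed
  qed (simp add: A_def)
  have sumA: "summable (\<lambda>n. \<integral>\<omega>. norm (A n \<omega>) \<partial>M)"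
  proof (rule summableI_nonneg_bounded[where x = "\<integral>\<omega>. H \<omega> \<partial>M"])
    fix N
    have "(\<Sum>n<N. \<integral>\<omega>. norm (A n \<omega>) \<partial>M) = (\<integral>\<omega>. (\<Sum>n<N. A n \<omega>) \<partial>M)"
      using A0 intA by (simp add: Bochner_Integration.integral_sum)
    also have "\<dots> \<le> (\<integral>\<omega>. H \<omega> \<partial>M)"
    proof (rule integral_mono_AE)
      show "AE \<omega> in M. (\<Sum>n<N. A n \<omega>) \<le> H \<omega>"
        using Y
      proof eventually_elim
        case (elim \<omega>)
        show ?case using As[OF elim] A0 sum_le_suminf[of "\<lambda>n. A n \<omega>" "{..<N}"] by (simp add: sums_iff)
      qed
    qed (use intA intH in auto)
    finally show "(\<Sum>n<N. \<integral>\<omega>. norm (A n \<omega>) \<partial>M) \<le> (\<integral>\<omega>. H \<omega> \<partial>M)" .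
  qed simp
  have AEA: "AE \<omega> in M. summable (\<lambda>n. norm (A n \<omega>))"
    using Y by eventually_elim (use As A0 in \<open>auto simp: sums_iff\<close>)
  have "(\<lambda>n. \<integral>\<omega>. A n \<omega> \<partial>M) sums (\<integral>\<omega>. (\<Sum>n. A n \<omega>) \<partial>M)"
    by (rule sums_integral[OF intA AEA sumA])
  also have "(\<integral>\<omega>. (\<Sum>n. A n \<omega>) \<partial>M) = (\<integral>\<omega>. H \<omega> \<partial>M)"
  proof (rule integral_cong_AE)
    show "(\<lambda>\<omega>. \<Sum>n. A n \<omega>) \<in> borel_measurable M" using intA by measurable
    show "H \<in> borel_measurable M" using intH by measurable
    show "AE \<omega> in M. (\<Sum>n. A n \<omega>) = H \<omega>"
      using Y by eventually_elim (use As in \<open>auto simp: sums_iff\<close>)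
  qed
  also have "(\<lambda>n. \<integral>\<omega>. A n \<omega> \<partial>M) = (\<lambda>n. real (Suc n) powr (p - 1) * g (real (Suc n)))"
  proof
    fix n
    have "(\<integral>\<omega>. A n \<omega> \<partial>M) = real (Suc n) powr (p - 1) * (\<integral>\<omega>. \<phi> \<omega> * exp (- real (Suc n) * Y \<omega>) \<partial>M)"
      by (subst integral_mult_right_zero[symmetric]) (simp add: A_def algebra_simps)
    also have "(\<integral>\<omega>. \<phi> \<omega> * exp (- real (Suc n) * Y \<omega>) \<partial>M) = g (real (Suc n))"
      using g[rule_format, of "real (Suc n)"] g0 \<phi> by (subst integral_eq_nn_integral) auto
    finally show "(\<integral>\<omega>. A n \<omega> \<partial>M) = real (Suc n) powr (p - 1) * g (real (Suc n))" .
  qed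
  finally show "(\<lambda>n. real (Suc n) powr (p - 1) * g (real (Suc n))) sums
      ((\<integral>t. t powr (p - 1) * g t \<partial>pos_lborel)
       + (\<Sum>l. 2 * (\<integral>t. cos (2 * pi * real (Suc l) * t) * (t powr (p - 1) * g t) \<partial>pos_lborel)))"
    unfolding H_eq .
qed

lemma Gamma_times_lipschitz_kernel:
  assumes p: "p > 0" and y: "y > 0"
  shows "Gamma p * lipschitz_kernel p y l = 2 * (\<integral>t. cos (2 * pi * real (Suc l) * t) * (t powr (p - 1) * exp (- y * t)) \<partial>pos_lborel)"
proof -
  define z where "z = of_real y + 2 * of_real pi * \<i> * of_nat (Suc l)"
  have z: "Re z = y" "Im z = 2 * pi * real (Suc l)" by (auto simp: z_def)
  have iz: "integrable pos_lborel (\<lambda>t. exp (- z * of_real t) * complex_of_real (t powr (p - 1)))"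
  proof (rule Bochner_Integration.integrable_bound[OF Gamma_integrable_scaled(1)[OF p y]])
    show "AE t in pos_lborel. norm (exp (- z * of_real t) * complex_of_real (t powr (p - 1))) \<le> norm (t powr (p - 1) * exp (- y * t))"
      by (auto simp: norm_mult z)
  qed measurable
  have "Gamma p * lipschitz_kernel p y l = 2 * Re (of_real (Gamma p) * z powr (- of_real p))"
    by (simp add: lipschitz_kernel_def z_def)
  also have "\<dots> = 2 * Re (\<integral>t. exp (- z * of_real t) * complex_of_real (t powr (p - 1)) \<partial>pos_lborel)"
    using Gamma_integral_complex_scaled[OF p, of z] z y by simp
  also have "\<dots> = 2 * (\<integral>t. Re (exp (- z * of_real t) * complex_of_real (t powr (p - 1))) \<partial>pos_lborel)"
    by (simp only: integral_Re[OF iz])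
  also have "(\<lambda>t. Re (exp (- z * of_real t) * complex_of_real (t powr (p - 1)))) = (\<lambda>t. cos (2 * pi * real (Suc l) * t) * (t powr (p - 1) * exp (- y * t)))"
    by (rule ext) (simp add: Re_exp z)
  finally show ?thesis .
qed

text \<open>The function \<open>t powr (p - 2) * exp (- y t)\<close> is the mixture of the exponentials \<open>exp (- t (x + y))\<close>
with weight \<open>x powr (1 - p) / \<Gamma>(2 - p)\<close>, so the formula for the exponent \<open>2\<close> yields the one for
\<open>p\<close>.\<close>

lemma lipschitz_formula_between_1_2:
  assumes p: "1 < p" "p < 2"
  shows "lipschitz_formula p"
  unfolding lipschitz_formula_def
proof (intro allI impI)
  fix y :: real assume y: "y > 0"
  \<comment> \<open>Any \<open>r\<close> strictly between \<open>1\<close> and \<open>p\<close> serves.\<close>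
  define r where "r = (1 + p) / 2"
  have r: "1 < r" "r < 2" "r < p" using p by (auto simp: r_def)
  define \<phi> where "\<phi> = (\<lambda>x. x powr (1 - p) / Gamma (2 - p))"
  define Y where "Y = (\<lambda>x. x + y)"
  define g where "g = (\<lambda>t. t powr (p - 2) * exp (- y * t))"
  have [measurable]: "\<phi> \<in> borel_measurable borel" "Y \<in> borel_measurable borel" "g \<in> borel_measurable borel"
    unfolding \<phi>_def Y_def g_def by measurable
  have G: "Gamma (2 - p) > 0" using p by simp
  have 1: "\<phi> x \<ge> 0" for x using G by (simp add: \<phi>_def)
  have 2: "AE x in pos_lborel. Y x > 0" using y by (intro AE_pos_lborelI) (simp add: Y_def)
  have 3: "\<forall>t>0. (\<integral>\<^sup>+x. ennreal (\<phi> x * exp (- t * Y x)) \<partial>pos_lborel) = ennreal (g t)"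
  proof (intro allI impI)
    fix t :: real assume t: "t > 0"
    have p2: "2 - p > 0" using p by simp
    have "(\<integral>\<^sup>+x. ennreal (\<phi> x * exp (- t * Y x)) \<partial>pos_lborel)
        = (\<integral>\<^sup>+x. ennreal (exp (- y * t) / Gamma (2 - p)) * ennreal (x powr ((2 - p) - 1) * exp (- t * x)) \<partial>pos_lborel)"
      using G by (intro nn_integral_cong) (simp add: \<phi>_def Y_def ennreal_mult[symmetric] exp_add[symmetric] algebra_simps flip: exp_add)
    also have "\<dots> = ennreal (exp (- y * t) / Gamma (2 - p)) * (\<integral>\<^sup>+x. ennreal (x powr ((2 - p) - 1) * exp (- t * x)) \<partial>pos_lborel)"
      by (rule nn_integral_cmult) measurable
    also have "\<dots> = ennreal (exp (- y * t) / Gamma (2 - p)) * ennreal (Gamma (2 - p) * t powr - (2 - p))"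
      by (simp only: Gamma_nn_integral_scaled[OF p2 t])
    also have "\<dots> = ennreal (g t)" using G by (simp add: ennreal_mult[symmetric] g_def)
    finally show "(\<integral>\<^sup>+x. ennreal (\<phi> x * exp (- t * Y x)) \<partial>pos_lborel) = ennreal (g t)" .
  qed
  have 4: "g t \<ge> 0" for t by (simp add: g_def)
  have e: "t powr (2 - 1) * g t = t powr (p - 1) * exp (- y * t)" if "t > 0" for t
  proof -
    have "t powr (2 - 1) * t powr (p - 2) = t powr (p - 1)" by (subst powr_add[symmetric]) simp
    then show ?thesis unfolding g_def mult.assoc[symmetric] by (simp only:)
  qed
  have e': "t powr (2 - r - 1) * g t = t powr ((p - r) - 1) * exp (- y * t)" if "t > 0" for t
  proof -
    have "t powr (2 - r - 1) * t powr (p - 2) = t powr (p - r - 1)" by (subst powr_add[symmetric]) simp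
    then show ?thesis unfolding g_def mult.assoc[symmetric] by (simp only:)
  qed
  have p0: "p > 0" "p - r > 0" using p r by auto
  have 5: "integrable pos_lborel (\<lambda>t. t powr (2 - 1) * g t)"
    by (rule integrable_cong_AE_imp[OF Gamma_integrable_scaled(1)[OF p0(1) y]]) (measurable, rule AE_pos_lborelI, erule e[symmetric])
  have 6: "integrable pos_lborel (\<lambda>t. t powr (2 - r - 1) * g t)"
    by (rule integrable_cong_AE_imp[OF Gamma_integrable_scaled(1)[OF p0(2) y]]) (measurable, rule AE_pos_lborelI, erule e'[symmetric])
  note P = poisson_mixture[OF pos_lborel.sigma_finite_measure_axioms _ _ _ 1 2 3 4 lipschitz_formula_2 r(1,2) 5 6]
  have c: "2 * (\<integral>t. cos (2 * pi * real (Suc l) * t) * (t powr (2 - 1) * g t) \<partial>pos_lborel) = Gamma p * lipschitz_kernel p y l" for l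
    unfolding Gamma_times_lipschitz_kernel[OF p0(1) y]
    by (rule arg_cong[where f = "\<lambda>x. 2 * x"], rule integral_pos_lborel_cong) (measurable, simp only: e)
  have c0: "(\<integral>t. t powr (2 - 1) * g t \<partial>pos_lborel) = Gamma p * y powr - p"
    unfolding Gamma_integrable_scaled(2)[OF p0(1) y, symmetric]
    by (rule integral_pos_lborel_cong) (measurable, erule e)
  have "(\<lambda>n. real (Suc n) powr (2 - 1) * g (real (Suc n))) sums (Gamma p * y powr - p + (\<Sum>l. Gamma p * lipschitz_kernel p y l))"
    using P(2) unfolding c c0 by simp
  also have "(\<lambda>n. real (Suc n) powr (2 - 1) * g (real (Suc n))) = (\<lambda>n. real (Suc n) powr (p - 1) * exp (- (real (Suc n) * y)))"
    by (rule ext) (subst e, simp_all add: mult.commute)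
  also have "(\<Sum>l. Gamma p * lipschitz_kernel p y l) = Gamma p * (\<Sum>l. lipschitz_kernel p y l)"
    using summable_rabs_cancel[OF summable_lipschitz_kernel[OF y p(1)]] by (rule suminf_mult)
  finally show "(\<lambda>n. real (Suc n) powr (p - 1) * exp (- (real (Suc n) * y))) sums
      (Gamma p * (y powr - p + (\<Sum>l. lipschitz_kernel p y l)))" by (simp add: distrib_left)
qed

theorem lipschitz_formula_nonint:
  assumes p: "p > 1" "p \<notin> \<int>"
  shows "lipschitz_formula p"
proof -
  have *: "lipschitz_formula (q + real m)" if "1 < q" "q < 2" for q m
  proof (induction m)
    case 0 then show ?case using lipschitz_formula_between_1_2[OF that] by simp
  next
    case (Suc m) then show ?case using lipschitz_formula_Suc[of "q + real m"] that by (simp add: add_ac)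
  qed
  define q where "q = frac p + 1"
  have "frac p \<noteq> 0" using p by (simp add: frac_eq_0_iff)
  then have q: "1 < q" "q < 2" using frac_ge_0[of p] frac_lt_1[of p] by (auto simp: q_def less_le)
  have "p = q + real (nat (\<lfloor>p\<rfloor> - 1))" using p by (simp add: q_def frac_def of_nat_nat)
  with *[OF q] show ?thesis by metis
qed

section \<open>The zeta function\<close>

text \<open>Weierstrass's theorem.  The majorant is only required from an index on that depends on the point; this
suits bounds by values of the Gamma function, which is monotone for large arguments only.\<close>

lemma holomorphic_suminf:
  fixes f :: "nat \<Rightarrow> complex \<Rightarrow> complex"
  assumes S: "open S" and hol: "\<And>n. f n holomorphic_on S"
    and bd: "\<And>z. z \<in> S \<Longrightarrow> \<exists>d M N. d > 0 \<and> summable M \<and> (\<forall>n\<ge>N. \<forall>w\<in>cball z d. w \<in> S \<longrightarrow> norm (f n w) \<le> M n)"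
  shows "(\<lambda>z. \<Sum>n. f n z) holomorphic_on S"
proof (rule holomorphic_uniform_sequence[OF S, where f = "\<lambda>n z. \<Sum>i<n. f i z"])
  show "(\<lambda>z. \<Sum>i<n. f i z) holomorphic_on S" for n by (intro holomorphic_intros hol)
  fix z assume z: "z \<in> S"
  obtain d M N where d: "d > 0" "summable M" "\<And>n w. n \<ge> N \<Longrightarrow> w \<in> cball z d \<Longrightarrow> w \<in> S \<Longrightarrow> norm (f n w) \<le> M n"
    using bd[OF z] by blast
  obtain e where e: "e > 0" "cball z e \<subseteq> S" using S z open_contains_cball by blast
  have "uniform_limit (cball z (min d e)) (\<lambda>n z. \<Sum>i<n. f i z) (\<lambda>z. \<Sum>i. f i z) sequentially"
  proof (rule Weierstrass_m_test_ev[OF _ d(2)])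
    show "\<forall>\<^sub>F n in sequentially. \<forall>x\<in>cball z (min d e). norm (f n x) \<le> M n"
      unfolding eventually_sequentially by (intro exI[of _ N]) (use d(3) e(2) in auto)
  qed
  then show "\<exists>d>0. cball z d \<subseteq> S \<and> uniform_limit (cball z d) (\<lambda>n z. \<Sum>i<n. f i z) (\<lambda>z. \<Sum>i. f i z) sequentially"
    using d e by (intro exI[of _ "min d e"]) auto
qed

text \<open>Here \<open>f 1\<close> is the integrand and \<open>f 0\<close> its antiderivative; the bound compares the Taylor expansion
of \<open>f 0\<close> at \<open>a\<close> with that of \<open>f 1\<close>.\<close>

lemma trapezoid_error:
  fixes f :: "nat \<Rightarrow> 'a::{real_normed_field} \<Rightarrow> 'a"
  assumes S: "convex S" "a \<in> S" "a + 1 \<in> S"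
    and d: "\<And>i x. x \<in> S \<Longrightarrow> i \<le> 2 \<Longrightarrow> (f i has_field_derivative f (Suc i) x) (at x within S)"
    and B: "\<And>x. x \<in> S \<Longrightarrow> norm (f 3 x) \<le> B"
  shows "norm ((f 1 a + f 1 (a + 1)) / 2 - (f 0 (a + 1) - f 0 a)) \<le> B"
proof -
  have s2: "(\<Sum>i\<le>2. g i) = g 0 + g 1 + g 2" "(\<Sum>i\<le>1. g i) = g 0 + g 1" for g :: "nat \<Rightarrow> 'a"
    by (simp_all add: numeral_2_eq_2)
  have "norm (f 0 (a + 1) - (\<Sum>i\<le>2. f i a * ((a + 1) - a) ^ i / fact i)) \<le> B * norm ((a + 1) - a) ^ Suc 2 / fact 2"
    by (rule field_Taylor[where S = S and f = f and n = 2]) (use B S d in \<open>auto simp: numeral_3_eq_3\<close>)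
  then have 1: "norm (f 0 (a + 1) - (f 0 a + f 1 a + f 2 a / 2)) \<le> B / 2" unfolding s2 by simp
  have "norm (f (Suc 0) (a + 1) - (\<Sum>i\<le>1. f (Suc i) a * ((a + 1) - a) ^ i / fact i)) \<le> B * norm ((a + 1) - a) ^ Suc 1 / fact 1"
    by (rule field_Taylor[where S = S and f = "\<lambda>i. f (Suc i)" and n = 1]) (use B S d in \<open>auto simp: numeral_3_eq_3 numeral_2_eq_2\<close>)
  then have 2: "norm (f 1 (a + 1) - (f 1 a + f 2 a)) \<le> B" unfolding s2 by (simp add: numeral_2_eq_2)
  have "(f 1 a + f 1 (a + 1)) / 2 - (f 0 (a + 1) - f 0 a)
      = (f 1 (a + 1) - (f 1 a + f 2 a)) / 2 - (f 0 (a + 1) - (f 0 a + f 1 a + f 2 a / 2))"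
    by (simp add: field_simps)
  also have "norm \<dots> \<le> norm ((f 1 (a + 1) - (f 1 a + f 2 a)) / 2) + norm (f 0 (a + 1) - (f 0 a + f 1 a + f 2 a / 2))"
    by (rule norm_triangle_ineq4)
  also have "\<dots> \<le> B" using 1 2 by (simp add: norm_divide)
  finally show ?thesis .
qed

text \<open>The error of the trapezoidal rule for \<open>x powr (- s)\<close> on the interval from \<open>n + 1\<close> to \<open>n + 2\<close>.  It
decays by two powers of \<open>n\<close> faster than the function, so the sum of the errors continues the zeta
function to \<open>Re s > -1\<close>.\<close>

definition zeta_trap :: "nat \<Rightarrow> complex \<Rightarrow> complex" where
  "zeta_trap n s = (of_nat (Suc n) powr (- s) + of_nat (Suc (Suc n)) powr (- s)) / 2
     - (of_nat (Suc (Suc n)) powr (1 - s) - of_nat (Suc n) powr (1 - s)) / (1 - s)"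

lemma norm_zeta_trap_le:
  assumes s: "Re s > -2" "s \<noteq> 1"
  shows "norm (zeta_trap n s) \<le> norm (s * (s + 1)) * real (Suc n) powr (- Re s - 2)"
proof -
  define S where "S = closed_segment (of_nat (Suc n)) (of_nat (Suc n) + 1 :: complex)"
  define f :: "nat \<Rightarrow> complex \<Rightarrow> complex" where "f = (\<lambda>i x.
     if i = 0 then x powr (1 - s) / (1 - s) else if i = 1 then x powr (- s)
     else if i = 2 then - s * x powr (- s - 1) else s * (s + 1) * x powr (- s - 2))"
  have S: "\<exists>t\<ge>real (Suc n). x = of_real t" if "x \<in> S" for x
  proof -
    obtain u where u: "0 \<le> u" "u \<le> 1" "x = (1 - u) *\<^sub>R of_nat (Suc n) + u *\<^sub>R (of_nat (Suc n) + 1)"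
      using \<open>x \<in> S\<close> unfolding S_def in_segment by blast
    then have "x = of_real (real (Suc n) + u)" by (simp add: scaleR_conv_of_real algebra_simps)
    then show ?thesis using u by (intro exI[of _ "real (Suc n) + u"]) auto
  qed
  have S0: "x \<notin> \<real>\<^sub>\<le>\<^sub>0" if "x \<in> S" for x
  proof -
    obtain t where "t \<ge> real (Suc n)" "x = of_real t" using S[OF \<open>x \<in> S\<close>] by blast
    then show ?thesis by (simp add: complex_nonpos_Reals_iff)
  qed
  have "norm ((f 1 (of_nat (Suc n)) + f 1 (of_nat (Suc n) + 1)) / 2 - (f 0 (of_nat (Suc n) + 1) - f 0 (of_nat (Suc n))))
      \<le> norm (s * (s + 1)) * real (Suc n) powr (- Re s - 2)"
  proof (rule trapezoid_error[where S = S])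
    fix i x assume x: "x \<in> S" and i: "i \<le> (2::nat)"
    have x0: "x \<noteq> 0" "x \<notin> \<real>\<^sub>\<le>\<^sub>0" using S0[OF x] by auto
    consider "i = 0" | "i = 1" | "i = 2" using i by linarith
    then show "(f i has_field_derivative f (Suc i) x) (at x within S)"
    proof cases
      case 1 then show ?thesis using x0 s(2) by (auto simp: f_def intro!: derivative_eq_intros)
    next
      case 2 then show ?thesis using x0 by (auto simp: f_def intro!: derivative_eq_intros)
    next
      case 3 then show ?thesis using x0 by (auto simp: f_def algebra_simps intro!: derivative_eq_intros)
    qed
  next
    fix x assume x: "x \<in> S"
    obtain t where t: "t \<ge> real (Suc n)" "x = of_real t" using S[OF x] by blast
    have "norm (x powr (- s - 2)) = t powr (- Re s - 2)" using t by (simp add: norm_powr_real_powr)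
    also have "\<dots> \<le> real (Suc n) powr (- Re s - 2)" using t s by (intro powr_mono2') auto
    finally show "norm (f 3 x) \<le> norm (s * (s + 1)) * real (Suc n) powr (- Re s - 2)"
      by (simp add: f_def norm_mult mult_left_mono)
  qed (auto simp: S_def)
  then show ?thesis by (simp add: f_def zeta_trap_def diff_divide_distrib add_ac)
qed

definition zeta_right :: "complex \<Rightarrow> complex" where
  "zeta_right s = 1 / (s - 1) + 1 / 2 + (\<Sum>n. zeta_trap n s)"

lemma zeta_right_holomorphic: "zeta_right holomorphic_on ({s. Re s > -1} - {1})"
proof -
  let ?S = "{s. Re s > -1} - {1::complex}"
  have op: "open ?S" by (intro open_Diff open_halfspace_Re_gt) auto
  have "(\<lambda>s. \<Sum>n. zeta_trap n s) holomorphic_on ?S"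
  proof (rule holomorphic_suminf[OF op])
    show "zeta_trap n holomorphic_on ?S" for n
      unfolding zeta_trap_def by (intro holomorphic_intros) auto
    fix s assume s: "s \<in> ?S"
    define d where "d = (Re s + 1) / 2"
    have d: "d > 0" using s by (simp add: d_def)
    have "norm (zeta_trap n w) \<le> ((norm s + d) * (norm s + d + 1)) * real (Suc n) powr (d - Re s - 2)"
      if w: "w \<in> cball s d" "w \<in> ?S" for n w
    proof -
      have dw: "norm (w - s) \<le> d" using w by (simp add: dist_norm norm_minus_commute)
      have nw: "norm w \<le> norm s + d" using dw norm_triangle_ineq2[of w s] by simp
      have "Re s - Re w \<le> d" using dw abs_Re_le_cmod[of "w - s"] by simp
      then have "real (Suc n) powr (- Re w - 2) \<le> real (Suc n) powr (d - Re s - 2)" by (intro powr_mono) auto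
      moreover have "norm (w * (w + 1)) \<le> (norm s + d) * (norm s + d + 1)"
        unfolding norm_mult using nw norm_triangle_ineq[of w 1] d by (intro mult_mono) auto
      ultimately have "norm (w * (w + 1)) * real (Suc n) powr (- Re w - 2) \<le> ((norm s + d) * (norm s + d + 1)) * real (Suc n) powr (d - Re s - 2)"
        using d by (intro mult_mono) auto
      moreover have "norm (zeta_trap n w) \<le> norm (w * (w + 1)) * real (Suc n) powr (- Re w - 2)"
        using w by (intro norm_zeta_trap_le) auto
      ultimately show ?thesis by linarith
    qed
    moreover have "summable (\<lambda>n. ((norm s + d) * (norm s + d + 1)) * real (Suc n) powr (d - Re s - 2))"
      using s by (intro summable_mult) (subst summable_Suc_iff, simp add: summable_real_powr_iff d_def)
    ultimately show "\<exists>d M N. d > 0 \<and> summable M \<and> (\<forall>n\<ge>N. \<forall>w\<in>cball s d. w \<in> ?S \<longrightarrow> norm (zeta_trap n w) \<le> M n)"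
      using d by blast
  qed
  then show ?thesis unfolding zeta_right_def by (intro holomorphic_intros) auto
qed

definition zeta_series :: "complex \<Rightarrow> complex" where
  "zeta_series s = (\<Sum>n. 1 / of_nat (Suc n) powr s)"

lemma norm_zeta_series_term: "norm (1 / of_nat (Suc n) powr s) = real (Suc n) powr (- Re s)"
proof -
  have "norm (of_nat (Suc n) powr s) = real (Suc n) powr Re s"
    using norm_powr_real_powr[of "of_nat (Suc n)" s] by (simp add: norm_powr_real_powr)
  then show ?thesis by (simp add: norm_divide norm_inverse powr_minus divide_inverse)
qed

lemma summable_zeta_series:
  assumes "Re s > 1"
  shows "summable (\<lambda>n. norm (1 / of_nat (Suc n) powr s))"
  unfolding norm_zeta_series_term using assms by (subst summable_Suc_iff) (simp add: summable_real_powr_iff)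

lemma zeta_series_sums:
  assumes "Re s > 1"
  shows "(\<lambda>n. 1 / of_nat (Suc n) powr s) sums zeta_series s"
  unfolding zeta_series_def using summable_norm_cancel[OF summable_zeta_series[OF assms]] by (rule summable_sums)

lemma zeta_series_holomorphic: "zeta_series holomorphic_on {s. Re s > 1}"
  unfolding zeta_series_def[abs_def]
proof (rule holomorphic_suminf[OF open_halfspace_Re_gt])
  show "(\<lambda>s. 1 / of_nat (Suc n) powr s) holomorphic_on {s. Re s > 1}" for n
    by (intro holomorphic_intros) (auto simp del: of_nat_Suc)
  fix s assume s: "s \<in> {s. Re s > 1}"
  define d where "d = (Re s - 1) / 2"
  have d: "d > 0" using s by (simp add: d_def)
  have "norm (1 / of_nat (Suc n) powr w) \<le> real (Suc n) powr (d - Re s)" if w: "w \<in> cball s d" for n w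
  proof -
    have "norm (w - s) \<le> d" using w by (simp add: dist_norm norm_minus_commute)
    then have "Re s - Re w \<le> d" using abs_Re_le_cmod[of "w - s"] by simp
    then show ?thesis unfolding norm_zeta_series_term by (intro powr_mono) auto
  qed
  moreover have "summable (\<lambda>n. real (Suc n) powr (d - Re s))"
    by (subst summable_Suc_iff) (use s in \<open>auto simp: summable_real_powr_iff d_def field_simps\<close>)
  ultimately show "\<exists>d M N. d > 0 \<and> summable M \<and> (\<forall>n\<ge>N. \<forall>w\<in>cball s d. w \<in> {s. Re s > 1} \<longrightarrow> norm (1 / of_nat (Suc n) powr w) \<le> M n)"
    using d by blast
qed

text \<open>In the partial sums of the trapezoidal errors the integrals telescope.\<close>

lemma zeta_right_eq_series:
  assumes s: "Re s > 1"
  shows "zeta_right s = zeta_series s"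
proof -
  have s1: "s \<noteq> 1" using s by auto
  define c where "c = (\<lambda>n. of_nat (Suc n) powr (- s))"
  define e where "e = (\<lambda>n. of_nat (Suc n) powr (1 - s) :: complex)"
  have c_eq: "c n = 1 / of_nat (Suc n) powr s" for n by (simp add: c_def powr_minus divide_inverse)
  have part: "(\<Sum>n<N. zeta_trap n s) = (\<Sum>n<N. c n) - 1 / 2 + c N / 2 - (e N - 1) / (1 - s)" for N
  proof (induction N)
    case 0 then show ?case by (simp add: c_def e_def)
  next
    case (Suc N)
    show ?case unfolding sum.lessThan_Suc Suc.IH
      by (simp add: zeta_trap_def c_def[symmetric] e_def[symmetric] diff_divide_distrib add_divide_distrib)
        (simp add: c_def e_def diff_divide_distrib add_divide_distrib)
  qed
  have "(\<lambda>n. real (Suc n) powr (1 - Re s)) \<longlonglongrightarrow> 0" "(\<lambda>n. real (Suc n) powr (- Re s)) \<longlonglongrightarrow> 0"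
  proof -
    have "(\<lambda>n. real (Suc n) powr u) \<longlonglongrightarrow> 0" if "u < 0" for u using that by real_asymp
    then show "(\<lambda>n. real (Suc n) powr (1 - Re s)) \<longlonglongrightarrow> 0" "(\<lambda>n. real (Suc n) powr (- Re s)) \<longlonglongrightarrow> 0"
      using s by simp_all
  qed
  moreover have "norm (e n) = real (Suc n) powr (1 - Re s)" "norm (c n) = real (Suc n) powr (- Re s)" for n
  proof -
    have e_eq: "e n = 1 / of_nat (Suc n) powr (s - 1)"
      using powr_minus[of "of_nat (Suc n) :: complex" "s - 1"] by (simp add: e_def divide_inverse)
    show "norm (e n) = real (Suc n) powr (1 - Re s)" unfolding e_eq norm_zeta_series_term by simp
    show "norm (c n) = real (Suc n) powr (- Re s)" unfolding c_eq norm_zeta_series_term by simp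
  qed
  ultimately have lim: "e \<longlonglongrightarrow> 0" "c \<longlonglongrightarrow> 0" by (auto intro: tendsto_norm_zero_cancel)
  have "(\<lambda>N. \<Sum>n<N. c n) \<longlonglongrightarrow> zeta_series s" using zeta_series_sums[OF s] unfolding c_eq sums_def .
  then have "(\<lambda>N. (\<Sum>n<N. c n) - 1 / 2 + c N / 2 - (e N - 1) / (1 - s)) \<longlonglongrightarrow> zeta_series s - 1 / 2 + 0 / 2 - (0 - 1) / (1 - s)"
    using s1 lim by (intro tendsto_intros) auto
  then have "(\<lambda>n. zeta_trap n s) sums (zeta_series s - 1 / 2 + 0 / 2 - (0 - 1) / (1 - s))"
    unfolding sums_def part .
  then have "(\<Sum>n. zeta_trap n s) = zeta_series s - 1 / 2 + 1 / (1 - s)" by (simp add: sums_iff)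
  then show ?thesis using s1 unfolding zeta_right_def by (simp add: field_simps)
qed

lemma isCont_imp_tendsto_at_right:
  fixes f :: "real \<Rightarrow> 'a::topological_space"
  shows "isCont f a \<Longrightarrow> (f \<longlongrightarrow> f a) (at_right a)"
  by (simp add: isCont_def filterlim_at_split)

text \<open>In Lipschitz's formula with exponent \<open>q\<close>, the sum and the term \<open>\<Gamma>(q) * y powr (- q)\<close> diverge as
\<open>y\<close> tends to \<open>0\<close>.  That term is the integral of the summand, so their difference is a series of
trapezoidal errors, which converges uniformly in \<open>y\<close> and becomes the series of \<open>zeta_right (1 - q)\<close> in
the limit.  The lattice sum on the other side tends to a multiple of \<open>\<Sum>n. n powr (- q)\<close>.\<close>

lemma zeta_right_functional_real:
  assumes q: "1 < q" "q < 2"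
  shows "zeta_right (of_real (1 - q)) = of_real (2 * (2 * pi) powr - q * cos (pi * q / 2) * Gamma q * (\<Sum>n. real (Suc n) powr - q))"
proof -
  define g where "g = (\<lambda>y x. x powr (q - 1) * exp (- y * x))"
  define I where "I = (\<lambda>y x. integral {0..x} (g y))"
  define h where "h = (\<lambda>y n. (g y (real n) + g y (real n + 1)) / 2 - (I y (real n + 1) - I y (real n)))"
  define R where "R = (\<lambda>y. Gamma q * (\<Sum>l. lipschitz_kernel q y l))"
  have g0: "g y 0 = 0" for y using q by (simp add: g_def)
  have I0: "I y 0 = 0" for y by (simp add: I_def)
  have contg: "continuous_on {0..x} (g y)" for x y
    unfolding g_def by (rule continuous_on_mult[OF continuous_on_powr']) (use q in \<open>auto intro!: continuous_intros\<close>)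
  have hsums: "h y sums R y" if y: "y > 0" for y
  proof -
    have part: "(\<Sum>n<N. h y n) = (\<Sum>n<N. g y (real (Suc n))) - g y (real N) / 2 - I y (real N)" for N
      by (induction N) (auto simp: h_def g0 I0 field_simps)
    have L: "(\<lambda>n. g y (real (Suc n))) sums (Gamma q * (y powr - q + (\<Sum>l. lipschitz_kernel q y l)))"
      using lipschitz_formula_between_1_2[OF q] y by (simp add: lipschitz_formula_def g_def mult.commute)
    have lim1: "(\<lambda>N. g y (real N)) \<longlonglongrightarrow> 0" unfolding g_def using y by real_asymp
    have q0: "q > 0" using q by simp
    have lim2: "(\<lambda>N. I y (real N)) \<longlonglongrightarrow> Gamma q * y powr - q"
    proof -
      have e: "I y (real N) = (\<integral>t. indicator {0..real N} t * g y t \<partial>lborel)" for N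
      proof -
        have "set_integrable lborel {0..real N} (g y)"
          by (rule borel_integrable_atLeastAtMost') (rule contg)
        from set_borel_integral_eq_integral(2)[OF this] show ?thesis
          by (simp add: I_def set_lebesgue_integral_def)
      qed
      have gm: "g y \<in> borel_measurable borel" unfolding g_def by measurable
      have int: "integrable lborel (\<lambda>t. indicator {0<..} t * g y t)"
        using Gamma_integrable_scaled(1)[OF q0 y] gm
        by (subst (asm) integrable_pos_lborel) (auto simp: g_def set_integrable_def)
      have val: "(\<integral>t. indicator {0<..} t * g y t \<partial>lborel) = Gamma q * y powr - q"
        using Gamma_integrable_scaled(2)[OF q0 y] gm
        by (subst (asm) integral_pos_lborel) (auto simp: g_def set_lebesgue_integral_def)
      have "(\<lambda>N. \<integral>t. indicator {0..real N} t * g y t \<partial>lborel) \<longlonglongrightarrow> (\<integral>t. indicator {0<..} t * g y t \<partial>lborel)"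
      proof (rule integral_dominated_convergence[where w = "\<lambda>t. indicator {0<..} t * g y t"])
        show "AE t in lborel. (\<lambda>N. indicator {0..real N} t * g y t) \<longlonglongrightarrow> indicator {0<..} t * g y t"
        proof (rule AE_I2)
          fix t :: real
          have "\<forall>\<^sub>F N in sequentially. indicator {0..real N} t * g y t = indicator {0<..} t * g y t"
            using eventually_ge_at_top[of "nat \<lceil>t\<rceil>"]
          proof eventually_elim
            case (elim N)
            then have N: "t \<le> real N" by linarith
            consider "t < 0" | "t = 0" | "t > 0" by linarith
            then show ?case by cases (use N in \<open>auto simp: indicator_def g0\<close>)
          qed
          then show "(\<lambda>N. indicator {0..real N} t * g y t) \<longlonglongrightarrow> indicator {0<..} t * g y t"
            by (rule tendsto_eventually)
        qed
        show "AE t in lborel. norm (indicator {0..real N} t * g y t) \<le> indicator {0<..} t * g y t" for N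
        proof (rule AE_I2)
          fix t :: real
          consider "t < 0" | "t = 0" | "t > 0" by linarith
          then show "norm (indicator {0..real N} t * g y t) \<le> indicator {0<..} t * g y t"
          proof cases
            case 2
            then show ?thesis by (simp add: g0)
          qed (auto simp: indicator_def g_def)
        qed
      qed (use gm int in auto)
      then show ?thesis unfolding e val .
    qed
    have "(\<lambda>N. (\<Sum>n<N. g y (real (Suc n))) - g y (real N) / 2 - I y (real N))
        \<longlonglongrightarrow> Gamma q * (y powr - q + (\<Sum>l. lipschitz_kernel q y l)) - 0 / 2 - Gamma q * y powr - q"
      using L lim1 lim2 unfolding sums_def by (intro tendsto_intros) auto
    then show ?thesis unfolding sums_def part R_def by (simp add: distrib_left)
  qed
  \<comment> \<open>Uniformity in \<open>y\<close>: with \<open>u = y * x\<close>, the second derivative of \<open>g y\<close> is \<open>x powr (q - 3)\<close> times a quadratic polynomial in \<open>u\<close> times \<open>exp (- u)\<close>.\<close>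
  have hbound: "\<bar>h y n\<bar> \<le> 2 * real n powr (q - 3)" if y: "y \<ge> 0" and n: "n \<ge> 1" for y n
  proof -
    define f :: "nat \<Rightarrow> real \<Rightarrow> real" where "f = (\<lambda>i x.
       if i = 0 then I y x else if i = 1 then g y x
       else if i = 2 then ((q - 1) * x powr (q - 2) - y * x powr (q - 1)) * exp (- y * x)
       else ((q - 1) * (q - 2) * x powr (q - 3) - 2 * y * (q - 1) * x powr (q - 2) + y\<^sup>2 * x powr (q - 1)) * exp (- y * x))"
    have "norm ((f 1 (real n) + f 1 (real n + 1)) / 2 - (f 0 (real n + 1) - f 0 (real n))) \<le> 2 * real n powr (q - 3)"
    proof (rule trapezoid_error[where S = "{real n..real n + 1}"])
      fix i x assume x: "x \<in> {real n..real n + 1}" and i: "i \<le> (2::nat)"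
      have x0: "x > 0" using x n by auto
      have p1: "x powr (q - 1) = x * x powr (q - 2)" "x powr (q - 2) = x * x powr (q - 3)"
        using x0 by (simp_all add: powr_mult_base)
      consider "i = 0" | "i = 1" | "i = 2" using i by linarith
      then show "(f i has_field_derivative f (Suc i) x) (at x within {real n..real n + 1})"
      proof cases
        case 1
        have "(I y has_real_derivative g y x) (at x within {0..real n + 1})"
          unfolding I_def using x n by (intro integral_has_real_derivative contg) auto
        then have "(I y has_real_derivative g y x) (at x within {real n..real n + 1})"
          by (rule DERIV_subset) auto
        then show ?thesis using 1 by (simp add: f_def)
      next
        case 2
        have "(g y has_real_derivative ((q - 1) * x powr (q - 2) - y * x powr (q - 1)) * exp (- y * x)) (at x within {real n..real n + 1})"
          unfolding g_def using x0 by (auto intro!: derivative_eq_intros simp: algebra_simps)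
        then show ?thesis using 2 by (simp add: f_def)
      next
        case 3
        have "((\<lambda>x. ((q - 1) * x powr (q - 2) - y * x powr (q - 1)) * exp (- y * x)) has_real_derivative 
           ((q - 1) * (q - 2) * x powr (q - 3) - 2 * y * (q - 1) * x powr (q - 2) + y\<^sup>2 * x powr (q - 1)) * exp (- y * x)) (at x within {real n..real n + 1})"
          using x0 by (auto intro!: derivative_eq_intros simp: algebra_simps power2_eq_square)
        then show ?thesis using 3 by (simp add: f_def)
      qed
    next
      fix x assume x: "x \<in> {real n..real n + 1}"
      have x0: "x > 0" using x n by auto
      have p1: "x powr (q - 1) = x\<^sup>2 * x powr (q - 3)" "x powr (q - 2) = x * x powr (q - 3)"
        using x0 by (simp_all add: powr_mult_base power2_eq_square mult.assoc)
      define u where "u = y * x"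
      have u: "u \<ge> 0" using y x0 by (simp add: u_def)
      have "f 3 x = x powr (q - 3) * (((q - 1) * (q - 2) - 2 * (q - 1) * u + u\<^sup>2) * exp (- u))"
        by (simp add: f_def p1 u_def power2_eq_square algebra_simps)
      also have "\<bar>\<dots>\<bar> = x powr (q - 3) * (\<bar>(q - 1) * (q - 2) - 2 * (q - 1) * u + u\<^sup>2\<bar> * exp (- u))"
        by (simp add: abs_mult)
      also have "\<dots> \<le> x powr (q - 3) * 2"
      proof (rule mult_left_mono)
        have "\<bar>(q - 1) * (q - 2)\<bar> \<le> 1" using q mult_le_one[of "q - 1" "2 - q"] mult_nonneg_nonneg[of "q - 1" "2 - q"]
          by (simp add: abs_if algebra_simps)
        moreover have "0 \<le> 2 * (q - 1) * u" "2 * (q - 1) * u \<le> 2 * u" using q u by (auto intro!: mult_right_mono)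
        ultimately have "\<bar>(q - 1) * (q - 2) - 2 * (q - 1) * u + u\<^sup>2\<bar> \<le> 1 + 2 * u + u\<^sup>2"
          using zero_le_power2[of u] by linarith
        also have "\<dots> \<le> 2 * exp u" using exp_lower_Taylor_quadratic[OF u] by simp
        finally show "\<bar>(q - 1) * (q - 2) - 2 * (q - 1) * u + u\<^sup>2\<bar> * exp (- u) \<le> 2"
          by (simp add: exp_minus field_simps)
      qed auto
      also have "\<dots> \<le> real n powr (q - 3) * 2" using x n q by (intro mult_right_mono powr_mono2') auto
      finally show "norm (f 3 x) \<le> 2 * real n powr (q - 3)" by simp
    qed auto
    then show ?thesis by (simp add: f_def h_def)
  qed
  have hlim: "((\<lambda>y. h y n) \<longlongrightarrow> h 0 n) (at_right 0)" for n
  proof -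
    have "isCont (\<lambda>y. g y x) 0" for x unfolding g_def by (intro continuous_intros)
    then have 1: "((\<lambda>y. g y x) \<longlongrightarrow> g 0 x) (at_right 0)" for x
      by (rule isCont_imp_tendsto_at_right)
    have "continuous_on UNIV (\<lambda>y. integral (cbox 0 x) (g y))" for x
    proof (rule integral_continuous_on_param)
      show "continuous_on (UNIV \<times> cbox 0 x) (\<lambda>(y, t). g y t)"
        unfolding g_def case_prod_beta
        by (rule continuous_on_mult[OF continuous_on_powr']) (use q in \<open>auto intro!: continuous_intros simp: cbox_interval\<close>)
    qed
    then have "isCont (\<lambda>y. I y x) 0" for x
      by (simp add: I_def cbox_interval continuous_on_eq_continuous_at)
    then have 2: "((\<lambda>y. I y x) \<longlongrightarrow> I 0 x) (at_right 0)" for x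
      by (rule isCont_imp_tendsto_at_right)
    show ?thesis unfolding h_def by (intro tendsto_intros 1 2) auto
  qed
  have ypos: "\<forall>\<^sub>F y in at_right 0. y > (0::real)" by (simp add: eventually_at_right_less)
  have T1: "((\<lambda>y. \<Sum>n. h y n) \<longlongrightarrow> (\<Sum>n. h 0 n)) (at_right 0)" and hs0: "summable (\<lambda>n. norm (h 0 n))"
  proof -
    have ev: "\<forall>\<^sub>F (n, y) in at_top \<times>\<^sub>F at_right 0. norm (h y n) \<le> 2 * real n powr (q - 3)"
      using eventually_prodI[OF eventually_ge_at_top[of "1::nat"] ypos]
      by eventually_elim (use hbound in auto)
    have sm: "summable (\<lambda>n. 2 * real n powr (q - 3))"
      using q by (intro summable_mult) (simp add: summable_real_powr_iff)
    from tannerys_theorem[OF hlim ev sm] show "((\<lambda>y. \<Sum>n. h y n) \<longlongrightarrow> (\<Sum>n. h 0 n)) (at_right 0)" "summable (\<lambda>n. norm (h 0 n))" by auto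
  qed
  have "(R \<longlongrightarrow> (\<Sum>n. h 0 n)) (at_right 0)"
    by (rule Lim_transform_eventually[OF T1]) (use ypos in eventually_elim, use hsums in \<open>auto simp: sums_iff\<close>)
  moreover have "(R \<longlongrightarrow> Gamma q * (\<Sum>l. lipschitz_kernel q 0 l)) (at_right 0)"
  proof -
    have klim: "((\<lambda>y. lipschitz_kernel q y l) \<longlongrightarrow> lipschitz_kernel q 0 l) (at_right 0)" for l
    proof -
      have "2 * of_real pi * \<i> * of_nat (Suc l) \<notin> \<real>\<^sub>\<le>\<^sub>0"
        by (simp add: complex_nonpos_Reals_iff del: of_nat_Suc)
      then have "isCont (\<lambda>y. lipschitz_kernel q y l) 0" unfolding lipschitz_kernel_def
        by (intro continuous_mult continuous_const bounded_linear.isCont[OF bounded_linear_Re] isCont_powr_complex continuous_add continuous_of_real continuous_ident)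
          (auto simp del: of_nat_Suc)
      then show ?thesis by (rule isCont_imp_tendsto_at_right)
    qed
    have ev: "\<forall>\<^sub>F (l, y) in at_top \<times>\<^sub>F at_right 0. norm (lipschitz_kernel q y l) \<le> 2 * (2 * pi * real (Suc l)) powr - q"
      using eventually_prodI[OF eventually_ge_at_top[of "1::nat"] ypos]
    proof eventually_elim
      case (elim x)
      then show ?case using lipschitz_kernel_bound[of "snd x" q q "fst x"] q by (auto simp: case_prod_beta)
    qed
    have sm: "summable (\<lambda>l. 2 * (2 * pi * real (Suc l)) powr - q)"
      using q by (intro summable_mult summable_lipschitz_weights) auto
    from tannerys_theorem[OF klim ev sm] show ?thesis unfolding R_def by (intro tendsto_intros) auto
  qed
  ultimately have eq: "(\<Sum>n. h 0 n) = Gamma q * (\<Sum>l. lipschitz_kernel q 0 l)"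
    by (intro tendsto_unique[of "at_right (0::real)"]) auto
  have kern: "lipschitz_kernel q 0 l = 2 * (2 * pi) powr - q * cos (pi * q / 2) * real (Suc l) powr - q" for l
  proof -
    define c where "c = 2 * pi * real (Suc l)"
    have c: "c > 0" by (simp add: c_def)
    have e: "2 * of_real pi * \<i> * of_nat (Suc l) = of_real c * \<i>" by (simp add: c_def)
    have L: "Ln (of_real c * \<i>) = of_real (ln c) + \<i> * of_real pi / 2"
    proof (rule Ln_unique)
      have "exp (\<i> * complex_of_real (pi / 2)) = \<i>" by (simp only: cis_conv_exp[symmetric] cis_pi_half)
      then show "exp (of_real (ln c) + \<i> * of_real pi / 2) = of_real c * \<i>"
        using c by (simp add: exp_add exp_of_real)
    qed (use pi_gt_zero in \<open>auto simp: field_simps\<close>)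
    have "(2 * of_real pi * \<i> * of_nat (Suc l)) powr (- of_real q) = exp (- of_real q * (of_real (ln (2 * pi * real (Suc l))) + \<i> * of_real pi / 2))"
      unfolding e powr_def L using c by (simp add: c_def del: of_nat_Suc)
    then have "lipschitz_kernel q 0 l = 2 * Re (exp (- of_real q * (of_real (ln (2 * pi * real (Suc l))) + \<i> * of_real pi / 2)))"
      unfolding lipschitz_kernel_def by simp
    also have "\<dots> = 2 * (exp (- q * ln (2 * pi * real (Suc l))) * cos (q * (pi / 2)))"
      by (simp add: Re_exp)
    also have "exp (- q * ln (2 * pi * real (Suc l))) = (2 * pi * real (Suc l)) powr - q" by (simp add: powr_def)
    also have "\<dots> = (2 * pi) powr - q * real (Suc l) powr - q" by (rule powr_mult)
    finally show ?thesis by (simp add: mult_ac)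
  qed
  have sq: "summable (\<lambda>n. real (Suc n) powr - q)" using q by (subst summable_Suc_iff) (simp add: summable_real_powr_iff)
  have I0': "I 0 x = x powr q / q" if "x \<ge> 0" for x
    using has_integral_powr_from_0[of "q - 1" x] q that by (simp add: I_def g_def integral_unique)
  \<comment> \<open>The trapezoidal errors in \<open>zeta_right\<close> start at \<open>1\<close>; the interval from \<open>0\<close> to \<open>1\<close> accounts for its explicit terms.\<close>
  have h00: "h 0 0 = 1 / 2 - 1 / q" using q by (simp add: h_def I0 I0' g0) (simp add: g_def)
  have hS: "of_real (h 0 (Suc n)) = zeta_trap n (of_real (1 - q))" for n
  proof -
    have a: "of_nat (Suc n) powr (- complex_of_real (1 - q)) = of_real (real (Suc n) powr (q - 1))"
         "of_nat (Suc (Suc n)) powr (- complex_of_real (1 - q)) = of_real (real (Suc (Suc n)) powr (q - 1))"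
         "of_nat (Suc n) powr (1 - complex_of_real (1 - q)) = of_real (real (Suc n) powr q)"
         "of_nat (Suc (Suc n)) powr (1 - complex_of_real (1 - q)) = of_real (real (Suc (Suc n)) powr q)"
      using powr_of_real[of "real (Suc n)" "q - 1"] powr_of_real[of "real (Suc (Suc n))" "q - 1"]
        powr_of_real[of "real (Suc n)" "q"] powr_of_real[of "real (Suc (Suc n))" "q"] by simp_all
    have "h 0 (Suc n) = (real (Suc n) powr (q - 1) + real (Suc (Suc n)) powr (q - 1)) / 2 - (real (Suc (Suc n)) powr q / q - real (Suc n) powr q / q)"
      by (simp add: h_def I0' g_def add_ac)
    then show ?thesis unfolding zeta_trap_def a by (simp add: diff_divide_distrib)
  qed
  have "summable (h 0)" using hs0 by (rule summable_norm_cancel)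
  then have "(\<Sum>n. h 0 n) = h 0 0 + (\<Sum>n. h 0 (Suc n))" using suminf_split_head[of "h 0"] by simp
  moreover have "complex_of_real (\<Sum>n. h 0 (Suc n)) = (\<Sum>n. zeta_trap n (of_real (1 - q)))"
    unfolding hS[symmetric] by (rule suminf_of_real) (subst summable_Suc_iff, fact)
  ultimately have "zeta_right (of_real (1 - q)) = of_real (\<Sum>n. h 0 n)"
    using h00 by (simp add: zeta_right_def)
  also have "(\<Sum>n. h 0 n) = 2 * (2 * pi) powr - q * cos (pi * q / 2) * Gamma q * (\<Sum>n. real (Suc n) powr - q)"
    unfolding eq kern suminf_mult[OF sq] by (simp only: mult_ac)
  finally show ?thesis .
qed

text \<open>The right-hand side of the functional equation, where \<open>1 - s\<close> lies in the half-plane of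
convergence.\<close>

definition zeta_left :: "complex \<Rightarrow> complex" where
  "zeta_left s = 2 * of_real (2 * pi) powr (s - 1) * cos (of_real pi * (1 - s) / 2) * Gamma (1 - s) * zeta_series (1 - s)"

lemma zeta_left_holomorphic: "zeta_left holomorphic_on {s. Re s < 0}"
proof -
  have "(zeta_series \<circ> (\<lambda>s. 1 - s)) holomorphic_on {s. Re s < 0}"
    by (rule holomorphic_on_compose_gen[OF _ zeta_series_holomorphic]) (auto intro!: holomorphic_intros)
  then show ?thesis unfolding zeta_left_def o_def
    by (intro holomorphic_intros) (auto elim!: nonpos_Ints_cases simp: complex_eq_iff)
qed

lemma zeta_right_eq_left:
  assumes s: "-1 < Re s" "Re s < 0"
  shows "zeta_right s = zeta_left s"
proof (rule holomorphic_eq_if_eq_on_reals[where f = zeta_right and g = zeta_left and A = "{s. Re s > -1} \<inter> {s. Re s < 0}" and u = "-1" and v = 0])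
  show "zeta_right holomorphic_on {s. Re s > -1} \<inter> {s. Re s < 0}"
    by (rule holomorphic_on_subset[OF zeta_right_holomorphic]) auto
  show "zeta_left holomorphic_on {s. Re s > -1} \<inter> {s. Re s < 0}"
    by (rule holomorphic_on_subset[OF zeta_left_holomorphic]) auto
  show "open ({s. Re s > -1} \<inter> {s. Re s < 0})" by (intro open_Int open_halfspace_Re_gt open_halfspace_Re_lt)
  show "connected ({s. Re s > -1} \<inter> {s. Re s < 0})"
    by (intro convex_connected convex_Int convex_halfspace_Re_gt convex_halfspace_Re_lt)
  fix x :: real assume x: "-1 < x" "x < 0"
  define q where "q = 1 - x"
  have q: "1 < q" "q < 2" "x = 1 - q" using x by (auto simp: q_def)
  have ser: "zeta_series (of_real q) = of_real (\<Sum>n. real (Suc n) powr - q)"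
  proof -
    have "1 / of_nat (Suc n) powr of_real q = complex_of_real (real (Suc n) powr - q)" for n
      using powr_of_real[of "real (Suc n)" q] by (simp add: powr_minus divide_inverse)
    moreover have "summable (\<lambda>n. real (Suc n) powr - q)" using q by (subst summable_Suc_iff) (simp add: summable_real_powr_iff)
    ultimately show ?thesis unfolding zeta_series_def by (simp add: suminf_of_real)
  qed
  have "zeta_left (of_real (1 - q)) = of_real (2 * (2 * pi) powr - q * cos (pi * q / 2) * Gamma q * (\<Sum>n. real (Suc n) powr - q))"
  proof -
    have "complex_of_real (2 * pi) powr (- of_real q) = of_real ((2 * pi) powr - q)"
      using powr_of_real[of "2 * pi" "- q"] by simp
    moreover have "cos (of_real pi * complex_of_real q / 2) = of_real (cos (pi * q / 2))"
      using cos_of_real[of "pi * q / 2", where 'a = complex] by simp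
    moreover have "Gamma (complex_of_real q) = of_real (Gamma q)" by (rule Gamma_complex_of_real)
    ultimately show ?thesis unfolding zeta_left_def by (simp add: ser)
  qed
  then show "zeta_right (of_real x) = zeta_left (of_real x)"
    using zeta_right_functional_real[OF q(1,2)] unfolding q(3) by simp
qed (use s in auto)

text \<open>The defining property of \<open>zeta\<close> is satisfiable: the functions \<open>zeta_right\<close> and \<open>zeta_left\<close> agree on
the strip where both are defined, and together they cover the plane.\<close>

lemma zeta_spec:
  "zeta holomorphic_on (- {1})" "\<And>s. Re s > 1 \<Longrightarrow> (\<lambda>n. 1 / of_nat (Suc n) powr s) sums zeta s"
proof -
  define Z where "Z = (\<lambda>s. if Re s > -1 then zeta_right s else zeta_left s)"
  have "Z holomorphic_on ({s. Re s > -1} - {1}) \<union> {s. Re s < 0}"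
  proof (rule holomorphic_on_Un)
    show "Z holomorphic_on {s. Re s > -1} - {1}"
      by (rule holomorphic_transform[OF zeta_right_holomorphic]) (auto simp: Z_def)
    show "Z holomorphic_on {s. Re s < 0}"
      by (rule holomorphic_transform[OF zeta_left_holomorphic]) (auto simp: Z_def zeta_right_eq_left)
    show "open ({s. Re s > -1} - {1::complex})" by (intro open_Diff open_halfspace_Re_gt) auto
    show "open {s. Re s < 0}" by (rule open_halfspace_Re_lt)
  qed
  moreover have "({s. Re s > -1} - {1}) \<union> {s. Re s < 0} = - {1::complex}" by auto
  ultimately have "Z holomorphic_on - {1}" by simp
  moreover have "(\<lambda>n. 1 / of_nat (Suc n) powr s) sums Z s" if "Re s > 1" for s
    using zeta_series_sums[OF that] zeta_right_eq_series[OF that] that by (simp add: Z_def)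
  ultimately have "\<exists>f. f holomorphic_on (- {1}) \<and> (\<forall>s. Re s > 1 \<longrightarrow> (\<lambda>n. 1 / of_nat (Suc n) powr s) sums f s)" by blast
  from someI_ex[OF this] show "zeta holomorphic_on (- {1})" "\<And>s. Re s > 1 \<Longrightarrow> (\<lambda>n. 1 / of_nat (Suc n) powr s) sums zeta s"
    unfolding zeta_def by auto
qed

lemma zeta_eq_series: "Re s > 1 \<Longrightarrow> zeta s = zeta_series s"
  using zeta_spec(2) zeta_series_sums sums_unique2 by blast

theorem zeta_functional_equation:
  assumes s: "Re s < 0"
  shows "zeta s = 2 * of_real (2 * pi) powr (s - 1) * cos (of_real pi * (1 - s) / 2) * Gamma (1 - s) * zeta (1 - s)"
proof -
  have r: "zeta w = zeta_right w" if w: "Re w > -1" "w \<noteq> 1" for w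
  proof (rule analytic_continuation_open[where f = zeta and g = zeta_right and s = "{s. Re s > 1}" and s' = "{s. Re s > -1} - {1}"])
    show "connected ({s. Re s > -1} - {1::complex})"
      by (rule connected_open_delete) (auto intro!: convex_connected convex_halfspace_Re_gt open_halfspace_Re_gt)
    show "open ({s. Re s > -1} - {1::complex})" by (intro open_Diff open_halfspace_Re_gt) auto
    show "zeta holomorphic_on {s. Re s > -1} - {1}" by (rule holomorphic_on_subset[OF zeta_spec(1)]) auto
    show "{s. 1 < Re s} \<noteq> {}" by (auto intro!: exI[of _ 2])
    show "open {s. 1 < Re s}" by (rule open_halfspace_Re_gt)
  qed (use w zeta_right_holomorphic zeta_eq_series zeta_right_eq_series in auto)
  have "zeta s = zeta_left s"
  proof (rule analytic_continuation_open[where f = zeta and g = zeta_left and s = "{s. Re s > -1} \<inter> {s. Re s < 0}" and s' = "{s. Re s < 0}"])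
    show "open ({s. Re s > -1} \<inter> {s. Re s < 0})" by (intro open_Int open_halfspace_Re_gt open_halfspace_Re_lt)
    have "(-1/2 :: complex) \<in> {s. Re s > -1} \<inter> {s. Re s < 0}" by simp
    then show "{s. Re s > -1} \<inter> {s. Re s < 0} \<noteq> {}" by blast
    show "zeta holomorphic_on {s. Re s < 0}" by (rule holomorphic_on_subset[OF zeta_spec(1)]) auto
    show "connected {s. Re s < 0}" by (intro convex_connected convex_halfspace_Re_lt)
    show "open {s. Re s < 0}" by (rule open_halfspace_Re_lt)
    show "zeta z = zeta_left z" if "z \<in> {s. Re s > -1} \<inter> {s. Re s < 0}" for z
    proof -
      have "z \<noteq> 1" using that by auto
      then show ?thesis using that r[of z] zeta_right_eq_left[of z] by auto
    qed
  qed (use s zeta_left_holomorphic in auto)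
  then show ?thesis using s by (simp add: zeta_left_def zeta_eq_series)
qed

section \<open>The Bessel function of the second kind as an integral\<close>

text \<open>In the variable \<open>w = (x / 2)\<^sup>2\<close> this is \<open>2 * (x / 2) powr \<mu> * K\<^sub>\<mu>(x)\<close>.  With this normalisation the
derivative lowers the order by one and changes the sign; writing the exponent as
\<open>w * (- 1 / v)\<close> makes it an exponential integral with parameter \<open>w\<close>.\<close>

definition bessel_kernel :: "real \<Rightarrow> real \<Rightarrow> real" where
  "bessel_kernel \<mu> w = (\<integral>v. exp (w * (- 1 / v)) * (v powr (\<mu> - 1) * exp (- v)) \<partial>pos_lborel)"

lemma bessel_kernel_integrable:
  assumes "w > 0"
  shows "integrable pos_lborel (\<lambda>v. exp (w * (- 1 / v)) * (v powr (\<mu> - 1) * exp (- v)))"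
proof -
  define k where "k = nat \<lceil>1 - \<mu>\<rceil>"
  have k: "\<mu> + real k > 0" unfolding k_def by linarith
  have i: "integrable pos_lborel (\<lambda>v. (fact k / w ^ k) * (v powr (\<mu> + real k - 1) * exp (- 1 * v)))"
    using Gamma_integrable_scaled(1)[OF k, of 1] by (intro integrable_mult_right) simp
  show ?thesis
  proof (rule Bochner_Integration.integrable_bound[OF i])
    show "AE v in pos_lborel. norm (exp (w * (- 1 / v)) * (v powr (\<mu> - 1) * exp (- v))) \<le> norm ((fact k / w ^ k) * (v powr (\<mu> + real k - 1) * exp (- 1 * v)))"
    proof (rule AE_pos_lborelI)
      fix v :: real assume v: "v > 0"
      have "(w / v) ^ k / fact k \<le> exp (w / v)"
      proof -
        have "(\<Sum>n\<in>{k}. (w / v) ^ n /\<^sub>R fact n) \<le> (\<Sum>n. (w / v) ^ n /\<^sub>R fact n)"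
          by (rule sum_le_suminf[OF summable_exp_generic]) (use assms v in auto)
        then show ?thesis by (simp add: exp_def divide_inverse mult.commute)
      qed
      then have "exp (w * (- 1 / v)) \<le> fact k / w ^ k * v ^ k"
        using v assms by (simp add: exp_minus field_simps power_divide)
      then have "exp (w * (- 1 / v)) * (v powr (\<mu> - 1) * exp (- v)) \<le> (fact k / w ^ k * v ^ k) * (v powr (\<mu> - 1) * exp (- v))"
        by (rule mult_right_mono) auto
      also have "\<dots> = (fact k / w ^ k) * (v powr (\<mu> + real k - 1) * exp (- 1 * v))"
        using v by (simp add: powr_diff powr_add powr_realpow)
      finally show "norm (exp (w * (- 1 / v)) * (v powr (\<mu> - 1) * exp (- v))) \<le> norm ((fact k / w ^ k) * (v powr (\<mu> + real k - 1) * exp (- 1 * v)))"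
        using assms by simp
    qed
  qed measurable
qed

lemma bessel_kernel_has_derivative:
  assumes w: "w > 0"
  shows "(bessel_kernel \<mu> has_real_derivative - bessel_kernel (\<mu> - 1) w) (at w)"
proof -
  define l where "l = (\<lambda>v::real. - 1 / v)"
  define f where "f = (\<lambda>v. v powr (\<mu> - 1) * exp (- v))"
  have [measurable]: "l \<in> borel_measurable pos_lborel" "f \<in> borel_measurable pos_lborel" by (simp_all add: l_def f_def)
  have int: "integrable pos_lborel (\<lambda>v. exp (\<sigma> * l v) * f v)" if "\<sigma> \<in> {0<..}" for \<sigma>
    using bessel_kernel_integrable[of \<sigma> \<mu>] that by (simp add: l_def f_def)
  have "((\<lambda>z. \<integral>v. exp (z * complex_of_real (l v)) * complex_of_real (f v) \<partial>pos_lborel) has_field_derivative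
      (\<integral>v. complex_of_real (l v) * exp (of_real w * complex_of_real (l v)) * complex_of_real (f v) \<partial>pos_lborel)) (at (of_real w))"
    by (rule exp_integral_has_field_derivative[where S = "{0<..}"]) (use int w in auto)
  then have "((\<lambda>x. Re (\<integral>v. exp (of_real x * of_real (l v)) * of_real (f v) \<partial>pos_lborel)) has_real_derivative
      Re (\<integral>v. of_real (l v) * exp (of_real w * of_real (l v)) * of_real (f v) \<partial>pos_lborel)) (at w)"
    by (intro has_field_derivative_Re has_vector_derivative_real_field)
  also have "(\<lambda>x. Re (\<integral>v. exp (of_real x * of_real (l v)) * of_real (f v) \<partial>pos_lborel)) = bessel_kernel \<mu>"
  proof
    fix x
    have "(\<integral>v. exp (of_real x * of_real (l v)) * complex_of_real (f v) \<partial>pos_lborel) = (\<integral>v. complex_of_real (exp (x * l v) * f v) \<partial>pos_lborel)"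
      by (simp add: exp_of_real[symmetric])
    also have "\<dots> = of_real (bessel_kernel \<mu> x)" by (subst integral_complex_of_real) (simp add: bessel_kernel_def l_def f_def)
    finally show "Re (\<integral>v. exp (of_real x * of_real (l v)) * complex_of_real (f v) \<partial>pos_lborel) = bessel_kernel \<mu> x" by simp
  qed
  also have "(\<integral>v. of_real (l v) * exp (of_real w * of_real (l v)) * complex_of_real (f v) \<partial>pos_lborel) = (\<integral>v. complex_of_real (l v * exp (w * l v) * f v) \<partial>pos_lborel)"
    by (simp add: exp_of_real[symmetric])
  also have "\<dots> = of_real (\<integral>v. l v * exp (w * l v) * f v \<partial>pos_lborel)" by (rule integral_complex_of_real)
  also have "(\<integral>v. l v * exp (w * l v) * f v \<partial>pos_lborel) = (\<integral>v. - (exp (w * (- 1 / v)) * (v powr ((\<mu> - 1) - 1) * exp (- v))) \<partial>pos_lborel)"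
  proof (rule integral_pos_lborel_cong)
    fix v :: real assume "v > 0"
    then have "v powr (\<mu> - 1) = v * v powr ((\<mu> - 1) - 1)" by (subst powr_mult_base) auto
    then show "l v * exp (w * l v) * f v = - (exp (w * (- 1 / v)) * (v powr ((\<mu> - 1) - 1) * exp (- v)))"
      using \<open>v > 0\<close> by (simp add: l_def f_def)
  qed (simp_all add: l_def f_def)
  also have "\<dots> = - bessel_kernel (\<mu> - 1) w" by (simp add: bessel_kernel_def)
  finally show ?thesis by simp
qed

text \<open>The substitution \<open>v = w / u\<close>.\<close>

lemma bessel_kernel_reflect:
  assumes w: "w > 0"
  shows "bessel_kernel \<mu> w = w powr \<mu> * bessel_kernel (- \<mu>) w"
proof -
  have "integral\<^sup>L pos_lborel (\<lambda>v. exp (w * (- 1 / v)) * (v powr (\<mu> - 1) * exp (- v)))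
     = integral\<^sup>L pos_lborel (\<lambda>v. w powr \<mu> * (exp (w * (- 1 / v)) * (v powr (- \<mu> - 1) * exp (- v))))"
  proof (rule pos_lborel_change_of_variables(2)[where g = "\<lambda>u. w / u" and g' = "\<lambda>u. - w / u\<^sup>2"])
    show "((\<lambda>u. w / u) has_real_derivative - w / u\<^sup>2) (at u)" if "u > 0" for u
      using that by (auto intro!: derivative_eq_intros simp: power2_eq_square)
    show "inj_on (\<lambda>u. w / u) {0<..}" using w by (auto simp: inj_on_def)
    show "(\<lambda>u. w / u) ` {0<..} = {0<..}"
    proof (intro equalityI subsetI)
      fix x :: real assume "x \<in> {0<..}"
      then show "x \<in> (\<lambda>u. w / u) ` {0<..}" using w by (intro image_eqI[of _ _ "w / x"]) auto
    qed (use w in auto)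
    show "\<bar>- w / u\<^sup>2\<bar> * (exp (w * (- 1 / (w / u))) * ((w / u) powr (\<mu> - 1) * exp (- (w / u)))) =
        w powr \<mu> * (exp (w * (- 1 / u)) * (u powr (- \<mu> - 1) * exp (- u)))" if u: "u > 0" for u
    proof -
      have "w / u\<^sup>2 * (w / u) powr (\<mu> - 1) = w powr \<mu> * u powr (- \<mu> - 1)"
        using w u by (simp add: powr_divide powr_diff powr_minus field_simps power2_eq_square)
      moreover have "\<bar>- w / u\<^sup>2\<bar> = w / u\<^sup>2" "w * (- 1 / (w / u)) = - u" "w * (- 1 / u) = - (w / u)" using w u by auto
      ultimately show ?thesis by (simp only: mult_ac)
    qed
    show "integrable pos_lborel (\<lambda>v. w powr \<mu> * (exp (w * (- 1 / v)) * (v powr (- \<mu> - 1) * exp (- v))))"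
      by (intro integrable_mult_right bessel_kernel_integrable w)
  qed measurable
  then show ?thesis by (simp add: bessel_kernel_def)
qed

lemma bessel_kernel_tendsto_Gamma:
  assumes \<mu>: "\<mu> > 0"
  shows "(bessel_kernel \<mu> \<longlongrightarrow> Gamma \<mu>) (at_right 0)"
  unfolding tendsto_at_iff_sequentially
proof (intro allI impI)
  fix X :: "nat \<Rightarrow> real" assume X: "\<forall>i. X i \<in> {0<..} - {0}" "X \<longlonglongrightarrow> 0"
  have "(\<lambda>n. \<integral>v. exp (X n * (- 1 / v)) * (v powr (\<mu> - 1) * exp (- v)) \<partial>pos_lborel) \<longlonglongrightarrow> (\<integral>v. v powr (\<mu> - 1) * exp (- v) \<partial>pos_lborel)"
  proof (rule integral_dominated_convergence[where w = "\<lambda>v. v powr (\<mu> - 1) * exp (- v)"])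
    show "integrable pos_lborel (\<lambda>v. v powr (\<mu> - 1) * exp (- v))"
      using Gamma_integrable_scaled(1)[OF \<mu>, of 1] by simp
    show "AE v in pos_lborel. (\<lambda>n. exp (X n * (- 1 / v)) * (v powr (\<mu> - 1) * exp (- v))) \<longlonglongrightarrow> v powr (\<mu> - 1) * exp (- v)"
    proof (rule AE_I2)
      fix v :: real
      have "(\<lambda>n. exp (X n * (- 1 / v)) * (v powr (\<mu> - 1) * exp (- v))) \<longlonglongrightarrow> exp (0 * (- 1 / v)) * (v powr (\<mu> - 1) * exp (- v))"
        by (intro tendsto_intros X(2))
      then show "(\<lambda>n. exp (X n * (- 1 / v)) * (v powr (\<mu> - 1) * exp (- v))) \<longlonglongrightarrow> v powr (\<mu> - 1) * exp (- v)" by simp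
    qed
    show "AE v in pos_lborel. norm (exp (X n * (- 1 / v)) * (v powr (\<mu> - 1) * exp (- v))) \<le> v powr (\<mu> - 1) * exp (- v)" for n
    proof (rule AE_pos_lborelI)
      fix v :: real assume "v > 0"
      moreover have "X n > 0" using X(1) by auto
      ultimately show "norm (exp (X n * (- 1 / v)) * (v powr (\<mu> - 1) * exp (- v))) \<le> v powr (\<mu> - 1) * exp (- v)"
        by (auto simp: mult_le_cancel_right1 not_less)
    qed
  qed measurable
  moreover have "(\<integral>v. v powr (\<mu> - 1) * exp (- v) \<partial>pos_lborel) = Gamma \<mu>"
    using Gamma_integrable_scaled(2)[OF \<mu>, of 1] by simp
  ultimately show "(bessel_kernel \<mu> \<circ> X) \<longlonglongrightarrow> Gamma \<mu>" by (simp add: bessel_kernel_def o_def)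
qed

definition bessel_coeff :: "real \<Rightarrow> nat \<Rightarrow> real" where
  "bessel_coeff \<mu> k = Gamma (\<mu> - real k) * (- 1) ^ k / fact k"

text \<open>Up to the factor \<open>sin (\<mu> * pi) / pi\<close> and a power of \<open>x\<close>, this is \<open>I\<^bsub>-\<mu>\<^esub>(x)\<close> at \<open>w = (x / 2)\<^sup>2\<close>.\<close>

definition bessel_entire :: "real \<Rightarrow> real \<Rightarrow> real" where
  "bessel_entire \<mu> w = (\<Sum>k. bessel_coeff \<mu> k * w ^ k)"

lemma nonint_not_nonpos: "x \<notin> \<int> \<Longrightarrow> x \<notin> \<int>\<^sub>\<le>\<^sub>0"
  using nonpos_Ints_subset_Ints by blast

lemma Gamma_shift:
  assumes "\<mu> \<notin> (\<int> :: real set)"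
  shows "Gamma (\<mu> - real k) = (\<mu> - real k - 1) * Gamma (\<mu> - real (Suc k))"
proof -
  have "\<mu> - real (Suc k) \<notin> \<int>" using assms Ints_add[of "\<mu> - real (Suc k)" "real (Suc k)"] by auto
  then have "Gamma (\<mu> - real (Suc k) + 1) = (\<mu> - real (Suc k)) * Gamma (\<mu> - real (Suc k))"
    by (intro Gamma_plus1 nonint_not_nonpos)
  then show ?thesis by (simp add: algebra_simps)
qed

lemma Gamma_nonint_nonzero: "\<mu> \<notin> (\<int> :: real set) \<Longrightarrow> Gamma (\<mu> - real k) \<noteq> 0"
  using Ints_add[of "\<mu> - real k" "real k"] nonint_not_nonpos[of "\<mu> - real k"] by (auto simp: Gamma_eq_zero_iff)

lemma bessel_coeff_Suc:
  assumes "\<mu> \<notin> \<int>"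
  shows "bessel_coeff \<mu> (Suc k) * ((real k + 1 - \<mu>) * (real k + 1)) = bessel_coeff \<mu> k"
proof -
  have gen: "G * (- e) / (x * F) * ((x - \<mu>) * x) = ((\<mu> - x) * G) * e / F" if "x \<noteq> 0" "F \<noteq> 0" for G e x F :: real
    using that by (simp add: field_simps)
  have 1: "bessel_coeff \<mu> (Suc k) = Gamma (\<mu> - real (Suc k)) * (- ((- 1) ^ k)) / ((real k + 1) * fact k)"
    by (simp add: bessel_coeff_def add.commute)
  have 2: "bessel_coeff \<mu> k = ((\<mu> - (real k + 1)) * Gamma (\<mu> - real (Suc k))) * (- 1) ^ k / fact k"
    unfolding bessel_coeff_def Gamma_shift[OF assms, of k] by (simp add: diff_diff_eq)
  show ?thesis unfolding 1 2 by (rule gen) auto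
qed

lemma summable_bessel_coeff:
  assumes \<mu>: "\<mu> \<notin> \<int>"
  shows "summable (\<lambda>k. bessel_coeff \<mu> k * w ^ k)"
proof -
  have "\<forall>\<^sub>F k in sequentially. 2 * \<bar>w\<bar> \<le> (real k + 1 - \<mu>) * (real k + 1)" by real_asymp
  moreover have "\<forall>\<^sub>F k in sequentially. real k + 1 - \<mu> > 0" by real_asymp
  ultimately have "\<forall>\<^sub>F k in sequentially. norm (bessel_coeff \<mu> (Suc k) * w ^ Suc k) \<le> 1 / 2 * norm (bessel_coeff \<mu> k * w ^ k)"
  proof eventually_elim
    case (elim k)
    have "norm (bessel_coeff \<mu> k) = norm (bessel_coeff \<mu> (Suc k)) * ((real k + 1 - \<mu>) * (real k + 1))"
      unfolding bessel_coeff_Suc[OF \<mu>, of k, symmetric] norm_mult using elim by simp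
    moreover have "norm (bessel_coeff \<mu> (Suc k)) * (2 * \<bar>w\<bar>) \<le> norm (bessel_coeff \<mu> (Suc k)) * ((real k + 1 - \<mu>) * (real k + 1))"
      using elim by (intro mult_left_mono) auto
    ultimately have "norm (bessel_coeff \<mu> (Suc k)) * (2 * \<bar>w\<bar>) \<le> norm (bessel_coeff \<mu> k)" by simp
    then have "norm (bessel_coeff \<mu> (Suc k)) * (2 * \<bar>w\<bar>) * \<bar>w\<bar> ^ k \<le> norm (bessel_coeff \<mu> k) * \<bar>w\<bar> ^ k"
      by (rule mult_right_mono) auto
    then show ?case by (simp add: norm_mult norm_power abs_mult power_abs mult_ac)
  qed
  then obtain N where "\<And>k. k \<ge> N \<Longrightarrow> norm (bessel_coeff \<mu> (Suc k) * w ^ Suc k) \<le> 1 / 2 * norm (bessel_coeff \<mu> k * w ^ k)"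
    by (auto simp: eventually_sequentially)
  then show ?thesis by (intro summable_ratio_test[of "1/2" N]) auto
qed

lemma bessel_entire_has_derivative:
  assumes \<mu>: "\<mu> \<notin> \<int>"
  shows "(bessel_entire \<mu> has_real_derivative - bessel_entire (\<mu> - 1) w) (at w)"
proof -
  have "((\<lambda>w. \<Sum>k. bessel_coeff \<mu> k * w ^ k) has_field_derivative (\<Sum>k. diffs (bessel_coeff \<mu>) k * w ^ k)) (at w)"
    by (rule termdiffs_strong_converges_everywhere) (rule summable_bessel_coeff[OF \<mu>])
  moreover have "diffs (bessel_coeff \<mu>) k = - bessel_coeff (\<mu> - 1) k" for k
    by (simp add: diffs_def bessel_coeff_def field_simps del: of_nat_Suc) (simp add: algebra_simps)
  moreover have "\<mu> - 1 \<notin> \<int>" using \<mu> Ints_add[of "\<mu> - 1" 1] by auto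
  then have "(\<Sum>k. - bessel_coeff (\<mu> - 1) k * w ^ k) = - bessel_entire (\<mu> - 1) w"
    unfolding bessel_entire_def using suminf_minus[OF summable_bessel_coeff[of "\<mu> - 1" w]] by simp
  ultimately show ?thesis by (simp add: bessel_entire_def[abs_def])
qed

text \<open>The recurrence of the Bessel functions in the form that gives \<open>bessel_kernel_series\<close> the same
derivative rule as \<open>bessel_kernel\<close>.\<close>

lemma bessel_entire_recurrence:
  assumes \<mu>: "\<mu> \<notin> \<int>"
  shows "\<mu> * bessel_entire (- \<mu>) w - w * bessel_entire (- \<mu> - 1) w = - bessel_entire (1 - \<mu>) w"
proof -
  have ni: "- \<mu> \<notin> \<int>" "- \<mu> - 1 \<notin> \<int>" "1 - \<mu> \<notin> \<int>"
    using \<mu> Ints_minus[of "- \<mu>"] Ints_add[of "- \<mu> - 1" 1] Ints_minus[of "-\<mu>"] Ints_diff[of 1 "1 - \<mu>"] by auto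
  define s where "s = (\<lambda>k. if k = 0 then 0 else bessel_coeff (- \<mu> - 1) (k - 1) * w ^ k)"
  have "(\<lambda>k. bessel_coeff (- \<mu> - 1) k * w ^ k * w) sums (bessel_entire (- \<mu> - 1) w * w)"
    unfolding bessel_entire_def by (intro sums_mult2 summable_sums summable_bessel_coeff ni)
  then have "(\<lambda>k. s (Suc k)) sums (w * bessel_entire (- \<mu> - 1) w)" by (simp add: s_def mult_ac)
  then have s: "s sums (w * bessel_entire (- \<mu> - 1) w)" by (subst (asm) sums_Suc_iff) (simp add: s_def)
  have "(\<lambda>k. \<mu> * (bessel_coeff (- \<mu>) k * w ^ k) - s k) sums (\<mu> * bessel_entire (- \<mu>) w - w * bessel_entire (- \<mu> - 1) w)"
    unfolding bessel_entire_def[of "- \<mu>"] by (intro sums_diff s sums_mult summable_sums summable_bessel_coeff ni)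
  moreover have "\<mu> * (bessel_coeff (- \<mu>) k * w ^ k) - s k = - (bessel_coeff (1 - \<mu>) k * w ^ k)" for k
  proof -
    have G: "Gamma (1 - \<mu> - real k) = (- \<mu> - real k) * Gamma (- \<mu> - real k)"
      using Gamma_shift[OF ni(3), of k] by (simp add: algebra_simps)
    show ?thesis
    proof (cases k)
      case 0 then show ?thesis using G by (simp add: s_def bessel_coeff_def)
    next
      case (Suc j)
      have "bessel_coeff (- \<mu> - 1) j = - real k * bessel_coeff (- \<mu>) k"
      proof -
        have gen: "G * e / F = - x * (G * (- e) / (x * F))" if "x \<noteq> 0" for G e x F :: real
          using that by simp
        have "bessel_coeff (- \<mu>) k = Gamma (- \<mu> - 1 - real j) * (- ((- 1) ^ j)) / (real k * fact j)"
          using Suc by (simp add: bessel_coeff_def algebra_simps)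
        then show ?thesis using gen[of "real k" "Gamma (- \<mu> - 1 - real j)" "(- 1) ^ j" "fact j"] Suc
          unfolding bessel_coeff_def[of "- \<mu> - 1"] by simp
      qed
      then have "s k = - real k * bessel_coeff (- \<mu>) k * w ^ k" using Suc by (simp add: s_def)
      then have "\<mu> * (bessel_coeff (- \<mu>) k * w ^ k) - s k = (\<mu> + real k) * bessel_coeff (- \<mu>) k * w ^ k"
        by (simp only:) (simp add: algebra_simps)
      also have "(\<mu> + real k) * bessel_coeff (- \<mu>) k = - bessel_coeff (1 - \<mu>) k"
      proof -
        have gen: "(m + x) * (G * e / F) = - ((- m - x) * G * e / F)" for m x G e F :: real
          by (cases "F = 0") (auto simp: field_simps)
        show ?thesis unfolding bessel_coeff_def G by (rule gen)
      qed
      finally show ?thesis by simp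
    qed
  qed
  ultimately have "(\<lambda>k. - (bessel_coeff (1 - \<mu>) k * w ^ k)) sums (\<mu> * bessel_entire (- \<mu>) w - w * bessel_entire (- \<mu> - 1) w)" by simp
  moreover have "(\<lambda>k. - (bessel_coeff (1 - \<mu>) k * w ^ k)) sums (- bessel_entire (1 - \<mu>) w)"
    unfolding bessel_entire_def by (intro sums_minus summable_sums summable_bessel_coeff ni)
  ultimately show ?thesis by (rule sums_unique2)
qed

definition bessel_kernel_series :: "real \<Rightarrow> real \<Rightarrow> real" where
  "bessel_kernel_series \<mu> w = bessel_entire \<mu> w + w powr \<mu> * bessel_entire (- \<mu>) w"

lemma bessel_kernel_series_has_derivative:
  assumes \<mu>: "\<mu> \<notin> \<int>" and w: "w > 0"
  shows "(bessel_kernel_series \<mu> has_real_derivative - bessel_kernel_series (\<mu> - 1) w) (at w)"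
proof -
  have ni: "- \<mu> \<notin> \<int>" using \<mu> Ints_minus[of "- \<mu>"] by auto
  have "((\<lambda>w. w powr \<mu>) has_real_derivative \<mu> * w powr (\<mu> - 1)) (at w)"
    using w by (auto intro!: derivative_eq_intros)
  from DERIV_add[OF bessel_entire_has_derivative[OF \<mu>, of w] DERIV_mult[OF this bessel_entire_has_derivative[OF ni, of w]]]
  have "(bessel_kernel_series \<mu> has_real_derivative (- bessel_entire (\<mu> - 1) w + (\<mu> * w powr (\<mu> - 1) * bessel_entire (- \<mu>) w + - bessel_entire (- \<mu> - 1) w * w powr \<mu>))) (at w)"
    unfolding bessel_kernel_series_def[abs_def] by (simp add: mult_ac)
  moreover have "\<mu> * w powr (\<mu> - 1) * bessel_entire (- \<mu>) w + - bessel_entire (- \<mu> - 1) w * w powr \<mu>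
      = w powr (\<mu> - 1) * (\<mu> * bessel_entire (- \<mu>) w - w * bessel_entire (- \<mu> - 1) w)"
    using powr_mult_base[of w "\<mu> - 1"] w by (simp add: algebra_simps)
  moreover have "w powr (\<mu> - 1) * (\<mu> * bessel_entire (- \<mu>) w - w * bessel_entire (- \<mu> - 1) w) = - (w powr (\<mu> - 1) * bessel_entire (1 - \<mu>) w)"
    unfolding bessel_entire_recurrence[OF \<mu>] by simp
  ultimately have "(bessel_kernel_series \<mu> has_real_derivative (- bessel_entire (\<mu> - 1) w + - (w powr (\<mu> - 1) * bessel_entire (1 - \<mu>) w))) (at w)"
    by (simp only:)
  then show ?thesis by (simp add: bessel_kernel_series_def)
qed

lemma bessel_kernel_series_reflect:
  assumes "w > 0"
  shows "bessel_kernel_series \<mu> w = w powr \<mu> * bessel_kernel_series (- \<mu>) w"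
  using assms by (simp add: bessel_kernel_series_def distrib_left powr_minus)

lemma bessel_kernel_series_tendsto_Gamma:
  assumes \<mu>: "\<mu> \<notin> \<int>" "\<mu> > 0"
  shows "(bessel_kernel_series \<mu> \<longlongrightarrow> Gamma \<mu>) (at_right 0)"
proof -
  have ni: "- \<mu> \<notin> \<int>" using \<mu> Ints_minus[of "- \<mu>"] by auto
  have c: "isCont (bessel_entire \<mu>) 0" "isCont (bessel_entire (- \<mu>)) 0"
    by (rule DERIV_isCont[OF bessel_entire_has_derivative[OF \<mu>(1)]], rule DERIV_isCont[OF bessel_entire_has_derivative[OF ni]])
  have "((\<lambda>w. w powr \<mu>) \<longlongrightarrow> 0) (at_right 0)" using \<mu>(2) by real_asymp
  then have "(bessel_kernel_series \<mu> \<longlongrightarrow> bessel_entire \<mu> 0 + 0 * bessel_entire (- \<mu>) 0) (at_right 0)"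
    unfolding bessel_kernel_series_def[abs_def]
    by (intro tendsto_intros isCont_imp_tendsto_at_right c)
  moreover have "bessel_entire \<mu> 0 = Gamma \<mu>"
    using powser_zero[of "bessel_coeff \<mu>"] by (simp add: bessel_entire_def bessel_coeff_def)
  ultimately show ?thesis by simp
qed

text \<open>The functions \<open>D * x powr s / s - f x\<close> and \<open>D * x powr s / s + f x\<close> are nondecreasing and tend to \<open>0\<close> at
\<open>0\<close>.\<close>

lemma bound_from_derivative_bound:
  fixes f :: "real \<Rightarrow> real"
  assumes der: "\<And>x. 0 < x \<Longrightarrow> x \<le> W \<Longrightarrow> (f has_real_derivative f' x) (at x)"
    and bd: "\<And>x. 0 < x \<Longrightarrow> x \<le> W \<Longrightarrow> \<bar>f' x\<bar> \<le> D * x powr (s - 1)"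
    and s: "s > 0" and lim: "(f \<longlongrightarrow> 0) (at_right 0)" and w: "0 < w" "w \<le> W"
  shows "\<bar>f w\<bar> \<le> D * w powr s / s"
proof -
  have main: "\<epsilon> * f w \<le> D * w powr s / s" if e: "\<epsilon> = 1 \<or> \<epsilon> = -1" for \<epsilon> :: real
  proof -
    define g where "g = (\<lambda>x. \<epsilon> * f x - D * x powr s / s)"
    have dg: "(g has_real_derivative (\<epsilon> * f' x - D * x powr (s - 1))) (at x)" if "0 < x" "x \<le> W" for x
      unfolding g_def using that s der[OF that] by (auto intro!: derivative_eq_intros)
    have le: "g w \<le> g x" if x: "0 < x" "x < w" for x
    proof (rule DERIV_nonpos_imp_nonincreasing[where f = g and a = x and b = w])
      fix t assume t: "x \<le> t" "t \<le> w"
      have "\<epsilon> * f' t - D * t powr (s - 1) \<le> 0" using bd[of t] t x w e by auto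
      then show "\<exists>y. (g has_real_derivative y) (at t) \<and> y \<le> 0" using dg[of t] t x w by auto
    qed (use x in simp)
    have "((\<lambda>x. x powr s) \<longlongrightarrow> 0) (at_right 0)" using s by real_asymp
    then have "(g \<longlongrightarrow> \<epsilon> * 0 - D * 0 / s) (at_right 0)" unfolding g_def by (intro tendsto_intros lim) (use s in auto)
    then have "(g \<longlongrightarrow> 0) (at_right 0)" by simp
    moreover have "\<forall>\<^sub>F x in at_right 0. g w \<le> g x"
      using eventually_at_right_less[of 0] eventually_at_right_real[OF w(1)] by eventually_elim (use le in auto)
    ultimately have "g w \<le> 0" by (rule tendsto_lowerbound) simp
    then show ?thesis by (simp add: g_def)
  qed
  show ?thesis using main[of 1] main[of "-1"] by auto
qed

text \<open>Integrating the bounds for \<open>u\<close> and \<open>v\<close> in turn gains a factor \<open>x / ((1 - a) * (n + 1))\<close> in each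
round, because the singularities of the coefficients at \<open>0\<close> are integrable.  Iteration makes the bound
for \<open>u\<close> arbitrarily small.\<close>

lemma volterra_pair_zero:
  fixes u v :: "real \<Rightarrow> real"
  assumes a: "0 < a" "a < 1"
    and du: "\<And>x. x > 0 \<Longrightarrow> (u has_real_derivative - (x powr (a - 1) * v x)) (at x)"
    and dv: "\<And>x. x > 0 \<Longrightarrow> (v has_real_derivative - (x powr (- a) * u x)) (at x)"
    and lu: "(u \<longlongrightarrow> 0) (at_right 0)" and lv: "(v \<longlongrightarrow> 0) (at_right 0)" and w: "w > 0"
  shows "u w = 0"
proof -
  \<comment> \<open>The value of \<open>u\<close> at \<open>0\<close> is arbitrary; the limit makes this extension continuous, hence bounded on \<open>[0, w]\<close>.\<close>
  define U where "U = (\<lambda>x. if x \<le> 0 then 0 else u x)"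
  have "continuous_on {0..w} U"
    unfolding continuous_on_eq_continuous_within
  proof
    fix x assume x: "x \<in> {0..w}"
    show "continuous (at x within {0..w}) U"
    proof (cases "x = 0")
      case True
      have "(U \<longlongrightarrow> 0) (at_right 0)"
        using lu by (rule Lim_transform_eventually) (use eventually_at_right_less[of 0] in eventually_elim, simp add: U_def)
      then have "(U \<longlongrightarrow> 0) (at 0 within {0..w})" using w by (simp add: at_within_Icc_at_right)
      then show ?thesis using True by (simp add: continuous_within U_def)
    next
      case False
      then have x0: "x > 0" using x by simp
      have "isCont u x" using du[OF x0] by (rule DERIV_isCont)
      moreover have "\<forall>\<^sub>F y in nhds x. U y = u y"
        using eventually_gt_at_top x0 by (auto simp: U_def eventually_nhds intro!: exI[of _ "{0<..}"])
      ultimately have "isCont U x" by (simp add: isCont_cong)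
      then show ?thesis by (rule continuous_at_imp_continuous_at_within)
    qed
  qed
  then have "bounded (U ` {0..w})" by (intro compact_imp_bounded compact_continuous_image) auto
  then obtain C where "\<forall>x\<in>U ` {0..w}. norm x \<le> C" unfolding bounded_iff by blast
  then have C: "\<And>x. x \<in> {0..w} \<Longrightarrow> \<bar>U x\<bar> \<le> C" by simp
  have C0: "C \<ge> 0" using C[of 0] w by (simp add: U_def)
  have "\<bar>u x\<bar> \<le> C / ((1 - a) ^ n * fact n) * x powr real n" if "0 < x" "x \<le> w" for x n
    using that
  proof (induction n arbitrary: x)
    case 0 then show ?case using C[of x] by (simp add: U_def)
  next
    case (Suc n)
    define D where "D = C / ((1 - a) ^ n * fact n)"
    have D0: "D \<ge> 0" using C0 a by (simp add: D_def)
    have na: "real n + 1 - a > 0" using a by simp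
    have vb: "\<bar>v x\<bar> \<le> D * x powr (real n + 1 - a) / (real n + 1 - a)" if x: "0 < x" "x \<le> w" for x
    proof (rule bound_from_derivative_bound[OF _ _ _ lv x])
      fix y assume y: "0 < y" "y \<le> w"
      show "(v has_real_derivative - (y powr (- a) * u y)) (at y)" by (rule dv[OF y(1)])
      have "\<bar>- (y powr (- a) * u y)\<bar> = y powr (- a) * \<bar>u y\<bar>" by (simp add: abs_mult)
      also have "\<dots> \<le> y powr (- a) * (D * y powr real n)" using Suc.IH[OF y] by (intro mult_left_mono) (auto simp: D_def)
      also have "\<dots> = D * y powr (real n + 1 - a - 1)" by (simp add: powr_add[symmetric] mult.left_commute)
      finally show "\<bar>- (y powr (- a) * u y)\<bar> \<le> D * y powr (real n + 1 - a - 1)" .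
    qed (use na in simp)
    have "\<bar>u x\<bar> \<le> D / (real n + 1 - a) * x powr (real n + 1) / (real n + 1)"
    proof (rule bound_from_derivative_bound[OF _ _ _ lu Suc.prems])
      fix y assume y: "0 < y" "y \<le> w"
      show "(u has_real_derivative - (y powr (a - 1) * v y)) (at y)" by (rule du[OF y(1)])
      have "\<bar>- (y powr (a - 1) * v y)\<bar> = y powr (a - 1) * \<bar>v y\<bar>" by (simp add: abs_mult)
      also have "\<dots> \<le> y powr (a - 1) * (D * y powr (real n + 1 - a) / (real n + 1 - a))" using vb[OF y] by (intro mult_left_mono) auto
      also have "\<dots> = D / (real n + 1 - a) * (y powr (a - 1) * y powr (real n + 1 - a))" by simp
      also have "y powr (a - 1) * y powr (real n + 1 - a) = y powr (real n + 1 - 1)" by (simp add: powr_add[symmetric])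
      finally show "\<bar>- (y powr (a - 1) * v y)\<bar> \<le> D / (real n + 1 - a) * y powr (real n + 1 - 1)" .
    qed simp
    also have "\<dots> \<le> D / (1 - a) * x powr (real n + 1) / (real n + 1)"
      using D0 a by (intro divide_right_mono mult_right_mono divide_left_mono) auto
    also have "\<dots> = C / ((1 - a) ^ Suc n * fact (Suc n)) * x powr real (Suc n)"
      using a by (simp add: D_def field_simps)
    finally show ?case .
  qed
  from this[OF w order_refl] have "\<bar>u w\<bar> \<le> C * (inverse (fact n) * (w / (1 - a)) ^ n)" for n
    using w by (simp add: powr_realpow power_mult_distrib power_inverse divide_inverse mult_ac)
  moreover have "(\<lambda>n. C * (inverse (fact n) * (w / (1 - a)) ^ n)) \<longlonglongrightarrow> C * 0"
    by (intro tendsto_intros summable_LIMSEQ_zero summable_exp)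
  ultimately have "\<bar>u w\<bar> \<le> C * 0" by (intro LIMSEQ_le_const) auto
  then show ?thesis by simp
qed

text \<open>The difference \<open>\<delta>\<close> of the two sides satisfies \<open>\<delta>\<^sub>\<mu>' = - \<delta>\<^bsub>\<mu>-1\<^esub>\<close> and a reflection rule, and it
tends to \<open>0\<close> at \<open>0\<close> for positive orders.  For \<open>0 < \<mu> < 1\<close> this is a Volterra system for the
orders \<open>\<mu>\<close> and \<open>1 - \<mu>\<close>; larger orders have derivative zero by induction.\<close>

lemma bessel_kernel_eq_series:
  assumes "\<mu> \<notin> \<int>" "\<mu> > 0" "w > 0"
  shows "bessel_kernel \<mu> w = bessel_kernel_series \<mu> w"
proof -
  define \<delta> where "\<delta> = (\<lambda>\<mu> w. bessel_kernel \<mu> w - bessel_kernel_series \<mu> w)"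
  have d\<delta>: "(\<delta> \<mu> has_real_derivative - \<delta> (\<mu> - 1) w) (at w)" if "\<mu> \<notin> \<int>" "w > 0" for \<mu> w
    using DERIV_diff[OF bessel_kernel_has_derivative[OF that(2)] bessel_kernel_series_has_derivative[OF that]]
    by (simp add: \<delta>_def[abs_def])
  have r\<delta>: "\<delta> \<mu> w = w powr \<mu> * \<delta> (- \<mu>) w" if "w > 0" for \<mu> w
    using bessel_kernel_reflect[OF that, of \<mu>] bessel_kernel_series_reflect[OF that, of \<mu>]
    by (simp add: \<delta>_def right_diff_distrib)
  have l\<delta>: "(\<delta> \<mu> \<longlongrightarrow> 0) (at_right 0)" if "\<mu> \<notin> \<int>" "\<mu> > 0" for \<mu>
    using tendsto_diff[OF bessel_kernel_tendsto_Gamma[OF that(2)] bessel_kernel_series_tendsto_Gamma[OF that]]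
    by (simp add: \<delta>_def[abs_def])
  have base: "\<delta> a w = 0" if a: "0 < a" "a < 1" and w: "w > 0" for a w
  proof (rule volterra_pair_zero[where u = "\<delta> a" and v = "\<delta> (1 - a)", OF a])
    have nonint: "x \<notin> \<int>" if "0 < x" "x < 1" for x :: real
      using that by (auto elim!: Ints_cases)
    have ni: "a \<notin> \<int>" "1 - a \<notin> \<int>" using nonint a by auto
    fix x :: real assume x: "x > 0"
    show "(\<delta> a has_real_derivative - (x powr (a - 1) * \<delta> (1 - a) x)) (at x)"
      using d\<delta>[OF ni(1) x] r\<delta>[OF x, of "a - 1"] by simp
    show "(\<delta> (1 - a) has_real_derivative - (x powr - a * \<delta> a x)) (at x)"
      using d\<delta>[OF ni(2) x] r\<delta>[OF x, of "- a"] by simp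
  next
    have nonint: "x \<notin> \<int>" if "0 < x" "x < 1" for x :: real
      using that by (auto elim!: Ints_cases)
    show "(\<delta> a \<longlongrightarrow> 0) (at_right 0)" "(\<delta> (1 - a) \<longlongrightarrow> 0) (at_right 0)" using l\<delta> nonint a by auto
  qed (rule w)
  have step: "\<delta> (a + real n) w = 0" if a: "0 < a" "a < 1" and "w > 0" for a n w
    using \<open>w > 0\<close>
  proof (induction n arbitrary: w)
    case 0 then show ?case using base[OF a] by simp
  next
    case (Suc n)
    define \<mu> where "\<mu> = a + real (Suc n)"
    have ni: "\<mu> \<notin> \<int>"
    proof
      assume "\<mu> \<in> \<int>"
      then have "\<mu> - real (Suc n) \<in> \<int>" by (intro Ints_diff) auto
      then show False using a by (auto simp: \<mu>_def elim!: Ints_cases)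
    qed
    have "\<bar>\<delta> \<mu> w\<bar> \<le> 0 * w powr 1 / 1"
    proof (rule bound_from_derivative_bound[where W = w and f = "\<delta> \<mu>" and s = 1 and D = 0])
      fix x assume x: "0 < x" "x \<le> w"
      show "(\<delta> \<mu> has_real_derivative - \<delta> (\<mu> - 1) x) (at x)" by (rule d\<delta>[OF ni x(1)])
      show "\<bar>- \<delta> (\<mu> - 1) x\<bar> \<le> 0 * x powr (1 - 1)" using Suc.IH[OF x(1)] by (simp add: \<mu>_def)
    qed (use Suc.prems l\<delta>[OF ni] a in \<open>auto simp: \<mu>_def\<close>)
    then show ?case by (simp add: \<mu>_def)
  qed
  have f: "0 < frac \<mu>" "frac \<mu> < 1" using assms(1) by (auto simp: frac_gt_0_iff frac_lt_1)
  have "\<mu> = frac \<mu> + real (nat \<lfloor>\<mu>\<rfloor>)" using assms(2) by (simp add: frac_def of_nat_nat)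
  with step[OF f assms(3), of "nat \<lfloor>\<mu>\<rfloor>"] have "\<delta> \<mu> w = 0" by simp
  then show ?thesis by (simp add: \<delta>_def)
qed

text \<open>The coefficient of \<open>t powr (2 * k - \<mu>)\<close> in \<open>K\<^sub>\<mu>(a t)\<close>; the powers \<open>t powr (2 * k + \<mu>)\<close> have the
coefficients \<open>K_coeff a (- \<mu>) k\<close>.\<close>

definition K_coeff :: "real \<Rightarrow> real \<Rightarrow> nat \<Rightarrow> real" where
  "K_coeff a \<mu> k = bessel_coeff \<mu> k * (a / 2) powr (2 * real k - \<mu>) / 2"

lemma nonint_uminus: "\<mu> \<notin> \<int> \<Longrightarrow> - \<mu> \<notin> (\<int> :: real set)"
  using Ints_minus[of "- \<mu>"] by auto

text \<open>The reflection formula of the Gamma function at \<open>\<mu> - k\<close>, whose sine supplies the sign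
\<open>(- 1) ^ k\<close>.\<close>

lemma bessel_coeff_conv_rGamma:
  assumes \<mu>: "\<mu> \<notin> \<int>"
  shows "bessel_coeff \<mu> k = pi / sin (\<mu> * pi) * (rGamma (- \<mu> + real k + 1) / fact k)"
proof -
  define z where "z = \<mu> - real k"
  have z: "z \<notin> \<int>" using \<mu> Ints_add[of z "real k"] by (auto simp: z_def)
  have "rGamma (complex_of_real z) * rGamma (1 - complex_of_real z) = sin (of_real pi * of_real z) / of_real pi"
    by (rule rGamma_reflection_complex)
  also have "\<dots> = of_real (sin (pi * z) / pi)" by (simp add: sin_of_real[symmetric])
  also have "rGamma (complex_of_real z) * rGamma (1 - complex_of_real z) = of_real (rGamma z * rGamma (1 - z))"
    using rGamma_complex_of_real[of z] rGamma_complex_of_real[of "1 - z"] by simp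
  finally have refl: "rGamma z * rGamma (1 - z) = sin (pi * z) / pi" by (simp only: of_real_eq_iff)
  have "sin (pi * z) = sin (pi * \<mu> - real k * pi)" by (simp add: z_def algebra_simps)
  also have "\<dots> = (- 1) ^ k * sin (pi * \<mu>)" by (simp add: sin_diff cos_npi sin_npi mult.commute)
  finally have sz: "sin (pi * z) = (- 1) ^ k * sin (pi * \<mu>)" .
  have s0: "sin (pi * \<mu>) \<noteq> 0" using \<mu> by (auto simp: sin_zero_iff_int2 mult.commute)
  have G: "Gamma z * rGamma z = 1" using Gamma_nonint_nonzero[OF \<mu>, of k] by (simp add: rGamma_inverse_Gamma z_def)
  have "rGamma (1 - z) = Gamma z * (rGamma z * rGamma (1 - z))" using G by (simp flip: mult.assoc)
  also have "\<dots> = Gamma z * ((- 1) ^ k * sin (pi * \<mu>) / pi)" by (simp add: refl sz)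
  finally have "Gamma z * (- 1) ^ k = pi / sin (pi * \<mu>) * rGamma (1 - z)" using s0 by (simp add: field_simps)
  then show ?thesis by (simp add: bessel_coeff_def z_def mult.commute algebra_simps)
qed

lemma bessel_I_sums:
  assumes \<mu>: "\<mu> \<notin> \<int>" and x: "x > 0"
  shows "pi / sin (\<mu> * pi) * bessel_I (- \<mu>) x = (x / 2) powr - \<mu> * bessel_entire \<mu> ((x / 2)\<^sup>2)"
proof -
  have e: "rGamma (- \<mu> + real k + 1) / fact k * (x / 2) powr (- \<mu> + 2 * real k)
      = (sin (\<mu> * pi) / pi * (x / 2) powr - \<mu>) * (bessel_coeff \<mu> k * ((x / 2)\<^sup>2) ^ k)" for k
  proof -
    have s0: "sin (\<mu> * pi) \<noteq> 0" using \<mu> by (auto simp: sin_zero_iff_int2)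
    have "(x / 2) powr (2 * real k) = ((x / 2)\<^sup>2) ^ k"
      using x powr_realpow[of "x / 2" "2 * k"] by (simp add: power_mult del: power_divide)
    then have "(x / 2) powr (- \<mu> + 2 * real k) = (x / 2) powr - \<mu> * ((x / 2)\<^sup>2) ^ k"
      unfolding powr_add by (simp only:)
    then show ?thesis using s0 unfolding bessel_coeff_conv_rGamma[OF \<mu>] by simp
  qed
  have s0: "sin (\<mu> * pi) \<noteq> 0" using \<mu> by (auto simp: sin_zero_iff_int2)
  have "bessel_I (- \<mu>) x = (sin (\<mu> * pi) / pi * (x / 2) powr - \<mu>) * bessel_entire \<mu> ((x / 2)\<^sup>2)"
    unfolding bessel_I_def e bessel_entire_def by (rule suminf_mult[OF summable_bessel_coeff[OF \<mu>]])
  then show ?thesis using s0 by simp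
qed

lemma bessel_K_nonint:
  assumes \<mu>: "\<mu> \<notin> \<int>" and x: "x > 0"
  shows "bessel_K \<mu> x = ((x / 2) powr - \<mu> * bessel_entire \<mu> ((x / 2)\<^sup>2) + (x / 2) powr \<mu> * bessel_entire (- \<mu>) ((x / 2)\<^sup>2)) / 2"
proof -
  have "bessel_K \<mu> x = (pi / sin (\<mu> * pi) * bessel_I (- \<mu>) x + pi / sin (- \<mu> * pi) * bessel_I (- (- \<mu>)) x) / 2"
  proof -
    have gen: "pi / 2 * ((A - B) / s) = (pi / s * A + pi / (- s) * B) / 2" for A B s :: real
      by (cases "s = 0") (auto simp: field_simps)
    have "bessel_K \<mu> x = pi / 2 * ((bessel_I (- \<mu>) x - bessel_I \<mu> x) / sin (\<mu> * pi))"
      using \<mu> by (simp add: bessel_K_def Let_def)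
    then show ?thesis unfolding gen by simp
  qed
  then show ?thesis using bessel_I_sums[OF \<mu> x] bessel_I_sums[OF nonint_uminus[OF \<mu>] x] by simp
qed

lemma bessel_K_eq_kernel:
  assumes \<mu>: "\<mu> \<notin> \<int>" "\<mu> > 0" and x: "x > 0"
  shows "bessel_K \<mu> x = (x / 2) powr - \<mu> * bessel_kernel \<mu> ((x / 2)\<^sup>2) / 2"
proof -
  have "((x / 2)\<^sup>2) powr \<mu> = (x / 2) powr \<mu> * (x / 2) powr \<mu>"
    unfolding power2_eq_square by (rule powr_mult)
  then have "(x / 2) powr - \<mu> * ((x / 2)\<^sup>2) powr \<mu> = (x / 2) powr \<mu>" using x by (simp add: powr_minus field_simps)
  moreover have "bessel_kernel \<mu> ((x / 2)\<^sup>2) = bessel_kernel_series \<mu> ((x / 2)\<^sup>2)" using bessel_kernel_eq_series[OF \<mu>] x by simp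
  ultimately show ?thesis unfolding bessel_K_nonint[OF \<mu>(1) x] bessel_kernel_series_def
    by (simp only: distrib_left mult.assoc[symmetric])
qed

text \<open>The substitution \<open>v = (x / 2) * y\<close> in the kernel shows that \<open>K\<^sub>\<mu>\<close> is a mixture of exponentials.
Decay and Poisson summation both rest on this form.\<close>

lemma bessel_K_eq_mixture:
  assumes \<mu>: "\<mu> \<notin> \<int>" "\<mu> > 0" and x: "x > 0"
  shows "(\<integral>\<^sup>+y. ennreal (y powr (\<mu> - 1) / 2 * exp (- x * ((y + 1 / y) / 2))) \<partial>pos_lborel) = ennreal (bessel_K \<mu> x)"
    and "bessel_K \<mu> x \<ge> 0"
proof -
  define c where "c = x / 2"
  have c: "c > 0" using x by (simp add: c_def)
  define f where "f = (\<lambda>v. exp (c\<^sup>2 * (- 1 / v)) * (v powr (\<mu> - 1) * exp (- v)))"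
  have [measurable]: "f \<in> borel_measurable borel" unfolding f_def by measurable
  have k0: "bessel_kernel \<mu> (c\<^sup>2) \<ge> 0" unfolding bessel_kernel_def by (intro integral_nonneg_AE) auto
  have K: "bessel_K \<mu> x = c powr - \<mu> * bessel_kernel \<mu> (c\<^sup>2) / 2"
    unfolding c_def by (rule bessel_K_eq_kernel[OF \<mu> x])
  show "bessel_K \<mu> x \<ge> 0" unfolding K using k0 by simp
  have "ennreal (bessel_kernel \<mu> (c\<^sup>2)) = (\<integral>\<^sup>+v. ennreal (f v) \<partial>pos_lborel)"
    unfolding bessel_kernel_def f_def
    using bessel_kernel_integrable[of "c\<^sup>2" \<mu>] c by (intro nn_integral_eq_integral[symmetric]) auto
  also have "\<dots> = ennreal c * (\<integral>\<^sup>+y. ennreal (f (c * y)) \<partial>pos_lborel)"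
    by (rule nn_integral_pos_lborel_scale[OF _ c]) measurable
  finally have 1: "ennreal (bessel_kernel \<mu> (c\<^sup>2)) = ennreal c * (\<integral>\<^sup>+y. ennreal (f (c * y)) \<partial>pos_lborel)" .
  have "ennreal (bessel_K \<mu> x) = ennreal (c powr - \<mu> / 2) * ennreal (bessel_kernel \<mu> (c\<^sup>2))"
    unfolding K using k0 by (simp add: ennreal_mult[symmetric])
  also have "\<dots> = ennreal (c powr - \<mu> / 2 * c) * (\<integral>\<^sup>+y. ennreal (f (c * y)) \<partial>pos_lborel)"
  proof -
    have "ennreal (c powr - \<mu> / 2 * c) = ennreal (c powr - \<mu> / 2) * ennreal c"
      by (rule ennreal_mult) (use c in auto)
    then show ?thesis unfolding 1 by (simp only: mult.assoc)
  qed
  also have "\<dots> = (\<integral>\<^sup>+y. ennreal (c powr - \<mu> / 2 * c) * ennreal (f (c * y)) \<partial>pos_lborel)"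
    by (rule nn_integral_cmult[symmetric]) measurable
  also have "\<dots> = (\<integral>\<^sup>+y. ennreal (y powr (\<mu> - 1) / 2 * exp (- x * ((y + 1 / y) / 2))) \<partial>pos_lborel)"
  proof (rule nn_integral_pos_lborel_cong)
    fix y :: real assume y: "y > 0"
    have "c powr - \<mu> * c * (c * y) powr (\<mu> - 1) = y powr (\<mu> - 1)"
      using c y by (simp add: powr_mult powr_diff powr_minus field_simps)
    moreover have "exp (c\<^sup>2 * (- 1 / (c * y))) * exp (- (c * y)) = exp (- x * ((y + 1 / y) / 2))"
      using c y by (simp add: mult_exp_exp c_def power2_eq_square field_simps)
    moreover have "c powr - \<mu> / 2 * c * f (c * y) = (c powr - \<mu> * c * (c * y) powr (\<mu> - 1)) / 2 * (exp (c\<^sup>2 * (- 1 / (c * y))) * exp (- (c * y)))"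
      by (simp add: f_def mult_ac)
    ultimately have "c powr - \<mu> / 2 * c * f (c * y) = y powr (\<mu> - 1) / 2 * exp (- x * ((y + 1 / y) / 2))"
      by (simp only:)
    then show "ennreal (c powr - \<mu> / 2 * c) * ennreal (f (c * y)) = ennreal (y powr (\<mu> - 1) / 2 * exp (- x * ((y + 1 / y) / 2)))"
      using c by (simp add: ennreal_mult[symmetric] f_def)
  qed
  finally show "(\<integral>\<^sup>+y. ennreal (y powr (\<mu> - 1) / 2 * exp (- x * ((y + 1 / y) / 2))) \<partial>pos_lborel) = ennreal (bessel_K \<mu> x)" ..
qed

text \<open>The frequencies \<open>(y + 1 / y) / 2\<close> of the mixture are at least \<open>1\<close>.\<close>

lemma bessel_K_decay:
  assumes \<mu>: "\<mu> \<notin> \<int>" "\<mu> > 0" and x: "x > 0"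
  shows "bessel_K \<mu> x \<le> exp (- x / 2) * bessel_K \<mu> (x / 2)"
proof -
  have x2: "x / 2 > 0" using x by simp
  have "ennreal (bessel_K \<mu> x) \<le> (\<integral>\<^sup>+y. ennreal (exp (- x / 2)) * ennreal (y powr (\<mu> - 1) / 2 * exp (- (x / 2) * ((y + 1 / y) / 2))) \<partial>pos_lborel)"
    unfolding bessel_K_eq_mixture(1)[OF \<mu> x, symmetric]
  proof (rule nn_integral_mono_AE, rule AE_pos_lborelI)
    fix y :: real assume y: "y > 0"
    have "0 \<le> (y - 1)\<^sup>2" by simp
    then have "2 \<le> y + 1 / y" using y by (simp add: field_simps power2_eq_square)
    then have "x / 4 * 2 \<le> x / 4 * (y + 1 / y)" using x by (intro mult_left_mono) auto
    moreover define Q where "Q = x / 4 * (y + 1 / y)"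
    ultimately have Q: "x / 2 \<le> Q" by simp
    have e: "- x * ((y + 1 / y) / 2) = - 2 * Q" "- (x / 2) * ((y + 1 / y) / 2) = - Q" by (simp_all add: Q_def)
    have "- x * ((y + 1 / y) / 2) \<le> - x / 2 + - (x / 2) * ((y + 1 / y) / 2)" unfolding e using Q by linarith
    then have "exp (- x * ((y + 1 / y) / 2)) \<le> exp (- x / 2) * exp (- (x / 2) * ((y + 1 / y) / 2))"
      by (simp only: mult_exp_exp exp_le_cancel_iff)
    then have "y powr (\<mu> - 1) / 2 * exp (- x * ((y + 1 / y) / 2)) \<le> y powr (\<mu> - 1) / 2 * (exp (- x / 2) * exp (- (x / 2) * ((y + 1 / y) / 2)))"
      by (intro mult_left_mono) auto
    then show "ennreal (y powr (\<mu> - 1) / 2 * exp (- x * ((y + 1 / y) / 2))) \<le> ennreal (exp (- x / 2)) * ennreal (y powr (\<mu> - 1) / 2 * exp (- (x / 2) * ((y + 1 / y) / 2)))"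
      by (simp add: ennreal_mult[symmetric] ennreal_leI mult_ac)
  qed
  also have "\<dots> = ennreal (exp (- x / 2)) * (\<integral>\<^sup>+y. ennreal (y powr (\<mu> - 1) / 2 * exp (- (x / 2) * ((y + 1 / y) / 2))) \<partial>pos_lborel)"
    by (rule nn_integral_cmult) measurable
  also have "\<dots> = ennreal (exp (- x / 2) * bessel_K \<mu> (x / 2))"
    unfolding bessel_K_eq_mixture(1)[OF \<mu> x2] using bessel_K_eq_mixture(2)[OF \<mu> x2] by (simp add: ennreal_mult)
  finally show ?thesis using bessel_K_eq_mixture(2)[OF \<mu> x2] by (subst (asm) ennreal_le_iff) auto
qed

lemma bessel_K_antimono:
  assumes \<mu>: "\<mu> \<notin> \<int>" "\<mu> > 0" and x: "0 < x" "x \<le> y"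
  shows "bessel_K \<mu> y \<le> bessel_K \<mu> x"
proof -
  have y: "y > 0" using x by simp
  have "ennreal (bessel_K \<mu> y) \<le> ennreal (bessel_K \<mu> x)"
    unfolding bessel_K_eq_mixture(1)[OF \<mu> x(1), symmetric] bessel_K_eq_mixture(1)[OF \<mu> y, symmetric]
    by (rule nn_integral_mono_AE, rule AE_pos_lborelI) (use x in \<open>auto intro!: ennreal_leI mult_left_mono mult_right_mono\<close>)
  then show ?thesis using bessel_K_eq_mixture(2)[OF \<mu> x(1)] by (subst (asm) ennreal_le_iff) auto
qed

lemma bessel_K_measurable [measurable]:
  assumes \<mu>: "\<mu> \<notin> \<int>"
  shows "bessel_K \<mu> \<in> borel_measurable borel"
proof -
  have "(\<lambda>x. bessel_I \<nu> x) \<in> borel_measurable borel" for \<nu>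
    unfolding bessel_I_def by measurable
  then show ?thesis using \<mu> unfolding bessel_K_def[abs_def] Let_def by simp
qed

section \<open>Moments and Poisson summation for the Bessel function\<close>

lemma gaussian_moment:
  assumes c: "c > 0" and \<kappa>: "\<kappa> > 0"
  shows "(\<integral>\<^sup>+t. ennreal (t powr (c - 1) * exp (- \<kappa> * t\<^sup>2)) \<partial>pos_lborel) = ennreal (Gamma (c / 2) * \<kappa> powr - (c / 2) / 2)"
proof -
  have c2: "c / 2 > 0" using c by simp
  have int: "integrable pos_lborel (\<lambda>u. (u powr (c / 2 - 1) * exp (- \<kappa> * u)) / 2)"
    by (intro integrable_divide Gamma_integrable_scaled c2 \<kappa>)
  note cov = pos_lborel_change_of_variables[where f = "\<lambda>t. t powr (c - 1) * exp (- \<kappa> * t\<^sup>2)"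
      and G = "\<lambda>u. (u powr (c / 2 - 1) * exp (- \<kappa> * u)) / 2" and g = sqrt and g' = "\<lambda>u. inverse (sqrt u) / 2"]
  have A: "(sqrt has_real_derivative inverse (sqrt u) / 2) (at u)" if "u > 0" for u using DERIV_real_sqrt[OF that] by simp
  have B: "inj_on sqrt {0<..}" by (simp add: inj_on_def)
  have C: "sqrt ` {0<..} = {0<..}"
  proof (intro equalityI subsetI)
    fix x :: real assume "x \<in> {0<..}"
    then show "x \<in> sqrt ` {0<..}" by (intro image_eqI[of _ _ "x\<^sup>2"]) auto
  qed auto
  have D: "\<bar>inverse (sqrt u) / 2\<bar> * (sqrt u powr (c - 1) * exp (- \<kappa> * (sqrt u)\<^sup>2)) = (u powr (c / 2 - 1) * exp (- \<kappa> * u)) / 2" if u: "u > 0" for u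
  proof -
    have "sqrt u = u powr (1 / 2)" using u by (simp add: powr_half_sqrt)
    then have "inverse (sqrt u) * sqrt u powr (c - 1) = u powr - (1 / 2) * u powr ((1 / 2) * (c - 1))"
      using u by (simp add: powr_minus powr_powr)
    also have "\<dots> = u powr (c / 2 - 1)"
    proof -
      have "- (1 / 2) + (1 / 2) * (c - 1) = c / 2 - 1" by (simp add: field_simps)
      then show ?thesis by (simp only: powr_add[symmetric])
    qed
    finally show ?thesis using u by (simp add: mult.assoc[symmetric])
  qed
  have 1: "integrable pos_lborel (\<lambda>t. t powr (c - 1) * exp (- \<kappa> * t\<^sup>2))"
    by (rule cov(1)) (use A B C D int in auto)
  have "integral\<^sup>L pos_lborel (\<lambda>t. t powr (c - 1) * exp (- \<kappa> * t\<^sup>2)) = integral\<^sup>L pos_lborel (\<lambda>u. (u powr (c / 2 - 1) * exp (- \<kappa> * u)) / 2)"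
    by (rule cov(2)) (use A B C D int in auto)
  also have "\<dots> = Gamma (c / 2) * \<kappa> powr - (c / 2) / 2"
    using Gamma_integrable_scaled(2)[OF c2 \<kappa>] by simp
  finally have I: "integral\<^sup>L pos_lborel (\<lambda>t. t powr (c - 1) * exp (- \<kappa> * t\<^sup>2)) = Gamma (c / 2) * \<kappa> powr - (c / 2) / 2" .
  show ?thesis by (subst nn_integral_eq_integral[OF 1]) (simp, simp only: I)
qed

definition mellin_K :: "real \<Rightarrow> real \<Rightarrow> real \<Rightarrow> real" where
  "mellin_K a \<mu> s = Gamma ((s - \<mu>) / 2) * Gamma ((s + \<mu>) / 2) * (a / 2) powr - s / 4"

text \<open>With the order of integration exchanged, the integral over \<open>t\<close> is a Gaussian moment, and the remaining
one over \<open>v\<close> is a Gamma integral.\<close>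

lemma bessel_K_mellin_nn:
  assumes \<mu>: "\<mu> \<notin> \<int>" "\<mu> > 0" and a: "a > 0" and s: "s > \<mu>"
  shows "(\<integral>\<^sup>+t. ennreal (t powr (s - 1) * bessel_K \<mu> (a * t)) \<partial>pos_lborel) = ennreal (mellin_K a \<mu> s)"
proof -
  define c where "c = a / 2"
  have c: "c > 0" using a by (simp add: c_def)
  have s\<mu>: "(s - \<mu>) / 2 > 0" "(s + \<mu>) / 2 > 0" "s - \<mu> > 0" using s \<mu> by auto
  interpret P: pair_sigma_finite pos_lborel pos_lborel ..
  define f where "f = (\<lambda>t v. (c powr - \<mu> / 2) * (v powr (\<mu> - 1) * exp (- v)) * (t powr ((s - \<mu>) - 1) * exp (- (c\<^sup>2 / v) * t\<^sup>2)))"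
  have "(\<integral>\<^sup>+t. ennreal (t powr (s - 1) * bessel_K \<mu> (a * t)) \<partial>pos_lborel) = (\<integral>\<^sup>+t. (\<integral>\<^sup>+v. ennreal (f t v) \<partial>pos_lborel) \<partial>pos_lborel)"
  proof (rule nn_integral_pos_lborel_cong)
    fix t :: real assume t: "t > 0"
    have w: "(c * t)\<^sup>2 > 0" using c t by simp
    have x: "a * t > 0" using a t by simp
    have "t powr (s - 1) * bessel_K \<mu> (a * t) = (t powr (s - 1) * (c * t) powr - \<mu> / 2) * bessel_kernel \<mu> ((c * t)\<^sup>2)"
      using bessel_K_eq_kernel[OF \<mu> x] by (simp add: c_def)
    also have "t powr (s - 1) * (c * t) powr - \<mu> / 2 = (c powr - \<mu> / 2) * t powr ((s - \<mu>) - 1)"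
    proof -
      have "t powr (s - 1) * t powr - \<mu> = t powr ((s - \<mu>) - 1)" by (simp add: powr_add[symmetric] algebra_simps)
      then show ?thesis by (simp add: powr_mult mult.left_commute)
    qed
    finally have eq: "t powr (s - 1) * bessel_K \<mu> (a * t) = (c powr - \<mu> / 2) * t powr ((s - \<mu>) - 1) * bessel_kernel \<mu> ((c * t)\<^sup>2)" .
    have "ennreal (t powr (s - 1) * bessel_K \<mu> (a * t)) = ennreal ((c powr - \<mu> / 2) * t powr ((s - \<mu>) - 1)) * (\<integral>\<^sup>+v. ennreal (exp ((c * t)\<^sup>2 * (- 1 / v)) * (v powr (\<mu> - 1) * exp (- v))) \<partial>pos_lborel)"
      unfolding eq bessel_kernel_def
      by (subst nn_integral_eq_integral[OF bessel_kernel_integrable[OF w]]) (auto simp: ennreal_mult[symmetric] integral_nonneg_AE)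
    also have "\<dots> = (\<integral>\<^sup>+v. ennreal ((c powr - \<mu> / 2) * t powr ((s - \<mu>) - 1)) * ennreal (exp ((c * t)\<^sup>2 * (- 1 / v)) * (v powr (\<mu> - 1) * exp (- v))) \<partial>pos_lborel)"
      by (rule nn_integral_cmult[symmetric]) measurable
    also have "\<dots> = (\<integral>\<^sup>+v. ennreal (f t v) \<partial>pos_lborel)"
      by (intro nn_integral_cong) (simp add: f_def ennreal_mult[symmetric] power_mult_distrib mult_ac)
    finally show "ennreal (t powr (s - 1) * bessel_K \<mu> (a * t)) = (\<integral>\<^sup>+v. ennreal (f t v) \<partial>pos_lborel)" .
  qed
  also have "\<dots> = (\<integral>\<^sup>+v. (\<integral>\<^sup>+t. ennreal (f t v) \<partial>pos_lborel) \<partial>pos_lborel)"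
    unfolding f_def by (rule P.Fubini'[symmetric]) measurable
  also have "\<dots> = (\<integral>\<^sup>+v. ennreal (c powr - s * Gamma ((s - \<mu>) / 2) / 4) * ennreal (v powr ((s + \<mu>) / 2 - 1) * exp (- 1 * v)) \<partial>pos_lborel)"
  proof (rule nn_integral_pos_lborel_cong)
    fix v :: real assume v: "v > 0"
    have \<kappa>: "c\<^sup>2 / v > 0" using c v by simp
    have "(\<integral>\<^sup>+t. ennreal (f t v) \<partial>pos_lborel) = (\<integral>\<^sup>+t. ennreal ((c powr - \<mu> / 2) * (v powr (\<mu> - 1) * exp (- v))) * ennreal (t powr ((s - \<mu>) - 1) * exp (- (c\<^sup>2 / v) * t\<^sup>2)) \<partial>pos_lborel)"
      by (intro nn_integral_cong) (simp add: f_def ennreal_mult[symmetric])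
    also have "\<dots> = ennreal ((c powr - \<mu> / 2) * (v powr (\<mu> - 1) * exp (- v))) * (\<integral>\<^sup>+t. ennreal (t powr ((s - \<mu>) - 1) * exp (- (c\<^sup>2 / v) * t\<^sup>2)) \<partial>pos_lborel)"
      by (rule nn_integral_cmult) measurable
    also have "\<dots> = ennreal ((c powr - \<mu> / 2) * (v powr (\<mu> - 1) * exp (- v))) * ennreal (Gamma ((s - \<mu>) / 2) * (c\<^sup>2 / v) powr - ((s - \<mu>) / 2) / 2)"
      unfolding gaussian_moment[OF s\<mu>(3) \<kappa>] ..
    also have "\<dots> = ennreal (((c powr - \<mu> / 2) * (v powr (\<mu> - 1) * exp (- v))) * (Gamma ((s - \<mu>) / 2) * (c\<^sup>2 / v) powr - ((s - \<mu>) / 2) / 2))"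
      by (rule ennreal_mult[symmetric]) (use s\<mu> c in auto)
    also have "((c powr - \<mu> / 2) * (v powr (\<mu> - 1) * exp (- v))) * (Gamma ((s - \<mu>) / 2) * (c\<^sup>2 / v) powr - ((s - \<mu>) / 2) / 2)
        = (c powr - s * Gamma ((s - \<mu>) / 2) / 4) * (v powr ((s + \<mu>) / 2 - 1) * exp (- 1 * v))"
    proof -
      have "(c\<^sup>2) powr - ((s - \<mu>) / 2) = c powr (\<mu> - s)"
      proof -
        have "2 * - ((s - \<mu>) / 2) = \<mu> - s" by (simp add: field_simps)
        moreover have "(c\<^sup>2) powr u = c powr (2 * u)" for u using c powr_powr[of c 2 u] by simp
        ultimately show ?thesis by (simp only:)
      qed
      moreover have "(c\<^sup>2 / v) powr - u = (c\<^sup>2) powr - u * v powr u" for u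
        using c v powr_divide[of "c\<^sup>2" v "- u"] powr_minus[of v u] by (simp add: divide_inverse)
      ultimately have h1: "(c\<^sup>2 / v) powr - ((s - \<mu>) / 2) = c powr (\<mu> - s) * v powr ((s - \<mu>) / 2)" by (simp only:)
      have h2: "c powr - \<mu> * c powr (\<mu> - s) = c powr - s" by (simp add: powr_add[symmetric])
      have h3: "v powr (\<mu> - 1) * v powr ((s - \<mu>) / 2) = v powr ((s + \<mu>) / 2 - 1)" by (simp add: powr_add[symmetric] field_simps)
      have gen: "((A / 2) * (B * E)) * (G * (A' * B') / 2) = ((A * A') * G / 4) * ((B * B') * E)" for A B E G A' B' :: real by simp
      show ?thesis unfolding h1 gen h2 h3 by simp
    qed
    also have "ennreal \<dots> = ennreal (c powr - s * Gamma ((s - \<mu>) / 2) / 4) * ennreal (v powr ((s + \<mu>) / 2 - 1) * exp (- 1 * v))"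
      by (rule ennreal_mult) (use s\<mu> c in auto)
    finally show "(\<integral>\<^sup>+t. ennreal (f t v) \<partial>pos_lborel) = ennreal (c powr - s * Gamma ((s - \<mu>) / 2) / 4) * ennreal (v powr ((s + \<mu>) / 2 - 1) * exp (- 1 * v))" .
  qed
  also have "\<dots> = ennreal (c powr - s * Gamma ((s - \<mu>) / 2) / 4) * (\<integral>\<^sup>+v. ennreal (v powr ((s + \<mu>) / 2 - 1) * exp (- 1 * v)) \<partial>pos_lborel)"
    by (rule nn_integral_cmult) measurable
  also have "\<dots> = ennreal (c powr - s * Gamma ((s - \<mu>) / 2) / 4) * ennreal (Gamma ((s + \<mu>) / 2) * 1 powr - ((s + \<mu>) / 2))"
    by (subst Gamma_nn_integral_scaled[OF s\<mu>(2)]) auto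
  also have "\<dots> = ennreal (mellin_K a \<mu> s)"
    using s\<mu> by (simp add: ennreal_mult[symmetric] mellin_K_def c_def mult_ac)
  finally show ?thesis .
qed

lemma bessel_K_mellin:
  assumes \<mu>: "\<mu> \<notin> \<int>" "\<mu> > 0" and a: "a > 0" and s: "s > \<mu>"
  shows "integrable pos_lborel (\<lambda>t. t powr (s - 1) * bessel_K \<mu> (a * t))"
    and "(\<integral>t. t powr (s - 1) * bessel_K \<mu> (a * t) \<partial>pos_lborel) = mellin_K a \<mu> s"
proof -
  have [measurable]: "bessel_K \<mu> \<in> borel_measurable borel" by (rule bessel_K_measurable[OF \<mu>(1)])
  have *: "has_bochner_integral pos_lborel (\<lambda>t. t powr (s - 1) * bessel_K \<mu> (a * t)) (mellin_K a \<mu> s)"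
  proof (rule has_bochner_integral_nn_integral[OF _ _ _ bessel_K_mellin_nn[OF assms]])
    show "AE t in pos_lborel. 0 \<le> t powr (s - 1) * bessel_K \<mu> (a * t)"
      by (rule AE_pos_lborelI) (use a bessel_K_eq_mixture(2)[OF \<mu>] in simp)
    show "0 \<le> mellin_K a \<mu> s" using s \<mu> by (simp add: mellin_K_def)
  qed measurable
  then show "integrable pos_lborel (\<lambda>t. t powr (s - 1) * bessel_K \<mu> (a * t))"
    "(\<integral>t. t powr (s - 1) * bessel_K \<mu> (a * t) \<partial>pos_lborel) = mellin_K a \<mu> s" by (auto simp: has_bochner_integral_iff)
qed

lemma bessel_K_poisson:
  assumes \<mu>: "\<mu> \<notin> \<int>" "\<mu> > 0" and a: "a > 0" and p: "p > \<mu> + 1" "p \<notin> \<int>"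
  shows "summable (\<lambda>l. 2 * (\<integral>t. cos (2 * pi * real (Suc l) * t) * (t powr (p - 1) * bessel_K \<mu> (a * t)) \<partial>pos_lborel))"
    and "(\<lambda>n. real (Suc n) powr (p - 1) * bessel_K \<mu> (a * real (Suc n))) sums
      (mellin_K a \<mu> p + (\<Sum>l. 2 * (\<integral>t. cos (2 * pi * real (Suc l) * t) * (t powr (p - 1) * bessel_K \<mu> (a * t)) \<partial>pos_lborel)))"
proof -
  \<comment> \<open>The condition \<open>p > \<mu> + 1\<close> leaves room for some \<open>r > 1\<close> such that the moment of order \<open>p - r > \<mu>\<close> is finite.\<close>
  define r where "r = (1 + (p - \<mu>)) / 2"
  have r: "1 < r" "r < p" "p - r > \<mu>" using p \<mu> by (auto simp: r_def field_simps)
  have [measurable]: "bessel_K \<mu> \<in> borel_measurable borel" by (rule bessel_K_measurable[OF \<mu>(1)])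
  define \<phi> where "\<phi> = (\<lambda>y. y powr (\<mu> - 1) / 2 :: real)"
  define Y where "Y = (\<lambda>y. a * ((y + 1 / y) / 2) :: real)"
  \<comment> \<open>The absolute value has an effect for \<open>t \<le> 0\<close> only, where the sign of \<open>bessel_K\<close> is not controlled.\<close>
  define g where "g = (\<lambda>t. \<bar>bessel_K \<mu> (a * t)\<bar>)"
  have g: "g t = bessel_K \<mu> (a * t)" if "t > 0" for t
    using bessel_K_eq_mixture(2)[OF \<mu>, of "a * t"] that a by (simp add: g_def)
  have [measurable]: "\<phi> \<in> borel_measurable borel" "Y \<in> borel_measurable borel" "g \<in> borel_measurable borel"
    unfolding \<phi>_def Y_def g_def by measurable
  have 1: "\<phi> x \<ge> 0" for x by (simp add: \<phi>_def)
  have 2: "AE x in pos_lborel. Y x > 0" using a by (intro AE_pos_lborelI) (simp add: Y_def add_pos_pos)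
  have 3: "\<forall>t>0. (\<integral>\<^sup>+x. ennreal (\<phi> x * exp (- t * Y x)) \<partial>pos_lborel) = ennreal (g t)"
  proof (intro allI impI)
    fix t :: real assume t: "t > 0"
    then have x: "a * t > 0" using a by simp
    show "(\<integral>\<^sup>+x. ennreal (\<phi> x * exp (- t * Y x)) \<partial>pos_lborel) = ennreal (g t)"
      using bessel_K_eq_mixture(1)[OF \<mu> x] g[OF t] by (simp add: \<phi>_def Y_def mult_ac)
  qed
  have 4: "g t \<ge> 0" for t by (simp add: g_def)
  have p\<mu>: "p > \<mu>" using p by simp
  have 5: "integrable pos_lborel (\<lambda>t. t powr (p - 1) * g t)"
    by (rule integrable_cong_AE_imp[OF bessel_K_mellin(1)[OF \<mu> a p\<mu>]]) (measurable, rule AE_pos_lborelI, simp add: g)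
  have 6: "integrable pos_lborel (\<lambda>t. t powr (p - r - 1) * g t)"
    by (rule integrable_cong_AE_imp[OF bessel_K_mellin(1)[OF \<mu> a r(3)]]) (measurable, rule AE_pos_lborelI, simp add: g)
  have p1: "p > 1" using p \<mu> by simp
  note P = poisson_mixture[OF pos_lborel.sigma_finite_measure_axioms _ _ _ 1 2 3 4 lipschitz_formula_nonint[OF p1 p(2)] r(1,2) 5 6]
  have c: "(\<integral>t. cos (2 * pi * real (Suc l) * t) * (t powr (p - 1) * g t) \<partial>pos_lborel) = (\<integral>t. cos (2 * pi * real (Suc l) * t) * (t powr (p - 1) * bessel_K \<mu> (a * t)) \<partial>pos_lborel)" for l
    by (rule integral_pos_lborel_cong) (measurable, simp only: g)
  have c0: "(\<integral>t. t powr (p - 1) * g t \<partial>pos_lborel) = mellin_K a \<mu> p"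
    unfolding bessel_K_mellin(2)[OF \<mu> a p\<mu>, symmetric]
    by (rule integral_pos_lborel_cong) (measurable, simp only: g)
  have gn: "g (real (Suc n)) = bessel_K \<mu> (a * real (Suc n))" for n by (rule g) simp
  show "summable (\<lambda>l. 2 * (\<integral>t. cos (2 * pi * real (Suc l) * t) * (t powr (p - 1) * bessel_K \<mu> (a * t)) \<partial>pos_lborel))"
    using P(1) unfolding c by simp
  show "(\<lambda>n. real (Suc n) powr (p - 1) * bessel_K \<mu> (a * real (Suc n))) sums
      (mellin_K a \<mu> p + (\<Sum>l. 2 * (\<integral>t. cos (2 * pi * real (Suc l) * t) * (t powr (p - 1) * bessel_K \<mu> (a * t)) \<partial>pos_lborel)))"
    using P(2) unfolding c c0 gn by simp
qed

section \<open>Double series\<close>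

lemma abs_summable_of_rows:
  fixes f :: "nat \<Rightarrow> nat \<Rightarrow> 'a::banach"
  assumes row: "\<And>k. summable (\<lambda>l. norm (f k l))" and sm: "summable (\<lambda>k. \<Sum>l. norm (f k l))"
  shows "(\<lambda>x. norm (case x of (k, l) \<Rightarrow> f k l)) summable_on (UNIV \<times> UNIV)"
proof -
  have r: "((\<lambda>l. norm (f k l)) has_sum (\<Sum>l. norm (f k l))) UNIV" for k
    using row[of k] by (intro norm_summable_imp_has_sum) (auto simp: summable_sums)
  then have e: "(\<Sum>\<^sub>\<infinity>l. norm (f k l)) = (\<Sum>l. norm (f k l))" for k by (rule infsumI)
  have n: "(\<Sum>l. norm (f k l)) \<ge> 0" for k by (intro suminf_nonneg row) auto
  have "(\<lambda>k. norm (\<Sum>l. norm (f k l))) summable_on UNIV"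
    by (rule norm_summable_imp_summable_on) (use sm n in simp)
  moreover have "(\<lambda>l. norm (f k l)) summable_on UNIV" for k using r by (auto simp: summable_on_def)
  ultimately show ?thesis
    by (intro Infinite_Sum.abs_summable_on_Sigma_iff[THEN iffD2] conjI ballI) (simp_all add: e)
qed

lemma bij_betw_diagonals: "bij_betw (\<lambda>(m, j). (j, m - j)) (SIGMA m:UNIV. {..m}) (UNIV \<times> (UNIV :: nat set))"
  by (rule bij_betwI[where g = "\<lambda>(j, k). (j + k, j)"]) auto

lemma abs_summable_of_diagonals:
  fixes f :: "nat \<Rightarrow> nat \<Rightarrow> 'a::banach"
  assumes sm: "summable (\<lambda>m. \<Sum>j\<le>m. norm (f j (m - j)))"
  shows "(\<lambda>x. norm (case x of (k, l) \<Rightarrow> f k l)) summable_on (UNIV \<times> UNIV)"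
proof -
  have "(\<lambda>x. norm (case x of (m, j) \<Rightarrow> f j (m - j))) summable_on (SIGMA m:UNIV. {..m})"
  proof (intro Infinite_Sum.abs_summable_on_Sigma_iff[THEN iffD2] conjI ballI)
    have n: "(\<Sum>j\<le>m. norm (f j (m - j))) \<ge> 0" for m by (intro sum_nonneg) auto
    have "(\<lambda>m. norm (\<Sum>j\<le>m. norm (f j (m - j)))) summable_on UNIV"
      by (rule norm_summable_imp_summable_on) (use sm n in simp)
    then show "(\<lambda>x. norm (\<Sum>\<^sub>\<infinity>y\<in>{..x}. norm (case (x, y) of (m, j) \<Rightarrow> f j (m - j)))) summable_on UNIV" by simp
  qed auto
  then have "(\<lambda>x. norm (case (case x of (m, j) \<Rightarrow> (j, m - j)) of (k, l) \<Rightarrow> f k l)) summable_on (SIGMA m:UNIV. {..m})"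
    by (simp add: case_prod_unfold)
  then show ?thesis
    by (subst (asm) summable_on_reindex_bij_betw[OF bij_betw_diagonals, where f = "\<lambda>x. norm (case x of (k, l) \<Rightarrow> f k l)"])
qed

text \<open>Absolute summability over the pairs of indices makes the sums by rows, by columns and by diagonals
equal.\<close>

lemma double_series:
  fixes f :: "nat \<Rightarrow> nat \<Rightarrow> 'a::banach"
  assumes abs: "(\<lambda>x. norm (case x of (k, l) \<Rightarrow> f k l)) summable_on (UNIV \<times> UNIV)"
  shows "\<And>k. summable (\<lambda>l. norm (f k l))" "\<And>l. summable (\<lambda>k. norm (f k l))"
    and "(\<lambda>l. \<Sum>k. f k l) sums (\<Sum>k. \<Sum>l. f k l)"
    and "(\<lambda>k. \<Sum>l. f k l) sums (\<Sum>k. \<Sum>l. f k l)"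
    and "(\<lambda>m. \<Sum>j\<le>m. f j (m - j)) sums (\<Sum>k. \<Sum>l. f k l)"
proof -
  let ?F = "\<lambda>(k, l). f k l"
  have row: "(\<lambda>l. norm (f k l)) summable_on UNIV" for k
    using Infinite_Sum.abs_summable_on_Sigma_iff[THEN iffD1, OF abs] by auto
  show r: "summable (\<lambda>l. norm (f k l))" for k by (rule summable_on_imp_summable[OF row])
  have bs: "bij_betw prod.swap (UNIV \<times> UNIV) (UNIV \<times> (UNIV :: nat set))" by (rule bij_betwI[where g = prod.swap]) auto
  have abs': "(\<lambda>x. norm (case x of (l, k) \<Rightarrow> f k l)) summable_on (UNIV \<times> UNIV)"
  proof -
    have "(\<lambda>x. norm (?F (prod.swap x))) summable_on (UNIV \<times> UNIV)"
      using abs by (subst summable_on_reindex_bij_betw[OF bs, where f = "\<lambda>x. norm (?F x)"])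
    then show ?thesis by (simp add: case_prod_unfold)
  qed
  have "(\<lambda>k. norm (f k l)) summable_on UNIV" for l
    using Infinite_Sum.abs_summable_on_Sigma_iff[THEN iffD1, OF abs'] by auto
  then show c: "summable (\<lambda>k. norm (f k l))" for l by (rule summable_on_imp_summable)
  obtain S where S: "(?F has_sum S) (UNIV \<times> UNIV)"
    using abs_summable_summable[OF abs] by (auto simp: summable_on_def)
  have hr: "((\<lambda>l. f k l) has_sum (\<Sum>l. f k l)) UNIV" for k
    by (rule norm_summable_imp_has_sum[OF r]) (rule summable_sums[OF summable_norm_cancel[OF r]])
  have hc: "((\<lambda>k. f k l) has_sum (\<Sum>k. f k l)) UNIV" for l
    by (rule norm_summable_imp_has_sum[OF c]) (rule summable_sums[OF summable_norm_cancel[OF c]])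
  have "((\<lambda>k. \<Sum>l. f k l) has_sum S) UNIV"
    by (rule has_sum_SigmaD[OF S]) (use hr in auto)
  then have 1: "(\<lambda>k. \<Sum>l. f k l) sums S" by (rule has_sum_imp_sums)
  then have Seq: "S = (\<Sum>k. \<Sum>l. f k l)" by (rule sums_unique)
  show "(\<lambda>k. \<Sum>l. f k l) sums (\<Sum>k. \<Sum>l. f k l)" using 1 Seq by simp
  have "((\<lambda>x. ?F (prod.swap x)) has_sum S) (UNIV \<times> UNIV)"
    using S by (subst has_sum_reindex_bij_betw[OF bs])
  then have "((\<lambda>l. \<Sum>k. f k l) has_sum S) UNIV"
    by (rule has_sum_SigmaD) (use hc in auto)
  then show "(\<lambda>l. \<Sum>k. f k l) sums (\<Sum>k. \<Sum>l. f k l)" using Seq has_sum_imp_sums by blast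
  have "((\<lambda>x. ?F (case x of (m, j) \<Rightarrow> (j, m - j))) has_sum S) (SIGMA m:UNIV. {..m})"
    using S by (subst has_sum_reindex_bij_betw[OF bij_betw_diagonals])
  then have "((\<lambda>m. \<Sum>j\<le>m. f j (m - j)) has_sum S) UNIV"
    by (rule has_sum_SigmaD) auto
  then show "(\<lambda>m. \<Sum>j\<le>m. f j (m - j)) sums (\<Sum>k. \<Sum>l. f k l)" using Seq has_sum_imp_sums by blast
qed

section \<open>The Laplace transform of the Bessel function\<close>

lemma K_coeff_Suc:
  assumes \<mu>: "\<mu> \<notin> \<int>" and a: "a > 0"
  shows "K_coeff a \<mu> (Suc k) * ((real k + 1 - \<mu>) * (real k + 1)) = K_coeff a \<mu> k * (a / 2)\<^sup>2"
proof -
  have "(a / 2) powr (2 * real (Suc k) - \<mu>) = (a / 2) powr (2 * real k - \<mu> + 2)" by (simp add: algebra_simps)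
  also have "\<dots> = (a / 2) powr (2 * real k - \<mu>) * (a / 2)\<^sup>2" unfolding powr_add using a by simp
  finally show ?thesis unfolding K_coeff_def bessel_coeff_Suc[OF \<mu>, of k, symmetric] by simp
qed

text \<open>The quotient of successive terms tends to \<open>(a / w)\<^sup>2 < 1\<close>.\<close>

lemma summable_K_coeff_Gamma:
  assumes \<mu>: "\<mu> \<notin> \<int>" and a: "0 < a" "a < w"
  shows "summable (\<lambda>k. \<bar>K_coeff a \<mu> k\<bar> * \<bar>Gamma (q + 2 * real k)\<bar> * w powr - (q + 2 * real k))"
proof -
  define u where "u = (\<lambda>k. \<bar>K_coeff a \<mu> k\<bar> * \<bar>Gamma (q + 2 * real k)\<bar> * w powr - (q + 2 * real k))"
  define c where "c = (1 + a\<^sup>2 / w\<^sup>2) / 2"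
  have w: "w > 0" using a by simp
  have aw: "a\<^sup>2 < w\<^sup>2" using a by (intro power_strict_mono) auto
  have "a\<^sup>2 / w\<^sup>2 < 1" "a\<^sup>2 / w\<^sup>2 \<ge> 0" using aw w by auto
  then have c: "c < 1" "c > 0" by (auto simp: c_def add_pos_nonneg)
  have "c * w\<^sup>2 = (w\<^sup>2 + a\<^sup>2) / 2" using w by (simp add: c_def distrib_right)
  then have c3: "a\<^sup>2 < c * w\<^sup>2" using aw by simp
  have "(\<lambda>k. ((a / 2)\<^sup>2 * ((q + 2 * real k) * (q + 2 * real k + 1))) / ((real k + 1 - \<mu>) * (real k + 1))) \<longlonglongrightarrow> (a / 2)\<^sup>2 * 4"
    using a(1) by real_asymp
  moreover have "(a / 2)\<^sup>2 * 4 = a\<^sup>2" by (simp add: power_divide)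
  ultimately have lim: "(\<lambda>k. ((a / 2)\<^sup>2 * ((q + 2 * real k) * (q + 2 * real k + 1))) / ((real k + 1 - \<mu>) * (real k + 1))) \<longlonglongrightarrow> a\<^sup>2"
    by (simp only:)
  have "\<forall>\<^sub>F k in sequentially. ((a / 2)\<^sup>2 * ((q + 2 * real k) * (q + 2 * real k + 1))) / ((real k + 1 - \<mu>) * (real k + 1)) < c * w\<^sup>2"
    by (rule order_tendstoD(2)[OF lim c3])
  moreover have "\<forall>\<^sub>F k in sequentially. real k + 1 - \<mu> > 0" by real_asymp
  moreover have "\<forall>\<^sub>F k in sequentially. q + 2 * real k > 0" by real_asymp
  ultimately have "\<forall>\<^sub>F k in sequentially. norm (u (Suc k)) \<le> c * norm (u k)"
  proof eventually_elim
    case (elim k)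
    define X where "X = (real k + 1 - \<mu>) * (real k + 1)"
    define Q where "Q = (q + 2 * real k) * (q + 2 * real k + 1)"
    have X: "X > 0" and Q: "Q > 0" using elim by (auto simp: X_def Q_def)
    have le: "(a / 2)\<^sup>2 * Q \<le> c * w\<^sup>2 * X" using elim(1) X unfolding X_def[symmetric] Q_def[symmetric]
      by (simp add: pos_divide_less_eq)
    have K: "\<bar>K_coeff a \<mu> (Suc k)\<bar> * X = \<bar>K_coeff a \<mu> k\<bar> * (a / 2)\<^sup>2"
    proof -
      have "\<bar>K_coeff a \<mu> (Suc k) * X\<bar> = \<bar>K_coeff a \<mu> k * (a / 2)\<^sup>2\<bar>" unfolding X_def K_coeff_Suc[OF \<mu> a(1)] ..
      then show ?thesis using X unfolding abs_mult by simp
    qed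
    have G: "Gamma (q + 2 * real (Suc k)) = Q * Gamma (q + 2 * real k)"
    proof -
      have "Gamma (q + 2 * real k + 1 + 1) = (q + 2 * real k + 1) * Gamma (q + 2 * real k + 1)"
        using elim by (intro Gamma_plus1) (auto elim!: nonpos_Ints_cases')
      moreover have "Gamma (q + 2 * real k + 1) = (q + 2 * real k) * Gamma (q + 2 * real k)"
        using elim by (intro Gamma_plus1) (auto elim!: nonpos_Ints_cases')
      moreover have "q + 2 * real (Suc k) = q + 2 * real k + 1 + 1" by simp
      ultimately show ?thesis by (simp only: Q_def mult_ac)
    qed
    have W: "w powr - (q + 2 * real (Suc k)) * w\<^sup>2 = w powr - (q + 2 * real k)"
    proof -
      have "w powr - (q + 2 * real (Suc k)) * w powr 2 = w powr - (q + 2 * real k)" by (simp add: powr_add[symmetric] algebra_simps)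
      then show ?thesis using w by simp
    qed
    have "u (Suc k) * (X * w\<^sup>2) = (\<bar>K_coeff a \<mu> (Suc k)\<bar> * X) * \<bar>Gamma (q + 2 * real (Suc k))\<bar> * (w powr - (q + 2 * real (Suc k)) * w\<^sup>2)"
      by (simp only: u_def mult_ac)
    also have "\<dots> = u k * ((a / 2)\<^sup>2 * Q)" unfolding K G W using Q by (simp add: u_def abs_mult)
    also have "\<dots> \<le> u k * (c * w\<^sup>2 * X)" using le by (intro mult_left_mono) (auto simp: u_def)
    finally have "u (Suc k) * (X * w\<^sup>2) \<le> (c * u k) * (X * w\<^sup>2)" by (simp add: mult_ac)
    then have "u (Suc k) \<le> c * u k" using X w by (simp add: mult_le_cancel_right_pos)
    then show ?case by (simp add: u_def)
  qed
  then obtain N where "\<And>k. k \<ge> N \<Longrightarrow> norm (u (Suc k)) \<le> c * norm (u k)" by (auto simp: eventually_sequentially)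
  then have "summable u" using c by (intro summable_ratio_test[of c N]) auto
  then show ?thesis by (simp add: u_def)
qed

definition K_half :: "real \<Rightarrow> real \<Rightarrow> real \<Rightarrow> real" where
  "K_half a \<mu> t = (\<Sum>k. K_coeff a \<mu> k * t powr (2 * real k - \<mu>))"

lemma K_coeff_powr:
  assumes a: "a > 0" and t: "t > 0"
  shows "K_coeff a \<mu> k * t powr (2 * real k - \<mu>) = (a * t / 2) powr - \<mu> / 2 * (bessel_coeff \<mu> k * ((a * t / 2)\<^sup>2) ^ k)"
proof -
  have "(a / 2) powr (2 * real k - \<mu>) * t powr (2 * real k - \<mu>) = (a * t / 2) powr (- \<mu> + 2 * real k)"
    using a t by (simp add: powr_mult[symmetric] mult.commute)
  also have "\<dots> = (a * t / 2) powr - \<mu> * (a * t / 2) powr (2 * real k)" by (rule powr_add)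
  also have "(a * t / 2) powr (2 * real k) = ((a * t / 2)\<^sup>2) ^ k"
    using a t powr_realpow[of "a * t / 2" "2 * k"] by (simp add: power_mult del: power_divide)
  finally have e: "(a / 2) powr (2 * real k - \<mu>) * t powr (2 * real k - \<mu>) = (a * t / 2) powr - \<mu> * ((a * t / 2)\<^sup>2) ^ k" .
  have "K_coeff a \<mu> k * t powr (2 * real k - \<mu>) = bessel_coeff \<mu> k * ((a / 2) powr (2 * real k - \<mu>) * t powr (2 * real k - \<mu>)) / 2"
    by (simp add: K_coeff_def)
  then show ?thesis unfolding e by simp
qed

lemma K_half_summable:
  assumes \<mu>: "\<mu> \<notin> \<int>" and a: "a > 0" and t: "t > 0"
  shows "summable (\<lambda>k. norm (K_coeff a \<mu> k * t powr (2 * real k - \<mu>)))"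
    and "K_half a \<mu> t = (a * t / 2) powr - \<mu> / 2 * bessel_entire \<mu> ((a * t / 2)\<^sup>2)"
proof -
  have "summable (\<lambda>k. norm (bessel_coeff \<mu> k * ((a * t / 2)\<^sup>2) ^ k))"
    by (rule powser_insidea[OF summable_bessel_coeff[OF \<mu>, of "(a * t / 2)\<^sup>2 + 1"]]) simp
  from summable_mult[OF this, of "norm ((a * t / 2) powr - \<mu> / 2)"]
  show "summable (\<lambda>k. norm (K_coeff a \<mu> k * t powr (2 * real k - \<mu>)))"
    unfolding K_coeff_powr[OF a t] norm_mult .
  show "K_half a \<mu> t = (a * t / 2) powr - \<mu> / 2 * bessel_entire \<mu> ((a * t / 2)\<^sup>2)"
    unfolding K_half_def K_coeff_powr[OF a t] bessel_entire_def by (rule suminf_mult[OF summable_bessel_coeff[OF \<mu>]])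
qed

lemma bessel_K_halves:
  assumes \<mu>: "\<mu> \<notin> \<int>" and a: "a > 0" and t: "t > 0"
  shows "bessel_K \<mu> (a * t) = K_half a \<mu> t + K_half a (- \<mu>) t"
  unfolding K_half_summable(2)[OF \<mu> a t] K_half_summable(2)[OF nonint_uminus[OF \<mu>] a t]
  using bessel_K_nonint[OF \<mu>, of "a * t"] a t by (simp add: add_divide_distrib)

text \<open>Termwise integration; \<open>a < x\<close> is the condition for absolute convergence.\<close>

lemma laplace_K_half:
  assumes \<mu>: "\<mu> \<notin> \<int>" and a: "0 < a" "a < x" and p: "p > \<mu>"
  shows "integrable pos_lborel (\<lambda>t. t powr (p - 1) * exp (- x * t) * K_half a \<mu> t)"
    and "(\<integral>t. t powr (p - 1) * exp (- x * t) * K_half a \<mu> t \<partial>pos_lborel)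
       = (\<Sum>k. K_coeff a \<mu> k * Gamma (p + 2 * real k - \<mu>) * x powr - (p + 2 * real k - \<mu>))"
proof -
  have x: "x > 0" using a by simp
  define q where "q = p - \<mu>"
  have q: "q + 2 * real k > 0" "q > 0" for k using p by (auto simp: q_def add_pos_nonneg)
  define f where "f = (\<lambda>k t. K_coeff a \<mu> k * (t powr (q + 2 * real k - 1) * exp (- x * t)))"
  have fi: "integrable pos_lborel (f k)" for k
    unfolding f_def by (intro integrable_mult_right Gamma_integrable_scaled q x)
  have fI: "(\<integral>t. f k t \<partial>pos_lborel) = K_coeff a \<mu> k * Gamma (q + 2 * real k) * x powr - (q + 2 * real k)" for k
    unfolding f_def using Gamma_integrable_scaled(2)[OF q(1) x] by simp
  have fn: "(\<integral>t. norm (f k t) \<partial>pos_lborel) = \<bar>K_coeff a \<mu> k\<bar> * \<bar>Gamma (q + 2 * real k)\<bar> * x powr - (q + 2 * real k)" for k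
  proof -
    have "(\<integral>t. norm (f k t) \<partial>pos_lborel) = (\<integral>t. \<bar>K_coeff a \<mu> k\<bar> * (t powr (q + 2 * real k - 1) * exp (- x * t)) \<partial>pos_lborel)"
      by (simp add: f_def abs_mult)
    then show ?thesis using Gamma_integrable_scaled(2)[OF q(1)[of k] x] q(1)[of k] by simp
  qed
  have ft: "f k t = t powr (p - 1) * exp (- x * t) * (K_coeff a \<mu> k * t powr (2 * real k - \<mu>))" for k t
  proof -
    have "t powr (p - 1) * t powr (2 * real k - \<mu>) = t powr (q + 2 * real k - 1)"
      unfolding powr_add[symmetric] by (simp add: q_def algebra_simps)
    then show ?thesis by (simp add: f_def mult_ac)
  qed
  have AEs: "AE t in pos_lborel. summable (\<lambda>k. norm (f k t))"
  proof (rule AE_pos_lborelI)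
    fix t :: real assume t: "t > 0"
    show "summable (\<lambda>k. norm (f k t))"
      unfolding ft norm_mult[of "t powr (p - 1) * exp (- x * t)"] by (intro summable_mult K_half_summable(1)[OF \<mu> a(1) t])
  qed
  have sm: "summable (\<lambda>k. \<integral>t. norm (f k t) \<partial>pos_lborel)"
    unfolding fn by (rule summable_K_coeff_Gamma[OF \<mu> a])
  have e: "(\<Sum>k. f k t) = t powr (p - 1) * exp (- x * t) * K_half a \<mu> t" if t: "t > 0" for t
    unfolding ft K_half_def by (rule suminf_mult[OF summable_norm_cancel[OF K_half_summable(1)[OF \<mu> a(1) t]]])
  have [measurable]: "K_half a \<mu> \<in> borel_measurable borel" unfolding K_half_def by measurable
  have [measurable]: "(\<lambda>t. \<Sum>k. f k t) \<in> borel_measurable borel" unfolding f_def by measurable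
  show "integrable pos_lborel (\<lambda>t. t powr (p - 1) * exp (- x * t) * K_half a \<mu> t)"
    by (rule integrable_cong_AE_imp[OF integrable_suminf[OF fi AEs sm]]) (measurable, rule AE_pos_lborelI, erule e)
  have "(\<integral>t. t powr (p - 1) * exp (- x * t) * K_half a \<mu> t \<partial>pos_lborel) = (\<integral>t. (\<Sum>k. f k t) \<partial>pos_lborel)"
    by (rule integral_pos_lborel_cong) (measurable, erule e[symmetric])
  also have "\<dots> = (\<Sum>k. \<integral>t. f k t \<partial>pos_lborel)" by (rule integral_suminf[OF fi AEs sm])
  finally show "(\<integral>t. t powr (p - 1) * exp (- x * t) * K_half a \<mu> t \<partial>pos_lborel)
       = (\<Sum>k. K_coeff a \<mu> k * Gamma (p + 2 * real k - \<mu>) * x powr - (p + 2 * real k - \<mu>))"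
    unfolding fI by (simp add: q_def algebra_simps)
qed

text \<open>The Laplace transform of \<open>t powr (p - 1) * K_half a \<mu> t\<close>, as a series that converges for
\<open>norm z > a\<close> and thus also on the imaginary axis beyond \<open>a\<close>.\<close>

definition laplace_series :: "real \<Rightarrow> real \<Rightarrow> real \<Rightarrow> complex \<Rightarrow> complex" where
  "laplace_series a \<mu> p z = (\<Sum>k. of_real (K_coeff a \<mu> k * Gamma (p + 2 * real k - \<mu>)) * z powr (- of_real (p + 2 * real k - \<mu>)))"

lemma laplace_series_holomorphic:
  assumes \<mu>: "\<mu> \<notin> \<int>" and a: "0 < a" and p: "p > \<mu>"
    and S: "open S" "\<And>z. z \<in> S \<Longrightarrow> norm z > a" "\<And>z. z \<in> S \<Longrightarrow> z \<notin> \<real>\<^sub>\<le>\<^sub>0"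
  shows "laplace_series a \<mu> p holomorphic_on S"
  unfolding laplace_series_def[abs_def]
proof (rule holomorphic_suminf[OF S(1)])
  show "(\<lambda>z. of_real (K_coeff a \<mu> k * Gamma (p + 2 * real k - \<mu>)) * z powr (- of_real (p + 2 * real k - \<mu>))) holomorphic_on S" for k
    by (intro holomorphic_intros) (use S in auto)
  fix z assume z: "z \<in> S"
  define d where "d = (norm z - a) / 2"
  define \<rho> where "\<rho> = norm z - d"
  have d: "d > 0" "a < \<rho>" using S(2)[OF z] by (auto simp: d_def \<rho>_def field_simps)
  define q where "q = p - \<mu>"
  have "norm (of_real (K_coeff a \<mu> k * Gamma (p + 2 * real k - \<mu>)) * w powr (- of_real (p + 2 * real k - \<mu>)))
      \<le> \<bar>K_coeff a \<mu> k\<bar> * \<bar>Gamma (q + 2 * real k)\<bar> * \<rho> powr - (q + 2 * real k)" if w: "w \<in> cball z d" "w \<in> S" for k w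
  proof -
    have "norm w \<ge> \<rho>" using w(1) norm_triangle_ineq2[of z w] by (simp add: \<rho>_def dist_norm)
    then have "norm w powr - (q + 2 * real k) \<le> \<rho> powr - (q + 2 * real k)"
      using d a p by (intro powr_mono2') (auto simp: q_def)
    moreover have "w \<noteq> 0" using S(2)[OF w(2)] a by auto
    then have n: "norm (w powr (- of_real (q + 2 * real k))) = norm w powr - (q + 2 * real k)"
      using norm_powr_of_real_exponent[of w "- (q + 2 * real k)"] unfolding of_real_minus by blast
    have e: "p + 2 * real k - \<mu> = q + 2 * real k" by (simp add: q_def)
    from \<open>norm w powr - (q + 2 * real k) \<le> \<rho> powr - (q + 2 * real k)\<close> show ?thesis
      unfolding e norm_mult norm_of_real abs_mult n by (intro mult_left_mono) auto
  qed
  moreover have "summable (\<lambda>k. \<bar>K_coeff a \<mu> k\<bar> * \<bar>Gamma (q + 2 * real k)\<bar> * \<rho> powr - (q + 2 * real k))"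
    by (rule summable_K_coeff_Gamma[OF \<mu> a d(2)])
  ultimately show "\<exists>d M N. d > 0 \<and> summable M \<and> (\<forall>n\<ge>N. \<forall>w\<in>cball z d. w \<in> S \<longrightarrow>
      norm (of_real (K_coeff a \<mu> n * Gamma (p + 2 * real n - \<mu>)) * w powr (- of_real (p + 2 * real n - \<mu>))) \<le> M n)"
    using d(1) by blast
qed

lemma laplace_series_of_real:
  assumes x: "x > 0" and \<mu>: "\<mu> \<notin> \<int>" and a: "0 < a" "a < x"
  shows "laplace_series a \<mu> p (of_real x) = of_real (\<Sum>k. K_coeff a \<mu> k * Gamma (p + 2 * real k - \<mu>) * x powr - (p + 2 * real k - \<mu>))"
proof -
  have "summable (\<lambda>k. norm (K_coeff a \<mu> k * Gamma (p + 2 * real k - \<mu>) * x powr - (p + 2 * real k - \<mu>)))"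
    using summable_K_coeff_Gamma[OF \<mu> a, of "p - \<mu>"] by (simp add: abs_mult algebra_simps)
  note s = summable_norm_cancel[OF this]
  have "of_real (K_coeff a \<mu> k * Gamma (p + 2 * real k - \<mu>)) * of_real x powr (- of_real (p + 2 * real k - \<mu>))
     = complex_of_real (K_coeff a \<mu> k * Gamma (p + 2 * real k - \<mu>) * x powr - (p + 2 * real k - \<mu>))" for k
    using powr_of_real[of x "- (p + 2 * real k - \<mu>)"] x by simp
  then show ?thesis unfolding laplace_series_def by (simp only: suminf_of_real[OF s])
qed

lemma Re_laplace_series_imaginary:
  assumes w: "w > a" and \<mu>: "\<mu> \<notin> \<int>" and a: "0 < a"
  shows "Re (laplace_series a \<mu> p (\<i> * of_real w)) = (\<Sum>k. K_coeff a \<mu> k * Gamma (p + 2 * real k - \<mu>) * w powr - (p + 2 * real k - \<mu>) * cos (pi * (p + 2 * real k - \<mu>) / 2))"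
proof -
  have w0: "w > 0" using w a by simp
  have L: "Ln (of_real w * \<i>) = of_real (ln w) + \<i> * of_real pi / 2"
  proof (rule Ln_unique)
    have "exp (\<i> * complex_of_real (pi / 2)) = \<i>" by (simp only: cis_conv_exp[symmetric] cis_pi_half)
    then show "exp (of_real (ln w) + \<i> * of_real pi / 2) = of_real w * \<i>"
      using w0 by (simp add: exp_add exp_of_real)
  qed (use pi_gt_zero in \<open>auto simp: field_simps\<close>)
  have P: "(\<i> * of_real w) powr (- of_real q) = exp (- of_real q * (of_real (ln w) + \<i> * of_real pi / 2))" for q
    using w0 by (simp add: powr_def L mult.commute[of \<i>])
  have R: "Re (of_real c * (\<i> * of_real w) powr (- of_real q)) = c * w powr - q * cos (pi * q / 2)" for c q
    unfolding P using w0 by (simp add: Re_exp powr_def mult_ac)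
  have n: "norm (of_real c * (\<i> * of_real w) powr (- of_real q)) = \<bar>c\<bar> * w powr - q" for c q
    using norm_powr_of_real_exponent[of "\<i> * of_real w" "- q"] w0 by (simp add: norm_mult)
  have "summable (\<lambda>k. norm (of_real (K_coeff a \<mu> k * Gamma (p + 2 * real k - \<mu>)) * (\<i> * of_real w) powr (- of_real (p + 2 * real k - \<mu>))))"
    unfolding n using summable_K_coeff_Gamma[OF \<mu> a w, of "p - \<mu>"] by (simp add: abs_mult algebra_simps)
  from sums_Re[OF summable_sums[OF summable_norm_cancel[OF this]]] show ?thesis
    unfolding laplace_series_def R by (rule sums_unique)
qed

text \<open>The Laplace transform of \<open>t powr (p - 1) * K\<^sub>\<mu>(a t)\<close> is holomorphic to the left of the imaginary
axis as well, because \<open>K\<^sub>\<mu>\<close> decays exponentially, while the two halves of \<open>K\<^sub>\<mu>\<close> grow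
and have Laplace transforms for \<open>Re z > a\<close> only.  A half-plane at distance \<open>a\<close> from the origin avoids the
disc where the series diverge; one that contains \<open>i w\<close> and all large real numbers carries
the identity from the real axis to \<open>i w\<close>.\<close>

lemma cosine_transform_bessel_K:
  assumes \<mu>: "\<mu> \<notin> \<int>" "\<mu> > 0" and a: "0 < a" "a < w" and p: "p > \<mu>"
  shows "(\<integral>t. cos (w * t) * (t powr (p - 1) * bessel_K \<mu> (a * t)) \<partial>pos_lborel)
     = (\<Sum>k. K_coeff a \<mu> k * Gamma (p + 2 * real k - \<mu>) * w powr - (p + 2 * real k - \<mu>) * cos (pi * (p + 2 * real k - \<mu>) / 2))
     + (\<Sum>k. K_coeff a (- \<mu>) k * Gamma (p + 2 * real k - - \<mu>) * w powr - (p + 2 * real k - - \<mu>) * cos (pi * (p + 2 * real k - - \<mu>) / 2))"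
proof -
  have ni: "- \<mu> \<notin> \<int>" by (rule nonint_uminus[OF \<mu>(1)])
  have pm: "p > - \<mu>" using p \<mu> by simp
  have w: "w > 0" using a by simp
  have [measurable]: "bessel_K \<mu> \<in> borel_measurable borel" by (rule bessel_K_measurable[OF \<mu>(1)])
  define f where "f = (\<lambda>t. t powr (p - 1) * bessel_K \<mu> (a * t))"
  have [measurable]: "f \<in> borel_measurable borel" unfolding f_def by measurable
  define F where "F = (\<lambda>z. \<integral>t. exp (z * complex_of_real (- t)) * of_real (f t) \<partial>pos_lborel)"
  have int: "integrable pos_lborel (\<lambda>t. exp (\<sigma> * (- t)) * f t)" if \<sigma>: "\<sigma> \<ge> - a / 2" for \<sigma>
  proof (rule Bochner_Integration.integrable_bound[OF bessel_K_mellin(1)[OF \<mu>, of "a / 2" p]])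
    show "AE t in pos_lborel. norm (exp (\<sigma> * (- t)) * f t) \<le> norm (t powr (p - 1) * bessel_K \<mu> (a / 2 * t))"
    proof (rule AE_pos_lborelI)
      fix t :: real assume t: "t > 0"
      have at: "a * t > 0" "a * t / 2 > 0" using a t by auto
      have "exp (\<sigma> * (- t)) * bessel_K \<mu> (a * t) \<le> exp (\<sigma> * (- t)) * (exp (- (a * t) / 2) * bessel_K \<mu> (a * t / 2))"
        by (intro mult_left_mono bessel_K_decay[OF \<mu> at(1)]) auto
      also have "\<dots> = exp (- (\<sigma> + a / 2) * t) * bessel_K \<mu> (a * t / 2)"
      proof -
        have "exp (\<sigma> * (- t)) * exp (- (a * t) / 2) = exp (- (\<sigma> + a / 2) * t)" by (simp add: mult_exp_exp algebra_simps)
        then show ?thesis by (simp only: mult.assoc[symmetric])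
      qed
      also have "\<dots> \<le> 1 * bessel_K \<mu> (a * t / 2)"
      proof (rule mult_right_mono[OF _ bessel_K_eq_mixture(2)[OF \<mu> at(2)]])
        have "- (\<sigma> + a / 2) * t \<le> 0" by (rule mult_nonpos_nonneg) (use \<sigma> t in auto)
        then show "exp (- (\<sigma> + a / 2) * t) \<le> 1" by (simp only: exp_le_one_iff)
      qed
      finally have "t powr (p - 1) * (exp (\<sigma> * (- t)) * bessel_K \<mu> (a * t)) \<le> t powr (p - 1) * bessel_K \<mu> (a / 2 * t)"
        by (intro mult_left_mono) auto
      then show "norm (exp (\<sigma> * (- t)) * f t) \<le> norm (t powr (p - 1) * bessel_K \<mu> (a / 2 * t))"
        using bessel_K_eq_mixture(2)[OF \<mu> at(1)] bessel_K_eq_mixture(2)[OF \<mu> at(2)] by (simp add: f_def mult_ac)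
    qed
  qed (use a p in auto)
  have Fhol: "F holomorphic_on {z. Re z \<in> {- a / 2<..}}"
    unfolding F_def by (rule exp_integral_holomorphic) (use int in auto)
  \<comment> \<open>The unit vector \<open>c + i s\<close> is normal to the half-plane; \<open>s > a / w\<close> puts \<open>i w\<close> into it, and \<open>c > 0\<close> the large real numbers.\<close>
  define s where "s = (a / w + 1) / 2"
  define c where "c = sqrt (1 - s\<^sup>2)"
  have s: "0 < s" "s < 1" "s * w > a" using a w by (auto simp: s_def field_simps)
  have s2: "s\<^sup>2 < 1" using s by (simp add: power_less_one_iff)
  have c: "c > 0" "c\<^sup>2 + s\<^sup>2 = 1" using s2 by (auto simp: c_def)
  define D where "D = {z. Re z > - a / 2} \<inter> {z. c * Re z + s * Im z > a}"
  have D_alt: "{z. c * Re z + s * Im z > a} = {z. inner (Complex c s) z > a}" by (simp add: inner_complex_def)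
  have opD: "open D" unfolding D_def D_alt by (intro open_Int open_halfspace_Re_gt open_halfspace_gt)
  have coD: "connected D" unfolding D_def D_alt
    by (intro convex_connected convex_Int convex_halfspace_Re_gt convex_halfspace_gt)
  have nD: "norm z > a" if "z \<in> D" for z
  proof -
    have "norm (Complex c s) = 1" using c by (simp add: cmod_def)
    then have "inner (Complex c s) z \<le> norm z" using norm_cauchy_schwarz[of "Complex c s" z] by simp
    then show ?thesis using that unfolding D_def D_alt by auto
  qed
  have rD: "z \<notin> \<real>\<^sub>\<le>\<^sub>0" if "z \<in> D" for z
  proof
    assume "z \<in> \<real>\<^sub>\<le>\<^sub>0"
    then have "Re z \<le> 0" "Im z = 0" by (auto simp: complex_nonpos_Reals_iff)
    then have "c * Re z + s * Im z \<le> 0" using c by (simp add: mult_nonneg_nonpos)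
    then show False using that a by (auto simp: D_def)
  qed
  have key: "F z = laplace_series a \<mu> p z + laplace_series a (- \<mu>) p z" if z: "z \<in> D" for z
  proof (rule holomorphic_eq_if_eq_on_reals[where f = F and g = "\<lambda>z. laplace_series a \<mu> p z + laplace_series a (- \<mu>) p z" and A = D and u = "a / c" and v = "a / c + 1"])
    show "F holomorphic_on D" by (rule holomorphic_on_subset[OF Fhol]) (auto simp: D_def)
    show "(\<lambda>z. laplace_series a \<mu> p z + laplace_series a (- \<mu>) p z) holomorphic_on D"
      by (intro holomorphic_on_add laplace_series_holomorphic \<mu> ni a p pm opD nD rD)
    show "of_real ` {a / c<..<a / c + 1} \<subseteq> D"
    proof
      fix z assume "z \<in> complex_of_real ` {a / c<..<a / c + 1}"
      then obtain x where x: "z = of_real x" "x > a / c" by auto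
      have "a / c > 0" using a c by simp
      then have "x > 0" using x by linarith
      then have "c * x > a" "x > - a / 2" using x c a by (auto simp: field_simps)
      then show "z \<in> D" using x by (simp add: D_def)
    qed
    fix x :: real assume x: "a / c < x" "x < a / c + 1"
    have "c \<le> 1" using c by (smt (verit) s2 power2_nonneg_ge_1_iff power_le_one_iff zero_le_power2 one_power2 power2_le_imp_le)
    then have "a \<le> a / c" using a c by (simp add: field_simps)
    then have ax: "a < x" using x by simp
    then have x0: "x > 0" using a by simp
    have "F (of_real x) = (\<integral>t. complex_of_real (exp (x * (- t)) * f t) \<partial>pos_lborel)"
      by (simp add: F_def exp_of_real[symmetric])
    also have "\<dots> = of_real (\<integral>t. exp (x * (- t)) * f t \<partial>pos_lborel)" by (rule integral_complex_of_real)
    also have "(\<integral>t. exp (x * (- t)) * f t \<partial>pos_lborel) = (\<integral>t. t powr (p - 1) * exp (- x * t) * K_half a \<mu> t + t powr (p - 1) * exp (- x * t) * K_half a (- \<mu>) t \<partial>pos_lborel)"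
    proof (rule integral_pos_lborel_cong)
      show "(\<lambda>t. t powr (p - 1) * exp (- x * t) * K_half a \<mu> t + t powr (p - 1) * exp (- x * t) * K_half a (- \<mu>) t) \<in> borel_measurable borel"
        unfolding K_half_def by measurable
      show "exp (x * (- t)) * f t = t powr (p - 1) * exp (- x * t) * K_half a \<mu> t + t powr (p - 1) * exp (- x * t) * K_half a (- \<mu>) t" if "t > 0" for t
        using bessel_K_halves[OF \<mu>(1) a(1) that] by (simp add: f_def algebra_simps)
    qed measurable
    also have "\<dots> = (\<integral>t. t powr (p - 1) * exp (- x * t) * K_half a \<mu> t \<partial>pos_lborel) + (\<integral>t. t powr (p - 1) * exp (- x * t) * K_half a (- \<mu>) t \<partial>pos_lborel)"
      by (rule Bochner_Integration.integral_add[OF laplace_K_half(1)[OF \<mu>(1) a(1) ax p] laplace_K_half(1)[OF ni a(1) ax pm]])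
    finally show "F (of_real x) = laplace_series a \<mu> p (of_real x) + laplace_series a (- \<mu>) p (of_real x)"
      unfolding laplace_series_of_real[OF x0 \<mu>(1) a(1) ax] laplace_series_of_real[OF x0 ni a(1) ax]
        laplace_K_half(2)[OF \<mu>(1) a(1) ax p] laplace_K_half(2)[OF ni a(1) ax pm] by simp
  qed (use opD coD z in auto)
  have iw: "\<i> * of_real w \<in> D" using s a by (auto simp: D_def)
  have "(\<integral>t. cos (w * t) * (t powr (p - 1) * bessel_K \<mu> (a * t)) \<partial>pos_lborel) = (\<integral>t. Re (exp (\<i> * of_real w * complex_of_real (- t)) * of_real (f t)) \<partial>pos_lborel)"
    by (simp add: f_def Re_exp)
  also have "\<dots> = Re (F (\<i> * of_real w))"
    unfolding F_def
  proof (rule integral_Re)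
    show "integrable pos_lborel (\<lambda>t. exp (\<i> * of_real w * complex_of_real (- t)) * complex_of_real (f t))"
    proof (rule Bochner_Integration.integrable_bound[OF int[of 0]])
      show "AE t in pos_lborel. norm (exp (\<i> * of_real w * complex_of_real (- t)) * complex_of_real (f t)) \<le> norm (exp (0 * (- t)) * f t)"
        by (auto simp: norm_mult)
    qed (use a in auto)
  qed
  finally show ?thesis
    unfolding key[OF iw] using Re_laplace_series_imaginary[OF a(2) \<mu>(1) a(1)] Re_laplace_series_imaginary[OF a(2) ni a(1)] by simp
qed

section \<open>The series of Bessel functions for real exponents\<close>

lemma zeta_reflection_real:
  assumes q: "q > 1"
  shows "zeta (of_real (1 - q)) = of_real (2 * (2 * pi) powr - q * cos (pi * q / 2) * Gamma q * (\<Sum>n. real (Suc n) powr - q))"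
proof -
  have ser: "zeta (of_real q) = of_real (\<Sum>n. real (Suc n) powr - q)"
  proof -
    have "1 / of_nat (Suc n) powr of_real q = complex_of_real (real (Suc n) powr - q)" for n
      using powr_of_real[of "real (Suc n)" q] by (simp add: powr_minus divide_inverse)
    moreover have "summable (\<lambda>n. real (Suc n) powr - q)" using q by (subst summable_Suc_iff) (simp add: summable_real_powr_iff)
    moreover have "zeta (of_real q) = zeta_series (of_real q)" using q by (intro zeta_eq_series) simp
    ultimately show ?thesis unfolding zeta_series_def by (simp add: suminf_of_real)
  qed
  have "complex_of_real (2 * pi) powr (- of_real q) = of_real ((2 * pi) powr - q)"
    using powr_of_real[of "2 * pi" "- q"] by simp
  moreover have "cos (of_real pi * complex_of_real q / 2) = of_real (cos (pi * q / 2))"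
    using cos_of_real[of "pi * q / 2", where 'a = complex] by simp
  moreover have "Gamma (complex_of_real q) = of_real (Gamma q)" by (rule Gamma_complex_of_real)
  ultimately show ?thesis using zeta_functional_equation[of "of_real (1 - q)"] q by (simp add: ser)
qed

text \<open>Summed over \<open>l\<close>, the powers of \<open>2 * pi * (l + 1)\<close> give the zeta values to the right of \<open>1\<close>, and the
cosine and Gamma factors are those of the functional equation.\<close>

lemma residue_series_sums:
  assumes \<mu>: "\<mu> \<notin> \<int>" and a: "0 < a" "a < 2 * pi" and p: "p > \<mu> + 1"
  defines "T \<equiv> \<lambda>l k. 2 * (K_coeff a \<mu> k * Gamma (p + 2 * real k - \<mu>) * (2 * pi * real (Suc l)) powr - (p + 2 * real k - \<mu>) * cos (pi * (p + 2 * real k - \<mu>) / 2))"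
  shows "summable (\<lambda>l. \<Sum>k. T l k)"
    and "(\<lambda>k. of_real (K_coeff a \<mu> k) * zeta (of_real (1 - (p + 2 * real k - \<mu>)))) sums of_real (\<Sum>l. \<Sum>k. T l k)"
proof -
  define q where "q = (\<lambda>k. p + 2 * real k - \<mu>)"
  have q_alt: "p + 2 * real k - \<mu> = q k" for k by (simp add: q_def)
  have T_alt: "T l k = 2 * (K_coeff a \<mu> k * Gamma (q k) * (2 * pi * real (Suc l)) powr - q k * cos (pi * q k / 2))" for l k
    unfolding T_def q_alt ..
  have q: "q k > 1" "q k \<ge> q 0" for k using p by (auto simp: q_def)
  define B where "B = (\<lambda>l. real (Suc l) powr - q 0)"
  define A where "A = (\<lambda>k. 2 * (\<bar>K_coeff a \<mu> k\<bar> * \<bar>Gamma (q k)\<bar> * (2 * pi) powr - q k))"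
  have sB: "summable B" unfolding B_def using q(1)[of 0] by (subst summable_Suc_iff) (simp add: summable_real_powr_iff)
  have sA: "summable A" unfolding A_def q_def
    using summable_K_coeff_Gamma[OF \<mu> a, of "p - \<mu>"] by (intro summable_mult) (simp add: algebra_simps)
  have bd: "norm (T l k) \<le> A k * B l" for l k
  proof -
    have "norm (T l k) = 2 * (\<bar>K_coeff a \<mu> k\<bar> * \<bar>Gamma (q k)\<bar> * (2 * pi) powr - q k) * (real (Suc l) powr - q k * \<bar>cos (pi * q k / 2)\<bar>)"
      by (simp add: T_alt abs_mult powr_mult)
    also have "\<dots> \<le> A k * (real (Suc l) powr - q 0 * 1)"
      unfolding A_def using q by (intro mult_left_mono mult_mono powr_mono) auto
    finally show ?thesis by (simp add: B_def)
  qed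
  have row: "summable (\<lambda>l. norm (T l k))" for k
    by (rule summable_comparison_test'[OF summable_mult[OF sB, of "A k"]]) (use bd in simp)
  have "summable (\<lambda>k. \<Sum>l. norm (T l k))"
  proof (rule summable_comparison_test'[OF summable_mult2[OF sA, of "suminf B"]])
    fix k
    have "(\<Sum>l. norm (T l k)) \<le> (\<Sum>l. A k * B l)" by (intro suminf_le bd row summable_mult sB)
    also have "\<dots> = A k * suminf B" by (rule suminf_mult[OF sB])
    finally show "norm (\<Sum>l. norm (T l k)) \<le> A k * suminf B"
      using suminf_nonneg[OF row[of k]] by simp
  qed
  note ab = double_series[OF abs_summable_of_rows[of "\<lambda>k l. T l k", OF row this]]
  show "summable (\<lambda>l. \<Sum>k. T l k)" using ab(3) by (simp add: sums_iff)
  have "(\<lambda>k. \<Sum>l. T l k) sums (\<Sum>l. \<Sum>k. T l k)" using ab(3,4) by (simp add: sums_iff)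
  then have "(\<lambda>k. complex_of_real (\<Sum>l. T l k)) sums of_real (\<Sum>l. \<Sum>k. T l k)" by (simp only: sums_of_real_iff)
  moreover have "complex_of_real (\<Sum>l. T l k) = of_real (K_coeff a \<mu> k) * zeta (of_real (1 - (p + 2 * real k - \<mu>)))" for k
  proof -
    have sq: "summable (\<lambda>n. real (Suc n) powr - q k)" using q(1)[of k] by (subst summable_Suc_iff) (simp add: summable_real_powr_iff)
    have "T l k = K_coeff a \<mu> k * (2 * (2 * pi) powr - q k * cos (pi * q k / 2) * Gamma (q k)) * real (Suc l) powr - q k" for l
      unfolding T_alt powr_mult by simp
    then have "(\<Sum>l. T l k) = K_coeff a \<mu> k * (2 * (2 * pi) powr - q k * cos (pi * q k / 2) * Gamma (q k)) * (\<Sum>l. real (Suc l) powr - q k)"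
      by (simp only: suminf_mult[OF sq])
    then show ?thesis unfolding q_alt zeta_reflection_real[OF q(1)] by (simp only: of_real_mult mult.assoc)
  qed
  ultimately show "(\<lambda>k. of_real (K_coeff a \<mu> k) * zeta (of_real (1 - (p + 2 * real k - \<mu>)))) sums of_real (\<Sum>l. \<Sum>k. T l k)" by (simp only:)
qed

text \<open>Poisson summation, with the cosine transforms expanded at the frequencies \<open>2 * pi * (l + 1) > a\<close>.\<close>

theorem schloemilch_real:
  assumes \<mu>: "\<mu> \<notin> \<int>" "\<mu> > 0" and a: "0 < a" "a < 2 * pi" and p: "p > \<mu> + 1" "p \<notin> \<int>"
  shows "of_real (\<Sum>n. real (Suc n) powr (p - 1) * bessel_K \<mu> (a * real (Suc n)))
     = of_real (mellin_K a \<mu> p) + (\<Sum>k. of_real (K_coeff a \<mu> k) * zeta (of_real (1 - (p + 2 * real k - \<mu>))))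
       + (\<Sum>k. of_real (K_coeff a (- \<mu>) k) * zeta (of_real (1 - (p + 2 * real k - - \<mu>))))"
proof -
  have ni: "- \<mu> \<notin> \<int>" by (rule nonint_uminus[OF \<mu>(1)])
  have pm: "p > - \<mu> + 1" "p > \<mu>" using p \<mu> by auto
  define T where "T = (\<lambda>\<mu> l k. 2 * (K_coeff a \<mu> k * Gamma (p + 2 * real k - \<mu>) * (2 * pi * real (Suc l)) powr - (p + 2 * real k - \<mu>) * cos (pi * (p + 2 * real k - \<mu>) / 2)))"
  have h1: "summable (\<lambda>l. \<Sum>k. T \<mu> l k)"
      "(\<lambda>k. of_real (K_coeff a \<mu> k) * zeta (of_real (1 - (p + 2 * real k - \<mu>)))) sums of_real (\<Sum>l. \<Sum>k. T \<mu> l k)"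
    unfolding T_def by (rule residue_series_sums(1)[OF \<mu>(1) a p(1)], rule residue_series_sums(2)[OF \<mu>(1) a p(1)])
  have h2: "summable (\<lambda>l. \<Sum>k. T (- \<mu>) l k)"
      "(\<lambda>k. of_real (K_coeff a (- \<mu>) k) * zeta (of_real (1 - (p + 2 * real k - - \<mu>)))) sums of_real (\<Sum>l. \<Sum>k. T (- \<mu>) l k)"
    unfolding T_def by (rule residue_series_sums(1)[OF ni a pm(1)], rule residue_series_sums(2)[OF ni a pm(1)])
  have e: "2 * (\<integral>t. cos (2 * pi * real (Suc l) * t) * (t powr (p - 1) * bessel_K \<mu> (a * t)) \<partial>pos_lborel) = (\<Sum>k. T \<mu> l k) + (\<Sum>k. T (- \<mu>) l k)" for l
  proof -
    have "2 * pi \<le> 2 * pi * real (Suc l)" by simp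
    then have al: "a < 2 * pi * real (Suc l)" by (rule less_le_trans[OF a(2)])
    have "summable (\<lambda>k. norm (K_coeff a \<sigma> k * Gamma (p + 2 * real k - \<sigma>) * (2 * pi * real (Suc l)) powr - (p + 2 * real k - \<sigma>) * cos (pi * (p + 2 * real k - \<sigma>) / 2)))" if "\<sigma> \<notin> \<int>" for \<sigma>
    proof (rule summable_comparison_test'[OF summable_K_coeff_Gamma[OF that a(1) al, of "p - \<sigma>"]])
      fix k
      define Q where "Q = p + 2 * real k - \<sigma>"
      have "p - \<sigma> + 2 * real k = Q" by (simp add: Q_def)
      moreover have "\<bar>K_coeff a \<sigma> k\<bar> * \<bar>Gamma Q\<bar> * (2 * pi * real (Suc l)) powr - Q * \<bar>cos (pi * Q / 2)\<bar> \<le> \<bar>K_coeff a \<sigma> k\<bar> * \<bar>Gamma Q\<bar> * (2 * pi * real (Suc l)) powr - Q * 1"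
        by (intro mult_left_mono) auto
      ultimately show "norm (norm (K_coeff a \<sigma> k * Gamma (p + 2 * real k - \<sigma>) * (2 * pi * real (Suc l)) powr - (p + 2 * real k - \<sigma>) * cos (pi * (p + 2 * real k - \<sigma>) / 2)))
          \<le> \<bar>K_coeff a \<sigma> k\<bar> * \<bar>Gamma (p - \<sigma> + 2 * real k)\<bar> * (2 * pi * real (Suc l)) powr - (p - \<sigma> + 2 * real k)"
        unfolding Q_def[symmetric] by (simp add: abs_mult)
    qed
    note s = summable_norm_cancel[OF this]
    show ?thesis unfolding cosine_transform_bessel_K[OF \<mu> a(1) al pm(2)] T_def
      suminf_mult[OF s[OF \<mu>(1)]] suminf_mult[OF s[OF ni]] by (simp only: distrib_left)
  qed
  have "(\<Sum>n. real (Suc n) powr (p - 1) * bessel_K \<mu> (a * real (Suc n))) = mellin_K a \<mu> p + (\<Sum>l. (\<Sum>k. T \<mu> l k) + (\<Sum>k. T (- \<mu>) l k))"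
    using bessel_K_poisson(2)[OF \<mu> a(1) p] unfolding e by (simp add: sums_iff)
  also have "(\<Sum>l. (\<Sum>k. T \<mu> l k) + (\<Sum>k. T (- \<mu>) l k)) = (\<Sum>l. \<Sum>k. T \<mu> l k) + (\<Sum>l. \<Sum>k. T (- \<mu>) l k)"
    by (rule suminf_add[OF h1(1) h2(1), symmetric])
  finally show ?thesis unfolding sums_unique[OF h1(2), symmetric] sums_unique[OF h2(2), symmetric]
    by (simp only: of_real_add add.assoc)
qed

section \<open>Growth of the zeta function\<close>

lemma norm_Gamma_le_Gamma_Re:
  assumes z: "Re z > 0"
  shows "norm (Gamma z) \<le> Gamma (Re z)"
proof -
  have i: "((\<lambda>t. of_real t powr (z - 1) / of_real (exp t)) has_integral Gamma z) {0..}"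
    by (rule Gamma_integral_complex[OF z])
  have r: "((\<lambda>t. t powr (Re z - 1) / exp t) has_integral Gamma (Re z)) {0..}"
    by (rule Gamma_integral_real[OF z])
  have "norm (integral {0..} (\<lambda>t. of_real t powr (z - 1) / of_real (exp t))) \<le> integral {0..} (\<lambda>t. t powr (Re z - 1) / exp t)"
  proof (rule integral_norm_bound_integral)
    show "(\<lambda>t. of_real t powr (z - 1) / of_real (exp t)) integrable_on {0..}" using i by blast
    show "(\<lambda>t. t powr (Re z - 1) / exp t) integrable_on {0..}" using r by blast
    fix t :: real assume t: "t \<in> {0..}"
    show "norm (of_real t powr (z - 1) / of_real (exp t)) \<le> t powr (Re z - 1) / exp t"
      using t by (cases "t = 0") (auto simp: norm_divide norm_powr_real_powr)
  qed
  then show ?thesis using i r by (simp add: integral_unique)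
qed

text \<open>In the functional equation, \<open>zeta (1 - s)\<close> is bounded because \<open>Re (1 - s) \<ge> 3 / 2\<close>, and the cosine is
bounded because \<open>Im s\<close> is.\<close>

lemma zeta_growth:
  assumes R: "R \<ge> 0"
  obtains C where "C \<ge> 0"
    "\<And>s. Re s \<le> -1/2 \<Longrightarrow> \<bar>Im s\<bar> \<le> R \<Longrightarrow> norm (zeta s) \<le> C * (2 * pi) powr - (1 - Re s) * Gamma (1 - Re s)"
proof
  define Z where "Z = (\<Sum>n. real (Suc n) powr (- (3/2)))"
  have sZ: "summable (\<lambda>n. real (Suc n) powr (- (3/2)))" by (subst summable_Suc_iff) (simp add: summable_real_powr_iff)
  have Z0: "Z \<ge> 0" unfolding Z_def by (rule suminf_nonneg[OF sZ]) auto
  show "2 * exp (pi * R) * Z \<ge> 0" using Z0 by simp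
  fix s assume s: "Re s \<le> -1/2" "\<bar>Im s\<bar> \<le> R"
  have zb: "norm (zeta (1 - s)) \<le> Z"
  proof -
    have re: "Re (1 - s) > 1" using s by simp
    have "norm (zeta_series (1 - s)) \<le> (\<Sum>n. norm (1 / of_nat (Suc n) powr (1 - s)))"
      unfolding zeta_series_def by (rule summable_norm[OF summable_zeta_series[OF re]])
    also have "\<dots> \<le> Z" unfolding Z_def
    proof (rule suminf_le[OF _ summable_zeta_series[OF re] sZ])
      show "norm (1 / of_nat (Suc n) powr (1 - s)) \<le> real (Suc n) powr (- (3/2))" for n
        unfolding norm_zeta_series_term using s by (intro powr_mono) auto
    qed
    finally show ?thesis by (simp add: zeta_eq_series[OF re])
  qed
  have cb: "norm (cos (of_real pi * (1 - s) / 2)) \<le> exp (pi * R)"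
  proof -
    have "norm (cos (of_real pi * (1 - s) / 2)) \<le> exp \<bar>Im (of_real pi * (1 - s) / 2)\<bar>"
      using cmod_cos_le_exp[of 1 "of_real pi * (1 - s) / 2"] by simp
    also have "\<bar>Im (of_real pi * (1 - s) / 2)\<bar> = pi * \<bar>Im s\<bar> / 2" by (simp add: abs_mult)
    also have "\<dots> \<le> pi * R"
    proof -
      have "pi * \<bar>Im s\<bar> \<le> pi * R" using s by (intro mult_left_mono) auto
      moreover have "0 \<le> pi * \<bar>Im s\<bar>" by simp
      ultimately show ?thesis by linarith
    qed
    finally show ?thesis by simp
  qed
  have gb: "norm (Gamma (1 - s)) \<le> Gamma (1 - Re s)" using norm_Gamma_le_Gamma_Re[of "1 - s"] s by simp
  have pb: "norm (complex_of_real (2 * pi) powr (s - 1)) = (2 * pi) powr - (1 - Re s)"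
    using norm_powr_real_powr[of "complex_of_real (2 * pi)" "s - 1"] by simp
  have G0: "Gamma (1 - Re s) > 0" using s by simp
  have "norm (zeta s) = 2 * (2 * pi) powr - (1 - Re s) * norm (cos (of_real pi * (1 - s) / 2)) * norm (Gamma (1 - s)) * norm (zeta (1 - s))"
    using s by (subst zeta_functional_equation) (auto simp: norm_mult pb simp del: of_real_mult)
  also have "\<dots> \<le> 2 * (2 * pi) powr - (1 - Re s) * exp (pi * R) * Gamma (1 - Re s) * Z"
    using cb gb zb Z0 G0 by (intro mult_mono mult_nonneg_nonneg) auto
  finally show "norm (zeta s) \<le> 2 * exp (pi * R) * Z * (2 * pi) powr - (1 - Re s) * Gamma (1 - Re s)"
    by (simp add: mult_ac)
qed

section \<open>The series of Bessel functions for complex exponents\<close>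

lemma Gamma_mono_ge2:
  assumes "2 \<le> x" "x \<le> y"
  shows "Gamma x \<le> Gamma (y :: real)"
  using Gamma_real_strict_mono[of x y] assms by (cases "x = y") auto

text \<open>The points where \<open>mellin_Kc a \<mu>\<close> has no pole.  The excluded points are also those where a zeta
function in the residue series is evaluated at its pole.\<close>

definition pole_free :: "real \<Rightarrow> complex set" where
  "pole_free \<mu> = {p. (p - of_real \<mu>) / 2 \<notin> \<int>\<^sub>\<le>\<^sub>0 \<and> (p + of_real \<mu>) / 2 \<notin> \<int>\<^sub>\<le>\<^sub>0}"

lemma pole_free_open_connected: "open (pole_free \<mu>)" "connected (pole_free \<mu>)"
proof -
  have cl: "closed {p::complex. (p + c) / 2 \<in> \<int>\<^sub>\<le>\<^sub>0}" for c
  proof -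
    have "closed ((\<lambda>p::complex. (p + c) / 2) -` \<int>\<^sub>\<le>\<^sub>0)"
      by (intro closed_vimage closed_nonpos_Ints continuous_intros) auto
    then show ?thesis by (simp add: vimage_def)
  qed
  have co: "countable {p::complex. (p + c) / 2 \<in> \<int>\<^sub>\<le>\<^sub>0}" for c
  proof (rule countable_subset)
    show "{p::complex. (p + c) / 2 \<in> \<int>\<^sub>\<le>\<^sub>0} \<subseteq> range (\<lambda>n::int. 2 * of_int n - c)"
    proof
      fix p assume "p \<in> {p::complex. (p + c) / 2 \<in> \<int>\<^sub>\<le>\<^sub>0}"
      then obtain n :: int where "(p + c) / 2 = of_int n" by (auto elim!: nonpos_Ints_cases)
      then have "p = 2 * of_int n - c" by (simp add: field_simps)
      then show "p \<in> range (\<lambda>n::int. 2 * of_int n - c)" by blast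
    qed
  qed auto
  have e: "pole_free \<mu> = UNIV - ({p. (p + of_real (- \<mu>)) / 2 \<in> \<int>\<^sub>\<le>\<^sub>0} \<union> {p. (p + of_real \<mu>) / 2 \<in> \<int>\<^sub>\<le>\<^sub>0})"
    by (auto simp: pole_free_def)
  show "open (pole_free \<mu>)" unfolding e by (intro open_Diff closed_Un cl) auto
  show "connected (pole_free \<mu>)" unfolding e
    by (rule connected_open_diff_countable) (auto simp: co simp del: of_real_minus)
qed

definition mellin_Kc :: "real \<Rightarrow> real \<Rightarrow> complex \<Rightarrow> complex" where
  "mellin_Kc a \<mu> s = Gamma ((s - of_real \<mu>) / 2) * Gamma ((s + of_real \<mu>) / 2) * of_real (a / 2) powr - s / 4"

lemma mellin_Kc_of_real:
  assumes "a > 0"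
  shows "mellin_Kc a \<mu> (of_real s) = of_real (mellin_K a \<mu> s)"
proof -
  have 1: "Gamma ((of_real s - of_real \<mu>) / 2) = complex_of_real (Gamma ((s - \<mu>) / 2))"
    "Gamma ((of_real s + of_real \<mu>) / 2) = complex_of_real (Gamma ((s + \<mu>) / 2))"
    using Gamma_complex_of_real[of "(s - \<mu>) / 2"] Gamma_complex_of_real[of "(s + \<mu>) / 2"] by simp_all
  have 2: "of_real (a / 2) powr - complex_of_real s = of_real ((a / 2) powr - s)"
    using powr_of_real[of "a / 2" "- s"] assms by simp
  show ?thesis unfolding mellin_Kc_def mellin_K_def 1 2 by simp
qed

lemma mellin_Kc_holomorphic:
  assumes "a > 0"
  shows "mellin_Kc a \<mu> holomorphic_on pole_free \<mu>"
  unfolding mellin_Kc_def[abs_def] using assms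
  by (intro holomorphic_intros) (auto simp: pole_free_def)

text \<open>By the growth of the zeta function, the terms are locally bounded by those of \<open>summable_K_coeff_Gamma\<close>
with \<open>w = 2 * pi\<close>, where \<open>a < 2 * pi\<close> gives convergence.\<close>

lemma residue_series_holomorphic:
  assumes \<mu>: "\<mu> \<notin> \<int>" and a: "0 < a" "a < 2 * pi" and A: "open A" "\<And>p. p \<in> A \<Longrightarrow> (p - of_real \<mu>) / 2 \<notin> \<int>\<^sub>\<le>\<^sub>0"
  shows "(\<lambda>p. \<Sum>k. of_real (K_coeff a \<mu> k) * zeta (1 - (p + 2 * of_nat k - of_real \<mu>))) holomorphic_on A"
proof (rule holomorphic_suminf[OF A(1)])
  fix k
  have ne: "1 - (p + 2 * of_nat k - of_real \<mu>) \<noteq> 1" if "p \<in> A" for p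
  proof
    assume "1 - (p + 2 * of_nat k - of_real \<mu>) = 1"
    then have "(p - of_real \<mu>) / 2 = - of_nat k" by (simp add: field_simps)
    then show False using A(2)[OF that] by simp
  qed
  have "(zeta \<circ> (\<lambda>p. 1 - (p + 2 * of_nat k - of_real \<mu>))) holomorphic_on A"
    by (rule holomorphic_on_compose_gen[OF _ zeta_spec(1)]) (use ne in \<open>auto intro!: holomorphic_intros\<close>)
  then show "(\<lambda>p. of_real (K_coeff a \<mu> k) * zeta (1 - (p + 2 * of_nat k - of_real \<mu>))) holomorphic_on A"
    unfolding o_def by (intro holomorphic_intros)
next
  fix p assume p: "p \<in> A"
  obtain C where C: "C \<ge> 0"
    "\<And>s. Re s \<le> -1/2 \<Longrightarrow> \<bar>Im s\<bar> \<le> \<bar>Im p\<bar> + 1 \<Longrightarrow> norm (zeta s) \<le> C * (2 * pi) powr - (1 - Re s) * Gamma (1 - Re s)"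
    using zeta_growth[of "\<bar>Im p\<bar> + 1"] by (metis abs_ge_zero add_nonneg_nonneg zero_le_one)
  define q where "q = Re p + 1 - \<mu>"
  \<comment> \<open>From this index on, the arguments of the Gamma function exceed \<open>2\<close>, where it is increasing.\<close>
  define N where "N = nat \<lceil>4 + \<bar>Re p\<bar> + \<bar>\<mu>\<bar>\<rceil>"
  define D where "D = C * (2 * pi) powr 2"
  have bd: "norm (of_real (K_coeff a \<mu> k) * zeta (1 - (w + 2 * of_nat k - of_real \<mu>)))
      \<le> D * (\<bar>K_coeff a \<mu> k\<bar> * \<bar>Gamma (q + 2 * real k)\<bar> * (2 * pi) powr - (q + 2 * real k))"
    if k: "k \<ge> N" and w: "w \<in> cball p 1" for k w
  proof -
    have dw: "norm (w - p) \<le> 1" using w by (simp add: dist_norm norm_minus_commute)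
    have re: "\<bar>Re w - Re p\<bar> \<le> 1" and im: "\<bar>Im w - Im p\<bar> \<le> 1"
      using abs_Re_le_cmod[of "w - p"] abs_Im_le_cmod[of "w - p"] dw by auto
    have kN: "real k \<ge> 4 + \<bar>Re p\<bar> + \<bar>\<mu>\<bar>" using k unfolding N_def by linarith
    define s where "s = 1 - (w + 2 * of_nat k - of_real \<mu>)"
    have s: "1 - Re s = Re w + 2 * real k - \<mu>" "Im s = - Im w" by (auto simp: s_def)
    have b: "2 \<le> 1 - Re s" "1 - Re s \<le> q + 2 * real k" "q + 2 * real k - 2 \<le> 1 - Re s" "Re s \<le> -1/2"
      using s(1) re kN by (auto simp: q_def abs_le_iff)
    have "norm (zeta s) \<le> C * (2 * pi) powr - (1 - Re s) * Gamma (1 - Re s)"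
      by (rule C(2)[OF b(4)]) (use im s(2) in linarith)
    also have "\<dots> \<le> C * (2 * pi) powr - (q + 2 * real k - 2) * Gamma (q + 2 * real k)"
      using b C(1) pi_gt3 by (intro mult_mono mult_left_mono powr_mono Gamma_mono_ge2) auto
    also have "(2 * pi) powr - (q + 2 * real k - 2) = (2 * pi) powr 2 * (2 * pi) powr - (q + 2 * real k)"
      unfolding powr_add[symmetric] by (simp add: algebra_simps)
    also have "C * ((2 * pi) powr 2 * (2 * pi) powr - (q + 2 * real k)) * Gamma (q + 2 * real k)
      = D * (\<bar>Gamma (q + 2 * real k)\<bar> * (2 * pi) powr - (q + 2 * real k))"
      using b by (simp add: D_def)
    finally have "\<bar>K_coeff a \<mu> k\<bar> * norm (zeta s) \<le> \<bar>K_coeff a \<mu> k\<bar> * (D * (\<bar>Gamma (q + 2 * real k)\<bar> * (2 * pi) powr - (q + 2 * real k)))"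
      by (intro mult_left_mono) auto
    then show ?thesis by (simp add: norm_mult s_def mult_ac)
  qed
  moreover have "summable (\<lambda>k. D * (\<bar>K_coeff a \<mu> k\<bar> * \<bar>Gamma (q + 2 * real k)\<bar> * (2 * pi) powr - (q + 2 * real k)))"
    by (intro summable_mult summable_K_coeff_Gamma \<mu> a)
  ultimately show "\<exists>d M N. d > 0 \<and> summable M \<and> (\<forall>n\<ge>N. \<forall>w\<in>cball p d. w \<in> A \<longrightarrow>
     norm (of_real (K_coeff a \<mu> n) * zeta (1 - (w + 2 * of_nat n - of_real \<mu>))) \<le> M n)"
    by (intro exI[of _ "1::real"] exI[of _ "\<lambda>k. D * (\<bar>K_coeff a \<mu> k\<bar> * \<bar>Gamma (q + 2 * real k)\<bar> * (2 * pi) powr - (q + 2 * real k))"] exI[of _ N]) auto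
qed

lemma summable_powr_bessel_K:
  assumes \<mu>: "\<mu> \<notin> \<int>" "\<mu> > 0" and a: "a > 0"
  shows "summable (\<lambda>n. real (Suc n) powr s * bessel_K \<mu> (a * real (Suc n)))"
proof (rule summable_comparison_test')
  have a2: "a / 2 > 0" using a by simp
  show "summable (\<lambda>n. bessel_K \<mu> (a / 2) * (real (Suc n) powr s * exp (- (real (Suc n) * (a / 2)))))"
    by (intro summable_mult summable_powr_exp a2)
  fix n
  have pos: "a * real (Suc n) > 0" using a by simp
  have "a / 2 * 1 \<le> a / 2 * real (Suc n)" using a by (intro mult_left_mono) auto
  then have h: "a / 2 \<le> a * real (Suc n) / 2" by simp
  have "bessel_K \<mu> (a * real (Suc n)) \<le> exp (- (a * real (Suc n)) / 2) * bessel_K \<mu> (a * real (Suc n) / 2)"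
    by (rule bessel_K_decay[OF \<mu> pos])
  also have "\<dots> \<le> exp (- (a * real (Suc n)) / 2) * bessel_K \<mu> (a / 2)"
    by (intro mult_left_mono bessel_K_antimono[OF \<mu> a2 h]) auto
  also have "exp (- (a * real (Suc n)) / 2) = exp (- (real (Suc n) * (a / 2)))" by (simp add: field_simps)
  finally have "real (Suc n) powr s * bessel_K \<mu> (a * real (Suc n)) \<le> real (Suc n) powr s * (exp (- (real (Suc n) * (a / 2))) * bessel_K \<mu> (a / 2))"
    by (intro mult_left_mono) auto
  moreover have "real (Suc n) powr s * bessel_K \<mu> (a * real (Suc n)) \<ge> 0"
    using bessel_K_eq_mixture(2)[OF \<mu> pos] by (intro mult_nonneg_nonneg) auto
  ultimately show "norm (real (Suc n) powr s * bessel_K \<mu> (a * real (Suc n))) \<le> bessel_K \<mu> (a / 2) * (real (Suc n) powr s * exp (- (real (Suc n) * (a / 2))))"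
    by (simp add: mult_ac)
qed

text \<open>Both sides are holomorphic on the connected set \<open>pole_free \<mu>\<close>, and they agree on a real interval
to the right of \<open>\<mu> + 1\<close> that contains no integer.\<close>

theorem schloemilch_complex:
  assumes \<mu>: "\<mu> \<notin> \<int>" "\<mu> > 0" and a: "0 < a" "a < 2 * pi" and p: "p \<in> pole_free \<mu>"
  shows "(\<Sum>n. of_nat (Suc n) powr (p - 1) * of_real (bessel_K \<mu> (a * real (Suc n))))
     = mellin_Kc a \<mu> p + (\<Sum>k. of_real (K_coeff a \<mu> k) * zeta (1 - (p + 2 * of_nat k - of_real \<mu>)))
       + (\<Sum>k. of_real (K_coeff a (- \<mu>) k) * zeta (1 - (p + 2 * of_nat k - of_real (- \<mu>))))"
proof -
  have ni: "- \<mu> \<notin> \<int>" by (rule nonint_uminus[OF \<mu>(1)])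
  define L where "L = (\<lambda>p. \<Sum>n. of_nat (Suc n) powr (p - 1) * complex_of_real (bessel_K \<mu> (a * real (Suc n))))"
  define R where "R = (\<lambda>p. mellin_Kc a \<mu> p + (\<Sum>k. of_real (K_coeff a \<mu> k) * zeta (1 - (p + 2 * of_nat k - of_real \<mu>)))
       + (\<Sum>k. of_real (K_coeff a (- \<mu>) k) * zeta (1 - (p + 2 * of_nat k - of_real (- \<mu>)))))"
  have nn: "norm (of_nat (Suc n) powr (w - 1) :: complex) = real (Suc n) powr (Re w - 1)" for w n
    using norm_powr_real_powr[of "of_nat (Suc n)" "w - 1"] by simp
  have Lhol: "L holomorphic_on pole_free \<mu>"
    unfolding L_def
  proof (rule holomorphic_suminf[OF pole_free_open_connected(1)])
    show "(\<lambda>p. of_nat (Suc n) powr (p - 1) * complex_of_real (bessel_K \<mu> (a * real (Suc n)))) holomorphic_on pole_free \<mu>" for n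
      by (intro holomorphic_intros) (auto simp del: of_nat_Suc)
    fix z assume "z \<in> pole_free \<mu>"
    have "norm (of_nat (Suc n) powr (w - 1) * complex_of_real (bessel_K \<mu> (a * real (Suc n)))) \<le> real (Suc n) powr (Re z) * bessel_K \<mu> (a * real (Suc n))"
      if w: "w \<in> cball z 1" for n w
    proof -
      have "norm (w - z) \<le> 1" using w by (simp add: dist_norm norm_minus_commute)
      then have "Re w - 1 \<le> Re z" using abs_Re_le_cmod[of "w - z"] by simp
      then have "real (Suc n) powr (Re w - 1) \<le> real (Suc n) powr (Re z)" by (intro powr_mono) auto
      moreover have "bessel_K \<mu> (a * real (Suc n)) \<ge> 0" using a by (intro bessel_K_eq_mixture(2)[OF \<mu>]) simp
      ultimately show ?thesis unfolding norm_mult nn norm_of_real by (simp add: mult_right_mono)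
    qed
    then show "\<exists>d M N. d > 0 \<and> summable M \<and> (\<forall>n\<ge>N. \<forall>w\<in>cball z d. w \<in> pole_free \<mu> \<longrightarrow>
       norm (of_nat (Suc n) powr (w - 1) * complex_of_real (bessel_K \<mu> (a * real (Suc n)))) \<le> M n)"
      using summable_powr_bessel_K[OF \<mu> a(1), of "Re z"]
      by (intro exI[of _ 1] exI[of _ "\<lambda>n. real (Suc n) powr (Re z) * bessel_K \<mu> (a * real (Suc n))"]) auto
  qed
  have Rhol: "R holomorphic_on pole_free \<mu>"
    unfolding R_def
    by (intro holomorphic_on_add mellin_Kc_holomorphic residue_series_holomorphic \<mu> ni a pole_free_open_connected) (auto simp: pole_free_def)
  \<comment> \<open>The open interval from \<open>N\<close> to \<open>N + 1\<close> satisfies the conditions of the real case.\<close>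
  define N :: int where "N = \<lceil>\<mu>\<rceil> + 2"
  have "L p = R p"
  proof (rule holomorphic_eq_if_eq_on_reals[where f = L and g = R, OF Lhol Rhol pole_free_open_connected, of "of_int N" "of_int N + 1"])
    have big: "x > \<mu> + 1" if "x > of_int N" for x using that unfolding N_def by linarith
    show "of_real ` {real_of_int N<..<real_of_int N + 1} \<subseteq> pole_free \<mu>"
    proof
      fix z assume "z \<in> complex_of_real ` {real_of_int N<..<real_of_int N + 1}"
      then obtain x where x: "z = of_real x" "x > of_int N" by auto
      have "(x - \<mu>) / 2 > 0" "(x + \<mu>) / 2 > 0" using big[OF x(2)] \<mu> by auto
      then have "Re ((z - of_real \<mu>) / 2) > 0" "Re ((z + of_real \<mu>) / 2) > 0" using x by auto
      moreover have "Re w \<le> 0" if "w \<in> \<int>\<^sub>\<le>\<^sub>0" for w :: complex using that by (auto elim!: nonpos_Ints_cases)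
      ultimately show "z \<in> pole_free \<mu>" unfolding pole_free_def using not_le by blast
    qed
    fix x :: real assume x: "of_int N < x" "x < of_int N + 1"
    have xi: "x \<notin> \<int>"
    proof
      assume "x \<in> \<int>"
      then obtain i where i: "x = of_int i" by (auto elim: Ints_cases)
      have "N < i" using x(1) unfolding i by simp
      moreover have "real_of_int i < real_of_int (N + 1)" using x(2) unfolding i by simp
      then have "i < N + 1" unfolding of_int_less_iff .
      ultimately show False by simp
    qed
    have "L (of_real x) = (\<Sum>n. complex_of_real (real (Suc n) powr (x - 1) * bessel_K \<mu> (a * real (Suc n))))"
    proof -
      have "of_nat (Suc n) powr (complex_of_real x - 1) = of_real (real (Suc n) powr (x - 1))" for n
        using powr_of_real[of "real (Suc n)" "x - 1"] by simp
      then show ?thesis unfolding L_def by simp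
    qed
    also have "\<dots> = of_real (\<Sum>n. real (Suc n) powr (x - 1) * bessel_K \<mu> (a * real (Suc n)))"
      by (rule suminf_of_real[OF summable_powr_bessel_K[OF \<mu> a(1)], symmetric])
    also have "\<dots> = R (of_real x)"
      unfolding schloemilch_real[OF \<mu> a big[OF x(1)] xi] R_def mellin_Kc_of_real[OF a(1)] by simp
    finally show "L (of_real x) = R (of_real x)" .
  qed (use p in auto)
  then show ?thesis by (simp only: L_def R_def)
qed

section \<open>Bounds for the coefficients\<close>

text \<open>For positive \<open>x\<close> this is Gauss's limit; the recurrence of the Gamma function carries it to smaller
\<open>x\<close>.\<close>

lemma Gamma_ratio_tendsto:
  fixes x :: real
  shows "(\<lambda>n. Gamma (x + real n) / (fact n * real (Suc n) powr (x - 1))) \<longlonglongrightarrow> 1"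
proof -
  have pos: "(\<lambda>n. Gamma (x + real n) / (fact n * real (Suc n) powr (x - 1))) \<longlonglongrightarrow> 1" if x: "x > 0" for x :: real
  proof -
    have G: "Gamma x > 0" using x by simp
    have lim: "(\<lambda>n. Gamma x / Gamma_series' x n) \<longlonglongrightarrow> Gamma x / Gamma x"
      using G by (intro tendsto_intros Gamma_series'_LIMSEQ) auto
    have "(\<lambda>n. (real n / real (Suc n)) powr (x - 1)) \<longlonglongrightarrow> 1" by real_asymp
    from tendsto_mult[OF lim this]
    have "(\<lambda>n. Gamma x / Gamma_series' x n * (real n / real (Suc n)) powr (x - 1)) \<longlonglongrightarrow> 1" using G by simp
    then show ?thesis
    proof (rule Lim_transform_eventually)
      show "\<forall>\<^sub>F n in sequentially. Gamma x / Gamma_series' x n * (real n / real (Suc n)) powr (x - 1) = Gamma (x + real n) / (fact n * real (Suc n) powr (x - 1))"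
        using eventually_gt_at_top[of 0]
      proof eventually_elim
        case (elim n)
        have "x \<notin> \<int>\<^sub>\<le>\<^sub>0" using x by (auto elim!: nonpos_Ints_cases)
        then have "pochhammer x n = Gamma (x + real n) / Gamma x" by (rule pochhammer_Gamma)
        moreover have "fact n = real n * fact (n - 1)" using elim by (simp add: fact_reduce)
        moreover have "exp (x * ln (real n)) = real n * real n powr (x - 1)"
          using elim powr_mult_base[of "real n" "x - 1"] by (simp add: powr_def)
        ultimately show ?case using elim G unfolding Gamma_series'_def powr_divide by (simp add: field_simps)
      qed
    qed
  qed
  have "(\<lambda>n. Gamma (x + real n) / (fact n * real (Suc n) powr (x - 1))) \<longlonglongrightarrow> 1" if "x + real k > 0" for k and x :: real
    using that
  proof (induction k arbitrary: x)
    case 0 then show ?case using pos by simp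
  next
    case (Suc k)
    have "(\<lambda>n. Gamma (x + 1 + real n) / (fact n * real (Suc n) powr (x + 1 - 1))) \<longlonglongrightarrow> 1"
      by (rule Suc.IH) (use Suc.prems in simp)
    moreover have "(\<lambda>n. real (Suc n) / (x + real n)) \<longlonglongrightarrow> 1" by real_asymp
    ultimately have "(\<lambda>n. Gamma (x + 1 + real n) / (fact n * real (Suc n) powr (x + 1 - 1)) * (real (Suc n) / (x + real n))) \<longlonglongrightarrow> 1 * 1"
      by (rule tendsto_mult)
    moreover have "\<forall>\<^sub>F n in sequentially. x + real n > 0" by real_asymp
    then have "\<forall>\<^sub>F n in sequentially. Gamma (x + 1 + real n) / (fact n * real (Suc n) powr (x + 1 - 1)) * (real (Suc n) / (x + real n)) = Gamma (x + real n) / (fact n * real (Suc n) powr (x - 1))"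
    proof eventually_elim
      case (elim n)
      have 1: "Gamma (x + real n + 1) = (x + real n) * Gamma (x + real n)"
        by (rule Gamma_plus1) (use elim in \<open>auto elim!: nonpos_Ints_cases\<close>)
      have 2: "real (Suc n) powr (x + 1 - 1) = real (Suc n) * real (Suc n) powr (x - 1)"
        using powr_mult_base[of "real (Suc n)" "x - 1"] by simp
      have 3: "x + 1 + real n = x + real n + 1" by simp
      have "(X * G) / (F * (S * P)) * (S / X) = G / (F * P)" if "X > 0" "S > 0" for X G F S P :: real
        using that by simp
      then show ?case unfolding 3 1 2 using elim by simp
    qed
    ultimately have "(\<lambda>n. Gamma (x + real n) / (fact n * real (Suc n) powr (x - 1))) \<longlonglongrightarrow> 1 * 1"
      by (rule Lim_transform_eventually)
    then show ?case by simp
  qed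
  moreover have "x + real (nat \<lceil>1 - x\<rceil>) > 0" by linarith
  ultimately show ?thesis by blast
qed

lemma Gamma_bound:
  obtains A where "A > 0" "\<And>n. \<bar>Gamma (x + real n)\<bar> \<le> A * (fact n * real (Suc n) powr (x - 1))"
proof -
  have "Bseq (\<lambda>n. Gamma (x + real n) / (fact n * real (Suc n) powr (x - 1)))"
    by (rule convergent_imp_Bseq[OF convergentI[OF Gamma_ratio_tendsto]])
  then obtain A where A: "A > 0" "\<And>n. norm (Gamma (x + real n) / (fact n * real (Suc n) powr (x - 1))) \<le> A"
    by (auto elim: BseqE)
  have "\<bar>Gamma (x + real n)\<bar> \<le> A * (fact n * real (Suc n) powr (x - 1))" for n
    using A(2)[of n] by (simp add: field_simps abs_mult)
  with A(1) show ?thesis using that by blast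
qed

lemma rGamma_bound:
  obtains A where "A > 0" "\<And>n. \<bar>rGamma (x + real n)\<bar> \<le> A * (real (Suc n) powr (1 - x) / fact n)"
proof -
  have "(\<lambda>n. inverse (Gamma (x + real n) / (fact n * real (Suc n) powr (x - 1)))) \<longlonglongrightarrow> inverse 1"
    by (intro tendsto_inverse Gamma_ratio_tendsto) auto
  then have "Bseq (\<lambda>n. inverse (Gamma (x + real n) / (fact n * real (Suc n) powr (x - 1))))"
    using convergentI convergent_imp_Bseq by blast
  then obtain A where A: "A > 0" "\<And>n. norm (inverse (Gamma (x + real n) / (fact n * real (Suc n) powr (x - 1)))) \<le> A"
    by (auto elim: BseqE)
  have "\<bar>rGamma (x + real n)\<bar> \<le> A * (real (Suc n) powr (1 - x) / fact n)" for n
  proof -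
    define P where "P = real (Suc n) powr (x - 1)"
    have P: "P > 0" "real (Suc n) powr (1 - x) = inverse P"
      using powr_minus[of "real (Suc n)" "x - 1"] by (auto simp: P_def)
    have "\<bar>rGamma (x + real n)\<bar> * (fact n * P) \<le> A"
    proof -
      have "norm (inverse (Gamma (x + real n) / (fact n * P))) = \<bar>rGamma (x + real n)\<bar> * (fact n * P)"
        using P(1) by (simp add: rGamma_inverse_Gamma abs_mult divide_inverse)
      then show ?thesis using A(2)[of n, folded P_def] by (simp only:)
    qed
    then show ?thesis unfolding P(2) using P(1) by (simp add: field_simps)
  qed
  with A(1) show ?thesis using that by blast
qed

text \<open>Negative moments of the binomial distribution.  The identity
\<open>(n choose i) * (n + 1) / (i + 1) = (n + 1) choose (i + 1)\<close> absorbs one factor at a time into the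
binomial coefficient.\<close>

lemma binomial_negative_moment:
  fixes a b :: real
  assumes a: "a > 0" and b: "b > 0"
  shows "\<exists>C>0. \<forall>n. (\<Sum>i\<le>n. real (n choose i) * b ^ i * a ^ (n - i) * ((real n + 1) / (real i + 1)) ^ r) \<le> C * (a + b) ^ n"
proof (induction r)
  case 0
  have "(\<Sum>i\<le>n. real (n choose i) * b ^ i * a ^ (n - i)) = (a + b) ^ n" for n
    unfolding add.commute[of a b] by (rule binomial_ring[symmetric])
  then show ?case by (intro exI[of _ 1]) simp
next
  case (Suc r)
  then obtain C where C: "C > 0" "\<And>n. (\<Sum>i\<le>n. real (n choose i) * b ^ i * a ^ (n - i) * ((real n + 1) / (real i + 1)) ^ r) \<le> C * (a + b) ^ n"
    by blast
  \<comment> \<open>The factor \<open>2 ^ r\<close> comes from replacing \<open>i + 1\<close> by \<open>i + 2\<close>, and \<open>(a + b) / b\<close> from the shift of \<open>n\<close> and \<open>i\<close> by one.\<close>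
  define C' where "C' = 2 ^ r / b * C * (a + b)"
  have "(\<Sum>i\<le>n. real (n choose i) * b ^ i * a ^ (n - i) * ((real n + 1) / (real i + 1)) ^ Suc r) \<le> C' * (a + b) ^ n" for n
  proof -
    define g where "g = (\<lambda>i. real (Suc n choose i) * b ^ i * a ^ (Suc n - i) * ((real (Suc n) + 1) / (real i + 1)) ^ r)"
    have g0: "g i \<ge> 0" for i using a b by (simp add: g_def)
    have "(\<Sum>i\<le>n. real (n choose i) * b ^ i * a ^ (n - i) * ((real n + 1) / (real i + 1)) ^ Suc r) \<le> (\<Sum>i\<le>n. 2 ^ r / b * g (Suc i))"
    proof (rule sum_mono)
      fix i assume i: "i \<in> {..n}"
      have ch: "real (n choose i) * ((real n + 1) / (real i + 1)) = real (Suc n choose Suc i)"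
      proof -
        have "real (Suc i * (Suc n choose Suc i)) = real (Suc n * (n choose i))" by (simp only: Suc_times_binomial_eq mult.commute)
        then show ?thesis by (simp add: field_simps)
      qed
      have "(real n + 1) / (real i + 1) \<le> 2 * ((real (Suc n) + 1) / (real (Suc i) + 1))"
        by (simp add: field_simps)
      then have "((real n + 1) / (real i + 1)) ^ r \<le> (2 * ((real (Suc n) + 1) / (real (Suc i) + 1))) ^ r"
        by (intro power_mono) auto
      then have "real (Suc n choose Suc i) * b ^ i * a ^ (n - i) * ((real n + 1) / (real i + 1)) ^ r \<le> real (Suc n choose Suc i) * b ^ i * a ^ (n - i) * (2 ^ r * ((real (Suc n) + 1) / (real (Suc i) + 1)) ^ r)"
        unfolding power_mult_distrib using a b by (intro mult_left_mono) auto
      also have "\<dots> = 2 ^ r / b * g (Suc i)" using b by (simp add: g_def)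
      finally show "real (n choose i) * b ^ i * a ^ (n - i) * ((real n + 1) / (real i + 1)) ^ Suc r \<le> 2 ^ r / b * g (Suc i)"
        unfolding ch[symmetric] by (simp add: mult_ac)
    qed
    also have "\<dots> = 2 ^ r / b * (\<Sum>i\<le>n. g (Suc i))" by (simp add: sum_distrib_left)
    also have "\<dots> \<le> 2 ^ r / b * (C * (a + b) ^ Suc n)"
    proof (rule mult_left_mono)
      have "(\<Sum>i\<le>n. g (Suc i)) \<le> (\<Sum>i\<le>Suc n. g i)" unfolding sum.atMost_Suc_shift using g0[of 0] by simp
      also have "\<dots> \<le> C * (a + b) ^ Suc n" unfolding g_def by (rule C(2))
      finally show "(\<Sum>i\<le>n. g (Suc i)) \<le> C * (a + b) ^ Suc n" .
    qed (use b in simp)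
    also have "\<dots> = C' * (a + b) ^ n" by (simp add: C'_def mult_ac)
    finally show ?thesis .
  qed
  moreover have "C' > 0" using C a b by (simp add: C'_def)
  ultimately show ?case by blast
qed

definition I_coeff :: "real \<Rightarrow> real \<Rightarrow> nat \<Rightarrow> real" where
  "I_coeff b \<nu> j = rGamma (\<nu> + real j + 1) / fact j * (b / 2) powr (\<nu> + 2 * real j)"

lemma I_coeff_nonneg: "\<nu> \<ge> 0 \<Longrightarrow> I_coeff b \<nu> j \<ge> 0"
  by (simp add: I_coeff_def rGamma_inverse_Gamma Gamma_real_nonneg add_nonneg_nonneg)

text \<open>The duplication formula compares \<open>(n!)\<^sup>2\<close> with \<open>(2 n)!\<close>.  With \<open>(2 n)!\<close> in the denominator, the
convolution of two such coefficients is a binomial sum.\<close>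

lemma rGamma_over_fact_bound:
  assumes c: "c > 0"
  obtains A where "A > 0"
    "\<And>n. \<bar>rGamma (x + real n)\<bar> / fact n * (c / 2) powr (2 * real n) \<le> A * (c ^ (2 * n) * real (Suc n) powr (1 / 2 - x) / fact (2 * n))"
proof -
  obtain A1 where A1: "A1 > 0" "\<And>n. \<bar>rGamma (x + real n)\<bar> \<le> A1 * (real (Suc n) powr (1 - x) / fact n)"
    using rGamma_bound by blast
  obtain A2 where A2: "A2 > 0" "\<And>n. \<bar>Gamma (1 / 2 + real n)\<bar> \<le> A2 * (fact n * real (Suc n) powr (1 / 2 - 1))"
    using Gamma_bound by blast
  define A where "A = A1 * (A2 / sqrt pi)"
  have sp: "sqrt pi > 0" by simp
  have "\<bar>rGamma (x + real n)\<bar> / fact n * (c / 2) powr (2 * real n) \<le> A * (c ^ (2 * n) * real (Suc n) powr (1 / 2 - x) / fact (2 * n))" for n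
  proof -
    define S where "S = real (Suc n)"
    have S: "S > 0" by (simp add: S_def)
    have "(1/2::real) \<notin> \<int>\<^sub>\<le>\<^sub>0" by (auto elim!: nonpos_Ints_cases)
    then have "pochhammer (1 / 2) n = Gamma (1 / 2 + real n) / sqrt pi"
      using pochhammer_Gamma[of "1/2::real" n] by (simp add: Gamma_one_half_real)
    then have "fact (2 * n) = 2 ^ (2 * n) * (Gamma (1 / 2 + real n) / sqrt pi) * (fact n :: real)"
      using fact_double[of n, where 'a = real] by simp
    also have "\<dots> \<le> 2 ^ (2 * n) * (A2 * (fact n * S powr (1 / 2 - 1)) / sqrt pi) * fact n"
      using A2(2)[of n] sp unfolding S_def
      by (intro mult_right_mono mult_left_mono divide_right_mono) auto
    finally have f: "fact (2 * n) \<le> 2 ^ (2 * n) * (A2 / sqrt pi) * (fact n)\<^sup>2 * S powr (- 1 / 2)"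
      by (simp add: power2_eq_square mult_ac)
    have "1 / (fact n)\<^sup>2 \<le> 2 ^ (2 * n) * (A2 / sqrt pi) * S powr (- 1 / 2) / (fact (2 * n) :: real)"
      using f by (simp add: divide_le_eq le_divide_eq mult_ac)
    have pw: "(c / 2) powr (2 * real n) = c ^ (2 * n) / 2 ^ (2 * n)"
      using c powr_realpow[of "c / 2" "2 * n"] by (simp add: power_divide)
    have "\<bar>rGamma (x + real n)\<bar> / fact n * (c ^ (2 * n) / 2 ^ (2 * n)) \<le> (A1 * (S powr (1 - x) / fact n)) / fact n * (c ^ (2 * n) / 2 ^ (2 * n))"
      using A1(2)[of n] c unfolding S_def by (intro mult_right_mono divide_right_mono) auto
    also have "(A1 * (S powr (1 - x) / fact n)) / fact n * (c ^ (2 * n) / 2 ^ (2 * n))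
        = (A1 * S powr (1 - x) * (c ^ (2 * n) / 2 ^ (2 * n))) * (1 / (fact n)\<^sup>2)"
      by (simp add: power2_eq_square)
    also have "\<dots> \<le> (A1 * S powr (1 - x) * (c ^ (2 * n) / 2 ^ (2 * n))) * (2 ^ (2 * n) * (A2 / sqrt pi) * S powr (- 1 / 2) / fact (2 * n))"
      using A1 c by (intro mult_left_mono \<open>1 / (fact n)\<^sup>2 \<le> _\<close>) auto
    also have "\<dots> = A * (c ^ (2 * n) * (S powr (1 - x) * S powr (- 1 / 2)) / fact (2 * n))"
      by (simp add: A_def)
    also have "S powr (1 - x) * S powr (- 1 / 2) = S powr (1 / 2 - x)" unfolding powr_add[symmetric] by simp
    finally show ?thesis unfolding pw S_def .
  qed
  moreover have "A > 0" using A1 A2 by (simp add: A_def)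
  ultimately show ?thesis using that by blast
qed

lemma I_coeff_bound:
  assumes "b > 0" "\<nu> \<ge> 0"
  obtains A where "A > 0" "\<And>j. I_coeff b \<nu> j \<le> A * (b ^ (2 * j) * real (Suc j) powr (- \<nu> - 1 / 2) / fact (2 * j))"
proof -
  obtain A where A: "A > 0" "\<And>n. \<bar>rGamma ((\<nu> + 1) + real n)\<bar> / fact n * (b / 2) powr (2 * real n) \<le> A * (b ^ (2 * n) * real (Suc n) powr (1 / 2 - (\<nu> + 1)) / fact (2 * n))"
    using rGamma_over_fact_bound[OF assms(1), of "\<nu> + 1"] by blast
  have "I_coeff b \<nu> j \<le> (b / 2) powr \<nu> * A * (b ^ (2 * j) * real (Suc j) powr (- \<nu> - 1 / 2) / fact (2 * j))" for j
  proof -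
    have "I_coeff b \<nu> j \<le> (b / 2) powr \<nu> * (\<bar>rGamma ((\<nu> + 1) + real j)\<bar> / fact j * (b / 2) powr (2 * real j))"
    proof -
      have "rGamma (\<nu> + real j + 1) \<le> \<bar>rGamma ((\<nu> + 1) + real j)\<bar>" by (simp add: add_ac)
      then have "rGamma (\<nu> + real j + 1) / fact j * ((b / 2) powr \<nu> * (b / 2) powr (2 * real j)) \<le> \<bar>rGamma ((\<nu> + 1) + real j)\<bar> / fact j * ((b / 2) powr \<nu> * (b / 2) powr (2 * real j))"
        by (intro mult_right_mono divide_right_mono) auto
      then show ?thesis unfolding I_coeff_def powr_add by (simp add: mult_ac)
    qed
    also have "\<dots> \<le> (b / 2) powr \<nu> * (A * (b ^ (2 * j) * real (Suc j) powr (1 / 2 - (\<nu> + 1)) / fact (2 * j)))"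
      using A(2)[of j] by (intro mult_left_mono) auto
    also have "1 / 2 - (\<nu> + 1) = - \<nu> - 1 / 2" by simp
    finally show ?thesis by (simp only: mult_ac)
  qed
  moreover have "(b / 2) powr \<nu> * A > 0" using A assms by simp
  ultimately show ?thesis using that by blast
qed

lemma K_coeff_bound:
  assumes "a > 0" and \<mu>: "\<mu> \<notin> \<int>"
  obtains A where "A > 0" "\<And>k. \<bar>K_coeff a \<mu> k\<bar> \<le> A * (a ^ (2 * k) * real (Suc k) powr (\<mu> - 1 / 2) / fact (2 * k))"
proof -
  obtain A where A: "A > 0" "\<And>n. \<bar>rGamma ((1 - \<mu>) + real n)\<bar> / fact n * (a / 2) powr (2 * real n) \<le> A * (a ^ (2 * n) * real (Suc n) powr (1 / 2 - (1 - \<mu>)) / fact (2 * n))"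
    using rGamma_over_fact_bound[OF assms(1), of "1 - \<mu>"] by blast
  define c where "c = \<bar>pi / sin (\<mu> * pi)\<bar> * (a / 2) powr - \<mu> / 2"
  have s0: "sin (\<mu> * pi) \<noteq> 0" using \<mu> by (auto simp: sin_zero_iff_int2)
  have c: "c > 0" using s0 assms by (simp add: c_def)
  have "\<bar>K_coeff a \<mu> k\<bar> \<le> c * A * (a ^ (2 * k) * real (Suc k) powr (\<mu> - 1 / 2) / fact (2 * k))" for k
  proof -
    have e: "- \<mu> + real k + 1 = (1 - \<mu>) + real k" by simp
    have p: "(a / 2) powr (2 * real k - \<mu>) = (a / 2) powr - \<mu> * (a / 2) powr (2 * real k)"
      unfolding powr_add[symmetric] by simp
    have "\<bar>K_coeff a \<mu> k\<bar> = c * (\<bar>rGamma ((1 - \<mu>) + real k)\<bar> / fact k * (a / 2) powr (2 * real k))"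
      unfolding K_coeff_def bessel_coeff_conv_rGamma[OF \<mu>] e p c_def by (simp add: abs_mult mult_ac)
    also have "\<dots> \<le> c * (A * (a ^ (2 * k) * real (Suc k) powr (1 / 2 - (1 - \<mu>)) / fact (2 * k)))"
      using A(2)[of k] c by (intro mult_left_mono) auto
    also have "1 / 2 - (1 - \<mu>) = \<mu> - 1 / 2" by simp
    finally show ?thesis by (simp only: mult_ac)
  qed
  moreover have "c * A > 0" using A c by simp
  ultimately show ?thesis using that by blast
qed

lemma even_binomial_moment:
  fixes a b :: real
  assumes "a > 0" "b > 0"
  obtains C where "C > 0"
    "\<And>m. (\<Sum>j\<le>m. real ((2 * m) choose (2 * j)) * b ^ (2 * j) * a ^ (2 * (m - j)) * ((real m + 1) / (real j + 1)) ^ r) \<le> C * (a + b) ^ (2 * m)"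
proof -
  obtain C where C: "C > 0" "\<And>n. (\<Sum>i\<le>n. real (n choose i) * b ^ i * a ^ (n - i) * ((real n + 1) / (real i + 1)) ^ r) \<le> C * (a + b) ^ n"
    using binomial_negative_moment[OF assms] by blast
  have "(\<Sum>j\<le>m. real ((2 * m) choose (2 * j)) * b ^ (2 * j) * a ^ (2 * (m - j)) * ((real m + 1) / (real j + 1)) ^ r) \<le> (2 ^ r * C) * (a + b) ^ (2 * m)" for m
  proof -
    define g where "g = (\<lambda>i. real ((2 * m) choose i) * b ^ i * a ^ (2 * m - i) * ((real (2 * m) + 1) / (real i + 1)) ^ r)"
    have g0: "g i \<ge> 0" for i using assms by (simp add: g_def)
    have "(\<Sum>j\<le>m. real ((2 * m) choose (2 * j)) * b ^ (2 * j) * a ^ (2 * (m - j)) * ((real m + 1) / (real j + 1)) ^ r) \<le> (\<Sum>j\<le>m. 2 ^ r * g (2 * j))"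
    proof (rule sum_mono)
      fix j
      have "(real m + 1) / (real j + 1) \<le> 2 * ((real (2 * m) + 1) / (real (2 * j) + 1))"
        by (simp add: field_simps)
      then have "((real m + 1) / (real j + 1)) ^ r \<le> (2 * ((real (2 * m) + 1) / (real (2 * j) + 1))) ^ r"
        by (intro power_mono) auto
      then have "real ((2 * m) choose (2 * j)) * b ^ (2 * j) * a ^ (2 * (m - j)) * ((real m + 1) / (real j + 1)) ^ r
         \<le> real ((2 * m) choose (2 * j)) * b ^ (2 * j) * a ^ (2 * (m - j)) * (2 * ((real (2 * m) + 1) / (real (2 * j) + 1))) ^ r"
        using assms by (intro mult_left_mono) auto
      also have "\<dots> = 2 ^ r * g (2 * j)" unfolding g_def power_mult_distrib by (simp add: right_diff_distrib')
      finally show "real ((2 * m) choose (2 * j)) * b ^ (2 * j) * a ^ (2 * (m - j)) * ((real m + 1) / (real j + 1)) ^ r \<le> 2 ^ r * g (2 * j)" .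
    qed
    also have "\<dots> = 2 ^ r * sum g ((\<lambda>j. 2 * j) ` {..m})"
      by (simp add: sum.reindex inj_on_def sum_distrib_left)
    also have "\<dots> \<le> 2 ^ r * sum g {..2 * m}"
      using g0 by (intro mult_left_mono sum_mono2) auto
    also have "\<dots> \<le> 2 ^ r * (C * (a + b) ^ (2 * m))"
      unfolding g_def by (intro mult_left_mono C(2)) auto
    finally show ?thesis by (simp only: mult.assoc)
  qed
  moreover have "2 ^ r * C > 0" using C by simp
  ultimately show ?thesis using that by blast
qed

text \<open>One of \<open>j\<close> and \<open>m - j\<close> is at least \<open>m / 2\<close>, so one of the two factors is at most \<open>2 ^ r\<close> and the
other one is a negative moment of the binomial distribution, in \<open>j\<close> or in \<open>m - j\<close>.\<close>

lemma even_binomial_moment_both: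
  fixes a b :: real
  assumes a: "a > 0" and b: "b > 0"
  obtains C where "C > 0"
    "\<And>m. (\<Sum>j\<le>m. real ((2 * m) choose (2 * j)) * b ^ (2 * j) * a ^ (2 * (m - j))
        * (((real m + 1) / (real j + 1)) ^ r * ((real m + 1) / (real (m - j) + 1)) ^ r)) \<le> C * (a + b) ^ (2 * m)"
proof -
  obtain C1 where C1: "C1 > 0" "\<And>m. (\<Sum>j\<le>m. real ((2 * m) choose (2 * j)) * b ^ (2 * j) * a ^ (2 * (m - j)) * ((real m + 1) / (real j + 1)) ^ r) \<le> C1 * (a + b) ^ (2 * m)"
    using even_binomial_moment[OF a b] by blast
  obtain C2 where C2: "C2 > 0" "\<And>m. (\<Sum>j\<le>m. real ((2 * m) choose (2 * j)) * a ^ (2 * j) * b ^ (2 * (m - j)) * ((real m + 1) / (real j + 1)) ^ r) \<le> C2 * (b + a) ^ (2 * m)"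
    using even_binomial_moment[OF b a] by blast
  have "(\<Sum>j\<le>m. real ((2 * m) choose (2 * j)) * b ^ (2 * j) * a ^ (2 * (m - j))
        * (((real m + 1) / (real j + 1)) ^ r * ((real m + 1) / (real (m - j) + 1)) ^ r)) \<le> (2 ^ r * (C1 + C2)) * (a + b) ^ (2 * m)" for m
  proof -
    define w where "w = (\<lambda>j. real ((2 * m) choose (2 * j)) * b ^ (2 * j) * a ^ (2 * (m - j)))"
    define X where "X = (\<lambda>j. (real m + 1) / (real j + 1))"
    have w0: "w j \<ge> 0" for j using a b by (simp add: w_def)
    have X0: "X j \<ge> 0" for j by (simp add: X_def)
    have XY: "X j ^ r * X (m - j) ^ r \<le> 2 ^ r * (X j ^ r + X (m - j) ^ r)" if j: "j \<le> m" for j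
    proof -
      have "X j \<le> 2 \<or> X (m - j) \<le> 2"
        using j by (auto simp: X_def divide_le_eq of_nat_diff)
      then show ?thesis
      proof
        assume "X j \<le> 2"
        then have "X j ^ r * X (m - j) ^ r \<le> 2 ^ r * X (m - j) ^ r" using X0 by (intro mult_right_mono power_mono) auto
        also have "\<dots> \<le> 2 ^ r * (X j ^ r + X (m - j) ^ r)" using X0 by (intro mult_left_mono) auto
        finally show ?thesis .
      next
        assume "X (m - j) \<le> 2"
        then have "X j ^ r * X (m - j) ^ r \<le> X j ^ r * 2 ^ r" using X0 by (intro mult_left_mono power_mono) auto
        also have "\<dots> \<le> (X j ^ r + X (m - j) ^ r) * 2 ^ r" using X0 by (intro mult_right_mono) auto
        finally show ?thesis by (simp only: mult.commute)
      qed
    qed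
    have "(\<Sum>j\<le>m. w j * (X j ^ r * X (m - j) ^ r)) \<le> (\<Sum>j\<le>m. w j * (2 ^ r * (X j ^ r + X (m - j) ^ r)))"
      using w0 XY by (intro sum_mono mult_left_mono) auto
    also have "\<dots> = 2 ^ r * ((\<Sum>j\<le>m. w j * X j ^ r) + (\<Sum>j\<le>m. w j * X (m - j) ^ r))"
      by (simp add: sum_distrib_left sum.distrib[symmetric] algebra_simps)
    also have "(\<Sum>j\<le>m. w j * X (m - j) ^ r) = (\<Sum>j\<le>m. real ((2 * m) choose (2 * j)) * a ^ (2 * j) * b ^ (2 * (m - j)) * X j ^ r)"
    proof (rule sum.reindex_bij_witness[where i = "\<lambda>j. m - j" and j = "\<lambda>j. m - j"])
      fix j assume j: "j \<in> {..m}"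
      have "(2 * m) choose (2 * j) = (2 * m) choose (2 * (m - j))"
        using j binomial_symmetric[of "2 * j" "2 * m"] by (simp add: right_diff_distrib')
      then show "real ((2 * m) choose (2 * (m - j))) * a ^ (2 * (m - j)) * b ^ (2 * (m - (m - j))) * X (m - j) ^ r = w j * X (m - j) ^ r"
        using j by (simp add: w_def)
    qed auto
    also have "2 ^ r * ((\<Sum>j\<le>m. w j * X j ^ r) + (\<Sum>j\<le>m. real ((2 * m) choose (2 * j)) * a ^ (2 * j) * b ^ (2 * (m - j)) * X j ^ r))
       \<le> 2 ^ r * (C1 * (a + b) ^ (2 * m) + C2 * (b + a) ^ (2 * m))"
      unfolding w_def X_def by (intro mult_left_mono add_mono C1 C2) auto
    also have "\<dots> = (2 ^ r * (C1 + C2)) * (a + b) ^ (2 * m)" by (simp add: algebra_simps)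
    finally show ?thesis by (simp only: w_def X_def)
  qed
  moreover have "2 ^ r * (C1 + C2) > 0" using C1 C2 by simp
  ultimately show ?thesis using that by blast
qed

text \<open>The factor \<open>(2 m)!\<close> from the Gamma function and the factorials of the coefficients form the binomial
coefficient of \<open>2 j\<close> out of \<open>2 m\<close>.  The remaining powers of \<open>j + 1\<close>, \<open>m - j + 1\<close> and \<open>m + 1\<close> have
total exponent \<open>- 1 - \<alpha>\<close>; relative to \<open>m + 1\<close> they are bounded by negative moments.\<close>

lemma I_K_convolution_bound:
  assumes a: "a > 0" and b: "b > 0" and \<nu>: "\<nu> \<ge> 0" and \<sigma>: "\<sigma> \<notin> \<int>"
  obtains C where "C > 0"
    "\<And>m. (\<Sum>j\<le>m. I_coeff b \<nu> j * \<bar>K_coeff a \<sigma> (m - j)\<bar>) * \<bar>Gamma ((1 - \<alpha> + \<nu> - \<sigma>) + real (2 * m))\<bar>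
        \<le> C * ((a + b) ^ (2 * m) * real (Suc m) powr (- 1 - \<alpha>))"
proof -
  obtain A1 where A1: "A1 > 0" "\<And>j. I_coeff b \<nu> j \<le> A1 * (b ^ (2 * j) * real (Suc j) powr (- \<nu> - 1 / 2) / fact (2 * j))"
    using I_coeff_bound[OF b \<nu>] by blast
  obtain A2 where A2: "A2 > 0" "\<And>k. \<bar>K_coeff a \<sigma> k\<bar> \<le> A2 * (a ^ (2 * k) * real (Suc k) powr (\<sigma> - 1 / 2) / fact (2 * k))"
    using K_coeff_bound[OF a \<sigma>] by blast
  define q where "q = 1 - \<alpha> + \<nu> - \<sigma>"
  obtain A3 where A3: "A3 > 0" "\<And>n. \<bar>Gamma (q + real n)\<bar> \<le> A3 * (fact n * real (Suc n) powr (q - 1))"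
    using Gamma_bound by blast
  \<comment> \<open>An integer no smaller than the exponents of the factors \<open>(m + 1) / (j + 1)\<close> and \<open>(m + 1) / (m - j + 1)\<close>.\<close>
  define r where "r = nat \<lceil>\<bar>\<nu>\<bar> + \<bar>\<sigma>\<bar> + 1\<rceil>"
  have "\<bar>\<nu>\<bar> + \<bar>\<sigma>\<bar> + 1 \<le> real r" unfolding r_def by linarith
  then have r: "\<nu> + 1 / 2 \<le> real r" "1 / 2 - \<sigma> \<le> real r" using \<nu> abs_ge_minus_self[of \<sigma>] by auto
  obtain C where C: "C > 0" "\<And>m. (\<Sum>j\<le>m. real ((2 * m) choose (2 * j)) * b ^ (2 * j) * a ^ (2 * (m - j))
        * (((real m + 1) / (real j + 1)) ^ r * ((real m + 1) / (real (m - j) + 1)) ^ r)) \<le> C * (a + b) ^ (2 * m)"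
    using even_binomial_moment_both[OF a b] by blast
  define A4 where "A4 = 2 powr \<bar>q - 1\<bar>"
  have m4: "real (Suc (2 * m)) powr (q - 1) \<le> A4 * real (Suc m) powr (q - 1)" for m
  proof -
    define R where "R = real (Suc (2 * m)) / real (Suc m)"
    have R: "1 \<le> R" "R \<le> 2" by (auto simp: R_def field_simps)
    have "R powr (q - 1) \<le> R powr \<bar>q - 1\<bar>" using R by (intro powr_mono) auto
    also have "\<dots> \<le> A4" unfolding A4_def using R by (intro powr_mono2) auto
    finally have "R powr (q - 1) * real (Suc m) powr (q - 1) \<le> A4 * real (Suc m) powr (q - 1)" by (intro mult_right_mono) auto
    moreover have "R powr (q - 1) * real (Suc m) powr (q - 1) = real (Suc (2 * m)) powr (q - 1)"
      unfolding powr_mult[symmetric] by (simp add: R_def)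
    ultimately show ?thesis by (simp only:)
  qed
  define B where "B = A1 * A2 * A3 * A4"
  have B0: "B > 0" using A1 A2 A3 by (simp add: B_def A4_def)
  have "(\<Sum>j\<le>m. I_coeff b \<nu> j * \<bar>K_coeff a \<sigma> (m - j)\<bar>) * \<bar>Gamma (q + real (2 * m))\<bar>
        \<le> (B * C) * ((a + b) ^ (2 * m) * real (Suc m) powr (- 1 - \<alpha>))" for m
  proof -
    define M where "M = real (Suc m)"
    have M: "M > 0" by (simp add: M_def)
    have G: "\<bar>Gamma (q + real (2 * m))\<bar> \<le> A3 * (fact (2 * m) * (A4 * M powr (q - 1)))"
    proof -
      have "\<bar>Gamma (q + real (2 * m))\<bar> \<le> A3 * (fact (2 * m) * real (Suc (2 * m)) powr (q - 1))" by (rule A3(2))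
      also have "\<dots> \<le> A3 * (fact (2 * m) * (A4 * M powr (q - 1)))"
        unfolding M_def using A3(1) m4 by (intro mult_left_mono) auto
      finally show ?thesis .
    qed
    have t: "I_coeff b \<nu> j * \<bar>K_coeff a \<sigma> (m - j)\<bar> * \<bar>Gamma (q + real (2 * m))\<bar>
       \<le> (B * M powr (- 1 - \<alpha>)) * (real ((2 * m) choose (2 * j)) * b ^ (2 * j) * a ^ (2 * (m - j))
          * (((real m + 1) / (real j + 1)) ^ r * ((real m + 1) / (real (m - j) + 1)) ^ r))" if j: "j \<le> m" for j
    proof -
      define J where "J = real (Suc j)"
      define K where "K = real (Suc (m - j))"
      have J: "0 < J" "J \<le> M" and K: "0 < K" "K \<le> M" using j by (auto simp: J_def K_def M_def)
      have "I_coeff b \<nu> j * \<bar>K_coeff a \<sigma> (m - j)\<bar> * \<bar>Gamma (q + real (2 * m))\<bar>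
         \<le> (A1 * (b ^ (2 * j) * J powr (- \<nu> - 1 / 2) / fact (2 * j))) * (A2 * (a ^ (2 * (m - j)) * K powr (\<sigma> - 1 / 2) / fact (2 * (m - j)))) * (A3 * (fact (2 * m) * (A4 * M powr (q - 1))))"
        using A1 A2 A3 a b I_coeff_nonneg[OF \<nu>] unfolding J_def K_def
        by (intro mult_mono G mult_nonneg_nonneg) auto
      also have "\<dots> = B * (fact (2 * m) / (fact (2 * j) * fact (2 * (m - j)))) * b ^ (2 * j) * a ^ (2 * (m - j))
           * (J powr (- \<nu> - 1 / 2) * K powr (\<sigma> - 1 / 2) * M powr (q - 1))"
        by (simp add: B_def)
      also have "fact (2 * m) / (fact (2 * j) * fact (2 * (m - j))) = real ((2 * m) choose (2 * j))"
        using j binomial_fact[of "2 * j" "2 * m", where 'a = real] by (simp add: right_diff_distrib')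
      also have "J powr (- \<nu> - 1 / 2) * K powr (\<sigma> - 1 / 2) * M powr (q - 1) = M powr (- 1 - \<alpha>) * ((M / J) powr (\<nu> + 1 / 2) * (M / K) powr (1 / 2 - \<sigma>))"
      proof -
        have "M powr (q - 1) = M powr (- 1 - \<alpha>) * M powr (\<nu> + 1 / 2) * M powr (1 / 2 - \<sigma>)"
          unfolding powr_add[symmetric] by (simp add: q_def algebra_simps)
        moreover have "J powr (- \<nu> - 1 / 2) = 1 / J powr (\<nu> + 1 / 2)"
          using powr_minus_divide[of J "\<nu> + 1 / 2"] by simp
        moreover have "K powr (\<sigma> - 1 / 2) = 1 / K powr (1 / 2 - \<sigma>)"
          using powr_minus_divide[of K "1 / 2 - \<sigma>"] by simp
        ultimately show ?thesis by (simp add: powr_divide)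
      qed
      also have "B * real ((2 * m) choose (2 * j)) * b ^ (2 * j) * a ^ (2 * (m - j)) * (M powr (- 1 - \<alpha>) * ((M / J) powr (\<nu> + 1 / 2) * (M / K) powr (1 / 2 - \<sigma>)))
          \<le> B * real ((2 * m) choose (2 * j)) * b ^ (2 * j) * a ^ (2 * (m - j)) * (M powr (- 1 - \<alpha>) * ((M / J) ^ r * (M / K) ^ r))"
      proof -
        have "(M / J) powr (\<nu> + 1 / 2) \<le> (M / J) powr real r" "(M / K) powr (1 / 2 - \<sigma>) \<le> (M / K) powr real r"
          using J K r by (auto intro!: powr_mono)
        then have "(M / J) powr (\<nu> + 1 / 2) \<le> (M / J) ^ r" "(M / K) powr (1 / 2 - \<sigma>) \<le> (M / K) ^ r"
          using J K M by (simp_all add: powr_realpow)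
        then show ?thesis using B0 a b M J K by (intro mult_left_mono mult_mono) auto
      qed
      finally show ?thesis by (simp add: M_def J_def K_def add_ac mult_ac)
    qed
    have "(\<Sum>j\<le>m. I_coeff b \<nu> j * \<bar>K_coeff a \<sigma> (m - j)\<bar>) * \<bar>Gamma (q + real (2 * m))\<bar>
       \<le> (\<Sum>j\<le>m. (B * M powr (- 1 - \<alpha>)) * (real ((2 * m) choose (2 * j)) * b ^ (2 * j) * a ^ (2 * (m - j))
          * (((real m + 1) / (real j + 1)) ^ r * ((real m + 1) / (real (m - j) + 1)) ^ r)))"
      unfolding sum_distrib_right by (intro sum_mono t) auto
    also have "\<dots> = (B * M powr (- 1 - \<alpha>)) * (\<Sum>j\<le>m. real ((2 * m) choose (2 * j)) * b ^ (2 * j) * a ^ (2 * (m - j))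
          * (((real m + 1) / (real j + 1)) ^ r * ((real m + 1) / (real (m - j) + 1)) ^ r))"
      by (rule sum_distrib_left[symmetric])
    also have "\<dots> \<le> (B * M powr (- 1 - \<alpha>)) * (C * (a + b) ^ (2 * m))"
      using B0 by (intro mult_left_mono C(2)) auto
    finally show ?thesis by (simp add: M_def mult_ac)
  qed
  moreover have "B * C > 0" using B0 C by simp
  ultimately show ?thesis using that unfolding q_def by blast
qed

text \<open>With the growth of the zeta function the diagonals are bounded by
\<open>((a + b) / (2 * pi)) ^ (2 * m) * (m + 1) powr (- 1 - \<alpha>)\<close>: a geometric factor if \<open>a + b < 2 * pi\<close>, and
a convergent power of \<open>m\<close> if \<open>a + b = 2 * pi\<close> and \<open>\<alpha> > 0\<close>.\<close>

lemma summable_residue_diagonals: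
  assumes a: "a > 0" and b: "b > 0" and \<nu>: "\<nu> \<ge> 0" and \<sigma>: "\<sigma> \<notin> \<int>"
    and ab: "a + b < 2 * pi \<or> (a + b \<le> 2 * pi \<and> \<alpha> > 0)"
  shows "summable (\<lambda>m. \<Sum>j\<le>m. norm (complex_of_real (I_coeff b \<nu> j * K_coeff a \<sigma> (m - j)) * zeta (of_real (s_pole \<alpha> \<nu> \<sigma> m))))"
proof -
  define q where "q = 1 - \<alpha> + \<nu> - \<sigma>"
  obtain C where C: "C > 0" "\<And>m. (\<Sum>j\<le>m. I_coeff b \<nu> j * \<bar>K_coeff a \<sigma> (m - j)\<bar>) * \<bar>Gamma (q + real (2 * m))\<bar>
        \<le> C * ((a + b) ^ (2 * m) * real (Suc m) powr (- 1 - \<alpha>))"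
    using I_K_convolution_bound[OF a b \<nu> \<sigma>, of \<alpha>] unfolding q_def by blast
  obtain Z where Z: "Z \<ge> 0" "\<And>s. Re s \<le> -1/2 \<Longrightarrow> \<bar>Im s\<bar> \<le> 0 \<Longrightarrow> norm (zeta s) \<le> Z * (2 * pi) powr - (1 - Re s) * Gamma (1 - Re s)"
    using zeta_growth[of 0] by blast
  define \<rho> where "\<rho> = (a + b) / (2 * pi)"
  have \<rho>: "\<rho> > 0" using a b by (simp add: \<rho>_def)
  define D where "D = (\<lambda>m. \<Sum>j\<le>m. I_coeff b \<nu> j * \<bar>K_coeff a \<sigma> (m - j)\<bar>)"
  have D0: "D m \<ge> 0" for m unfolding D_def by (intro sum_nonneg mult_nonneg_nonneg I_coeff_nonneg \<nu>) auto
  have D_eq: "(\<Sum>j\<le>m. norm (complex_of_real (I_coeff b \<nu> j * K_coeff a \<sigma> (m - j)) * zeta (of_real (s_pole \<alpha> \<nu> \<sigma> m)))) = D m * norm (zeta (of_real (s_pole \<alpha> \<nu> \<sigma> m)))" for m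
    unfolding D_def sum_distrib_right by (intro sum.cong refl) (simp add: norm_mult abs_mult I_coeff_nonneg[OF \<nu>])
  define E where "E = Z * (2 * pi) powr - q * C"
  have bound: "\<forall>\<^sub>F m in sequentially. norm (D m * norm (zeta (of_real (s_pole \<alpha> \<nu> \<sigma> m)))) \<le> E * (\<rho> ^ (2 * m) * real (Suc m) powr (- 1 - \<alpha>))"
  proof -
    have "\<forall>\<^sub>F m in sequentially. q + real (2 * m) \<ge> 3 / 2" by real_asymp
    then show ?thesis
    proof eventually_elim
      case (elim m)
      define s where "s = complex_of_real (s_pole \<alpha> \<nu> \<sigma> m)"
      have s: "1 - Re s = q + real (2 * m)" "Im s = 0" by (auto simp: s_def s_pole_def q_def)
      have "norm (zeta s) \<le> Z * (2 * pi) powr - (q + real (2 * m)) * Gamma (q + real (2 * m))"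
        using Z(2)[of s] s elim by simp
      also have "\<dots> \<le> Z * (2 * pi) powr - (q + real (2 * m)) * \<bar>Gamma (q + real (2 * m))\<bar>"
        using Z(1) by (intro mult_left_mono) auto
      finally have "D m * norm (zeta s) \<le> D m * (Z * (2 * pi) powr - (q + real (2 * m)) * \<bar>Gamma (q + real (2 * m))\<bar>)"
        using D0 by (intro mult_left_mono) auto
      also have "\<dots> = Z * (2 * pi) powr - (q + real (2 * m)) * (D m * \<bar>Gamma (q + real (2 * m))\<bar>)" by simp
      also have "\<dots> \<le> Z * (2 * pi) powr - (q + real (2 * m)) * (C * ((a + b) ^ (2 * m) * real (Suc m) powr (- 1 - \<alpha>)))"
        unfolding D_def using C(2)[of m] Z(1) by (intro mult_left_mono) auto
      also have "(2 * pi) powr - (q + real (2 * m)) = (2 * pi) powr - q / (2 * pi) ^ (2 * m)"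
      proof -
        have "(2 * pi) powr - (q + real (2 * m)) = (2 * pi) powr - q * (2 * pi) powr - real (2 * m)" unfolding powr_add[symmetric] by simp
        also have "(2 * pi) powr - real (2 * m) = 1 / (2 * pi) ^ (2 * m)"
          using powr_minus_divide[of "2 * pi" "real (2 * m)"] powr_realpow[of "2 * pi" "2 * m"] by simp
        finally show ?thesis by simp
      qed
      also have "Z * ((2 * pi) powr - q / (2 * pi) ^ (2 * m)) * (C * ((a + b) ^ (2 * m) * real (Suc m) powr (- 1 - \<alpha>))) = E * (\<rho> ^ (2 * m) * real (Suc m) powr (- 1 - \<alpha>))"
        by (simp add: E_def \<rho>_def power_divide)
      finally show ?case using D0[of m] by (simp add: s_def)
    qed
  qed
  have "summable (\<lambda>m. \<rho> ^ (2 * m) * real (Suc m) powr (- 1 - \<alpha>))"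
  proof (cases "\<rho> < 1")
    case True
    define y where "y = - 2 * ln \<rho>"
    have y: "y > 0" using True \<rho> by (simp add: y_def)
    have eq: "\<rho> ^ (2 * m) * real (Suc m) powr (- 1 - \<alpha>) = exp y * (real (Suc m) powr (- 1 - \<alpha>) * exp (- (real (Suc m) * y)))" for m
    proof -
      have "exp y * exp (- (real (Suc m) * y)) = exp (real (2 * m) * ln \<rho>)" by (simp add: mult_exp_exp y_def algebra_simps)
      also have "\<dots> = \<rho> ^ (2 * m)" using \<rho> by (simp only: exp_of_nat_mult exp_ln)
      finally show ?thesis by (simp add: mult_ac)
    qed
    show ?thesis unfolding eq by (rule summable_mult[OF summable_powr_exp[OF y]])
  next
    case False
    have "a + b = 2 * pi" "\<alpha> > 0" using False ab by (auto simp: \<rho>_def field_simps)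
    then have "\<rho> = 1" by (simp add: \<rho>_def)
    moreover have "summable (\<lambda>m. real (Suc m) powr (- 1 - \<alpha>))" using \<open>\<alpha> > 0\<close> by (subst summable_Suc_iff) (simp add: summable_real_powr_iff)
    ultimately show ?thesis by simp
  qed
  from summable_mult[OF this, of E] show ?thesis
    unfolding D_eq using bound by (rule summable_comparison_test_ev[rotated])
qed

section \<open>The Mellin transform of the product\<close>

lemma bessel_I_expansion:
  assumes b: "b > 0" and t: "t > 0"
  shows "bessel_I \<nu> (b * t) = (\<Sum>j. I_coeff b \<nu> j * t powr (\<nu> + 2 * real j))"
proof -
  have "rGamma (\<nu> + real j + 1) / fact j * (b * t / 2) powr (\<nu> + 2 * real j) = I_coeff b \<nu> j * t powr (\<nu> + 2 * real j)" for j
    using b t powr_mult[of "b / 2" t "\<nu> + 2 * real j"] by (simp add: I_coeff_def)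
  then show ?thesis unfolding bessel_I_def by simp
qed

text \<open>The terms are \<open>(b / a) ^ (2 * j)\<close> times a power of \<open>j\<close>, up to constants.\<close>

lemma summable_I_coeff_Gamma:
  assumes b: "0 < b" "b < a" and \<nu>: "\<nu> \<ge> 0"
  shows "summable (\<lambda>j. I_coeff b \<nu> j * (\<bar>Gamma (x + real j)\<bar> * \<bar>Gamma (y + real j)\<bar>) * (a / 2) powr - (2 * real j))"
proof -
  obtain A1 where A1: "A1 > 0" "\<And>n. \<bar>rGamma ((\<nu> + 1) + real n)\<bar> \<le> A1 * (real (Suc n) powr (1 - (\<nu> + 1)) / fact n)"
    using rGamma_bound by blast
  obtain A2 where A2: "A2 > 0" "\<And>n. \<bar>Gamma (x + real n)\<bar> \<le> A2 * (fact n * real (Suc n) powr (x - 1))" using Gamma_bound by blast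
  obtain A3 where A3: "A3 > 0" "\<And>n. \<bar>Gamma (y + real n)\<bar> \<le> A3 * (fact n * real (Suc n) powr (y - 1))" using Gamma_bound by blast
  have a: "a > 0" using b by simp
  define \<theta> where "\<theta> = (b / a)\<^sup>2"
  have \<theta>: "0 < \<theta>" "\<theta> < 1" using b a by (auto simp: \<theta>_def power_less_one_iff)
  define e where "e = (1 - (\<nu> + 1)) + (x - 1) + (y - 1)"
  define Y where "Y = - ln \<theta>"
  have Y: "Y > 0" using \<theta> by (simp add: Y_def)
  define B where "B = A1 * A2 * A3 * (b / 2) powr \<nu> * exp Y"
  show ?thesis
  proof (rule summable_comparison_test'[OF summable_mult[OF summable_powr_exp[OF Y, of e], of B]])
    fix j
    define S where "S = real (Suc j)"
    have "0 \<le> I_coeff b \<nu> j * (\<bar>Gamma (x + real j)\<bar> * \<bar>Gamma (y + real j)\<bar>) * (a / 2) powr - (2 * real j)"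
      by (intro mult_nonneg_nonneg I_coeff_nonneg \<nu>) auto
    then have "norm (I_coeff b \<nu> j * (\<bar>Gamma (x + real j)\<bar> * \<bar>Gamma (y + real j)\<bar>) * (a / 2) powr - (2 * real j))
       = I_coeff b \<nu> j * (\<bar>Gamma (x + real j)\<bar> * \<bar>Gamma (y + real j)\<bar>) * (a / 2) powr - (2 * real j)" by simp
    also have "\<dots> \<le> ((A1 * (S powr (1 - (\<nu> + 1)) / fact j)) / fact j * (b / 2) powr (\<nu> + 2 * real j)) * ((A2 * (fact j * S powr (x - 1))) * (A3 * (fact j * S powr (y - 1)))) * (a / 2) powr - (2 * real j)"
    proof (intro mult_right_mono mult_mono)
      have "rGamma (\<nu> + real j + 1) \<le> A1 * (S powr (1 - (\<nu> + 1)) / fact j)"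
        using A1(2)[of j] abs_ge_self[of "rGamma ((\<nu> + 1) + real j)"] by (simp add: S_def add_ac)
      then show "I_coeff b \<nu> j \<le> (A1 * (S powr (1 - (\<nu> + 1)) / fact j)) / fact j * (b / 2) powr (\<nu> + 2 * real j)"
        unfolding I_coeff_def by (intro mult_right_mono divide_right_mono) auto
    qed (use A1 A2 A3 in \<open>auto simp: S_def\<close>)
    also have "\<dots> = A1 * A2 * A3 * (S powr (1 - (\<nu> + 1)) * S powr (x - 1) * S powr (y - 1)) * ((b / 2) powr (\<nu> + 2 * real j) * (a / 2) powr - (2 * real j))"
      by simp
    also have "S powr (1 - (\<nu> + 1)) * S powr (x - 1) * S powr (y - 1) = S powr e"
      unfolding powr_add[symmetric] e_def by simp
    also have "(b / 2) powr (\<nu> + 2 * real j) * (a / 2) powr - (2 * real j) = (b / 2) powr \<nu> * \<theta> ^ j"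
    proof -
      have "(b / 2) powr (2 * real j) = (b / 2) ^ (2 * j)" "(a / 2) powr (2 * real j) = (a / 2) ^ (2 * j)"
        using b a powr_realpow[of "b / 2" "2 * j"] powr_realpow[of "a / 2" "2 * j"] by simp_all
      then have "(b / 2) powr (2 * real j) * (a / 2) powr - (2 * real j) = \<theta> ^ j"
        using a unfolding powr_minus_divide by (simp add: \<theta>_def power_divide power_mult[symmetric])
      then show ?thesis unfolding powr_add by (simp only: mult.assoc)
    qed
    also have "\<theta> ^ j = exp Y * exp (- (S * Y))"
    proof -
      have "exp Y * exp (- (S * Y)) = exp (real j * ln \<theta>)" by (simp add: mult_exp_exp Y_def S_def algebra_simps)
      also have "\<dots> = \<theta> ^ j" using \<theta> by (simp only: exp_of_nat_mult exp_ln)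
      finally show ?thesis ..
    qed
    finally show "norm (I_coeff b \<nu> j * (\<bar>Gamma (x + real j)\<bar> * \<bar>Gamma (y + real j)\<bar>) * (a / 2) powr - (2 * real j)) \<le> B * (real (Suc j) powr e * exp (- (real (Suc j) * Y)))"
      by (simp add: B_def S_def mult_ac)
  qed
qed

lemma summable_I_coeff_mellin_K:
  assumes b: "0 < b" "b < a" and \<nu>: "\<nu> \<ge> 0"
  shows "summable (\<lambda>j. norm (I_coeff b \<nu> j * mellin_K a \<mu> (s + 2 * real j)))"
proof -
  have eq: "norm (I_coeff b \<nu> j * mellin_K a \<mu> (s + 2 * real j)) = (a / 2) powr - s / 4 * (I_coeff b \<nu> j * (\<bar>Gamma ((s - \<mu>) / 2 + real j)\<bar> * \<bar>Gamma ((s + \<mu>) / 2 + real j)\<bar>) * (a / 2) powr - (2 * real j))" for j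
  proof -
    have e1: "(s + 2 * real j - \<mu>) / 2 = (s - \<mu>) / 2 + real j" "(s + 2 * real j + \<mu>) / 2 = (s + \<mu>) / 2 + real j" by (simp_all add: field_simps)
    have e2: "(a / 2) powr - (s + 2 * real j) = (a / 2) powr - s * (a / 2) powr - (2 * real j)" unfolding powr_add[symmetric] by simp
    show ?thesis unfolding mellin_K_def e1 e2 real_norm_def abs_mult abs_divide by (simp add: I_coeff_nonneg[OF \<nu>] mult_ac)
  qed
  show ?thesis unfolding eq by (intro summable_mult summable_I_coeff_Gamma b \<nu>)
qed

text \<open>The terms of the series of \<open>I\<^sub>\<nu>\<close> and the function \<open>K\<^sub>\<mu>\<close> are nonnegative, so convergence of the
series of integrals justifies termwise integration.\<close>

lemma KI_mellin_real:
  assumes \<mu>: "\<mu> \<notin> \<int>" "\<mu> > 0" and b: "0 < b" "b < a" and \<nu>: "\<nu> \<ge> 0" and s: "s + \<nu> > \<mu>"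
  shows "integrable pos_lborel (\<lambda>t. t powr (s - 1) * bessel_K \<mu> (a * t) * bessel_I \<nu> (b * t))"
    and "(\<integral>t. t powr (s - 1) * bessel_K \<mu> (a * t) * bessel_I \<nu> (b * t) \<partial>pos_lborel) = (\<Sum>j. I_coeff b \<nu> j * mellin_K a \<mu> (s + \<nu> + 2 * real j))"
proof -
  have a: "a > 0" using b by simp
  have [measurable]: "bessel_K \<mu> \<in> borel_measurable borel" by (rule bessel_K_measurable[OF \<mu>(1)])
  have [measurable]: "bessel_I \<nu> \<in> borel_measurable borel" unfolding bessel_I_def by measurable
  define f where "f = (\<lambda>j t. I_coeff b \<nu> j * (t powr (s + \<nu> + 2 * real j - 1) * bessel_K \<mu> (a * t)))"
  have sj: "s + \<nu> + 2 * real j > \<mu>" for j using s by (simp add: add_strict_increasing2)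
  have fi: "integrable pos_lborel (f j)" for j
    unfolding f_def by (intro integrable_mult_right bessel_K_mellin(1)[OF \<mu> a sj])
  have fI: "(\<integral>t. f j t \<partial>pos_lborel) = I_coeff b \<nu> j * mellin_K a \<mu> (s + \<nu> + 2 * real j)" for j
    unfolding f_def using bessel_K_mellin(2)[OF \<mu> a sj] by simp
  have f0: "f j t \<ge> 0" if "t > 0" for j t
    unfolding f_def using I_coeff_nonneg[OF \<nu>] bessel_K_eq_mixture(2)[OF \<mu>, of "a * t"] a that by (intro mult_nonneg_nonneg) auto
  have fn: "(\<integral>t. norm (f j t) \<partial>pos_lborel) = I_coeff b \<nu> j * mellin_K a \<mu> (s + \<nu> + 2 * real j)" for j
    unfolding fI[symmetric] by (rule integral_pos_lborel_cong) (use f0 in \<open>auto simp: f_def\<close>)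
  have ft: "f j t = (t powr (s - 1) * bessel_K \<mu> (a * t)) * (I_coeff b \<nu> j * t powr (\<nu> + 2 * real j))" for j t
  proof -
    have "t powr (s - 1) * t powr (\<nu> + 2 * real j) = t powr (s + \<nu> + 2 * real j - 1)" unfolding powr_add[symmetric] by (simp add: algebra_simps)
    then show ?thesis by (simp add: f_def mult_ac)
  qed
  have sI: "summable (\<lambda>j. I_coeff b \<nu> j * t powr (\<nu> + 2 * real j))" if t: "t > 0" for t
  proof -
    obtain A1 where A1: "A1 > 0" "\<And>n. \<bar>rGamma ((\<nu> + 1) + real n)\<bar> \<le> A1 * (real (Suc n) powr (1 - (\<nu> + 1)) / fact n)"
      using rGamma_bound by blast
    show ?thesis
    proof (rule summable_comparison_test')
    show "summable (\<lambda>j. (A1 * (b * t / 2) powr \<nu>) * (inverse (fact j) * ((b * t / 2)\<^sup>2) ^ j))"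
      by (intro summable_mult summable_exp)
    fix j
    have n0: "I_coeff b \<nu> j * t powr (\<nu> + 2 * real j) \<ge> 0" using I_coeff_nonneg[OF \<nu>] by simp
    have "I_coeff b \<nu> j * t powr (\<nu> + 2 * real j) = rGamma (\<nu> + real j + 1) * ((b * t / 2) powr (\<nu> + 2 * real j) / fact j)"
      using b t powr_mult[of "b / 2" t "\<nu> + 2 * real j"] by (simp add: I_coeff_def)
    also have "\<dots> \<le> A1 * ((b * t / 2) powr (\<nu> + 2 * real j) / fact j)"
    proof (rule mult_right_mono)
      have "real (Suc j) powr (1 - (\<nu> + 1)) \<le> 1" using \<nu> powr_mono[of "- \<nu>" 0 "real (Suc j)"] by simp
      moreover have "(1::real) \<le> fact j" by (rule fact_ge_1)
      ultimately have "real (Suc j) powr (1 - (\<nu> + 1)) \<le> 1 * fact j" by linarith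
      then have "real (Suc j) powr (1 - (\<nu> + 1)) / fact j \<le> 1" by (subst divide_le_eq) auto
      then have "A1 * (real (Suc j) powr (1 - (\<nu> + 1)) / fact j) \<le> A1 * 1" using A1(1) by (intro mult_left_mono) auto
      then show "rGamma (\<nu> + real j + 1) \<le> A1"
        using A1(2)[of j] abs_ge_self[of "rGamma ((\<nu> + 1) + real j)"] by (simp add: add_ac)
    qed (use b t in auto)
    also have "(b * t / 2) powr (\<nu> + 2 * real j) = (b * t / 2) powr \<nu> * ((b * t / 2)\<^sup>2) ^ j"
    proof -
      have "(b * t / 2) powr (2 * real j) = ((b * t / 2)\<^sup>2) ^ j"
        using b t powr_realpow[of "b * t / 2" "2 * j"] by (simp add: power_mult del: power_divide)
      then show ?thesis unfolding powr_add by (simp only:)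
    qed
    finally have le: "I_coeff b \<nu> j * t powr (\<nu> + 2 * real j) \<le> A1 * ((b * t / 2) powr \<nu> * ((b * t / 2)\<^sup>2) ^ j / fact j)" .
    have "A1 * ((b * t / 2) powr \<nu> * ((b * t / 2)\<^sup>2) ^ j / fact j) = (A1 * (b * t / 2) powr \<nu>) * (inverse (fact j) * ((b * t / 2)\<^sup>2) ^ j)"
      by (simp only: divide_inverse mult_ac)
    then show "norm (I_coeff b \<nu> j * t powr (\<nu> + 2 * real j)) \<le> (A1 * (b * t / 2) powr \<nu>) * (inverse (fact j) * ((b * t / 2)\<^sup>2) ^ j)"
      unfolding real_norm_def abs_of_nonneg[OF n0] using le by (simp only:)
    qed
  qed
  have e: "(\<Sum>j. f j t) = t powr (s - 1) * bessel_K \<mu> (a * t) * bessel_I \<nu> (b * t)" if t: "t > 0" for t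
    unfolding ft bessel_I_expansion[OF b(1) t] by (rule suminf_mult[OF sI[OF t]])
  have AEs: "AE t in pos_lborel. summable (\<lambda>j. norm (f j t))"
  proof (rule AE_pos_lborelI)
    fix t :: real assume t: "t > 0"
    have "summable (\<lambda>j. f j t)" unfolding ft by (intro summable_mult sI t)
    then show "summable (\<lambda>j. norm (f j t))" using f0[OF t] by simp
  qed
  have sm: "summable (\<lambda>j. \<integral>t. norm (f j t) \<partial>pos_lborel)"
    unfolding fn by (rule summable_norm_cancel[OF summable_I_coeff_mellin_K[OF b \<nu>]])
  have [measurable]: "(\<lambda>t. \<Sum>j. f j t) \<in> borel_measurable borel" unfolding f_def by measurable
  show "integrable pos_lborel (\<lambda>t. t powr (s - 1) * bessel_K \<mu> (a * t) * bessel_I \<nu> (b * t))"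
    by (rule integrable_cong_AE_imp[OF integrable_suminf[OF fi AEs sm]]) (measurable, rule AE_pos_lborelI, erule e)
  have "(\<integral>t. t powr (s - 1) * bessel_K \<mu> (a * t) * bessel_I \<nu> (b * t) \<partial>pos_lborel) = (\<integral>t. (\<Sum>j. f j t) \<partial>pos_lborel)"
    by (rule integral_pos_lborel_cong) (measurable, erule e[symmetric])
  also have "\<dots> = (\<Sum>j. \<integral>t. f j t \<partial>pos_lborel)" by (rule integral_suminf[OF fi AEs sm])
  finally show "(\<integral>t. t powr (s - 1) * bessel_K \<mu> (a * t) * bessel_I \<nu> (b * t) \<partial>pos_lborel) = (\<Sum>j. I_coeff b \<nu> j * mellin_K a \<mu> (s + \<nu> + 2 * real j))"
    unfolding fI .
qed

text \<open>The Mellin transform of \<open>K\<^sub>\<mu>(a t) * I\<^sub>\<nu>(b t)\<close> taken term by term; in this form it is defined beyond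
the half-plane where the integral converges.\<close>

definition KI_transform :: "real \<Rightarrow> real \<Rightarrow> real \<Rightarrow> real \<Rightarrow> complex \<Rightarrow> complex" where
  "KI_transform a b \<mu> \<nu> s = (\<Sum>j. of_real (I_coeff b \<nu> j) * mellin_Kc a \<mu> (s + of_real \<nu> + 2 * of_nat j))"

lemma nonpos_Ints_add_nat:
  fixes w :: complex
  assumes "w + of_nat j \<in> \<int>\<^sub>\<le>\<^sub>0"
  shows "w \<in> \<int>\<^sub>\<le>\<^sub>0"
proof -
  obtain i :: int where i: "w + of_nat j = of_int i" "i \<le> 0" using assms by (auto elim!: nonpos_Ints_cases)
  then have "w = of_int (i - int j)" by (simp add: algebra_simps)
  moreover have "i - int j \<le> 0" using i by simp
  ultimately show ?thesis by (metis nonpos_Ints_of_int)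
qed

lemma pole_free_add_even:
  assumes "p \<in> pole_free \<mu>"
  shows "p + 2 * of_nat j \<in> pole_free \<mu>"
proof -
  have e: "(p + 2 * of_nat j - of_real \<mu>) / 2 = (p - of_real \<mu>) / 2 + of_nat j" "(p + 2 * of_nat j + of_real \<mu>) / 2 = (p + of_real \<mu>) / 2 + of_nat j"
    by (simp_all add: field_simps)
  show ?thesis using assms unfolding pole_free_def mem_Collect_eq e using nonpos_Ints_add_nat by blast
qed

text \<open>On a disc of radius \<open>1\<close>, the Gamma factors with large index are bounded by their values at the
rightmost point of the disc.\<close>

lemma KI_transform_holomorphic:
  assumes b: "0 < b" "b < a" and \<nu>: "\<nu> \<ge> 0" and A: "open A" "\<And>s. s \<in> A \<Longrightarrow> s + of_real \<nu> \<in> pole_free \<mu>"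
  shows "KI_transform a b \<mu> \<nu> holomorphic_on A"
  unfolding KI_transform_def[abs_def]
proof (rule holomorphic_suminf[OF A(1)])
  have a: "a > 0" using b by simp
  fix j
  have "(mellin_Kc a \<mu> \<circ> (\<lambda>s. s + of_real \<nu> + 2 * of_nat j)) holomorphic_on A"
    by (rule holomorphic_on_compose_gen[OF _ mellin_Kc_holomorphic[OF a]])
       (use A(2) pole_free_add_even in \<open>auto intro!: holomorphic_intros\<close>)
  then show "(\<lambda>s. of_real (I_coeff b \<nu> j) * mellin_Kc a \<mu> (s + of_real \<nu> + 2 * of_nat j)) holomorphic_on A"
    unfolding o_def by (intro holomorphic_intros)
next
  have a: "a > 0" using b by simp
  fix s assume s: "s \<in> A"
  define x where "x = (Re s + 1 + \<nu> - \<mu>) / 2"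
  define y where "y = (Re s + 1 + \<nu> + \<mu>) / 2"
  define c where "c = a / 2"
  have c: "c > 0" using a by (simp add: c_def)
  define B where "B = c powr - (Re s + \<nu>) * (c + 1 / c) / 4"
  define N where "N = nat \<lceil>4 + \<bar>Re s\<bar> + \<bar>\<nu>\<bar> + \<bar>\<mu>\<bar>\<rceil>"
  have bd: "norm (of_real (I_coeff b \<nu> j) * mellin_Kc a \<mu> (w + of_real \<nu> + 2 * of_nat j))
      \<le> B * (I_coeff b \<nu> j * (\<bar>Gamma (x + real j)\<bar> * \<bar>Gamma (y + real j)\<bar>) * (a / 2) powr - (2 * real j))"
    if j: "j \<ge> N" and w: "w \<in> cball s 1" for j w
  proof -
    define z where "z = w + of_real \<nu> + 2 * of_nat j"
    have "norm (w - s) \<le> 1" using w by (simp add: dist_norm norm_minus_commute)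
    then have re: "\<bar>Re w - Re s\<bar> \<le> 1" using abs_Re_le_cmod[of "w - s"] by auto
    have jN: "real j \<ge> 4 + \<bar>Re s\<bar> + \<bar>\<nu>\<bar> + \<bar>\<mu>\<bar>" using j unfolding N_def by linarith
    have rz: "Re ((z - of_real \<mu>) / 2) = (Re w + \<nu> - \<mu>) / 2 + real j" "Re ((z + of_real \<mu>) / 2) = (Re w + \<nu> + \<mu>) / 2 + real j"
      by (auto simp: z_def field_simps)
    have reN: "Re s - 1 \<le> Re w" "Re w \<le> Re s + 1" using re by (auto simp: abs_le_iff)
    have g1: "2 \<le> (Re w + \<nu> - \<mu>) / 2 + real j" "2 \<le> (Re w + \<nu> + \<mu>) / 2 + real j"
      using reN(1) jN \<nu> abs_ge_minus_self[of "Re s"] abs_ge_self[of \<mu>] abs_ge_minus_self[of \<mu>] by (simp_all add: field_simps)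
    have g2: "(Re w + \<nu> - \<mu>) / 2 + real j \<le> x + real j" "(Re w + \<nu> + \<mu>) / 2 + real j \<le> y + real j"
      using reN(2) by (auto simp: x_def y_def)
    have g0: "0 < Re ((z - of_real \<mu>) / 2)" "0 < Re ((z + of_real \<mu>) / 2)"
      unfolding rz by (rule less_le_trans[OF zero_less_numeral g1(1)], rule less_le_trans[OF zero_less_numeral g1(2)])
    have G1: "norm (Gamma ((z - of_real \<mu>) / 2)) \<le> \<bar>Gamma (x + real j)\<bar>"
    proof -
      have "norm (Gamma ((z - of_real \<mu>) / 2)) \<le> Gamma (Re ((z - of_real \<mu>) / 2))"
        by (rule norm_Gamma_le_Gamma_Re[OF g0(1)])
      also have "\<dots> \<le> Gamma (x + real j)" unfolding rz by (rule Gamma_mono_ge2[OF g1(1) g2(1)])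
      finally show ?thesis by simp
    qed
    have G2: "norm (Gamma ((z + of_real \<mu>) / 2)) \<le> \<bar>Gamma (y + real j)\<bar>"
    proof -
      have "norm (Gamma ((z + of_real \<mu>) / 2)) \<le> Gamma (Re ((z + of_real \<mu>) / 2))"
        by (rule norm_Gamma_le_Gamma_Re[OF g0(2)])
      also have "\<dots> \<le> Gamma (y + real j)" unfolding rz by (rule Gamma_mono_ge2[OF g1(2) g2(2)])
      finally show ?thesis by simp
    qed
    have P: "norm (of_real c powr - z) \<le> 4 * B * c powr - (2 * real j)"
    proof -
      have "norm (complex_of_real c powr - z) = c powr - Re z" using c by (simp add: norm_powr_real_powr)
      also have "- Re z = (Re s - Re w) + - (Re s + \<nu>) + - (2 * real j)" by (simp add: z_def)
      also have "c powr \<dots> = c powr (Re s - Re w) * c powr - (Re s + \<nu>) * c powr - (2 * real j)" by (simp only: powr_add)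
      also have "\<dots> \<le> (c + 1 / c) * c powr - (Re s + \<nu>) * c powr - (2 * real j)"
      proof (intro mult_right_mono)
        show "c powr (Re s - Re w) \<le> c + 1 / c"
        proof (cases "c \<ge> 1")
          case True
          have "c powr (Re s - Re w) \<le> c powr 1" using True re by (intro powr_mono) auto
          then show ?thesis using c by (simp add: add_increasing2)
        next
          case False
          have "c powr (Re s - Re w) \<le> c powr - 1" using False re c by (intro powr_mono') auto
          then show ?thesis using c by (simp add: powr_minus_divide add_increasing)
        qed
      qed auto
      finally show ?thesis by (simp add: B_def mult_ac)
    qed
    have "norm (mellin_Kc a \<mu> z) = norm (Gamma ((z - of_real \<mu>) / 2)) * norm (Gamma ((z + of_real \<mu>) / 2)) * norm (of_real c powr - z) / 4"
      unfolding mellin_Kc_def c_def by (simp add: norm_mult norm_divide)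
    also have "\<dots> \<le> \<bar>Gamma (x + real j)\<bar> * \<bar>Gamma (y + real j)\<bar> * (4 * B * c powr - (2 * real j)) / 4"
      by (intro divide_right_mono mult_mono G1 G2 P mult_nonneg_nonneg) auto
    finally have "norm (mellin_Kc a \<mu> z) \<le> B * ((\<bar>Gamma (x + real j)\<bar> * \<bar>Gamma (y + real j)\<bar>) * c powr - (2 * real j))" by (simp add: mult_ac)
    then have "I_coeff b \<nu> j * norm (mellin_Kc a \<mu> z) \<le> I_coeff b \<nu> j * (B * ((\<bar>Gamma (x + real j)\<bar> * \<bar>Gamma (y + real j)\<bar>) * c powr - (2 * real j)))"
      by (rule mult_left_mono) (rule I_coeff_nonneg[OF \<nu>])
    then show ?thesis by (simp add: norm_mult z_def I_coeff_nonneg[OF \<nu>] c_def mult_ac)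
  qed
  moreover have "summable (\<lambda>j. B * (I_coeff b \<nu> j * (\<bar>Gamma (x + real j)\<bar> * \<bar>Gamma (y + real j)\<bar>) * (a / 2) powr - (2 * real j)))"
    by (intro summable_mult summable_I_coeff_Gamma b \<nu>)
  ultimately show "\<exists>d M N. d > 0 \<and> summable M \<and> (\<forall>n\<ge>N. \<forall>w\<in>cball s d. w \<in> A \<longrightarrow>
     norm (of_real (I_coeff b \<nu> n) * mellin_Kc a \<mu> (w + of_real \<nu> + 2 * of_nat n)) \<le> M n)"
    by (intro exI[of _ "1::real"] exI[of _ "\<lambda>j. B * (I_coeff b \<nu> j * (\<bar>Gamma (x + real j)\<bar> * \<bar>Gamma (y + real j)\<bar>) * (a / 2) powr - (2 * real j))"] exI[of _ N]) auto
qed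

lemma KI_transform_of_real:
  assumes b: "0 < b" "b < a" and \<nu>: "\<nu> \<ge> 0"
  shows "KI_transform a b \<mu> \<nu> (of_real s) = of_real (\<Sum>j. I_coeff b \<nu> j * mellin_K a \<mu> (s + \<nu> + 2 * real j))"
proof -
  have "of_real (I_coeff b \<nu> j) * mellin_Kc a \<mu> (of_real s + of_real \<nu> + 2 * of_nat j) = of_real (I_coeff b \<nu> j * mellin_K a \<mu> (s + \<nu> + 2 * real j))" for j
    using mellin_Kc_of_real[of a \<mu> "s + \<nu> + 2 * real j"] b by simp
  then show ?thesis unfolding KI_transform_def
    by (simp only: suminf_of_real[OF summable_norm_cancel[OF summable_I_coeff_mellin_K[OF b \<nu>]]])
qed

text \<open>Both sides are holomorphic in the half-plane and agree for real \<open>s\<close>, where the integrand is a real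
series of nonnegative terms.\<close>

lemma KI_transform_has_integral:
  assumes \<mu>: "\<mu> \<notin> \<int>" "\<mu> > 0" and b: "0 < b" "b < a" and \<nu>: "\<nu> \<ge> 0" and s: "Re s > \<alpha> - \<nu> + \<mu>"
  shows "((\<lambda>t. of_real t powr (s - 1) * of_real (t powr (- \<alpha>) * bessel_K \<mu> (a * t) * bessel_I \<nu> (b * t)))
     has_integral KI_transform a b \<mu> \<nu> (s - of_real \<alpha>)) {0<..}"
proof -
  have [measurable]: "bessel_K \<mu> \<in> borel_measurable borel" by (rule bessel_K_measurable[OF \<mu>(1)])
  have [measurable]: "bessel_I \<nu> \<in> borel_measurable borel" unfolding bessel_I_def by measurable
  define f where "f = (\<lambda>t. t powr (- 1) * bessel_K \<mu> (a * t) * bessel_I \<nu> (b * t))"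
  have [measurable]: "f \<in> borel_measurable borel" unfolding f_def by measurable
  define S where "S = {\<mu> - \<nu><..}"
  have ef: "exp (\<sigma> * ln t) * f t = t powr (\<sigma> - 1) * bessel_K \<mu> (a * t) * bessel_I \<nu> (b * t)" if "t > 0" for \<sigma> t
  proof -
    have "exp (\<sigma> * ln t) = t powr \<sigma>" using that by (simp add: powr_def)
    moreover have "t powr \<sigma> * t powr (- 1) = t powr (\<sigma> - 1)" unfolding powr_add[symmetric] by simp
    ultimately show ?thesis unfolding f_def by (simp only: mult.assoc[symmetric])
  qed
  have int: "integrable pos_lborel (\<lambda>t. exp (\<sigma> * ln t) * f t)" if "\<sigma> \<in> S" for \<sigma>
  proof -
    have "\<sigma> + \<nu> > \<mu>" using that by (simp add: S_def)
    from KI_mellin_real(1)[OF \<mu> b \<nu> this] show ?thesis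
      by (rule integrable_cong_AE_imp) (measurable, rule AE_pos_lborelI, simp add: ef)
  qed
  define H where "H = (\<lambda>z. \<integral>t. exp (z * complex_of_real (ln t)) * of_real (f t) \<partial>pos_lborel)"
  have Hhol: "H holomorphic_on {z. Re z \<in> S}"
    unfolding H_def by (rule exp_integral_holomorphic) (use int in \<open>auto simp: S_def\<close>)
  have S_eq: "{z. Re z \<in> S} = {z. Re z > \<mu> - \<nu>}" by (auto simp: S_def)
  have Heq: "H z = KI_transform a b \<mu> \<nu> z" if z: "Re z > \<mu> - \<nu>" for z
  proof (rule holomorphic_eq_if_eq_on_reals[where f = H and g = "KI_transform a b \<mu> \<nu>" and A = "{z. Re z > \<mu> - \<nu>}" and u = "\<mu> - \<nu>" and v = "\<mu> - \<nu> + 1"])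
    show "H holomorphic_on {z. Re z > \<mu> - \<nu>}" using Hhol unfolding S_eq .
    show op: "open {z. Re z > \<mu> - \<nu>}" by (rule open_halfspace_Re_gt)
    show "connected {z. Re z > \<mu> - \<nu>}" by (intro convex_connected convex_halfspace_Re_gt)
    show "KI_transform a b \<mu> \<nu> holomorphic_on {z. Re z > \<mu> - \<nu>}"
    proof (rule KI_transform_holomorphic[OF b \<nu> op])
      fix s assume "s \<in> {z. Re z > \<mu> - \<nu>}"
      then have "Re ((s + of_real \<nu> - of_real \<mu>) / 2) > 0" "Re ((s + of_real \<nu> + of_real \<mu>) / 2) > 0" using \<mu> by auto
      moreover have "Re w \<le> 0" if "w \<in> \<int>\<^sub>\<le>\<^sub>0" for w :: complex using that by (auto elim!: nonpos_Ints_cases)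
      ultimately show "s + of_real \<nu> \<in> pole_free \<mu>" unfolding pole_free_def using not_le by blast
    qed
    fix x :: real assume x: "\<mu> - \<nu> < x" "x < \<mu> - \<nu> + 1"
    have x': "x + \<nu> > \<mu>" using x by simp
    have "H (of_real x) = (\<integral>t. complex_of_real (exp (x * ln t) * f t) \<partial>pos_lborel)"
      unfolding H_def by (simp add: exp_of_real[symmetric])
    also have "\<dots> = of_real (\<integral>t. exp (x * ln t) * f t \<partial>pos_lborel)" by (rule integral_complex_of_real)
    also have "(\<integral>t. exp (x * ln t) * f t \<partial>pos_lborel) = (\<integral>t. t powr (x - 1) * bessel_K \<mu> (a * t) * bessel_I \<nu> (b * t) \<partial>pos_lborel)"
      by (rule integral_pos_lborel_cong) (measurable, erule ef)
    also have "\<dots> = (\<Sum>j. I_coeff b \<nu> j * mellin_K a \<mu> (x + \<nu> + 2 * real j))" by (rule KI_mellin_real(2)[OF \<mu> b \<nu> x'])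
    finally show "H (of_real x) = KI_transform a b \<mu> \<nu> (of_real x)" unfolding KI_transform_of_real[OF b \<nu>] .
  qed (use z in auto)
  define w where "w = s - of_real \<alpha>"
  have w: "Re w > \<mu> - \<nu>" using s by (simp add: w_def)
  define g where "g = (\<lambda>t. exp (w * complex_of_real (ln t)) * of_real (f t))"
  have [measurable]: "g \<in> borel_measurable borel" unfolding g_def by measurable
  have gi: "integrable pos_lborel g"
  proof (rule Bochner_Integration.integrable_bound[OF int[of "Re w"]])
    show "AE t in pos_lborel. norm (g t) \<le> norm (exp (Re w * ln t) * f t)"
      by (auto simp: g_def norm_mult)
  qed (use w in \<open>auto simp: S_def\<close>)
  have "g absolutely_integrable_on {0<..}" using gi by (simp add: integrable_pos_lborel_iff_absolutely_integrable)
  then have "g integrable_on {0<..}" using absolutely_integrable_on_def by blast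
  then have "(g has_integral integral {0<..} g) {0<..}" by (rule integrable_integral)
  also have "integral {0<..} g = H w" unfolding H_def g_def[symmetric] by (rule integral_pos_lborel_eq_integral[symmetric]) (use gi in auto)
  also have "\<dots> = KI_transform a b \<mu> \<nu> (s - of_real \<alpha>)" using Heq[OF w] by (simp add: w_def)
  finally have hi: "(g has_integral KI_transform a b \<mu> \<nu> (s - of_real \<alpha>)) {0<..}" .
  show ?thesis
  proof (rule has_integral_eq[OF _ hi])
    fix t :: real assume "t \<in> {0<..}"
    then have t: "t > 0" by simp
    have "of_real t powr (s - 1) * of_real (t powr (- \<alpha>)) = (of_real t powr (s - 1) * of_real t powr (- of_real \<alpha>) :: complex)"
      using powr_of_real[of t "- \<alpha>"] t by simp
    also have "\<dots> = of_real t powr (w + - 1)" unfolding powr_add[symmetric] by (simp add: w_def algebra_simps)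
    also have "\<dots> = exp (w * of_real (ln t)) * of_real (t powr (- 1))"
      unfolding powr_add using powr_of_real[of t "- 1"] t by (simp add: powr_def Ln_of_real)
    finally have "of_real t powr (s - 1) * of_real (t powr (- \<alpha>)) = exp (w * of_real (ln t)) * complex_of_real (t powr (- 1))" .
    then show "g t = of_real t powr (s - 1) * of_real (t powr (- \<alpha>) * bessel_K \<mu> (a * t) * bessel_I \<nu> (b * t))"
      by (simp only: g_def f_def of_real_mult mult.assoc[symmetric])
  qed
qed

lemma pole_set_complement:
  "- (\<Union>m. {of_real (s_pole \<alpha> \<nu> \<mu> m), of_real (s_pole \<alpha> \<nu> (- \<mu>) m)}) = {s. s - of_real \<alpha> + of_real \<nu> \<in> pole_free \<mu>}"
proof -
  have e: "(\<exists>m. s = complex_of_real (s_pole \<alpha> \<nu> \<sigma> m)) \<longleftrightarrow> (s - of_real \<alpha> + of_real \<nu> - of_real \<sigma>) / 2 \<in> \<int>\<^sub>\<le>\<^sub>0" for s \<sigma>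
  proof
    assume "\<exists>m. s = complex_of_real (s_pole \<alpha> \<nu> \<sigma> m)"
    then obtain m where "s = of_real (s_pole \<alpha> \<nu> \<sigma> m)" by blast
    then have "(s - of_real \<alpha> + of_real \<nu> - of_real \<sigma>) / 2 = - of_nat m" by (simp add: s_pole_def field_simps)
    then show "(s - of_real \<alpha> + of_real \<nu> - of_real \<sigma>) / 2 \<in> \<int>\<^sub>\<le>\<^sub>0" by simp
  next
    assume "(s - of_real \<alpha> + of_real \<nu> - of_real \<sigma>) / 2 \<in> \<int>\<^sub>\<le>\<^sub>0"
    then obtain m where "(s - of_real \<alpha> + of_real \<nu> - of_real \<sigma>) / 2 = - of_nat m" by (auto elim!: nonpos_Ints_cases')
    then have "s = of_real (s_pole \<alpha> \<nu> \<sigma> m)" by (simp add: s_pole_def field_simps)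
    then show "\<exists>m. s = complex_of_real (s_pole \<alpha> \<nu> \<sigma> m)" by blast
  qed
  show ?thesis using e[of _ \<mu>] e[of _ "- \<mu>"] unfolding pole_free_def by auto
qed

text \<open>Any two functions with the defining property of \<open>mellin_KI\<close> agree on a half-plane, hence on the
connected complement of the poles.\<close>

lemma mellin_KI_eq:
  assumes \<mu>: "\<mu> \<notin> \<int>" "\<mu> > 0" and b: "0 < b" "b < a" and \<nu>: "\<nu> \<ge> 0" and s: "s - of_real \<alpha> + of_real \<nu> \<in> pole_free \<mu>"
  shows "mellin_KI \<alpha> \<mu> \<nu> a b s = KI_transform a b \<mu> \<nu> (s - of_real \<alpha>)"
proof -
  define \<Omega> where "\<Omega> = - (\<Union>m. {complex_of_real (s_pole \<alpha> \<nu> \<mu> m), of_real (s_pole \<alpha> \<nu> (- \<mu>) m)})"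
  have \<Omega>: "\<Omega> = {s. s - of_real \<alpha> + of_real \<nu> \<in> pole_free \<mu>}" unfolding \<Omega>_def by (rule pole_set_complement)
  define c where "c = complex_of_real \<nu> - of_real \<alpha>"
  have \<Omega>_img: "\<Omega> = (\<lambda>s. s - c) ` pole_free \<mu>" unfolding \<Omega> c_def
    by (auto simp: image_iff algebra_simps intro!: bexI[of _ "_ + of_real \<nu> - of_real \<alpha>"])
  have op: "open \<Omega>" and con: "connected \<Omega>"
    unfolding \<Omega>_img using pole_free_open_connected[of \<mu>]
    by (auto intro!: open_translation_subtract connected_continuous_image continuous_intros)
  let ?P = "\<lambda>F. F holomorphic_on \<Omega> \<and> (\<forall>s. Re s > \<alpha> - \<nu> + \<mu> \<longrightarrow>
       ((\<lambda>t. of_real t powr (s - 1) * of_real (t powr (- \<alpha>) * bessel_K \<mu> (a * t) * bessel_I \<nu> (b * t)))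
          has_integral F s) {0<..})"
  define G where "G = (\<lambda>s. KI_transform a b \<mu> \<nu> (s - of_real \<alpha>))"
  have opP: "open {u. u + of_real \<nu> \<in> pole_free \<mu>}"
  proof -
    have "{u. u + of_real \<nu> \<in> pole_free \<mu>} = (\<lambda>s. s - of_real \<nu>) ` pole_free \<mu>"
      by (auto simp: image_iff intro!: bexI[of _ "_ + of_real \<nu>"])
    then show ?thesis using pole_free_open_connected[of \<mu>] by (auto intro!: open_translation_subtract)
  qed
  have "(KI_transform a b \<mu> \<nu> \<circ> (\<lambda>s. s - of_real \<alpha>)) holomorphic_on \<Omega>"
    by (rule holomorphic_on_compose_gen[OF _ KI_transform_holomorphic[OF b \<nu> opP]]) (auto simp: \<Omega> intro!: holomorphic_intros)
  then have Ghol: "G holomorphic_on \<Omega>" by (simp add: G_def o_def)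
  have GP: "?P G" using Ghol KI_transform_has_integral[OF \<mu> b \<nu>] by (auto simp: G_def)
  have "?P (mellin_KI \<alpha> \<mu> \<nu> a b)" unfolding mellin_KI_def \<Omega>_def[symmetric] by (rule someI[of ?P G, OF GP])
  note MP = this
  have M1: "mellin_KI \<alpha> \<mu> \<nu> a b holomorphic_on \<Omega>" using MP by (rule conjunct1)
  have M2: "mellin_KI \<alpha> \<mu> \<nu> a b s = G s" if "Re s > \<alpha> - \<nu> + \<mu>" for s
    by (rule has_integral_unique[OF MP[THEN conjunct2, rule_format, OF that] GP[THEN conjunct2, rule_format, OF that]])
  have "mellin_KI \<alpha> \<mu> \<nu> a b s = G s"
  proof (rule analytic_continuation_open[where f = "mellin_KI \<alpha> \<mu> \<nu> a b" and g = G and s = "{s. Re s > \<alpha> - \<nu> + \<mu>}" and s' = \<Omega>])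
    show "{s. \<alpha> - \<nu> + \<mu> < Re s} \<noteq> {}" by (auto intro!: exI[of _ "complex_of_real (\<alpha> - \<nu> + \<mu> + 1)"])
    show "open {s. \<alpha> - \<nu> + \<mu> < Re s}" by (rule open_halfspace_Re_gt)
    show "{s. \<alpha> - \<nu> + \<mu> < Re s} \<subseteq> \<Omega>"
    proof
      fix s assume "s \<in> {s. \<alpha> - \<nu> + \<mu> < Re s}"
      then have "Re ((s - of_real \<alpha> + of_real \<nu> - of_real \<mu>) / 2) > 0" "Re ((s - of_real \<alpha> + of_real \<nu> + of_real \<mu>) / 2) > 0" using \<mu> by auto
      moreover have "Re w \<le> 0" if "w \<in> \<int>\<^sub>\<le>\<^sub>0" for w :: complex using that by (auto elim!: nonpos_Ints_cases)
      ultimately show "s \<in> \<Omega>" unfolding \<Omega> pole_free_def using not_le by blast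
    qed
  qed (use op con M1 M2 Ghol s in \<open>simp_all add: \<Omega>\<close>)
  then show ?thesis by (simp add: G_def)
qed

section \<open>The hypergeometric coefficients\<close>

lemma hyp2F1_eq_suminf:
  "hyp2F1 A B C z = (\<Sum>n. pochhammer A n * pochhammer B n / (pochhammer C n * fact n) * z ^ n)"
  unfolding hyp2F1_def eval_fps_def by simp

lemma pochhammer_uminus_nat:
  assumes "j \<le> m"
  shows "pochhammer (- real m) j = (- 1) ^ j * (fact m / fact (m - j))"
proof -
  have "real (m choose j) = (- 1) ^ j * pochhammer (- real m) j / fact j"
    by (simp only: binomial_gbinomial gbinomial_pochhammer)
  moreover have "real (m choose j) = fact m / (fact j * fact (m - j))" by (rule binomial_fact[OF assms])
  ultimately have "(- 1) ^ j * pochhammer (- real m) j = fact m / fact (m - j)" by (simp add: field_simps)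
  then have "(- 1) ^ j * ((- 1) ^ j * pochhammer (- real m) j) = (- 1) ^ j * (fact m / fact (m - j))" by (simp only:)
  moreover have "(- 1) ^ j * ((- 1) ^ j * pochhammer (- real m) j) = pochhammer (- real m) j"
    unfolding mult.assoc[symmetric] power_mult_distrib[symmetric] by simp
  ultimately show ?thesis by (simp only:)
qed

lemma rGamma_conv_pochhammer:
  assumes "\<nu> \<ge> 0"
  shows "rGamma (\<nu> + real j + 1) = 1 / (Gamma (1 + \<nu>) * pochhammer (1 + \<nu>) j)"
proof -
  have "1 + \<nu> > 0" using assms by simp
  then have "1 + \<nu> \<notin> \<int>\<^sub>\<le>\<^sub>0" by (auto elim!: nonpos_Ints_cases)
  then have "pochhammer (1 + \<nu>) j = Gamma (1 + \<nu> + real j) / Gamma (1 + \<nu>)" by (rule pochhammer_Gamma)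
  moreover have "Gamma (1 + \<nu>) > 0" using \<open>1 + \<nu> > 0\<close> by (rule Gamma_real_pos)
  ultimately have "Gamma (1 + \<nu>) * pochhammer (1 + \<nu>) j = Gamma (\<nu> + real j + 1)" by (simp add: add_ac)
  then show ?thesis by (simp add: rGamma_inverse_Gamma divide_inverse)
qed

lemma F_poly_eq_sum:
  assumes \<sigma>: "\<sigma> \<notin> \<int>"
  shows "F_poly m \<nu> \<sigma> z = (\<Sum>j\<le>m. (- 1) ^ j * (fact m / fact (m - j)) * (Gamma (\<sigma> - real (m - j)) / Gamma (\<sigma> - real m)) / (pochhammer (1 + \<nu>) j * fact j) * z ^ j)"
proof -
  have "F_poly m \<nu> \<sigma> z = (\<Sum>j\<le>m. pochhammer (- real m) j * pochhammer (- real m + \<sigma>) j / (pochhammer (1 + \<nu>) j * fact j) * z ^ j)"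
    unfolding F_poly_def hyp2F1_eq_suminf
    by (rule suminf_finite) (auto simp: pochhammer_of_nat_eq_0_lemma)
  also have "\<dots> = (\<Sum>j\<le>m. (- 1) ^ j * (fact m / fact (m - j)) * (Gamma (\<sigma> - real (m - j)) / Gamma (\<sigma> - real m)) / (pochhammer (1 + \<nu>) j * fact j) * z ^ j)"
  proof (rule sum.cong[OF refl])
    fix j assume j: "j \<in> {..m}"
    have "- real m + \<sigma> \<notin> \<int>"
    proof
      assume "- real m + \<sigma> \<in> \<int>"
      then have "- real m + \<sigma> + real m \<in> \<int>" by (intro Ints_add) auto
      with \<sigma> show False by simp
    qed
    then have "- real m + \<sigma> \<notin> \<int>\<^sub>\<le>\<^sub>0" by (rule nonint_not_nonpos)
    then have "pochhammer (- real m + \<sigma>) j = Gamma (- real m + \<sigma> + real j) / Gamma (- real m + \<sigma>)" by (rule pochhammer_Gamma)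
    moreover have "- real m + \<sigma> + real j = \<sigma> - real (m - j)" "Gamma (- real m + \<sigma>) = Gamma (\<sigma> - real m)" using j by (simp_all add: of_nat_diff)
    ultimately have "pochhammer (- real m + \<sigma>) j = Gamma (\<sigma> - real (m - j)) / Gamma (\<sigma> - real m)" by (simp only:)
    then show "pochhammer (- real m) j * pochhammer (- real m + \<sigma>) j / (pochhammer (1 + \<nu>) j * fact j) * z ^ j
      = (- 1) ^ j * (fact m / fact (m - j)) * (Gamma (\<sigma> - real (m - j)) / Gamma (\<sigma> - real m)) / (pochhammer (1 + \<nu>) j * fact j) * z ^ j"
      using j by (simp only: pochhammer_uminus_nat atMost_iff)
  qed
  finally show ?thesis .
qed

lemma half_powr_even:
  assumes "a > (0::real)"
  shows "(a / 2) powr (2 * real j) = (a / 2) ^ (2 * j)"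
  using powr_realpow[of "a / 2" "2 * j"] assms by simp

text \<open>The coefficient of \<open>t powr (\<nu> - \<sigma> + 2 * m)\<close> in the product of \<open>I\<^sub>\<nu>(b t)\<close> and
\<open>K_half a \<sigma> t\<close>.  Relative to the term \<open>j = 0\<close>, its terms are those of the hypergeometric sum.\<close>

lemma I_K_convolution:
  assumes \<sigma>: "\<sigma> \<notin> \<int>" and a: "a > 0" and b: "b > 0" and \<nu>: "\<nu> \<ge> 0"
  shows "(\<Sum>j\<le>m. I_coeff b \<nu> j * K_coeff a \<sigma> (m - j))
    = b powr \<nu> / 2 powr (1 + \<nu>) * ((- 1) ^ m * Gamma (\<sigma> - real m) / (fact m * Gamma (1 + \<nu>))
      * (F_poly m \<nu> \<sigma> (b\<^sup>2 / a\<^sup>2) * (a / 2) powr (2 * real m - \<sigma>)))"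
proof -
  have "\<sigma> - real m \<notin> \<int>"
  proof
    assume "\<sigma> - real m \<in> \<int>"
    then have "\<sigma> - real m + real m \<in> \<int>" by (intro Ints_add) auto
    with \<sigma> show False by simp
  qed
  then have g: "Gamma (\<sigma> - real m) \<noteq> 0" by (simp add: Gamma_eq_zero_iff nonint_not_nonpos)
  have bp: "(b / 2) powr \<nu> / 2 = b powr \<nu> / 2 powr (1 + \<nu>)"
    using b by (simp add: powr_divide powr_add)
  have "I_coeff b \<nu> j * K_coeff a \<sigma> (m - j)
     = (b powr \<nu> / 2 powr (1 + \<nu>) * ((- 1) ^ m * Gamma (\<sigma> - real m) / (fact m * Gamma (1 + \<nu>)) * (a / 2) powr (2 * real m - \<sigma>)))
       * ((- 1) ^ j * (fact m / fact (m - j)) * (Gamma (\<sigma> - real (m - j)) / Gamma (\<sigma> - real m)) / (pochhammer (1 + \<nu>) j * fact j) * (b\<^sup>2 / a\<^sup>2) ^ j)"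
    if j: "j \<le> m" for j
  proof -
    define G where "G = Gamma (1 + \<nu>)"
    define H where "H = pochhammer (1 + \<nu>) j"
    define A where "A = (a / 2) powr (2 * real (m - j) - \<sigma>)"
    have ap: "(a / 2) powr (2 * real m - \<sigma>) = A * (a / 2) ^ (2 * j)"
    proof -
      have "2 * real m - \<sigma> = (2 * real (m - j) - \<sigma>) + 2 * real j" using j by (simp add: of_nat_diff algebra_simps)
      then show ?thesis unfolding A_def half_powr_even[OF a, symmetric] powr_add[symmetric] by (simp only:)
    qed
    have chi: "(a / 2) ^ (2 * j) * (b\<^sup>2 / a\<^sup>2) ^ j = (b / 2) ^ (2 * j)"
    proof -
      have "(a / 2)\<^sup>2 * (b\<^sup>2 / a\<^sup>2) = (b / 2)\<^sup>2" using a by (simp add: power_divide)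
      then show ?thesis unfolding power_mult power_mult_distrib[symmetric] by (simp only:)
    qed
    have sg: "(- 1 :: real) ^ (m - j) = (- 1) ^ m * (- 1) ^ j"
    proof -
      have "(- 1 :: real) ^ m = (- 1) ^ (m - j) * (- 1) ^ j" using j by (simp add: power_add[symmetric])
      then show ?thesis by (simp add: mult.assoc power_mult_distrib[symmetric])
    qed
    have L: "I_coeff b \<nu> j * K_coeff a \<sigma> (m - j)
       = ((b / 2) powr \<nu> / 2) * (((- 1) ^ m * (- 1) ^ j) * Gamma (\<sigma> - real (m - j)) / (G * H * fact j * fact (m - j)) * A * (b / 2) ^ (2 * j))"
      unfolding I_coeff_def K_coeff_def bessel_coeff_def rGamma_conv_pochhammer[OF \<nu>] sg powr_add[of "b / 2" \<nu>] half_powr_even[OF b] A_def[symmetric] G_def[symmetric] H_def[symmetric]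
      by (simp add: mult_ac)
    show ?thesis
      unfolding L bp ap chi[symmetric] G_def[symmetric] H_def[symmetric] using g by (simp add: mult_ac)
  qed
  then have "(\<Sum>j\<le>m. I_coeff b \<nu> j * K_coeff a \<sigma> (m - j)) = (b powr \<nu> / 2 powr (1 + \<nu>) * ((- 1) ^ m * Gamma (\<sigma> - real m) / (fact m * Gamma (1 + \<nu>)) * (a / 2) powr (2 * real m - \<sigma>))) * F_poly m \<nu> \<sigma> (b\<^sup>2 / a\<^sup>2)"
    unfolding F_poly_eq_sum[OF \<sigma>] sum_distrib_left by (intro sum.cong) auto
  then show ?thesis by (simp only: mult_ac)
qed

lemma KI_transform_hyp2F1:
  assumes b: "0 < b" "b < a" and \<nu>: "\<nu> \<ge> 0"
    and A: "(1 - \<alpha> + \<nu> - \<mu>) / 2 \<notin> \<int>\<^sub>\<le>\<^sub>0" and B: "(1 - \<alpha> + \<nu> + \<mu>) / 2 \<notin> \<int>\<^sub>\<le>\<^sub>0"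
  shows "(\<Sum>j. I_coeff b \<nu> j * mellin_K a \<mu> (1 - \<alpha> + \<nu> + 2 * real j))
    = b powr \<nu> * (a / 2) powr \<alpha> / (2 * a powr (1 + \<nu>))
       * (Gamma (1/2 - \<alpha>/2 + \<nu>/2 - \<mu>/2) * Gamma (1/2 - \<alpha>/2 + \<nu>/2 + \<mu>/2) / Gamma (1 + \<nu>))
       * hyp2F1 ((1 - \<alpha> + \<nu> - \<mu>) / 2) ((1 - \<alpha> + \<nu> + \<mu>) / 2) (1 + \<nu>) (b\<^sup>2 / a\<^sup>2)"
proof -
  have a: "a > 0" using b by simp
  define x where "x = (1 - \<alpha> + \<nu> - \<mu>) / 2"
  define y where "y = (1 - \<alpha> + \<nu> + \<mu>) / 2"
  define p where "p = 1 - \<alpha> + \<nu>"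
  define c where "c = ((b / 2) powr \<nu> * (a / 2) powr - p / 4) * (Gamma x * Gamma y / Gamma (1 + \<nu>))"
  define h where "h = (\<lambda>j. pochhammer x j * pochhammer y j / (pochhammer (1 + \<nu>) j * fact j) * (b\<^sup>2 / a\<^sup>2) ^ j)"
  have gx: "Gamma x \<noteq> 0" "Gamma y \<noteq> 0" using A B by (auto simp: Gamma_eq_zero_iff x_def y_def)
  have gn: "Gamma (1 + \<nu>) > 0" using \<nu> by (intro Gamma_real_pos) auto
  have c0: "c \<noteq> 0" using gx gn a b by (simp add: c_def)
  have t: "I_coeff b \<nu> j * mellin_K a \<mu> (1 - \<alpha> + \<nu> + 2 * real j) = c * h j" for j
  proof -
    have x1: "Gamma ((1 - \<alpha> + \<nu> + 2 * real j - \<mu>) / 2) = Gamma x * pochhammer x j"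
    proof -
      have "(1 - \<alpha> + \<nu> + 2 * real j - \<mu>) / 2 = x + real j" by (simp add: x_def field_simps)
      then have "Gamma ((1 - \<alpha> + \<nu> + 2 * real j - \<mu>) / 2) = Gamma (x + real j)" by (simp only:)
      then show ?thesis using pochhammer_Gamma[of x j] A gx by (simp add: x_def[symmetric])
    qed
    have y1: "Gamma ((1 - \<alpha> + \<nu> + 2 * real j + \<mu>) / 2) = Gamma y * pochhammer y j"
    proof -
      have "(1 - \<alpha> + \<nu> + 2 * real j + \<mu>) / 2 = y + real j" by (simp add: y_def field_simps)
      then have "Gamma ((1 - \<alpha> + \<nu> + 2 * real j + \<mu>) / 2) = Gamma (y + real j)" by (simp only:)
      then show ?thesis using pochhammer_Gamma[of y j] B gx by (simp add: y_def[symmetric])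
    qed
    have pw: "(a / 2) powr - (1 - \<alpha> + \<nu> + 2 * real j) = (a / 2) powr - p / (a / 2) ^ (2 * j)"
    proof -
      have "- (1 - \<alpha> + \<nu> + 2 * real j) = - p - 2 * real j" by (simp add: p_def)
      then show ?thesis using powr_diff[of "a / 2" "- p" "2 * real j"] half_powr_even[OF a] by (simp only:)
    qed
    have chi: "(b / 2) ^ (2 * j) / (a / 2) ^ (2 * j) = (b\<^sup>2 / a\<^sup>2) ^ j"
      using a by (simp add: power_mult power_divide)
    have "I_coeff b \<nu> j * mellin_K a \<mu> (1 - \<alpha> + \<nu> + 2 * real j)
       = c * (pochhammer x j * pochhammer y j / (pochhammer (1 + \<nu>) j * fact j) * ((b / 2) ^ (2 * j) / (a / 2) ^ (2 * j)))"
      unfolding I_coeff_def mellin_K_def rGamma_conv_pochhammer[OF \<nu>] powr_add[of "b / 2" \<nu>] half_powr_even[OF b(1)] pw x1 y1 c_def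
      by (simp add: mult_ac)
    then show ?thesis unfolding chi h_def .
  qed
  have "summable (\<lambda>j. c * h j)"
    using summable_norm_cancel[OF summable_I_coeff_mellin_K[OF b \<nu>, of \<mu> "1 - \<alpha> + \<nu>"]] unfolding t .
  then have hs: "summable h" using c0 by (rule summable_mult_D)
  have "(\<Sum>j. I_coeff b \<nu> j * mellin_K a \<mu> (1 - \<alpha> + \<nu> + 2 * real j)) = c * hyp2F1 x y (1 + \<nu>) (b\<^sup>2 / a\<^sup>2)"
    using suminf_mult[OF hs, of c] unfolding t by (simp add: hyp2F1_eq_suminf h_def)
  moreover have "c = b powr \<nu> * (a / 2) powr \<alpha> / (2 * a powr (1 + \<nu>)) * (Gamma x * Gamma y / Gamma (1 + \<nu>))"
  proof -
    have "(a / 2) powr - p = (a / 2) powr \<alpha> / (a / 2) powr (1 + \<nu>)" unfolding powr_diff[symmetric] by (simp add: p_def diff_diff_eq)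
    also have "\<dots> = (a / 2) powr \<alpha> * (2 * 2 powr \<nu>) / a powr (1 + \<nu>)" using a by (simp add: powr_divide powr_add[of 2])
    finally have "(b / 2) powr \<nu> * (a / 2) powr - p / 4 = b powr \<nu> * (a / 2) powr \<alpha> / (2 * a powr (1 + \<nu>))"
      using b by (simp add: powr_divide[of b])
    then show ?thesis unfolding c_def by (simp only:)
  qed
  moreover have "1/2 - \<alpha>/2 + \<nu>/2 - \<mu>/2 = x" "1/2 - \<alpha>/2 + \<nu>/2 + \<mu>/2 = y" by (simp_all add: x_def y_def field_simps)
  ultimately show ?thesis by (simp only: x_def[symmetric] y_def[symmetric])
qed

section \<open>The expansion of the series\<close>

text \<open>All terms of the double series are nonnegative, so the order of summation does not matter.\<close>

lemma KI_series_sums: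
  assumes \<mu>: "\<mu> \<notin> \<int>" "\<mu> > 0" and a: "0 < b" "b < a" and \<nu>: "\<nu> \<ge> 0"
    and sm: "summable (\<lambda>j. I_coeff b \<nu> j * (\<Sum>n. real (Suc n) powr (\<nu> + 2 * real j - \<alpha>) * bessel_K \<mu> (a * real (Suc n))))"
  shows "(\<lambda>n. bessel_K \<mu> (a * real (Suc n)) * bessel_I \<nu> (b * real (Suc n)) / real (Suc n) powr \<alpha>)
    sums (\<Sum>j. I_coeff b \<nu> j * (\<Sum>n. real (Suc n) powr (\<nu> + 2 * real j - \<alpha>) * bessel_K \<mu> (a * real (Suc n))))"
proof -
  have a0: "a > 0" using a by simp
  define g where "g = (\<lambda>j n. I_coeff b \<nu> j * (real (Suc n) powr (\<nu> + 2 * real j - \<alpha>) * bessel_K \<mu> (a * real (Suc n))))"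
  have K0: "bessel_K \<mu> (a * real (Suc n)) \<ge> 0" for n
    using bessel_K_eq_mixture(2)[OF \<mu>, of "a * real (Suc n)"] a0 by simp
  have g0: "norm (g j n) = g j n" for j n
    unfolding g_def using I_coeff_nonneg[OF \<nu>] K0[of n] by (simp add: abs_mult del: of_nat_Suc)
  have row: "summable (g j)" for j
    unfolding g_def by (intro summable_mult summable_powr_bessel_K \<mu> a0)
  have rowsum: "(\<Sum>n. g j n) = I_coeff b \<nu> j * (\<Sum>n. real (Suc n) powr (\<nu> + 2 * real j - \<alpha>) * bessel_K \<mu> (a * real (Suc n)))" for j
    unfolding g_def by (intro suminf_mult summable_powr_bessel_K \<mu> a0)
  have abs: "(\<lambda>x. norm (case x of (j, n) \<Rightarrow> g j n)) summable_on (UNIV \<times> UNIV)"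
  proof (rule abs_summable_of_rows)
    show "summable (\<lambda>n. norm (g j n))" for j unfolding g0 by (rule row)
    show "summable (\<lambda>j. \<Sum>n. norm (g j n))" unfolding g0 rowsum by (rule sm)
  qed
  have "(\<Sum>j. g j n) = bessel_K \<mu> (a * real (Suc n)) * bessel_I \<nu> (b * real (Suc n)) / real (Suc n) powr \<alpha>" for n
  proof -
    define t where "t = real (Suc n)"
    have t: "t > 0" by (simp add: t_def)
    define k where "k = bessel_K \<mu> (a * t) / t powr \<alpha>"
    have e: "g j n = k * (I_coeff b \<nu> j * t powr (\<nu> + 2 * real j))" for j
      unfolding g_def t_def[symmetric] powr_diff by (simp add: k_def)
    have "k * (\<Sum>j. I_coeff b \<nu> j * t powr (\<nu> + 2 * real j)) = (\<Sum>j. k * (I_coeff b \<nu> j * t powr (\<nu> + 2 * real j)))"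
    proof (cases "k = 0")
      case False
      have "summable (\<lambda>j. k * (I_coeff b \<nu> j * t powr (\<nu> + 2 * real j)))"
        by (rule summable_norm_cancel) (use double_series(2)[OF abs, of n] in \<open>simp only: e\<close>)
      then have "summable (\<lambda>j. I_coeff b \<nu> j * t powr (\<nu> + 2 * real j))" using False by (rule summable_mult_D)
      then show ?thesis by (rule suminf_mult[symmetric])
    qed simp
    then show ?thesis unfolding e bessel_I_expansion[OF a(1) t] t_def[symmetric] by (simp add: k_def)
  qed
  then show ?thesis using double_series(3)[OF abs] unfolding rowsum by simp
qed

lemma schloemilch_at_real:
  assumes \<mu>: "\<mu> \<notin> \<int>" "\<mu> > 0" and a: "0 < a" "a < 2 * pi" and p: "complex_of_real p \<in> pole_free \<mu>"
  shows "complex_of_real (\<Sum>n. real (Suc n) powr (p - 1) * bessel_K \<mu> (a * real (Suc n)))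
     = of_real (mellin_K a \<mu> p) + (\<Sum>k. of_real (K_coeff a \<mu> k) * zeta (of_real (1 - (p + 2 * real k - \<mu>))))
       + (\<Sum>k. of_real (K_coeff a (- \<mu>) k) * zeta (of_real (1 - (p + 2 * real k - (- \<mu>)))))"
proof -
  have "of_nat (Suc n) powr (complex_of_real p - 1) * of_real (bessel_K \<mu> (a * real (Suc n))) = complex_of_real (real (Suc n) powr (p - 1) * bessel_K \<mu> (a * real (Suc n)))" for n
    using powr_of_real[of "real (Suc n)" "p - 1"] by simp
  then have "complex_of_real (\<Sum>n. real (Suc n) powr (p - 1) * bessel_K \<mu> (a * real (Suc n))) = (\<Sum>n. of_nat (Suc n) powr (complex_of_real p - 1) * of_real (bessel_K \<mu> (a * real (Suc n))))"
    by (simp only: suminf_of_real[OF summable_powr_bessel_K[OF \<mu> a(1)]])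
  then show ?thesis unfolding schloemilch_complex[OF \<mu> a p] mellin_Kc_of_real[OF a(1)] by simp
qed

text \<open>A row of the double series is a residue series of the Bessel function of the second kind alone, weighted with a coefficient of
\<open>I\<^sub>\<nu>\<close>; a diagonal collects all terms with the same zeta value and is a multiple of \<open>P m\<close>.\<close>

lemma residue_double_series:
  assumes a: "a > 0" and b: "b > 0" and \<nu>: "\<nu> \<ge> 0" and \<sigma>: "\<sigma> \<notin> \<int>"
    and ab: "a + b < 2 * pi \<or> (a + b \<le> 2 * pi \<and> \<alpha> > 0)"
  defines "r \<equiv> \<lambda>j. of_real (I_coeff b \<nu> j) * (\<Sum>k. of_real (K_coeff a \<sigma> k) * zeta (of_real (1 - (1 - \<alpha> + \<nu> + 2 * real j + 2 * real k - \<sigma>))))"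
    and "P \<equiv> \<lambda>m. of_real ((- 1) ^ m * Gamma (\<sigma> - real m)) * zeta (of_real (s_pole \<alpha> \<nu> \<sigma> m))
                  / of_real (fact m * Gamma (1 + \<nu>))
                  * of_real (F_poly m \<nu> \<sigma> (b\<^sup>2 / a\<^sup>2) * (a / 2) powr (2 * real m - \<sigma>))"
  shows "summable r" and "summable P" and "(\<Sum>j. r j) = of_real (b powr \<nu> / 2 powr (1 + \<nu>)) * (\<Sum>m. P m)"
proof -
  define f where "f = (\<lambda>j k. complex_of_real (I_coeff b \<nu> j * K_coeff a \<sigma> k) * zeta (of_real (s_pole \<alpha> \<nu> \<sigma> (j + k))))"
  define c where "c = complex_of_real (b powr \<nu> / 2 powr (1 + \<nu>))"
  have c0: "c \<noteq> 0" using b by (simp add: c_def)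
  have fd: "f j (m - j) = of_real (I_coeff b \<nu> j * K_coeff a \<sigma> (m - j)) * zeta (of_real (s_pole \<alpha> \<nu> \<sigma> m))" if "j \<le> m" for j m
    using that by (simp add: f_def)
  have "(\<Sum>j\<le>m. norm (f j (m - j))) = (\<Sum>j\<le>m. norm (complex_of_real (I_coeff b \<nu> j * K_coeff a \<sigma> (m - j)) * zeta (of_real (s_pole \<alpha> \<nu> \<sigma> m))))" for m
    by (intro sum.cong refl) (simp only: fd atMost_iff)
  then have abs: "(\<lambda>x. norm (case x of (j, k) \<Rightarrow> f j k)) summable_on (UNIV \<times> UNIV)"
    using summable_residue_diagonals[OF a b \<nu> \<sigma> ab] by (intro abs_summable_of_diagonals) (simp only:)
  \<comment> \<open>A zero coefficient cannot be cancelled when summability passes from \<open>f j\<close> to the residue series, but then both sides vanish.\<close>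
  have row: "(\<Sum>k. f j k) = r j" for j
  proof (cases "I_coeff b \<nu> j = 0")
    case False
    let ?h = "\<lambda>k. complex_of_real (K_coeff a \<sigma> k) * zeta (of_real (1 - (1 - \<alpha> + \<nu> + 2 * real j + 2 * real k - \<sigma>)))"
    have e: "f j k = of_real (I_coeff b \<nu> j) * ?h k" for k
    proof -
      have "s_pole \<alpha> \<nu> \<sigma> (j + k) = 1 - (1 - \<alpha> + \<nu> + 2 * real j + 2 * real k - \<sigma>)" by (simp add: s_pole_def)
      then show ?thesis unfolding f_def by (simp only: of_real_mult mult.assoc)
    qed
    have "summable (f j)" by (rule summable_norm_cancel[OF double_series(1)[OF abs]])
    then have "summable ?h" unfolding e[abs_def] by (rule summable_mult_D) (use False in simp)
    then show ?thesis unfolding e r_def by (rule suminf_mult)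
  qed (simp add: f_def r_def)
  have dg: "(\<Sum>j\<le>m. f j (m - j)) = c * P m" for m
  proof -
    have "(\<Sum>j\<le>m. f j (m - j)) = of_real (\<Sum>j\<le>m. I_coeff b \<nu> j * K_coeff a \<sigma> (m - j)) * zeta (of_real (s_pole \<alpha> \<nu> \<sigma> m))"
      unfolding of_real_sum sum_distrib_right by (intro sum.cong refl) (simp only: fd atMost_iff)
    also have "\<dots> = c * P m"
      unfolding I_K_convolution[OF \<sigma> a b \<nu>] c_def P_def by simp
    finally show ?thesis .
  qed
  have R: "r sums (\<Sum>k. \<Sum>l. f k l)" using double_series(4)[OF abs] unfolding row .
  have D: "(\<lambda>m. c * P m) sums (\<Sum>k. \<Sum>l. f k l)" using double_series(5)[OF abs] unfolding dg .
  show "summable r" using R by (rule sums_summable)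
  show sP: "summable P" using sums_summable[OF D] c0 by (rule summable_mult_D)
  have "(\<Sum>j. r j) = (\<Sum>m. c * P m)" using R D by (simp add: sums_iff)
  then show "(\<Sum>j. r j) = of_real (b powr \<nu> / 2 powr (1 + \<nu>)) * (\<Sum>m. P m)"
    unfolding suminf_mult[OF sP] c_def .
qed

theorem theorem6:
  fixes a b \<mu> \<nu> \<alpha> chi :: real
  assumes "a \<ge> b" and "b > 0" and "\<mu> \<ge> 0" and "\<nu> \<ge> 0"
    and "a = b \<Longrightarrow> \<alpha> > 0"
    and "chi = b\<^sup>2 / a\<^sup>2"
    and "\<alpha> > 0 \<Longrightarrow> 0 < a + b \<and> a + b \<le> 2 * pi"
    and "\<alpha> \<le> 0 \<Longrightarrow> 0 < a + b \<and> a + b < 2 * pi"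
    and "\<mu> \<notin> \<nat>"
    and "\<And>m. s_pole \<alpha> \<nu> \<mu> m \<noteq> 1" and "\<And>m. s_pole \<alpha> \<nu> (- \<mu>) m \<noteq> 1"
    and "0 < chi" and "chi < 1"
  defines "S \<equiv> \<lambda>n. bessel_K \<mu> (a * real (Suc n)) * bessel_I \<nu> (b * real (Suc n)) / real (Suc n) powr \<alpha>"
    and "P \<equiv> \<lambda>m. of_real ((- 1) ^ m * Gamma (\<mu> - real m)) * zeta (of_real (s_pole \<alpha> \<nu> \<mu> m))
                  / of_real (fact m * Gamma (1 + \<nu>))
                  * of_real (F_poly m \<nu> \<mu> chi * (a / 2) powr (2 * real m - \<mu>))"
    and "N \<equiv> \<lambda>m. of_real ((- 1) ^ m * Gamma (- \<mu> - real m)) * zeta (of_real (s_pole \<alpha> \<nu> (- \<mu>) m))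
                  / of_real (fact m * Gamma (1 + \<nu>))
                  * of_real (F_poly m \<nu> (- \<mu>) chi * (a / 2) powr (2 * real m + \<mu>))"
  shows "summable S \<and> summable P \<and> summable N \<and>
    of_real (\<Sum>n. S n) = mellin_KI \<alpha> \<mu> \<nu> a b 1
      + of_real (b powr \<nu> / 2 powr (1 + \<nu>)) * (\<Sum>m. P m)
      + of_real (b powr \<nu> / 2 powr (1 + \<nu>)) * (\<Sum>m. N m) \<and>
    mellin_KI \<alpha> \<mu> \<nu> a b 1 = of_real
      (b powr \<nu> * (a / 2) powr \<alpha> / (2 * a powr (1 + \<nu>))
       * (Gamma (1/2 - \<alpha>/2 + \<nu>/2 - \<mu>/2) * Gamma (1/2 - \<alpha>/2 + \<nu>/2 + \<mu>/2) / Gamma (1 + \<nu>))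
       * hyp2F1 ((1 - \<alpha> + \<nu> - \<mu>) / 2) ((1 - \<alpha> + \<nu> + \<mu>) / 2) (1 + \<nu>) chi)"
proof -
  note b = \<open>b > 0\<close> and \<nu> = \<open>\<nu> \<ge> 0\<close> and chi = \<open>chi = b\<^sup>2 / a\<^sup>2\<close>
  have a: "a > 0" using \<open>a \<ge> b\<close> b by simp
  have "a \<noteq> b" using \<open>chi < 1\<close> chi a by auto
  then have ba: "0 < b" "b < a" using \<open>a \<ge> b\<close> b by auto
  have \<mu>0: "\<mu> \<notin> \<int>" using \<open>\<mu> \<notin> \<nat>\<close> \<open>\<mu> \<ge> 0\<close> by (auto simp: Nats_altdef2)
  have "\<mu> \<noteq> 0" using \<mu>0 by auto
  then have \<mu>: "\<mu> \<notin> \<int>" "\<mu> > 0" using \<mu>0 \<open>\<mu> \<ge> 0\<close> by auto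
  have \<mu>': "- \<mu> \<notin> \<int>" by (rule nonint_uminus[OF \<mu>(1)])
  have ab: "a + b < 2 * pi \<or> (a + b \<le> 2 * pi \<and> \<alpha> > 0)" using assms(7,8) by (cases "\<alpha> > 0") auto
  have a2: "a < 2 * pi" using ab b by auto
  define p where "p = 1 - \<alpha> + \<nu>"
  \<comment> \<open>As \<open>1\<close> is none of the poles \<open>s\<^sub>m\<^sup>\<plusminus>\<close>, no exponent \<open>p + 2 * j\<close> is a pole of the corresponding residue expansion.\<close>
  have "complex_of_real 1 \<in> - (\<Union>m. {of_real (s_pole \<alpha> \<nu> \<mu> m), of_real (s_pole \<alpha> \<nu> (- \<mu>) m)})"
    using assms(10,11) by (auto simp del: of_real_1 simp: eq_commute[of "1::real"])
  then have p0: "1 - complex_of_real \<alpha> + of_real \<nu> \<in> pole_free \<mu>" unfolding pole_set_complement by simp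
  have pj: "complex_of_real (p + 2 * real j) \<in> pole_free \<mu>" for j
    using pole_free_add_even[OF p0, of j] by (simp add: p_def)
  define T where "T = (\<lambda>j. \<Sum>n. real (Suc n) powr (\<nu> + 2 * real j - \<alpha>) * bessel_K \<mu> (a * real (Suc n)))"
  define r where "r = (\<lambda>\<sigma> j. of_real (I_coeff b \<nu> j) * (\<Sum>k. complex_of_real (K_coeff a \<sigma> k) * zeta (of_real (1 - (1 - \<alpha> + \<nu> + 2 * real j + 2 * real k - \<sigma>)))))"
  have rows: "complex_of_real (I_coeff b \<nu> j * T j) = of_real (I_coeff b \<nu> j * mellin_K a \<mu> (1 - \<alpha> + \<nu> + 2 * real j)) + r \<mu> j + r (- \<mu>) j" for j
  proof -
    have "\<nu> + 2 * real j - \<alpha> = p + 2 * real j - 1" by (simp add: p_def)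
    then have "complex_of_real (T j) = of_real (mellin_K a \<mu> (p + 2 * real j)) + (\<Sum>k. of_real (K_coeff a \<mu> k) * zeta (of_real (1 - (p + 2 * real j + 2 * real k - \<mu>))))
       + (\<Sum>k. of_real (K_coeff a (- \<mu>) k) * zeta (of_real (1 - (p + 2 * real j + 2 * real k - (- \<mu>)))))"
      unfolding T_def by (simp only: schloemilch_at_real[OF \<mu> a a2 pj])
    then show ?thesis unfolding of_real_mult r_def by (simp only: p_def distrib_left)
  qed
  have sM: "summable (\<lambda>j. I_coeff b \<nu> j * mellin_K a \<mu> (1 - \<alpha> + \<nu> + 2 * real j))"
    by (rule summable_norm_cancel[OF summable_I_coeff_mellin_K[OF ba \<nu>]])
  have sMc: "summable (\<lambda>j. complex_of_real (I_coeff b \<nu> j * mellin_K a \<mu> (1 - \<alpha> + \<nu> + 2 * real j)))"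
    using sM by (rule summable_of_real)
  have plus: "summable (r \<mu>)" "summable P" "(\<Sum>j. r \<mu> j) = of_real (b powr \<nu> / 2 powr (1 + \<nu>)) * (\<Sum>m. P m)"
    unfolding r_def P_def chi using residue_double_series[OF a b \<nu> \<mu>(1) ab] by simp_all
  have minus: "summable (r (- \<mu>))" "summable N" "(\<Sum>j. r (- \<mu>) j) = of_real (b powr \<nu> / 2 powr (1 + \<nu>)) * (\<Sum>m. N m)"
    unfolding r_def N_def chi using residue_double_series[OF a b \<nu> \<mu>' ab] by simp_all
  have "(\<lambda>j. complex_of_real (I_coeff b \<nu> j * T j)) sums (of_real (\<Sum>j. I_coeff b \<nu> j * mellin_K a \<mu> (1 - \<alpha> + \<nu> + 2 * real j)) + (\<Sum>j. r \<mu> j) + (\<Sum>j. r (- \<mu>) j))"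
    unfolding rows suminf_of_real[OF sM] by (intro sums_add summable_sums sMc plus minus)
  note IT = this
  have sT: "summable (\<lambda>j. I_coeff b \<nu> j * T j)"
    using sums_summable[OF IT] by (simp only: summable_of_real_iff)
  have S: "S sums (\<Sum>j. I_coeff b \<nu> j * T j)"
    unfolding S_def T_def by (rule KI_series_sums[OF \<mu> ba \<nu>]) (use sT in \<open>simp only: T_def\<close>)
  have "1 - complex_of_real \<alpha> = of_real (1 - \<alpha>)" by simp
  then have F: "mellin_KI \<alpha> \<mu> \<nu> a b 1 = of_real (\<Sum>j. I_coeff b \<nu> j * mellin_K a \<mu> (1 - \<alpha> + \<nu> + 2 * real j))"
    unfolding mellin_KI_eq[OF \<mu> ba \<nu> p0] by (simp only: KI_transform_of_real[OF ba \<nu>])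
  have "complex_of_real (\<Sum>n. S n) = (\<Sum>j. complex_of_real (I_coeff b \<nu> j * T j))"
    unfolding suminf_of_real[OF sT, symmetric] using S by (simp add: sums_iff)
  also have "\<dots> = mellin_KI \<alpha> \<mu> \<nu> a b 1 + of_real (b powr \<nu> / 2 powr (1 + \<nu>)) * (\<Sum>m. P m) + of_real (b powr \<nu> / 2 powr (1 + \<nu>)) * (\<Sum>m. N m)"
    unfolding sums_unique[OF IT, symmetric] F plus(3) minus(3) ..
  finally have eq: "complex_of_real (\<Sum>n. S n) = mellin_KI \<alpha> \<mu> \<nu> a b 1 + of_real (b powr \<nu> / 2 powr (1 + \<nu>)) * (\<Sum>m. P m) + of_real (b powr \<nu> / 2 powr (1 + \<nu>)) * (\<Sum>m. N m)" .
  have np: "x \<notin> \<int>\<^sub>\<le>\<^sub>0" if "complex_of_real x \<notin> \<int>\<^sub>\<le>\<^sub>0" for x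
  proof
    assume "x \<in> \<int>\<^sub>\<le>\<^sub>0"
    then obtain n where "x = - real n" by (auto elim!: nonpos_Ints_cases')
    then have "complex_of_real x = - of_nat n" by simp
    with that show False by simp
  qed
  have A: "(1 - \<alpha> + \<nu> - \<mu>) / 2 \<notin> \<int>\<^sub>\<le>\<^sub>0" and B: "(1 - \<alpha> + \<nu> + \<mu>) / 2 \<notin> \<int>\<^sub>\<le>\<^sub>0"
    using p0 by (auto simp: pole_free_def intro!: np)
  show ?thesis
    using sums_summable[OF S] plus(2) minus(2) eq KI_transform_hyp2F1[OF ba \<nu> A B] F chi by (simp only: simp_thms)
qed

end
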